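(* Let $d=2$, $\nu>0$ and let $\mathcal{X}_h=\mathcal{X}_{FS}=\mathbf{X}_{0,FS}\times Q_{FS}$ be the Fortin–Soulie mixed finite element space on $\mathcal{T}_h$, where $(\mathcal{T}_h)_h$ is a shape-regular triangulation sequence of $\Omega$. Then the continuous bilinear form $a_{S,h}(\cdot,\cdot)$ on $\mathcal{X}_h\times\mathcal{X}_h$ is $T_h$-coercive, and the problem: find $(\mathbf{u}_h,p_h)\in\mathcal{X}_h$ such that $$a_{S,h}\big((\mathbf{u}_h,p_h),(\mathbf{v}_h,q_h)\big)=\ell_{\mathbf{f}}\big((\mathbf{v}_h,q_h)\big)\qquad\forall(\mathbf{v}_h,q_h)\in\mathcal{X}_h$$ is well-posed.
   Context: $\Omega\subset\mathbb{R}^2$ is a connected bounded domain with polygonal boundary, and $(\mathcal{T}_h)_h$ is a shape-regular sequence of triangulations of $\Omega$ into triangles $K$ (the ratios of diameter to inscribed-circle diameter are bounded by a constant $\sigma$ uniformly in $h$ and $K$), with edges $F$. $\mathbf{L}^2(\Omega)=L^2(\Omega)^2$, $\mathbf{H}^1_0(\Omega)=H^1_0(\Omega)^2$, $\mathbf{H}^{-1}(\Omega)$ is the dual of $\mathbf{H}^1_0(\Omega)$, and $L^2_{zmv}(\Omega)=\{q\in L^2(\Omega):\int_\Omega q=0\}$. $P^m_{disc}(\mathcal{T}_h)$ is the space of $q\in L^2(\Omega)$ with $q_{|K}\in P^m(K)$ for every $K$; $[v]$ is the jump across an edge. $$X_{FS}=\Big\{v_h\in P^2_{disc}(\mathcal{T}_h):\int_F[v_h]\,q=0\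 \text{for every interior edge }F,\ \forall q\in P^1(F)\Big\},$$ $$X_{0,FS}=\Big\{v_h\in X_{FS}:\int_Fv_h\,q=0\ \text{for every boundary edge }F,\ \forall q\in P^1(F)\Big\},$$ $\mathbf{X}_{0,FS}=(X_{0,FS})^2$ and $Q_{FS}=P^1_{disc}(\mathcal{T}_h)\cap L^2_{zmv}(\Omega)$. With $\mathbf{Grad}\,\mathbf{v}=(\partial_jv_i)_{i,j}$, set $(\mathbf{v},\mathbf{w})_h=\sum_K\int_K\mathbf{Grad}\,\mathbf{v}:\mathbf{Grad}\,\mathbf{w}$, $\|\mathbf{v}\|_h^2=(\mathbf{v},\mathbf{v})_h$, $(\mathrm{div}_h\mathbf{v},q)=\sum_K\int_K q\,\mathrm{div}\,\mathbf{v}$. The norm on $\mathcal{X}_h$ is $\|(\mathbf{v}_h,q_h)\|_{\mathcal{X}_h}=\|\mathbf{v}_h\|_h+\nu^{-1}\|q_h\|_{L^2(\Omega)}$, and $$a_{S,h}\big((\mathbf{u}'_h,p'_h),(\mathbf{v}_h,q_h)\big)=\nu(\mathbf{u}'_h,\mathbf{v}_h)_h-(p'_h,\mathrm{div}_h\mathbf{v}_h)-(q_h,\mathrm{div}_h\mathbf{u}'_h).$$ For $\mathbf{f}\in\mathbf{H}^{-1}(\Omega)$: $\ell_{\mathbf{f}}((\mathbf{v}_h,q_h))=(\mathbf{f},\mathbf{v}_h)_{\mathbf{L}^2(\Omega)}$ if $\mathbf{f}\in\mathbf{L}^2(\Omega)$, and $\ell_{\mathbf{f}}((\mathbf{v}_h,q_h))=\langle\mathbf{f},\mathcal{I}_h(\mathbf{v}_h)\rangle_{\mathbf{H}^1_0(\Omega)}$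 otherwise, where $\mathcal{I}_h$ is the linear averaging operator from $\mathbf{X}_{0,FS}$ to the continuous piecewise $P^2$ vector fields vanishing on $\partial\Omega$ (value at each interior $P^2$-Lagrange node: mean of the values at this node of $\mathbf{v}_{h|K}$ over all elements $K$ containing it; value $0$ at boundary nodes). $T_h$-coercive (for the symmetric form $a_{S,h}$) means: there exist a continuous linear operator $T_h:\mathcal{X}_h\to\mathcal{X}_h$ and $\alpha>0$ such that $|a_{S,h}(x,T_hx)|\ge\alpha\|x\|_{\mathcal{X}_h}^2$ for all $x\in\mathcal{X}_h$. Well-posed means: for every continuous linear form on $\mathcal{X}_h$ as right-hand side there is exactly one solution, and it depends continuously on the right-hand side. *)

theory Defs
  imports "HOL-Analysis.Analysis" "HOL-Library.Function_Algebras"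
begin

text \<open>Functions form a real vector space pointwise, so that function spaces are
  subsets of the types \<^typ>\<open>real^2 \<Rightarrow> real\<close> and \<^typ>\<open>real^2 \<Rightarrow> real^2\<close>, and mixed
  velocity-pressure spaces are subsets of their product.\<close>

instantiation "fun" :: (type, real_vector) real_vector
begin

definition scaleR_fun :: "real \<Rightarrow> ('a \<Rightarrow> 'b) \<Rightarrow> 'a \<Rightarrow> 'b"
  where "scaleR_fun c f = (\<lambda>x. c *\<^sub>R f x)"

instance
  by standard (simp_all add: scaleR_fun_def fun_eq_iff scaleR_add_right scaleR_add_left)

end


section \<open>Forms and operators on a normed subspace\<close>

text \<open>\<^term>\<open>X\<close> is a linear subspace and \<^term>\<open>N\<close> its norm.\<close>

definition linear_on :: "'a::real_vector set \<Rightarrow> ('a \<Rightarrow> 'b::real_vector) \<Rightarrow> bool"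
  where "linear_on X f \<longleftrightarrow>
    (\<forall>x\<in>X. \<forall>y\<in>X. f (x + y) = f x + f y) \<and> (\<forall>c. \<forall>x\<in>X. f (c *\<^sub>R x) = c *\<^sub>R f x)"

definition continuous_dual :: "'a::real_vector set \<Rightarrow> ('a \<Rightarrow> real) \<Rightarrow> ('a \<Rightarrow> real) set"
  where "continuous_dual X N = {l. linear_on X l \<and> (\<exists>C. \<forall>x\<in>X. \<bar>l x\<bar> \<le> C * N x)}"

definition dual_norm :: "'a::real_vector set \<Rightarrow> ('a \<Rightarrow> real) \<Rightarrow> ('a \<Rightarrow> real) \<Rightarrow> real"
  where "dual_norm X N l = Sup {\<bar>l x\<bar> | x. x \<in> X \<and> N x \<le> 1}"

definition continuous_operator :: "'a::real_vector set \<Rightarrow> ('a \<Rightarrow> real) \<Rightarrow> ('a \<Rightarrow> 'a) \<Rightarrow> bool"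
  where "continuous_operator X N T \<longleftrightarrow>
    T ` X \<subseteq> X \<and> linear_on X T \<and> (\<exists>C. \<forall>x\<in>X. N (T x) \<le> C * N x)"

definition continuous_bilinear_form ::
    "'a::real_vector set \<Rightarrow> ('a \<Rightarrow> real) \<Rightarrow> ('a \<Rightarrow> 'a \<Rightarrow> real) \<Rightarrow> bool"
  where "continuous_bilinear_form X N a \<longleftrightarrow>
    (\<forall>x\<in>X. linear_on X (\<lambda>y. a x y)) \<and> (\<forall>y\<in>X. linear_on X (\<lambda>x. a x y)) \<and>
    (\<exists>C. \<forall>x\<in>X. \<forall>y\<in>X. \<bar>a x y\<bar> \<le> C * N x * N y)"

definition T_coercive :: "'a::real_vector set \<Rightarrow> ('a \<Rightarrow> real) \<Rightarrow> ('a \<Rightarrow> 'a \<Rightarrow> real) \<Rightarrow> bool"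
  where "T_coercive X N a \<longleftrightarrow>
    (\<exists>T \<alpha>. continuous_operator X N T \<and> \<alpha> > 0 \<and> (\<forall>x\<in>X. \<bar>a x (T x)\<bar> \<ge> \<alpha> * (N x)\<^sup>2))"

definition solves :: "'a set \<Rightarrow> ('a \<Rightarrow> 'a \<Rightarrow> real) \<Rightarrow> ('a \<Rightarrow> real) \<Rightarrow> 'a \<Rightarrow> bool"
  where "solves X a l x \<longleftrightarrow> x \<in> X \<and> (\<forall>y\<in>X. a x y = l y)"

definition well_posed :: "'a::real_vector set \<Rightarrow> ('a \<Rightarrow> real) \<Rightarrow> ('a \<Rightarrow> 'a \<Rightarrow> real) \<Rightarrow> bool"
  where "well_posed X N a \<longleftrightarrow>
    (\<forall>l\<in>continuous_dual X N. \<exists>!x. solves X a l x) \<and>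
    (\<exists>C. \<forall>l\<in>continuous_dual X N. \<forall>x. solves X a l x \<longrightarrow> N x \<le> C * dual_norm X N l)"


section \<open>Domains and triangulations\<close>

definition polygonal_domain :: "(real^2) set \<Rightarrow> bool"
  where "polygonal_domain \<Omega> \<longleftrightarrow>
    open \<Omega> \<and> connected \<Omega> \<and> bounded \<Omega> \<and> \<Omega> \<noteq> {} \<and>
    (\<exists>S. finite S \<and> (\<forall>(a, b)\<in>S. a \<noteq> b) \<and> frontier \<Omega> = (\<Union>(a, b)\<in>S. closed_segment a b))"

definition edges :: "(real^2) set set \<Rightarrow> (real^2) set set"
  where "edges T = {F. \<exists>K\<in>T. F edge_of K}"

definition boundary_edges :: "(real^2) set \<Rightarrow> (real^2) set set \<Rightarrow> (real^2) set set"
  where "boundary_edges \<Omega> T = {F \<in> edges T. F \<subseteq> frontier \<Omega>}"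

definition interior_edges :: "(real^2) set \<Rightarrow> (real^2) set set \<Rightarrow> (real^2) set set"
  where "interior_edges \<Omega> T = edges T - boundary_edges \<Omega> T"

text \<open>The library notion \<^const>\<open>triangulation\<close> provides finiteness and conformity. The last
  condition is automatic if \<^term>\<open>\<Omega> = interior (closure \<Omega>)\<close>; otherwise (slits) it says
  that the mesh resolves the boundary.\<close>

definition triangulation_of :: "(real^2) set \<Rightarrow> (real^2) set set \<Rightarrow> bool"
  where "triangulation_of \<Omega> T \<longleftrightarrow>
    triangulation T \<and> (\<forall>K\<in>T. 2 simplex K) \<and> \<Union>T = closure \<Omega> \<and>
    frontier \<Omega> = \<Union>(boundary_edges \<Omega> T)"

definition inscribed_diameter :: "(real^2) set \<Rightarrow> real"
  where "inscribed_diameter K = Sup {2 * r | r. r \<ge> 0 \<and> (\<exists>x. cball x r \<subseteq> K)}"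

definition shape_regular_triangulations :: "(real^2) set \<Rightarrow> ('h \<Rightarrow> (real^2) set set) \<Rightarrow> bool"
  where "shape_regular_triangulations \<Omega> \<T> \<longleftrightarrow>
    (\<forall>h. triangulation_of \<Omega> (\<T> h)) \<and>
    (\<exists>\<sigma>. \<forall>h. \<forall>K\<in>\<T> h. diameter K / inscribed_diameter K \<le> \<sigma>)"


section \<open>Lebesgue and Sobolev spaces\<close>

text \<open>Elements of Lebesgue and Sobolev spaces are represented by functions; two functions
  that agree almost everywhere on \<^term>\<open>\<Omega>\<close> have distance zero.\<close>

definition L2_space :: "(real^2) set \<Rightarrow> (real^2 \<Rightarrow> 'b::euclidean_space) set"
  where "L2_space \<Omega> =
    {f \<in> borel_measurable (lebesgue_on \<Omega>). integrable (lebesgue_on \<Omega>) (\<lambda>x. (norm (f x))\<^sup>2)}"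

definition L2_norm :: "(real^2) set \<Rightarrow> (real^2 \<Rightarrow> 'b::euclidean_space) \<Rightarrow> real"
  where "L2_norm \<Omega> f = sqrt (\<integral>x. (norm (f x))\<^sup>2 \<partial>lebesgue_on \<Omega>)"

definition L2_zmv :: "(real^2) set \<Rightarrow> (real^2 \<Rightarrow> real) set"
  where "L2_zmv \<Omega> = {q \<in> L2_space \<Omega>. (\<integral>x. q x \<partial>lebesgue_on \<Omega>) = 0}"

definition pd :: "2 \<Rightarrow> (real^2 \<Rightarrow> real) \<Rightarrow> real^2 \<Rightarrow> real"
  where "pd j f x = frechet_derivative f (at x) (axis j 1)"

primrec Ck :: "nat \<Rightarrow> (real^2 \<Rightarrow> real) \<Rightarrow> bool"
  where
    "Ck 0 f \<longleftrightarrow> continuous_on UNIV f"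
  | "Ck (Suc k) f \<longleftrightarrow> (\<forall>x. f differentiable (at x)) \<and> (\<forall>j. Ck k (pd j f))"

definition test_functions :: "(real^2) set \<Rightarrow> (real^2 \<Rightarrow> real) set"
  where "test_functions \<Omega> =
    {\<phi>. (\<forall>k. Ck k \<phi>) \<and> compact (closure {x. \<phi> x \<noteq> 0}) \<and> closure {x. \<phi> x \<noteq> 0} \<subseteq> \<Omega>}"

definition is_weak_grad :: "(real^2) set \<Rightarrow> (real^2 \<Rightarrow> real) \<Rightarrow> (real^2 \<Rightarrow> real^2) \<Rightarrow> bool"
  where "is_weak_grad \<Omega> u g \<longleftrightarrow> g \<in> L2_space \<Omega> \<and>
    (\<forall>\<phi>\<in>test_functions \<Omega>. \<forall>j.
      (\<integral>x. u x * pd j \<phi> x \<partial>lebesgue_on \<Omega>) = - (\<integral>x. g x $ j * \<phi> x \<partial>lebesgue_on \<Omega>))"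

definition H1 :: "(real^2) set \<Rightarrow> (real^2 \<Rightarrow> real) set"
  where "H1 \<Omega> = {u \<in> L2_space \<Omega>. \<exists>g. is_weak_grad \<Omega> u g}"

text \<open>The weak gradient is determined almost everywhere, so the norm does not depend on the
  choice.\<close>

definition H1_norm :: "(real^2) set \<Rightarrow> (real^2 \<Rightarrow> real) \<Rightarrow> real"
  where "H1_norm \<Omega> u =
    sqrt ((L2_norm \<Omega> u)\<^sup>2 + (L2_norm \<Omega> (SOME g. is_weak_grad \<Omega> u g))\<^sup>2)"

definition H10 :: "(real^2) set \<Rightarrow> (real^2 \<Rightarrow> real) set"
  where "H10 \<Omega> = {u \<in> H1 \<Omega>. \<forall>\<epsilon>>0. \<exists>\<phi>\<in>test_functions \<Omega>. H1_norm \<Omega> (u - \<phi>) < \<epsilon>}"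

definition vector_fields :: "(real^2 \<Rightarrow> real) set \<Rightarrow> (real^2 \<Rightarrow> real^2) set"
  where "vector_fields X = {v. \<forall>i. (\<lambda>x. v x $ i) \<in> X}"

definition H1_vec_norm :: "(real^2) set \<Rightarrow> (real^2 \<Rightarrow> real^2) \<Rightarrow> real"
  where "H1_vec_norm \<Omega> v = sqrt (\<Sum>i\<in>UNIV. (H1_norm \<Omega> (\<lambda>x. v x $ i))\<^sup>2)"

definition H_minus1 :: "(real^2) set \<Rightarrow> ((real^2 \<Rightarrow> real^2) \<Rightarrow> real) set"
  where "H_minus1 \<Omega> = continuous_dual (vector_fields (H10 \<Omega>)) (H1_vec_norm \<Omega>)"


section \<open>The Fortin--Soulie spaces\<close>

definition polys :: "nat \<Rightarrow> (real^2 \<Rightarrow> real) set"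
  where "polys m = span {\<lambda>x. x $ 1 ^ i * x $ 2 ^ j | i j. i + j \<le> m}"

text \<open>Each class in \<open>L\<^sup>2\<close> has exactly one representative that is polynomial on the interior of
  every triangle and zero elsewhere; thus equality of elements is equality of functions.\<close>

definition P_disc :: "nat \<Rightarrow> (real^2) set \<Rightarrow> (real^2) set set \<Rightarrow> (real^2 \<Rightarrow> real) set"
  where "P_disc m \<Omega> T =
    {q \<in> L2_space \<Omega>. (\<forall>K\<in>T. \<exists>p\<in>polys m. \<forall>x\<in>interior K. q x = p x) \<and>
                     (\<forall>x. x \<notin> (\<Union>K\<in>T. interior K) \<longrightarrow> q x = 0)}"

definition elem_trace :: "(real^2) set \<Rightarrow> (real^2 \<Rightarrow> 'b::t2_space) \<Rightarrow> real^2 \<Rightarrow> 'b"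
  where "elem_trace K v x = Lim (at x within interior K) v"

definition edge_integral :: "real^2 \<Rightarrow> real^2 \<Rightarrow> (real^2 \<Rightarrow> real) \<Rightarrow> real"
  where "edge_integral a b g = dist a b * integral {0..1} (\<lambda>t. g (linepath a b t))"

definition X_FS :: "(real^2) set \<Rightarrow> (real^2) set set \<Rightarrow> (real^2 \<Rightarrow> real) set"
  where "X_FS \<Omega> T =
    {v \<in> P_disc 2 \<Omega> T.
      \<forall>a b. closed_segment a b \<in> interior_edges \<Omega> T \<longrightarrow>
        (\<forall>K\<in>T. \<forall>K'\<in>T. K \<noteq> K' \<and> closed_segment a b edge_of K \<and> closed_segment a b edge_of K' \<longrightarrow>
          (\<forall>q\<in>polys 1. edge_integral a b (\<lambda>x. (elem_trace K v x - elem_trace K' v x) * q x) = 0))}"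

definition X0_FS :: "(real^2) set \<Rightarrow> (real^2) set set \<Rightarrow> (real^2 \<Rightarrow> real) set"
  where "X0_FS \<Omega> T =
    {v \<in> X_FS \<Omega> T.
      \<forall>a b. closed_segment a b \<in> boundary_edges \<Omega> T \<longrightarrow>
        (\<forall>K\<in>T. closed_segment a b edge_of K \<longrightarrow>
          (\<forall>q\<in>polys 1. edge_integral a b (\<lambda>x. elem_trace K v x * q x) = 0))}"

definition Q_FS :: "(real^2) set \<Rightarrow> (real^2) set set \<Rightarrow> (real^2 \<Rightarrow> real) set"
  where "Q_FS \<Omega> T = P_disc 1 \<Omega> T \<inter> L2_zmv \<Omega>"

type_synonym mixed = "(real^2 \<Rightarrow> real^2) \<times> (real^2 \<Rightarrow> real)"

definition mixed_FS :: "(real^2) set \<Rightarrow> (real^2) set set \<Rightarrow> mixed set"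
  where "mixed_FS \<Omega> T = vector_fields (X0_FS \<Omega> T) \<times> Q_FS \<Omega> T"


section \<open>The discrete Stokes problem\<close>

definition Grad :: "(real^2 \<Rightarrow> real^2) \<Rightarrow> real^2 \<Rightarrow> real^2^2"
  where "Grad v x = (\<chi> i j. pd j (\<lambda>y. v y $ i) x)"

definition grad_inner_h :: "(real^2) set set \<Rightarrow> (real^2 \<Rightarrow> real^2) \<Rightarrow> (real^2 \<Rightarrow> real^2) \<Rightarrow> real"
  where "grad_inner_h T v w = (\<Sum>K\<in>T. \<integral>x. Grad v x \<bullet> Grad w x \<partial>lebesgue_on K)"

definition div_h :: "(real^2) set set \<Rightarrow> (real^2 \<Rightarrow> real^2) \<Rightarrow> (real^2 \<Rightarrow> real) \<Rightarrow> real"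
  where "div_h T v q = (\<Sum>K\<in>T. \<integral>x. q x * (\<Sum>i\<in>UNIV. Grad v x $ i $ i) \<partial>lebesgue_on K)"

definition mixed_norm :: "real \<Rightarrow> (real^2) set \<Rightarrow> (real^2) set set \<Rightarrow> mixed \<Rightarrow> real"
  where "mixed_norm \<nu> \<Omega> T = (\<lambda>(v, q). sqrt (grad_inner_h T v v) + inverse \<nu> * L2_norm \<Omega> q)"

definition a_S :: "real \<Rightarrow> (real^2) set set \<Rightarrow> mixed \<Rightarrow> mixed \<Rightarrow> real"
  where "a_S \<nu> T = (\<lambda>(u, p) (v, q). \<nu> * grad_inner_h T u v - div_h T v p - div_h T u q)"

definition Lagrange_nodes :: "(real^2) set set \<Rightarrow> (real^2) set"
  where "Lagrange_nodes T =
    {x. \<exists>K\<in>T. x extreme_point_of K} \<union> {midpoint a b | a b. closed_segment a b \<in> edges T}"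

definition conforming_P2 :: "(real^2) set \<Rightarrow> (real^2) set set \<Rightarrow> (real^2 \<Rightarrow> real) set"
  where "conforming_P2 \<Omega> T =
    {w. continuous_on UNIV w \<and> (\<forall>K\<in>T. \<exists>p\<in>polys 2. \<forall>x\<in>K. w x = p x) \<and> (\<forall>x. x \<notin> \<Omega> \<longrightarrow> w x = 0)}"

definition averaging :: "(real^2) set \<Rightarrow> (real^2) set set \<Rightarrow> (real^2 \<Rightarrow> real^2) \<Rightarrow> real^2 \<Rightarrow> real^2"
  where "averaging \<Omega> T v =
    (THE w. w \<in> vector_fields (conforming_P2 \<Omega> T) \<and>
      (\<forall>x\<in>Lagrange_nodes T. w x =
        (if x \<in> frontier \<Omega> then 0
         else (\<Sum>K | K \<in> T \<and> x \<in> K. elem_trace K v x) /\<^sub>R real (card {K \<in> T. x \<in> K}))))"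

text \<open>A functional lies in \<open>L\<^sup>2\<close> if it is represented by a square integrable field, which is
  then determined almost everywhere.\<close>

definition represents ::
    "(real^2) set \<Rightarrow> (real^2 \<Rightarrow> real^2) \<Rightarrow> ((real^2 \<Rightarrow> real^2) \<Rightarrow> real) \<Rightarrow> bool"
  where "represents \<Omega> g f \<longleftrightarrow> g \<in> L2_space \<Omega> \<and>
    (\<forall>w\<in>vector_fields (H10 \<Omega>). f w = (\<integral>x. g x \<bullet> w x \<partial>lebesgue_on \<Omega>))"

definition load ::
    "(real^2) set \<Rightarrow> (real^2) set set \<Rightarrow> ((real^2 \<Rightarrow> real^2) \<Rightarrow> real) \<Rightarrow> mixed \<Rightarrow> real"
  where "load \<Omega> T f = (\<lambda>(v, q).
    if \<exists>g. represents \<Omega> g f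
    then (\<integral>x. (SOME g. represents \<Omega> g f) x \<bullet> v x \<partial>lebesgue_on \<Omega>)
    else f (averaging \<Omega> T v))"

end

theory Submission
  imports Defs
begin

text \<open>The mesh is fixed and all constants may depend on it, so the statement concerns a symmetric bilinear
  form on a finite-dimensional space.  Let \<open>G\<close> be an inner product whose norm is equivalent to the given
  one, and represent the form as \<open>a x y = G x (A y)\<close>.  If the form is nondegenerate then \<open>A\<close> is
  bijective, and \<open>T = A\<inverse>\<close> satisfies \<open>a x (T x) = G x x\<close>: this is T-coercivity, and well-posedness follows.
  The argument is carried out in the locale \<open>normed_inner_on\<close>.

  The broken gradient seminorm is a norm, because a function with vanishing piecewise gradient is
  piecewise constant; the edge conditions make the constants agree across interior edges, the
  connectedness of \<open>\<Omega>\<close> makes them all equal, and a boundary edge makes them zero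
  (\<open>X0_FS_gradient_zero\<close>).

  Nondegeneracy reduces to the qualitative inf-sup condition \<open>orthogonal_to_divergences\<close>: a pressure
  orthogonal to all discrete divergences vanishes.  Two kinds of velocities suffice.  The nonconforming
  bubble \<open>2 - 3 (\<lambda>\<^sub>1\<^sup>2 + \<lambda>\<^sub>2\<^sup>2 + \<lambda>\<^sub>3\<^sup>2)\<close> of a triangle is orthogonal to the affine functions on every edge
  and forces the pressure to be constant on the triangle.  The functions \<open>\<lambda>\<^sub>a \<lambda>\<^sub>b\<close> on the two
  triangles at an interior edge \<open>[a, b]\<close> force these constants to agree.  A constant of mean value zero
  is zero.  The integrals needed are moments of barycentric coordinates, of which only relations
  following from the symmetry of the triangle are used.

  On a finite-dimensional normed space every linear form is continuous, so the load only has to be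
  linear.  When \<open>f\<close> is not represented by a square integrable field, this requires that the averaging
  operator is well defined and linear, which is quadratic Lagrange interpolation
  (\<open>conforming_interpolation\<close>), and that its values lie in \<open>H\<^sup>1\<^sub>0\<close>, where \<open>f\<close> is linear
  (\<open>conforming_H10\<close>).  For the latter, a conforming function \<open>w\<close> is Lipschitz and vanishes outside \<open>\<Omega>\<close>.
  Its soft thresholds have compact support in \<open>\<Omega>\<close> and are limits of mollifications, which are test
  functions; as the threshold tends to zero they converge to \<open>w\<close>, their gradients to the gradient
  of \<open>w\<close> off the zero set of \<open>w\<close>.  The fundamental lemma of the calculus of variations shows that weak
  gradients are unique, so that the Sobolev norm can be computed from any of them.\<close>

section \<open>Symmetric nondegenerate forms on finite-dimensional inner product spaces\<close>

lemma linear_on_0: "linear_on X f \<Longrightarrow> subspace X \<Longrightarrow> f 0 = 0"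
  unfolding linear_on_def by (metis scale_zero_left subspace_0)

lemma linear_on_add: "linear_on X f \<Longrightarrow> x \<in> X \<Longrightarrow> y \<in> X \<Longrightarrow> f (x + y) = f x + f y"
  by (simp add: linear_on_def)

lemma linear_on_scale: "linear_on X f \<Longrightarrow> x \<in> X \<Longrightarrow> f (c *\<^sub>R x) = c *\<^sub>R f x"
  by (simp add: linear_on_def)

lemma linear_on_diff:
  assumes "linear_on X f" "subspace X" "x \<in> X" "y \<in> X"
  shows "f (x - y) = f x - f y"
proof -
  have "f (x + (-1) *\<^sub>R y) = f x + f ((-1) *\<^sub>R y)"
    by (rule linear_on_add[OF assms(1,3) subspace_scale[OF assms(2,4)]])
  then show ?thesis using linear_on_scale[OF assms(1,4), of "-1"] by simp
qed

lemma linear_on_sum: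
  assumes "linear_on X f" "subspace X" "\<And>i. i \<in> I \<Longrightarrow> g i \<in> X"
  shows "f (sum g I) = (\<Sum>i\<in>I. f (g i))"
  using assms(3)
proof (induction I rule: infinite_finite_induct)
  case (insert i I)
  then show ?case
    using assms(1,2) by (simp add: linear_on_add subspace_sum)
qed (use linear_on_0[OF assms(1,2)] in auto)

text \<open>A finite-dimensional subspace \<open>X\<close> with an inner product \<open>G\<close>.  Nothing is assumed about \<open>G\<close> off \<open>X\<close>.\<close>

locale inner_on =
  fixes X :: "'a::real_vector set" and G :: "'a \<Rightarrow> 'a \<Rightarrow> real"
  assumes subspace: "subspace X"
    and lin: "x \<in> X \<Longrightarrow> linear_on X (G x)"
    and sym: "x \<in> X \<Longrightarrow> y \<in> X \<Longrightarrow> G x y = G y x"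
    and pos: "x \<in> X \<Longrightarrow> x \<noteq> 0 \<Longrightarrow> G x x > 0"
    and fin: "\<exists>B. finite B \<and> X \<subseteq> span B"
begin

lemma G_nonneg: "x \<in> X \<Longrightarrow> 0 \<le> G x x"
  using pos[of x] linear_on_0[OF lin[of 0] subspace] subspace_0[OF subspace]
  by (cases "x = 0") force+

lemma lin_left: "y \<in> X \<Longrightarrow> linear_on X (\<lambda>x. G x y)"
  using lin[of y] sym[of y] subspace unfolding linear_on_def
  by (metis subspace_add subspace_scale)

text \<open>An orthonormal set of maximal cardinality spans: the cardinality of orthonormal sets is bounded by
  the size of a spanning set, and a nonzero remainder could be normalised and added.\<close>

lemma orthonormal_basis:
  obtains E where "finite E" "E \<subseteq> X" "\<And>x. x \<in> X \<Longrightarrow> x = (\<Sum>e\<in>E. G x e *\<^sub>R e)"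
proof -
  define P where "P E \<longleftrightarrow> finite E \<and> E \<subseteq> X \<and> (\<forall>e\<in>E. \<forall>f\<in>E. G e f = (if e = f then 1 else 0))" for E
  obtain B where B: "finite B" "X \<subseteq> span B" using fin by blast
  have coord: "G (\<Sum>e\<in>E. c e *\<^sub>R e) f = c f" if "P E" "f \<in> E" for E c f
  proof -
    have E: "finite E" "E \<subseteq> X" using that by (auto simp: P_def)
    have "f \<in> X" using that E by auto
    have "G (\<Sum>e\<in>E. c e *\<^sub>R e) f = (\<Sum>e\<in>E. G (c e *\<^sub>R e) f)"
      using E by (intro linear_on_sum[OF lin_left[OF \<open>f \<in> X\<close>] subspace])
        (auto intro: subspace_scale[OF subspace])
    also have "\<dots> = (\<Sum>e\<in>E. if e = f then c f else 0)"
      using that E linear_on_scale[OF lin_left[OF \<open>f \<in> X\<close>]]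
      by (intro sum.cong) (auto simp: P_def subset_iff)
    also have "\<dots> = c f" using E that by simp
    finally show ?thesis .
  qed
  have card: "card E \<le> card B" if "P E" for E
  proof -
    have E: "finite E" "E \<subseteq> X" using that by (auto simp: P_def)
    have "independent E"
      unfolding independent_explicit_finite_subsets
    proof (intro allI impI ballI)
      fix S u v
      assume S: "S \<subseteq> E" "finite S" "(\<Sum>v\<in>S. u v *\<^sub>R v) = 0" "v \<in> S"
      have "P S" using that S unfolding P_def by (meson finite_subset order_trans subsetD)
      then have "u v = G 0 v" using coord[of S v u] S by simp
      also have "\<dots> = 0" using linear_on_0[OF lin_left subspace] E S by auto
      finally show "u v = 0" .
    qed
    then show ?thesis using independent_span_bound[OF B(1)] E B(2) by blast
  qed
  have "\<exists>E. P E \<and> (\<forall>E'. P E' \<longrightarrow> card E' \<le> card E)"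
    by (rule ex_has_greatest_nat[of P "{}" card "Suc (card B)"])
       (use card in \<open>auto simp: P_def less_Suc_eq_le\<close>)
  then obtain E where E: "P E" "\<And>E'. P E' \<Longrightarrow> card E' \<le> card E" by blast
  have fE: "finite E" "E \<subseteq> X" using E by (auto simp: P_def)
  have "x = (\<Sum>e\<in>E. G x e *\<^sub>R e)" if x: "x \<in> X" for x
  proof (rule ccontr)
    assume ne: "x \<noteq> (\<Sum>e\<in>E. G x e *\<^sub>R e)"
    define r where "r = x - (\<Sum>e\<in>E. G x e *\<^sub>R e)"
    have sX: "(\<Sum>e\<in>E. G x e *\<^sub>R e) \<in> X"
      using fE by (intro subspace_sum[OF subspace] subspace_scale[OF subspace]) auto
    have rX: "r \<in> X" unfolding r_def using sX x subspace by (intro subspace_diff)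
    have orth: "G r f = 0" if "f \<in> E" for f
    proof -
      have "G r f = G x f - G (\<Sum>e\<in>E. G x e *\<^sub>R e) f"
        unfolding r_def using that fE x sX by (intro linear_on_diff[OF lin_left subspace]) auto
      then show ?thesis using coord[OF E(1) that] by simp
    qed
    have r0: "G r r > 0" using ne rX by (intro pos) (auto simp: r_def)
    define s where "s = inverse (sqrt (G r r)) *\<^sub>R r"
    have sinX: "s \<in> X" unfolding s_def using rX subspace by (intro subspace_scale)
    have Gs: "G s y = inverse (sqrt (G r r)) * G r y" if "y \<in> X" for y
      unfolding s_def using linear_on_scale[OF lin_left[OF that] rX] by simp
    have Grs: "G r s = inverse (sqrt (G r r)) * G r r"
      unfolding s_def using linear_on_scale[OF lin[OF rX] rX] by simp
    have ss: "G s s = 1" using Gs[OF sinX] Grs r0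
      by (simp add: field_simps)
    have se: "G s e = 0" "G e s = 0" if "e \<in> E" for e
      using Gs[of e] orth[OF that] that fE sym[OF sinX, of e] by auto
    have "s \<notin> E" using se ss by force
    moreover have "P (insert s E)"
      using E(1) se ss sinX unfolding P_def by auto
    ultimately show False using E(2)[of "insert s E"] fE by simp
  qed
  then show thesis using that fE by blast
qed

lemma cauchy_schwarz:
  assumes "x \<in> X" "y \<in> X" shows "\<bar>G x y\<bar> \<le> sqrt (G x x) * sqrt (G y y)"
proof (cases "y = 0")
  case True
  then show ?thesis using linear_on_0[OF lin[OF assms(1)] subspace] linear_on_0[OF lin[OF assms(2)] subspace] by simp
next
  case False
  have y: "G y y > 0" using pos False assms by blast
  define t where "t = G x y / G y y"
  have z: "x - t *\<^sub>R y \<in> X" using assms subspace by (auto intro: subspace_diff subspace_scale)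
  have ty: "t *\<^sub>R y \<in> X" using assms subspace by (auto intro: subspace_scale)
  have "G (x - t *\<^sub>R y) (x - t *\<^sub>R y) = G x x - 2 * t * G x y + t\<^sup>2 * G y y"
    using linear_on_diff[OF lin[OF z] subspace assms(1) ty]
      linear_on_diff[OF lin_left[OF assms(1)] subspace assms(1) ty]
      linear_on_diff[OF lin_left[OF ty] subspace assms(1) ty]
      linear_on_scale[OF lin[OF assms(1)] assms(2), of t] linear_on_scale[OF lin[OF ty] assms(2), of t]
      linear_on_scale[OF lin_left[OF assms(2)] assms(2), of t]
      linear_on_scale[OF lin_left[OF assms(1)] assms(2), of t] sym[OF assms]
    by (simp add: algebra_simps power2_eq_square)
  then have "0 \<le> G x x - 2 * t * G x y + t\<^sup>2 * G y y" using G_nonneg[OF z] by simp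
  also have "\<dots> = G x x - (G x y)\<^sup>2 / G y y"
    unfolding t_def using y by (simp add: field_simps power2_eq_square)
  finally have "(G x y)\<^sup>2 \<le> G x x * G y y" using y by (simp add: field_simps)
  then have "sqrt ((G x y)\<^sup>2) \<le> sqrt (G x x * G y y)" by (rule real_sqrt_le_mono)
  then show ?thesis by (simp add: real_sqrt_mult)
qed

lemma linear_on_bounded:
  assumes "linear_on X l"
  shows "\<exists>C\<ge>0. \<forall>x\<in>X. \<bar>l x\<bar> \<le> C * sqrt (G x x)" and "\<exists>r\<in>X. \<forall>x\<in>X. l x = G x r"
proof -
  obtain E where E: "finite E" "E \<subseteq> X" "\<And>x. x \<in> X \<Longrightarrow> x = (\<Sum>e\<in>E. G x e *\<^sub>R e)"
    using orthonormal_basis by blast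
  define r where "r = (\<Sum>e\<in>E. l e *\<^sub>R e)"
  have rX: "r \<in> X" unfolding r_def
    using E(2) by (intro subspace_sum[OF subspace] subspace_scale[OF subspace]) auto
  have eq: "l x = G x r" if x: "x \<in> X" for x
  proof -
    have "l x = l (\<Sum>e\<in>E. G x e *\<^sub>R e)" using E(3)[OF x] by simp
    also have "\<dots> = (\<Sum>e\<in>E. l (G x e *\<^sub>R e))"
      using E(2) by (intro linear_on_sum[OF assms subspace] subspace_scale[OF subspace]) auto
    also have "\<dots> = (\<Sum>e\<in>E. G x (l e *\<^sub>R e))"
      using E(2) linear_on_scale[OF assms] linear_on_scale[OF lin[OF x]]
      by (intro sum.cong) (auto simp: subset_iff)
    also have "\<dots> = G x r"
      unfolding r_def using E(2)
      by (intro linear_on_sum[OF lin[OF x] subspace, symmetric] subspace_scale[OF subspace]) auto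
    finally show ?thesis .
  qed
  then show "\<exists>r\<in>X. \<forall>x\<in>X. l x = G x r" using rX by blast
  show "\<exists>C\<ge>0. \<forall>x\<in>X. \<bar>l x\<bar> \<le> C * sqrt (G x x)"
    using eq cauchy_schwarz[OF _ rX] G_nonneg[OF rX]
    by (intro exI[of _ "sqrt (G r r)"]) (auto simp: mult.commute)
qed

end

text \<open>A norm \<open>N\<close> equivalent to that of \<open>G\<close>, and a symmetric nondegenerate bilinear form \<open>a\<close>.  The factor
  \<open>2\<close> is what a sum of two seminorms needs in comparison with the root of the sum of their squares.\<close>

locale normed_inner_on = inner_on +
  fixes N :: "'a::real_vector \<Rightarrow> real" and a :: "'a \<Rightarrow> 'a \<Rightarrow> real"
  assumes N_lower: "x \<in> X \<Longrightarrow> sqrt (G x x) \<le> N x"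
    and N_upper: "x \<in> X \<Longrightarrow> N x \<le> 2 * sqrt (G x x)"
    and N_scale: "x \<in> X \<Longrightarrow> N (c *\<^sub>R x) = \<bar>c\<bar> * N x"
    and a_lin: "x \<in> X \<Longrightarrow> linear_on X (a x)"
    and a_sym: "x \<in> X \<Longrightarrow> y \<in> X \<Longrightarrow> a x y = a y x"
    and a_nondeg: "x \<in> X \<Longrightarrow> (\<And>y. y \<in> X \<Longrightarrow> a x y = 0) \<Longrightarrow> x = 0"
begin

lemma N_nonneg: "x \<in> X \<Longrightarrow> 0 \<le> N x"
  using N_lower[of x] G_nonneg[of x] by (meson order_trans real_sqrt_ge_zero)

lemma in_dual:
  assumes "linear_on X l" shows "l \<in> continuous_dual X N"
proof -
  obtain C where C: "C \<ge> 0" "\<forall>x\<in>X. \<bar>l x\<bar> \<le> C * sqrt (G x x)"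
    using linear_on_bounded(1)[OF assms] by blast
  have "\<bar>l x\<bar> \<le> C * N x" if "x \<in> X" for x
    using C that N_lower[OF that] mult_left_mono[of "sqrt (G x x)" "N x" C] by fastforce
  then show ?thesis using assms by (auto simp: continuous_dual_def)
qed

text \<open>The operator \<open>A\<close> representing the form: \<open>a y x = G x (A y)\<close>.\<close>

definition riesz :: "'a \<Rightarrow> 'a"
  where "riesz y = (SOME r. r \<in> X \<and> (\<forall>x\<in>X. a y x = G x r))"

lemma riesz: assumes "y \<in> X" shows "riesz y \<in> X" "x \<in> X \<Longrightarrow> a y x = G x (riesz y)"
proof -
  have "\<exists>r. r \<in> X \<and> (\<forall>x\<in>X. a y x = G x r)"
    using linear_on_bounded(2)[OF a_lin[OF assms]] by blast
  from someI_ex[OF this] show "riesz y \<in> X" "x \<in> X \<Longrightarrow> a y x = G x (riesz y)"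
    by (auto simp: riesz_def)
qed

lemma G_eqI:
  assumes "x \<in> X" "y \<in> X" "\<And>z. z \<in> X \<Longrightarrow> G z x = G z y" shows "x = y"
proof (rule ccontr)
  assume "x \<noteq> y"
  have z: "x - y \<in> X" using assms subspace by (auto intro: subspace_diff)
  have "G (x - y) (x - y) > 0" using pos[OF z] \<open>x \<noteq> y\<close> by simp
  then show False using linear_on_diff[OF lin[OF z] subspace assms(1,2)] assms(3)[OF z] by simp
qed

lemma riesz_linear: "linear_on X riesz"
  unfolding linear_on_def
proof (intro conjI ballI allI)
  fix x y assume xy: "x \<in> X" "y \<in> X"
  have s: "x + y \<in> X" using xy subspace by (auto intro: subspace_add)
  show "riesz (x + y) = riesz x + riesz y"
  proof (rule G_eqI)
    fix z assume z: "z \<in> X"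
    have "G z (riesz (x + y)) = a z (x + y)" using riesz(2)[OF s z] a_sym[OF s z] by simp
    also have "\<dots> = a z x + a z y" using linear_on_add[OF a_lin[OF z]] xy by simp
    also have "\<dots> = G z (riesz x) + G z (riesz y)" using riesz(2)[OF _ z] a_sym z xy by simp
    also have "\<dots> = G z (riesz x + riesz y)" using linear_on_add[OF lin[OF z]] riesz(1) xy by simp
    finally show "G z (riesz (x + y)) = G z (riesz x + riesz y)" .
  qed (use riesz(1) xy s subspace in \<open>auto intro: subspace_add\<close>)
next
  fix c x assume xy: "x \<in> X"
  have s: "c *\<^sub>R x \<in> X" using xy subspace by (auto intro: subspace_scale)
  show "riesz (c *\<^sub>R x) = c *\<^sub>R riesz x"
  proof (rule G_eqI)
    fix z assume z: "z \<in> X"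
    have "G z (riesz (c *\<^sub>R x)) = a z (c *\<^sub>R x)" using riesz(2)[OF s z] a_sym[OF s z] by simp
    also have "\<dots> = c * a z x" using linear_on_scale[OF a_lin[OF z] xy] by simp
    also have "\<dots> = c * G z (riesz x)" using riesz(2)[OF _ z] a_sym z xy by simp
    also have "\<dots> = G z (c *\<^sub>R riesz x)" using linear_on_scale[OF lin[OF z]] riesz(1) xy by simp
    finally show "G z (riesz (c *\<^sub>R x)) = G z (c *\<^sub>R riesz x)" .
  qed (use riesz(1) xy s subspace in \<open>auto intro: subspace_scale\<close>)
qed

lemma riesz_inj: "inj_on riesz X"
proof (rule inj_onI)
  fix x y assume xy: "x \<in> X" "y \<in> X" "riesz x = riesz y"
  have d: "x - y \<in> X" using xy subspace by (auto intro: subspace_diff)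
  have "a (x - y) z = 0" if z: "z \<in> X" for z
  proof -
    have "a (x - y) z = a z x - a z y"
      using linear_on_diff[OF a_lin[OF z] subspace xy(1,2)] a_sym[OF d z] by simp
    then show ?thesis using a_sym[OF z] riesz(2)[OF _ z] xy by simp
  qed
  then show "x = y" using a_nondeg[OF d] by simp
qed

text \<open>The range is a subspace, and what is orthogonal to it lies in the kernel of the symmetric
  form, hence vanishes.\<close>

lemma riesz_surj: assumes "r \<in> X" shows "\<exists>x\<in>X. riesz x = r"
proof -
  let ?R = "riesz ` X"
  have RX: "?R \<subseteq> X" using riesz(1) by auto
  have sub: "subspace ?R"
    unfolding subspace_def
  proof (intro conjI ballI allI)
    show "0 \<in> ?R"
      using linear_on_0[OF riesz_linear subspace] subspace_0[OF subspace] by (metis image_eqI)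
    show "x + y \<in> ?R" if "x \<in> ?R" "y \<in> ?R" for x y
    proof -
      obtain u v where uv: "u \<in> X" "v \<in> X" "x = riesz u" "y = riesz v" using \<open>x \<in> ?R\<close> \<open>y \<in> ?R\<close> by blast
      have "x + y = riesz (u + v)" using linear_on_add[OF riesz_linear uv(1,2)] uv by simp
      then show ?thesis using subspace_add[OF subspace uv(1,2)] by blast
    qed
    show "c *\<^sub>R x \<in> ?R" if "x \<in> ?R" for x c
    proof -
      obtain u where u: "u \<in> X" "x = riesz u" using \<open>x \<in> ?R\<close> by blast
      have "c *\<^sub>R x = riesz (c *\<^sub>R u)" using linear_on_scale[OF riesz_linear u(1)] u by simp
      then show ?thesis using subspace_scale[OF subspace u(1)] by blast
    qed
  qed
  interpret R: inner_on ?R G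
  proof
    show "\<exists>B. finite B \<and> ?R \<subseteq> span B" using fin RX by blast
    show "linear_on ?R (G x)" if "x \<in> ?R" for x
      using lin[of x] that RX unfolding linear_on_def by (meson subset_iff)
    show "G x y = G y x" if "x \<in> ?R" "y \<in> ?R" for x y using sym that RX by blast
    show "0 < G x x" if "x \<in> ?R" "x \<noteq> 0" for x using pos that RX by blast
  qed (rule sub)
  have "linear_on ?R (G r)" using lin[OF assms] RX unfolding linear_on_def by (meson subset_iff)
  then obtain s where s: "s \<in> ?R" "\<forall>x\<in>?R. G r x = G x s" using R.linear_on_bounded(2) by blast
  have sX: "s \<in> X" using s RX by blast
  have d: "r - s \<in> X" using assms sX subspace by (auto intro: subspace_diff)
  have "a (r - s) z = 0" if z: "z \<in> X" for z
  proof -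
    have rz: "riesz z \<in> X" "riesz z \<in> ?R" using riesz(1) z by auto
    have "a (r - s) z = G (r - s) (riesz z)" using a_sym[OF d z] riesz(2)[OF z d] by simp
    also have "\<dots> = G r (riesz z) - G s (riesz z)"
      using linear_on_diff[OF lin_left[OF rz(1)] subspace assms sX] .
    also have "\<dots> = 0" using bspec[OF s(2) rz(2)] sym[OF sX rz(1)] by simp
    finally show ?thesis .
  qed
  then have "r = s" using a_nondeg[OF d] by simp
  then show ?thesis using s(1) by auto
qed

text \<open>The inverse of the representing operator, which turns the form into the inner product.\<close>

definition coercing :: "'a \<Rightarrow> 'a" where "coercing = inv_into X riesz"

lemma coercing: assumes "x \<in> X" shows "coercing x \<in> X" "riesz (coercing x) = x"
  using riesz_surj[OF assms] unfolding coercing_def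
  by (metis image_eqI inv_into_into, metis f_inv_into_f image_eqI)

lemma coercing_linear: "linear_on X coercing"
  unfolding linear_on_def
proof (intro conjI ballI allI)
  fix x y assume xy: "x \<in> X" "y \<in> X"
  have "riesz (coercing (x + y)) = riesz (coercing x + coercing y)"
    using coercing xy subspace_add[OF subspace] linear_on_add[OF riesz_linear] by simp
  then show "coercing (x + y) = coercing x + coercing y"
    by (rule inj_onD[OF riesz_inj]) (use coercing xy subspace_add[OF subspace] in auto)
next
  fix c x assume xy: "x \<in> X"
  have "riesz (coercing (c *\<^sub>R x)) = riesz (c *\<^sub>R coercing x)"
    using coercing xy subspace_scale[OF subspace] linear_on_scale[OF riesz_linear] by simp
  then show "coercing (c *\<^sub>R x) = c *\<^sub>R coercing x"
    by (rule inj_onD[OF riesz_inj]) (use coercing xy subspace_scale[OF subspace] in auto)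
qed

lemma a_coercing: "x \<in> X \<Longrightarrow> a x (coercing x) = G x x"
  using riesz(2)[of "coercing x" x] coercing a_sym by simp

lemma linear_map_bounded: "linear_on X f \<Longrightarrow> f ` X \<subseteq> X \<Longrightarrow> \<exists>C\<ge>0. \<forall>x\<in>X. N (f x) \<le> C * N x"
proof -
  assume f: "linear_on X f" "f ` X \<subseteq> X"
  obtain E where E: "finite E" "E \<subseteq> X" "\<And>x. x \<in> X \<Longrightarrow> x = (\<Sum>e\<in>E. G x e *\<^sub>R e)"
    using orthonormal_basis by blast
  have "\<exists>C\<ge>0. \<forall>x\<in>X. \<bar>G (f x) e\<bar> \<le> C * sqrt (G x x)" if "e \<in> E" for e
  proof (rule linear_on_bounded(1))
    show "linear_on X (\<lambda>x. G (f x) e)"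
      using f lin_left[of e] that E(2) unfolding linear_on_def by (simp add: image_subset_iff subset_iff)
  qed
  then obtain C where C: "\<And>e. e \<in> E \<Longrightarrow> C e \<ge> 0" "\<And>e x. e \<in> E \<Longrightarrow> x \<in> X \<Longrightarrow> \<bar>G (f x) e\<bar> \<le> C e * sqrt (G x x)"
    by metis
  \<comment> \<open>the bounds for the coordinates of \<open>f x\<close> add up to a bound for its norm\<close>
  let ?D = "\<Sum>e\<in>E. C e * sqrt (G e e)"
  have D: "?D \<ge> 0" using C(1) E(2) G_nonneg by (intro sum_nonneg mult_nonneg_nonneg) auto
  have bd: "sqrt (G (f x) (f x)) \<le> ?D * sqrt (G x x)" if x: "x \<in> X" for x
  proof (cases "G (f x) (f x) = 0")
    case True
    then show ?thesis using D G_nonneg[OF x] by simp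
  next
    case False
    have fx: "f x \<in> X" using f x by auto
    let ?y = "f x"
    have "G ?y ?y = G ?y (\<Sum>e\<in>E. G ?y e *\<^sub>R e)" using E(3)[OF fx] by simp
    also have "\<dots> = (\<Sum>e\<in>E. G ?y (G ?y e *\<^sub>R e))"
      using E(2) by (intro linear_on_sum[OF lin[OF fx] subspace] subspace_scale[OF subspace]) auto
    also have "\<dots> = (\<Sum>e\<in>E. G ?y e * G ?y e)"
      using E(2) linear_on_scale[OF lin[OF fx]] by (intro sum.cong) (auto simp: subset_iff)
    also have "\<dots> \<le> (\<Sum>e\<in>E. (C e * sqrt (G x x)) * (sqrt (G ?y ?y) * sqrt (G e e)))"
    proof (rule sum_mono)
      fix e assume e: "e \<in> E"
      have "G ?y e * G ?y e = \<bar>G ?y e\<bar> * \<bar>G ?y e\<bar>" by simp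
      also have "\<dots> \<le> (C e * sqrt (G x x)) * (sqrt (G ?y ?y) * sqrt (G e e))"
        using C(2)[OF e x] cauchy_schwarz[OF fx, of e] e E(2) C(1)[OF e] G_nonneg[OF x]
        by (intro mult_mono) auto
      finally show "G ?y e * G ?y e \<le> (C e * sqrt (G x x)) * (sqrt (G ?y ?y) * sqrt (G e e))" .
    qed
    also have "\<dots> = (?D * sqrt (G x x)) * sqrt (G ?y ?y)"
      by (simp add: sum_distrib_left sum_distrib_right mult_ac)
    finally have "sqrt (G ?y ?y) * sqrt (G ?y ?y) \<le> (?D * sqrt (G x x)) * sqrt (G ?y ?y)"
      using G_nonneg[OF fx] by simp
    moreover have "sqrt (G ?y ?y) > 0" using False G_nonneg[OF fx] by simp
    ultimately show ?thesis by (simp only: mult_le_cancel_right_pos)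
  qed
  have "N (f x) \<le> 2 * ?D * N x" if x: "x \<in> X" for x
  proof -
    have "N (f x) \<le> 2 * sqrt (G (f x) (f x))" using N_upper f x by auto
    also have "\<dots> \<le> 2 * (?D * sqrt (G x x))" using bd[OF x] by simp
    also have "\<dots> \<le> 2 * (?D * N x)" using mult_left_mono[OF N_lower[OF x] D] by simp
    finally show ?thesis by simp
  qed
  then show ?thesis using D by (intro exI[of _ "2 * ?D"]) auto
qed

lemma form_continuous: "continuous_bilinear_form X N a"
proof -
  obtain C where C: "C \<ge> 0" "\<forall>x\<in>X. N (riesz x) \<le> C * N x"
    using linear_map_bounded[OF riesz_linear] riesz(1) by blast
  have "\<bar>a x y\<bar> \<le> C * N x * N y" if xy: "x \<in> X" "y \<in> X" for x y
  proof -
    have "\<bar>a x y\<bar> \<le> sqrt (G y y) * sqrt (G (riesz x) (riesz x))"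
      using riesz(2)[OF xy] cauchy_schwarz[OF xy(2) riesz(1)[OF xy(1)]] by simp
    also have "\<dots> \<le> N y * (C * N x)"
      using N_lower[OF xy(2)] N_lower[OF riesz(1)[OF xy(1)]] C(2) xy(1) N_nonneg[OF xy(2)]
        G_nonneg[OF riesz(1)[OF xy(1)]]
      by (intro mult_mono) (auto intro: order_trans)
    finally show ?thesis by (simp add: mult_ac)
  qed
  moreover have "linear_on X (\<lambda>x. a x y)" if "y \<in> X" for y
    using a_lin[OF that] a_sym[OF that] subspace unfolding linear_on_def
    by (metis subspace_add subspace_scale)
  ultimately show ?thesis using a_lin unfolding continuous_bilinear_form_def by blast
qed

lemma G_N: "x \<in> X \<Longrightarrow> 1/4 * (N x)\<^sup>2 \<le> G x x"
proof -
  assume x: "x \<in> X"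
  have "(N x)\<^sup>2 \<le> (2 * sqrt (G x x))\<^sup>2" using N_upper[OF x] N_nonneg[OF x] by (rule power_mono)
  then show ?thesis using G_nonneg[OF x] by (simp add: power_mult_distrib)
qed

lemma coercive: "T_coercive X N a"
proof -
  have "continuous_operator X N coercing"
    unfolding continuous_operator_def
    using linear_map_bounded[OF coercing_linear] coercing(1) coercing_linear by blast
  moreover have "1/4 * (N x)\<^sup>2 \<le> \<bar>a x (coercing x)\<bar>" if "x \<in> X" for x
    using G_N[OF that] a_coercing[OF that] by simp
  ultimately show ?thesis unfolding T_coercive_def
    by (intro exI[of _ coercing] exI[of _ "1/4"]) auto
qed

lemma unique_solution:
  assumes "linear_on X l" shows "\<exists>!x. solves X a l x"
proof -
  obtain r where r: "r \<in> X" "\<forall>x\<in>X. l x = G x r" using linear_on_bounded(2)[OF assms] by blast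
  have "solves X a l (coercing r)"
    unfolding solves_def using coercing[OF r(1)] r riesz(2)[of "coercing r"] by simp
  moreover have "x = y" if "solves X a l x" "solves X a l y" for x y
  proof -
    have xy: "x \<in> X" "y \<in> X" using that by (auto simp: solves_def)
    have "riesz x = riesz y"
      using that riesz xy by (intro G_eqI) (auto simp: solves_def)
    then show ?thesis using riesz_inj xy by (auto simp: inj_on_def)
  qed
  ultimately show ?thesis by blast
qed

lemma dual_norm_bound:
  assumes l: "l \<in> continuous_dual X N" and y: "y \<in> X"
  shows "\<bar>l y\<bar> \<le> dual_norm X N l * N y" "0 \<le> dual_norm X N l"
proof -
  let ?S = "{\<bar>l x\<bar> | x. x \<in> X \<and> N x \<le> 1}"
  have lin_l: "linear_on X l" using l by (simp add: continuous_dual_def)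
  obtain C where C: "\<forall>x\<in>X. \<bar>l x\<bar> \<le> C * N x" using l by (auto simp: continuous_dual_def)
  have bdd: "bdd_above ?S"
  proof (rule bdd_aboveI[of _ "\<bar>C\<bar>"])
    fix s assume "s \<in> ?S"
    then obtain x where x: "x \<in> X" "N x \<le> 1" "s = \<bar>l x\<bar>" by blast
    have "C * N x \<le> \<bar>C\<bar> * 1" using x N_nonneg[OF x(1)] by (intro mult_mono) auto
    then show "s \<le> \<bar>C\<bar>" using C x by force
  qed
  have N0: "N 0 = 0" using N_scale[OF y, of 0] by simp
  have "\<bar>l 0\<bar> \<in> ?S" using N0 subspace_0[OF subspace] by force
  then have "\<bar>l 0\<bar> \<le> dual_norm X N l" unfolding dual_norm_def using bdd by (rule cSup_upper)
  then show "0 \<le> dual_norm X N l" by simp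
  show "\<bar>l y\<bar> \<le> dual_norm X N l * N y"
  proof (cases "N y = 0")
    case True
    then show ?thesis using C y by force
  next
    case False
    then have p: "N y > 0" using N_nonneg[OF y] by simp
    let ?z = "inverse (N y) *\<^sub>R y"
    have "?z \<in> X" using y subspace by (auto intro: subspace_scale)
    moreover have "N ?z = 1" using N_scale[OF y] p by simp
    ultimately have "\<bar>l ?z\<bar> \<in> ?S" by force
    then have "\<bar>l ?z\<bar> \<le> dual_norm X N l" unfolding dual_norm_def using bdd by (rule cSup_upper)
    then have "inverse (N y) * \<bar>l y\<bar> \<le> dual_norm X N l"
      using linear_on_scale[OF lin_l y] p by (simp add: abs_mult)
    then show ?thesis using p by (simp add: field_simps)
  qed
qed

lemma well_posed: "well_posed X N a"
proof -
  obtain C where C: "C \<ge> 0" "\<forall>x\<in>X. N (coercing x) \<le> C * N x"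
    using linear_map_bounded[OF coercing_linear] coercing(1) by blast
  have "N x \<le> (4 * C) * dual_norm X N l"
    if l: "l \<in> continuous_dual X N" and s: "solves X a l x" for l x
  proof -
    have x: "x \<in> X" using s by (simp add: solves_def)
    note d = dual_norm_bound[OF l]
    have "1/4 * (N x)\<^sup>2 \<le> a x (coercing x)" using G_N[OF x] a_coercing[OF x] by simp
    also have "\<dots> \<le> \<bar>l (coercing x)\<bar>" using s coercing(1)[OF x] by (simp add: solves_def)
    also have "\<dots> \<le> dual_norm X N l * N (coercing x)" using d(1)[OF coercing(1)[OF x]] .
    also have "\<dots> \<le> dual_norm X N l * (C * N x)" using C x d(2)[OF x] by (intro mult_left_mono) auto
    finally have "N x * N x \<le> (4 * C * dual_norm X N l) * N x" by (simp add: power2_eq_square mult_ac)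
    then show ?thesis
      using N_nonneg[OF x] d(2)[OF x] C(1) by (cases "N x = 0") (auto simp: mult_le_cancel_right)
  qed
  moreover have "\<exists>!x. solves X a l x" if "l \<in> continuous_dual X N" for l
    using unique_solution that by (simp add: continuous_dual_def)
  ultimately show ?thesis
    unfolding well_posed_def by blast
qed

end

section \<open>Triangles and triangulations\<close>

text \<open>The signed area of the parallelogram spanned by two vectors.\<close>

definition det2 :: "real^2 \<Rightarrow> real^2 \<Rightarrow> real"
  where "det2 u v = u$1 * v$2 - u$2 * v$1"

text \<open>The barycentric coordinate that belongs to the first of the three vertices \<open>a, b, c\<close>; the other two
  are obtained by cyclic rotation of the arguments.\<close>

definition bary :: "real^2 \<Rightarrow> real^2 \<Rightarrow> real^2 \<Rightarrow> real^2 \<Rightarrow> real"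
  where "bary a b c x = det2 (b - x) (c - x) / det2 (b - a) (c - a)"

text \<open>\<open>K\<close> is a nondegenerate triangle with vertices labelled \<open>a, b, c\<close>, of either orientation.\<close>

definition tri :: "real^2 \<Rightarrow> real^2 \<Rightarrow> real^2 \<Rightarrow> (real^2) set \<Rightarrow> bool"
  where "tri a b c K \<longleftrightarrow> det2 (b - a) (c - a) \<noteq> 0 \<and> K = convex hull {a, b, c}"

lemma det2_rotate: "det2 (c - b) (a - b) = det2 (b - a) (c - a)"
  by (simp add: det2_def algebra_simps)

lemma det2_swap: "det2 (a - b) (c - b) = - det2 (b - a) (c - a)"
  by (simp add: det2_def algebra_simps)

lemma tri_rotate: "tri a b c K \<Longrightarrow> tri b c a K"
  by (simp add: tri_def det2_rotate[of c b a] insert_commute)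

lemma tri_swap: "tri a b c K \<Longrightarrow> tri b a c K"
  by (simp add: tri_def det2_swap[of a b c] insert_commute)

lemma tri_distinct: assumes "tri a b c K" shows "a \<noteq> b" "b \<noteq> c" "a \<noteq> c"
  using assms by (auto simp: tri_def det2_def)

lemma bary_swap: "bary a c b x = bary a b c x"
proof -
  have "det2 (c - x) (b - x) = - det2 (b - x) (c - x)" "det2 (c - a) (b - a) = - det2 (b - a) (c - a)"
    by (simp_all add: det2_def)
  then show ?thesis by (simp add: bary_def)
qed

lemma bary_affine_comb:
  assumes "det2 (b - a) (c - a) \<noteq> 0" "u + v + w = 1"
  shows "bary a b c (u *\<^sub>R a + v *\<^sub>R b + w *\<^sub>R c) = u"
proof -
  have u: "u = 1 - v - w" using assms(2) by simp
  have "det2 (b - (u *\<^sub>R a + v *\<^sub>R b + w *\<^sub>R c)) (c - (u *\<^sub>R a + v *\<^sub>R b + w *\<^sub>R c))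
      = u * det2 (b - a) (c - a)"
    unfolding u by (simp add: det2_def algebra_simps)
  then show ?thesis using assms(1) by (simp add: bary_def)
qed

lemma bary_sum:
  assumes "det2 (b - a) (c - a) \<noteq> 0"
  shows "bary a b c x + bary b c a x + bary c a b x = 1"
proof -
  have "det2 (b - x) (c - x) + det2 (c - x) (a - x) + det2 (a - x) (b - x) = det2 (b - a) (c - a)"
    by (simp add: det2_def algebra_simps)
  moreover have "det2 (c - b) (a - b) = det2 (b - a) (c - a)" "det2 (a - c) (b - c) = det2 (b - a) (c - a)"
    by (simp_all add: det2_def algebra_simps)
  ultimately show ?thesis using assms by (simp add: bary_def add_divide_distrib[symmetric])
qed

lemma bary_comb:
  assumes "det2 (b - a) (c - a) \<noteq> 0"
  shows "bary a b c x *\<^sub>R a + bary b c a x *\<^sub>R b + bary c a b x *\<^sub>R c = x"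
proof -
  let ?D = "det2 (b - a) (c - a)"
  have d: "det2 (c - b) (a - b) = ?D" "det2 (a - c) (b - c) = ?D"
    by (simp_all add: det2_def algebra_simps)
  have "det2 (b - x) (c - x) * a$i + det2 (c - x) (a - x) * b$i + det2 (a - x) (b - x) * c$i = ?D * x$i"
    if "i = 1 \<or> i = 2" for i
    using that by (auto simp: det2_def algebra_simps)
  then have "(det2 (b - x) (c - x) * a$i + det2 (c - x) (a - x) * b$i + det2 (a - x) (b - x) * c$i) / ?D = x$i"
    for i :: 2
    using assms exhaust_2[of i] by (metis nonzero_mult_div_cancel_left)
  then show ?thesis
    by (simp add: bary_def d vec_eq_iff add_divide_distrib)
qed

lemma bary_add_scale:
  assumes "u + v = 1"
  shows "bary a b c (u *\<^sub>R x + v *\<^sub>R y) = u * bary a b c x + v * bary a b c y"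
proof -
  have u: "u = 1 - v" using assms by simp
  have "det2 (b - (u *\<^sub>R x + v *\<^sub>R y)) (c - (u *\<^sub>R x + v *\<^sub>R y))
      = u * det2 (b - x) (c - x) + v * det2 (b - y) (c - y)"
    unfolding u by (simp add: det2_def algebra_simps)
  then show ?thesis by (simp add: bary_def add_divide_distrib)
qed

lemma tri_bary_vertices:
  assumes "tri a b c K"
  shows "bary a b c a = 1" "bary a b c b = 0" "bary a b c c = 0"
  using assms by (auto simp: tri_def bary_def det2_def)

lemma tri_mem:
  assumes "tri a b c K"
  shows "x \<in> K \<longleftrightarrow> bary a b c x \<ge> 0 \<and> bary b c a x \<ge> 0 \<and> bary c a b x \<ge> 0"
proof
  have D: "det2 (b - a) (c - a) \<noteq> 0" using assms by (simp add: tri_def)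
  have D': "det2 (c - b) (a - b) \<noteq> 0" "det2 (a - c) (b - c) \<noteq> 0"
    using D det2_rotate[of c b a] det2_rotate[of a c b] by auto
  assume "x \<in> K"
  then obtain u v w where "0 \<le> u" "0 \<le> v" "0 \<le> w" and s: "u + v + w = 1"
    and x: "x = u *\<^sub>R a + v *\<^sub>R b + w *\<^sub>R c"
    using assms by (auto simp: tri_def convex_hull_3)
  moreover have "bary a b c x = u" using bary_affine_comb[OF D s] x by simp
  moreover have "bary b c a x = v"
    using bary_affine_comb[OF D'(1), of v w u] s x by (simp add: algebra_simps)
  moreover have "bary c a b x = w"
    using bary_affine_comb[OF D'(2), of w u v] s x by (simp add: algebra_simps)
  ultimately show "bary a b c x \<ge> 0 \<and> bary b c a x \<ge> 0 \<and> bary c a b x \<ge> 0" by simp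
next
  have D: "det2 (b - a) (c - a) \<noteq> 0" using assms by (simp add: tri_def)
  assume "bary a b c x \<ge> 0 \<and> bary b c a x \<ge> 0 \<and> bary c a b x \<ge> 0"
  then show "x \<in> K"
    using bary_sum[OF D, of x] bary_comb[OF D, of x] assms
    unfolding tri_def convex_hull_3 by (metis (mono_tags, lifting) mem_Collect_eq)
qed

lemma det2_collinear: "det2 (b - a) (c - a) = 0 \<longleftrightarrow> collinear {a, b, c}"
proof -
  have c: "collinear {a, b, c} \<longleftrightarrow> collinear {0, b - a, c - a}"
    using collinear_3[of b a c] by (simp add: insert_commute)
  have "det2 u v = 0 \<longleftrightarrow> collinear {0, u, v}" for u v :: "real^2"
  proof
    assume "collinear {0, u, v}"
    then show "det2 u v = 0" by (auto simp: collinear_lemma det2_def)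
  next
    assume d: "det2 u v = 0"
    show "collinear {0, u, v}"
    proof (cases "u$1 = 0")
      case False
      have "v = (v$1 / u$1) *\<^sub>R u"
        using d False by (simp add: vec_eq_iff forall_2 det2_def field_simps)
      then show ?thesis by (auto simp: collinear_lemma)
    next
      case True
      show ?thesis
      proof (cases "u$2 = 0")
        case True
        then have "u = 0" using \<open>u$1 = 0\<close> by (simp add: vec_eq_iff forall_2)
        then show ?thesis by simp
      next
        case False
        have "v = (v$2 / u$2) *\<^sub>R u"
          using d False True by (simp add: vec_eq_iff forall_2 det2_def field_simps)
        then show ?thesis by (auto simp: collinear_lemma)
      qed
    qed
  qed
  then show ?thesis using c by simp
qed

lemma tri_indep: assumes "tri a b c K" shows "\<not> affine_dependent {a, b, c}"
  using assms tri_distinct[OF assms] det2_collinear[of b a c]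
  by (auto simp: tri_def collinear_3_eq_affine_dependent)

lemma simplex_tri:
  assumes "2 simplex (K :: (real^2) set)" obtains a b c where "tri a b c K"
proof -
  obtain C where C: "\<not> affine_dependent C" "int (card C) = 3" "K = convex hull C"
    using assms by (auto simp: simplex_def)
  then obtain a b c where abc: "C = {a, b, c}" "a \<noteq> b" "b \<noteq> c" "a \<noteq> c"
    using card_3_iff[of C] by auto
  then have "\<not> collinear {a, b, c}" using C by (simp add: collinear_3_eq_affine_dependent)
  then show thesis using that C abc det2_collinear[of b a c] by (auto simp: tri_def)
qed

lemma tri_interior:
  assumes "tri a b c K"
  shows "x \<in> interior K \<longleftrightarrow> bary a b c x > 0 \<and> bary b c a x > 0 \<and> bary c a b x > 0"
proof -
  have D: "det2 (b - a) (c - a) \<noteq> 0" using assms by (simp add: tri_def)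
  have D': "det2 (c - b) (a - b) \<noteq> 0" "det2 (a - c) (b - c) \<noteq> 0"
    using D det2_rotate[of c b a] det2_rotate[of a c b] by auto
  have nc: "\<not> collinear {a, b, c}" using D det2_collinear by blast
  have int: "interior K = {v. \<exists>x y z. 0 < x \<and> 0 < y \<and> 0 < z \<and> x + y + z = 1 \<and> x *\<^sub>R a + y *\<^sub>R b + z *\<^sub>R c = v}"
    using interior_convex_hull_3_minimal[OF nc] assms by (simp add: tri_def)
  show ?thesis
  proof
    assume "x \<in> interior K"
    then obtain u v w where "0 < u" "0 < v" "0 < w" and s: "u + v + w = 1"
      and x: "x = u *\<^sub>R a + v *\<^sub>R b + w *\<^sub>R c"
      unfolding int by blast
    moreover have "bary a b c x = u" using bary_affine_comb[OF D s] x by simp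
    moreover have "bary b c a x = v"
      using bary_affine_comb[OF D'(1), of v w u] s x by (simp add: algebra_simps)
    moreover have "bary c a b x = w"
      using bary_affine_comb[OF D'(2), of w u v] s x by (simp add: algebra_simps)
    ultimately show "bary a b c x > 0 \<and> bary b c a x > 0 \<and> bary c a b x > 0" by simp
  next
    assume "bary a b c x > 0 \<and> bary b c a x > 0 \<and> bary c a b x > 0"
    then show "x \<in> interior K"
      using bary_sum[OF D, of x] bary_comb[OF D, of x] unfolding int by blast
  qed
qed

lemma tri_interior_nonempty: assumes "tri a b c K" shows "interior K \<noteq> {}"
proof -
  let ?x = "(1/3) *\<^sub>R a + (1/3) *\<^sub>R b + (1/3) *\<^sub>R c"
  have D: "det2 (b - a) (c - a) \<noteq> 0" using assms by (simp add: tri_def)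
  have D': "det2 (c - b) (a - b) \<noteq> 0" "det2 (a - c) (b - c) \<noteq> 0"
    using D det2_rotate[of c b a] det2_rotate[of a c b] by auto
  have "bary a b c ?x = 1/3" using bary_affine_comb[OF D, of "1/3" "1/3" "1/3"] by simp
  moreover have "bary b c a ?x = 1/3"
    using bary_affine_comb[OF D'(1), of "1/3" "1/3" "1/3"] by (simp add: algebra_simps)
  moreover have "bary c a b ?x = 1/3"
    using bary_affine_comb[OF D'(2), of "1/3" "1/3" "1/3"] by (simp add: algebra_simps)
  ultimately show ?thesis using tri_interior[OF assms, of ?x] by auto
qed

lemma tri_basic:
  assumes "tri a b c K"
  shows "convex K" "compact K" "closed K" "bounded K" "a \<in> K" "b \<in> K" "c \<in> K" "closed_segment a b \<subseteq> K"
proof -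
  have K: "K = convex hull {a, b, c}" using assms by (simp add: tri_def)
  show "convex K" "compact K" unfolding K by (auto intro: compact_convex_hull finite_imp_compact)
  then show "closed K" "bounded K" by (auto simp: compact_imp_closed compact_imp_bounded)
  show "a \<in> K" "b \<in> K" "c \<in> K" unfolding K by (auto intro: hull_inc)
  then show "closed_segment a b \<subseteq> K" using \<open>convex K\<close> by (simp add: closed_segment_subset)
qed

lemma tri_faces:
  assumes "tri a b c K" "F face_of K"
  shows "F \<in> {{}, {a}, {b}, {c}, closed_segment a b, closed_segment b c, closed_segment c a, K}"
proof -
  obtain S where S: "S \<subseteq> {a, b, c}" "F = convex hull S"
    using face_of_convex_hull_affine_independent[OF tri_indep[OF assms(1)], of F] assms by (auto simp: tri_def)
  have "S \<in> {{}, {a}, {b}, {c}, {a,b}, {b,c}, {c,a}, {a,b,c}}"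
  proof -
    have "S \<in> Pow {a, b, c}" using S(1) by blast
    then show ?thesis unfolding Pow_insert Pow_empty by (auto simp: insert_commute)
  qed
  then have "F \<in> {convex hull {}, convex hull {a}, convex hull {b}, convex hull {c}, convex hull {a,b},
      convex hull {b,c}, convex hull {c,a}, convex hull {a,b,c}}"
    unfolding S(2) by blast
  then show ?thesis using assms(1) by (simp add: tri_def segment_convex_hull)
qed

lemma tri_edge_face:
  assumes "tri a b c K" shows "closed_segment a b edge_of K" "{a} face_of K"
proof -
  have "closed_segment a b face_of K" "{a} face_of K"
    using face_of_convex_hull_affine_independent[OF tri_indep[OF assms]] assms
    by (auto simp: tri_def segment_convex_hull intro: exI[of _ "{a,b}"] exI[of _ "{a}"])
  then show "closed_segment a b edge_of K" "{a} face_of K"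
    using tri_distinct[OF assms] by (auto simp: edge_of_def segment_convex_hull aff_dim_convex_hull aff_dim_2)
qed

lemma tri_aff_dim: assumes "tri a b c K" shows "aff_dim K = 2"
proof -
  have "aff_dim K = int (card {a,b,c}) - 1"
    using aff_dim_affine_independent[OF tri_indep[OF assms]] assms
    by (simp add: tri_def aff_dim_convex_hull)
  then show ?thesis using tri_distinct[OF assms] by simp
qed

lemma tri_edges:
  assumes "tri a b c K"
  shows "F edge_of K \<longleftrightarrow> F \<in> {closed_segment a b, closed_segment b c, closed_segment c a}"
proof
  assume F: "F edge_of K"
  then have "F \<in> {{}, {a}, {b}, {c}, closed_segment a b, closed_segment b c, closed_segment c a, K}"
    using tri_faces[OF assms] by (simp add: edge_of_def)
  then show "F \<in> {closed_segment a b, closed_segment b c, closed_segment c a}"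
    using F tri_aff_dim[OF assms] by (auto simp: edge_of_def)
next
  assume "F \<in> {closed_segment a b, closed_segment b c, closed_segment c a}"
  then show "F edge_of K"
    using tri_edge_face(1)[OF assms] tri_edge_face(1)[OF tri_rotate[OF assms]]
      tri_edge_face(1)[OF tri_rotate[OF tri_rotate[OF assms]]] by auto
qed

lemma edge_tri:
  assumes "2 simplex K" "closed_segment a b edge_of K" obtains c where "tri a b c K"
proof -
  obtain p q r where t: "tri p q r K" using simplex_tri[OF assms(1)] .
  have s: "tri q p r K" "tri q r p K" "tri r q p K" "tri r p q K" "tri p r q K"
    using t tri_swap tri_rotate by blast+
  have "closed_segment a b \<in> {closed_segment p q, closed_segment q r, closed_segment r p}"
    using tri_edges[OF t] assms(2) by blast
  then have "{a,b} = {p,q} \<or> {a,b} = {q,r} \<or> {a,b} = {r,p}" by simp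
  then show thesis using that t s by (auto simp: doubleton_eq_iff)
qed

lemma bary_edge:
  assumes "tri a b c K" "x \<in> closed_segment a b" shows "bary c a b x = 0"
proof -
  obtain u where "x = (1 - u) *\<^sub>R a + u *\<^sub>R b" using assms(2) by (auto simp: closed_segment_def)
  then show ?thesis
    using bary_add_scale[of "1-u" u c a b a b] tri_bary_vertices[OF tri_rotate[OF tri_rotate[OF assms(1)]]] by simp
qed

text \<open>Two triangles on the same side of a common edge overlap.\<close>

lemma same_side_overlap:
  assumes K: "tri a b c K" and K': "tri a b c' K'"
    and same: "det2 (b - a) (c - a) * det2 (b - a) (c' - a) > 0"
  shows "interior K \<inter> interior K' \<noteq> {}"
proof -
  define m where "m = (1/2) *\<^sub>R a + (1/2) *\<^sub>R b"
  define \<alpha> where "\<alpha> = bary a b c' c"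
  define \<beta> where "\<beta> = bary b c' a c"
  \<comment> \<open>the weight of \<open>c\<close> is so small that the other two coordinates in the second triangle stay positive\<close>
  define e where "e = 1 / (3 + 2 * \<bar>\<alpha>\<bar> + 2 * \<bar>\<beta>\<bar>)"
  define p where "p = (1 - e) *\<^sub>R m + e *\<^sub>R c"
  have e: "0 < e" "e < 1" "e * (1 + 2 * \<bar>\<alpha>\<bar>) < 1" "e * (1 + 2 * \<bar>\<beta>\<bar>) < 1"
    unfolding e_def by (auto simp: field_simps add_pos_nonneg)
  have comb: "bary x y z p = (1 - e) * (1/2 * bary x y z a + 1/2 * bary x y z b) + e * bary x y z c" for x y z
    unfolding p_def m_def by (subst bary_add_scale; simp)+
  note rot = tri_rotate[OF K] tri_rotate[OF tri_rotate[OF K]]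
  note rot' = tri_rotate[OF K'] tri_rotate[OF tri_rotate[OF K']]
  have "p \<in> interior K"
    unfolding tri_interior[OF K] comb
    using e tri_bary_vertices[OF K] tri_bary_vertices[OF rot(1)] tri_bary_vertices[OF rot(2)] by simp
  moreover have "p \<in> interior K'"
  proof -
    have \<gamma>: "bary c' a b c > 0"
    proof -
      have "det2 (a - c) (b - c) = det2 (b - a) (c - a)" "det2 (a - c') (b - c') = det2 (b - a) (c' - a)"
        by (simp_all add: det2_def algebra_simps)
      then show ?thesis using same by (simp add: bary_def zero_less_divide_iff zero_less_mult_iff)
    qed
    have pos: "(1 - e) * (1/2) + e * t > 0" if "e * (1 + 2 * \<bar>t\<bar>) < 1" for t
    proof -
      have "e * (- t) \<le> e * \<bar>t\<bar>" using e by (intro mult_left_mono) auto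
      moreover have "e + 2 * (e * \<bar>t\<bar>) < 1" using that by (simp add: algebra_simps)
      ultimately show ?thesis by (simp add: field_simps)
    qed
    show ?thesis
      unfolding tri_interior[OF K'] comb
      using e pos[OF e(3)] pos[OF e(4)] \<gamma> tri_bary_vertices[OF K'] tri_bary_vertices[OF rot'(1)] tri_bary_vertices[OF rot'(2)]
      by (simp add: \<alpha>_def \<beta>_def)
  qed
  ultimately show ?thesis by blast
qed

text \<open>A triangulation of a polygonal domain.\<close>

locale mesh =
  fixes \<Omega> :: "(real^2) set" and T :: "(real^2) set set"
  assumes dom: "polygonal_domain \<Omega>" and tr: "triangulation_of \<Omega> T"
begin

lemma Omega: "open \<Omega>" "connected \<Omega>" "bounded \<Omega>" "\<Omega> \<noteq> {}"
  using dom by (auto simp: polygonal_domain_def)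

lemma finite_T: "finite T" and Union_T: "\<Union>T = closure \<Omega>"
  and frontier_Omega: "frontier \<Omega> = \<Union>(boundary_edges \<Omega> T)"
  and simplex_T: "K \<in> T \<Longrightarrow> 2 simplex K"
  using tr by (auto simp: triangulation_of_def triangulation_def)

lemma face_T: "K \<in> T \<Longrightarrow> K' \<in> T \<Longrightarrow> K \<inter> K' face_of K"
  using tr unfolding triangulation_of_def triangulation_def by blast

lemma tri_T: assumes "K \<in> T" obtains a b c where "tri a b c K"
  using simplex_tri[OF simplex_T[OF assms]] .

lemma basic_T: assumes "K \<in> T"
  shows "convex K" "compact K" "closed K" "bounded K" "interior K \<noteq> {}" "K \<noteq> {}"
  using tri_T[OF assms] tri_basic tri_interior_nonempty by (metis interior_empty)+

lemma interior_meets: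
  assumes "K \<in> T" "K' \<in> T" "x \<in> interior K" "x \<in> K'" shows "K = K'"
proof -
  have sub: "K \<subseteq> K'"
    using face_of_disjoint_interior[OF face_T[OF assms(1,2)]] assms interior_subset by blast
  then have "x \<in> interior K'" using assms(3) interior_mono by blast
  then have "K' \<subseteq> K"
    using face_of_disjoint_interior[OF face_T[OF assms(2,1)]] assms interior_subset by blast
  then show ?thesis using sub by blast
qed

text \<open>A boundary point in the interior of a triangle would lie on a boundary edge, which by conformity is
  an edge of that same triangle.\<close>

lemma interior_Omega: assumes "K \<in> T" shows "interior K \<subseteq> \<Omega>"
proof
  fix x assume x: "x \<in> interior K"
  show "x \<in> \<Omega>"
  proof (rule ccontr)
    assume "x \<notin> \<Omega>"
    moreover have "x \<in> closure \<Omega>" using x assms interior_subset Union_T by blast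
    ultimately have "x \<in> frontier \<Omega>" using Omega(1) by (simp add: frontier_def interior_open)
    then have "x \<in> \<Union>(boundary_edges \<Omega> T)" using frontier_Omega by blast
    then obtain F K' where F: "x \<in> F" "K' \<in> T" "F edge_of K'"
      unfolding boundary_edges_def edges_def by blast
    have "K = K'" using interior_meets[OF assms F(2) x] F edge_of_imp_subset by blast
    then have "F face_of K" "aff_dim F = 1" using F by (auto simp: edge_of_def)
    moreover have "aff_dim K = 2" using tri_T[OF assms] tri_aff_dim by metis
    ultimately show False using face_of_disjoint_interior[of F K] F(1) x by force
  qed
qed

text \<open>The vertices of the mesh.\<close>

definition verts :: "(real^2) set" where "verts = {x. \<exists>K\<in>T. x extreme_point_of K}"

lemma finite_verts: "finite verts"
proof -
  have "finite {x. x extreme_point_of K}" if KT: "K \<in> T" for K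
  proof -
    obtain a b c where K: "tri a b c K" using tri_T[OF KT] .
    have "{x. x extreme_point_of K} \<subseteq> {a, b, c}"
      using K extreme_point_of_convex_hull[of _ "{a,b,c}"] by (auto simp: tri_def)
    then show ?thesis using finite_subset by blast
  qed
  moreover have "verts = (\<Union>K\<in>T. {x. x extreme_point_of K})" by (auto simp: verts_def)
  ultimately show ?thesis using finite_T by simp
qed

lemma common_edge:
  assumes "K \<in> T" "K' \<in> T" "K \<noteq> K'" "x \<in> K" "x \<in> K'" "x \<notin> verts"
  shows "K \<inter> K' edge_of K" "K \<inter> K' edge_of K'"
proof -
  obtain a b c where K: "tri a b c K" using tri_T[OF assms(1)] .
  have "K \<inter> K' \<in> {{}, {a}, {b}, {c}, closed_segment a b, closed_segment b c, closed_segment c a, K}"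
    using tri_faces[OF K face_T[OF assms(1,2)]] .
  moreover have "K \<inter> K' \<noteq> K"
    using interior_meets[OF assms(1,2)] basic_T(5)[OF assms(1)] assms(3) interior_subset by blast
  moreover have "K \<inter> K' \<noteq> {y}" for y
  proof
    assume y: "K \<inter> K' = {y}"
    then have "{y} face_of K" using face_T[OF assms(1,2)] by simp
    then have "y \<in> verts" using assms(1) face_of_singleton by (auto simp: verts_def)
    then show False using y assms(4-6) by (metis IntI singletonD)
  qed
  moreover have "K \<inter> K' \<noteq> {}" using assms(4,5) by blast
  ultimately have "K \<inter> K' \<in> {closed_segment a b, closed_segment b c, closed_segment c a}"
    by simp
  then show "K \<inter> K' edge_of K" using tri_edges[OF K] by blast
  then show "K \<inter> K' edge_of K'" using face_T[OF assms(2,1)] by (simp add: edge_of_def Int_commute)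
qed

text \<open>Removing the finitely many vertices leaves \<open>\<Omega>\<close> connected, and away from the vertices two
  triangles can only meet in an edge.\<close>

lemma constant_across_edges:
  assumes "\<And>K K' F. K \<in> T \<Longrightarrow> K' \<in> T \<Longrightarrow> K \<noteq> K' \<Longrightarrow> F \<in> interior_edges \<Omega> T \<Longrightarrow> F edge_of K \<Longrightarrow> F edge_of K' \<Longrightarrow> f K = f K'"
    and "K0 \<in> T" "K1 \<in> T"
  shows "f K0 = f K1"
proof (rule ccontr)
  assume ne: "f K0 \<noteq> f K1"
  let ?A = "{K\<in>T. f K = f K0}" and ?B = "{K\<in>T. f K \<noteq> f K0}"
  \<comment> \<open>the triangles with value \<open>f K0\<close> and the others would separate \<open>\<Omega>\<close> without the vertices\<close>
  have con: "connected (\<Omega> - verts)"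
    using connected_open_delete_finite[OF Omega(1,2) _ finite_verts] by simp
  have cl: "closed (\<Union>?A)" "closed (\<Union>?B)" using finite_T basic_T(3) by (auto intro!: closed_Union)
  have cov: "\<Omega> - verts \<subseteq> \<Union>?A \<union> \<Union>?B" using Union_T closure_subset by blast
  have meet: "interior K \<inter> (\<Omega> - verts) \<noteq> {}" if "K \<in> T" for K
  proof -
    have "infinite (interior K)" using basic_T(5)[OF that] open_interior finite_imp_not_open by blast
    then have "interior K - verts \<noteq> {}" using finite_verts by (metis Diff_eq_empty_iff finite_subset)
    then show ?thesis using interior_Omega[OF that] by blast
  qed
  have "\<Union>?A \<inter> (\<Omega> - verts) \<noteq> {}" "\<Union>?B \<inter> (\<Omega> - verts) \<noteq> {}"
    using meet[OF assms(2)] meet[OF assms(3)] assms(2,3) ne interior_subset by fastforce+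
  moreover have "\<Union>?A \<inter> \<Union>?B \<inter> (\<Omega> - verts) = {}"
  proof (rule ccontr)
    assume "\<Union>?A \<inter> \<Union>?B \<inter> (\<Omega> - verts) \<noteq> {}"
    then obtain x K K' where x: "x \<in> \<Omega>" "x \<notin> verts" "x \<in> K" "x \<in> K'" "K \<in> T" "K' \<in> T" "f K = f K0" "f K' \<noteq> f K0"
      by blast
    then have "K \<noteq> K'" by auto
    note ce = common_edge[OF x(5,6) this x(3,4,2)]
    have "K \<inter> K' \<in> interior_edges \<Omega> T"
    proof -
      have "frontier \<Omega> \<inter> \<Omega> = {}" using Omega(1) by (auto simp: frontier_def interior_open)
      then show ?thesis
        using ce x unfolding interior_edges_def boundary_edges_def edges_def by blast
    qed
    then show False using assms(1)[OF x(5,6) \<open>K \<noteq> K'\<close> _ ce] x by simp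
  qed
  moreover have "\<not> (closed X \<and> closed Y \<and> \<Omega> - verts \<subseteq> X \<union> Y \<and> X \<inter> Y \<inter> (\<Omega> - verts) = {} \<and>
      X \<inter> (\<Omega> - verts) \<noteq> {} \<and> Y \<inter> (\<Omega> - verts) \<noteq> {})" for X Y
    using con unfolding connected_closed by blast
  ultimately show False using cl cov by meson
qed

lemma edge_opposite_sides:
  assumes "K \<in> T" "K' \<in> T" "K \<noteq> K'" "tri a b c K" "tri a b c' K'"
  shows "det2 (b - a) (c - a) * det2 (b - a) (c' - a) < 0"
proof -
  have "interior K \<inter> interior K' = {}"
    using interior_meets[OF assms(1,2)] assms(3) interior_subset by blast
  then have "\<not> det2 (b - a) (c - a) * det2 (b - a) (c' - a) > 0"
    using same_side_overlap[OF assms(4,5)] by blast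
  moreover have "det2 (b - a) (c - a) * det2 (b - a) (c' - a) \<noteq> 0" using assms(4,5) by (simp add: tri_def)
  ultimately show ?thesis by linarith
qed

text \<open>Of three triangles at one edge, two would lie on the same side.\<close>

lemma at_most_two:
  assumes "K \<in> T" "K' \<in> T" "K'' \<in> T" "F edge_of K" "F edge_of K'" "F edge_of K''"
    "F = closed_segment a b" "K \<noteq> K'" "K'' \<noteq> K" shows "K'' = K'"
proof (rule ccontr)
  assume ne: "K'' \<noteq> K'"
  obtain c where c: "tri a b c K" using edge_tri[OF simplex_T[OF assms(1)]] assms by blast
  obtain c' where c': "tri a b c' K'" using edge_tri[OF simplex_T[OF assms(2)]] assms by blast
  obtain c'' where c'': "tri a b c'' K''" using edge_tri[OF simplex_T[OF assms(3)]] assms by blast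
  have "det2 (b - a) (c - a) * det2 (b - a) (c' - a) < 0"
    "det2 (b - a) (c - a) * det2 (b - a) (c'' - a) < 0"
    "det2 (b - a) (c' - a) * det2 (b - a) (c'' - a) < 0"
    using edge_opposite_sides[OF assms(1,2,8) c c'] edge_opposite_sides[OF assms(1,3) assms(9)[symmetric] c c'']
      edge_opposite_sides[OF assms(2,3) ne[symmetric] c' c''] by auto
  then show False by (auto simp: mult_less_0_iff)
qed

lemma T_nonempty: "T \<noteq> {}" using Union_T Omega(4) closure_subset by fastforce

lemma exists_boundary_edge:
  obtains K a b c where "K \<in> T" "tri a b c K" "closed_segment a b \<in> boundary_edges \<Omega> T"
proof -
  have "\<Omega> \<noteq> UNIV" using Omega(3) not_bounded_UNIV by blast
  then have "frontier \<Omega> \<noteq> {}" using frontier_eq_empty Omega(4) by blast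
  then have "boundary_edges \<Omega> T \<noteq> {}" using frontier_Omega by fastforce
  then obtain F K where F: "F \<in> boundary_edges \<Omega> T" "K \<in> T" "F edge_of K"
    unfolding boundary_edges_def edges_def by blast
  obtain a b c where abc: "tri a b c K" using tri_T[OF F(2)] .
  have "F \<in> {closed_segment a b, closed_segment b c, closed_segment c a}"
    using F(3) tri_edges[OF abc] by blast
  then show thesis
    using that[OF F(2)] abc tri_rotate[OF abc] tri_rotate[OF tri_rotate[OF abc]] F(1) by auto
qed

end

section \<open>Polynomials, partial derivatives and traces\<close>

lemma subspace_polys: "subspace (polys m)" by (simp add: polys_def)

lemma polys_monom: "i + j \<le> m \<Longrightarrow> (\<lambda>x. x $ 1 ^ i * x $ 2 ^ j) \<in> polys m"
  unfolding polys_def by (intro span_base) blast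

lemma polys_add: "p \<in> polys m \<Longrightarrow> q \<in> polys m \<Longrightarrow> (\<lambda>x. p x + q x) \<in> polys m"
  using subspace_add[OF subspace_polys, of p m q] by (simp add: plus_fun_def)

lemma polys_scale: "p \<in> polys m \<Longrightarrow> (\<lambda>x. c * p x) \<in> polys m"
  using subspace_scale[OF subspace_polys, of p m c] by (simp add: scaleR_fun_def)

lemma polys_const: "(\<lambda>x. c) \<in> polys m"
  using polys_scale[OF polys_monom[of 0 0 m], of c] by simp

lemma polys_diff: "p \<in> polys m \<Longrightarrow> q \<in> polys m \<Longrightarrow> (\<lambda>x. p x - q x) \<in> polys m"
  using polys_add[OF _ polys_scale[of q m "-1"], of p] by simp

lemma polys_induct [consumes 1, case_names monom add scale]:
  assumes "p \<in> polys m"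
    and "\<And>i j. i + j \<le> m \<Longrightarrow> P (\<lambda>x. x $ 1 ^ i * x $ 2 ^ j)"
    and "\<And>p q. p \<in> polys m \<Longrightarrow> q \<in> polys m \<Longrightarrow> P p \<Longrightarrow> P q \<Longrightarrow> P (\<lambda>x. p x + q x)"
    and "\<And>c p. p \<in> polys m \<Longrightarrow> P p \<Longrightarrow> P (\<lambda>x. c * p x)"
  shows "P p"
proof -
  have "subspace {p \<in> polys m. P p}"
    unfolding subspace_def
  proof (intro conjI ballI allI)
    show "0 \<in> {p \<in> polys m. P p}"
      using assms(4)[OF polys_monom[of 0 0 m], of 0] assms(2)[of 0 0] polys_const[of 0 m]
      by (simp add: zero_fun_def)
    show "x + y \<in> {p \<in> polys m. P p}" if "x \<in> {p \<in> polys m. P p}" "y \<in> {p \<in> polys m. P p}" for x y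
      using that assms(3)[of x y] polys_add[of x m y] by (simp add: plus_fun_def)
    show "c *\<^sub>R x \<in> {p \<in> polys m. P p}" if "x \<in> {p \<in> polys m. P p}" for x c
      using that assms(4)[of x c] polys_scale[of x m c] by (simp add: scaleR_fun_def)
  qed
  moreover have "{\<lambda>x. x $ 1 ^ i * x $ 2 ^ j | i j. i + j \<le> m} \<subseteq> {p \<in> polys m. P p}"
    using assms(2) polys_monom by auto
  ultimately have "polys m \<subseteq> {p \<in> polys m. P p}"
    unfolding polys_def by (intro span_minimal)
  then show ?thesis using assms(1) by blast
qed

lemma polys1_form:
  "p \<in> polys 1 \<longleftrightarrow> (\<exists>a b c. p = (\<lambda>x. a + b * x$1 + c * x$2))"
proof
  assume "p \<in> polys 1"
  then show "\<exists>a b c. p = (\<lambda>x. a + b * x$1 + c * x$2)"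
  proof (induction rule: polys_induct)
    case (monom i j)
    then consider "i = 0" "j = 0" | "i = 1" "j = 0" | "i = 0" "j = 1" by linarith
    then show ?case
    proof cases
      case 1 then show ?thesis by (intro exI[of _ 1] exI[of _ 0]) simp
    next
      case 2 then show ?thesis by (intro exI[of _ 0] exI[of _ 1] exI[of _ 0]) (simp add: fun_eq_iff)
    next
      case 3 then show ?thesis by (intro exI[of _ 0] exI[of _ 0] exI[of _ 1]) (simp add: fun_eq_iff)
    qed
  next
    case (add p q)
    then obtain a b c a' b' c' where "p = (\<lambda>x. a + b * x$1 + c * x$2)" "q = (\<lambda>x. a' + b' * x$1 + c' * x$2)"
      by blast
    then show ?case
      by (intro exI[of _ "a+a'"] exI[of _ "b+b'"] exI[of _ "c+c'"]) (simp add: fun_eq_iff algebra_simps)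
  next
    case (scale d p)
    then obtain a b c where "p = (\<lambda>x. a + b * x$1 + c * x$2)" by blast
    then show ?case
      by (intro exI[of _ "d*a"] exI[of _ "d*b"] exI[of _ "d*c"]) (simp add: fun_eq_iff algebra_simps)
  qed
next
  assume "\<exists>a b c. p = (\<lambda>x. a + b * x$1 + c * x$2)"
  then obtain a b c where p: "p = (\<lambda>x. a + b * x$1 + c * x$2)" by blast
  have "(\<lambda>x::real^2. x$1) \<in> polys 1" "(\<lambda>x::real^2. x$2) \<in> polys 1"
    using polys_monom[of 1 0 1] polys_monom[of 0 1 1] by simp_all
  then show "p \<in> polys 1" unfolding p by (intro polys_add polys_const polys_scale)
qed

lemma polys_mult:
  assumes "p \<in> polys m" "q \<in> polys n" shows "(\<lambda>x. p x * q x) \<in> polys (m + n)"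
  using assms(1)
proof (induction rule: polys_induct)
  case (monom i j)
  from assms(2) show ?case
  proof (induction rule: polys_induct)
    case (monom k l)
    have "(\<lambda>x::real^2. x $ 1 ^ i * x $ 2 ^ j * (x $ 1 ^ k * x $ 2 ^ l)) = (\<lambda>x. x $ 1 ^ (i + k) * x $ 2 ^ (j + l))"
      by (simp add: power_add fun_eq_iff mult_ac)
    moreover have "(i + k) + (j + l) \<le> m + n" using monom \<open>i + j \<le> m\<close> by simp
    ultimately show ?case using polys_monom by simp
  next
    case (add p q) then show ?case using polys_add by (simp add: distrib_left)
  next
    case (scale c p)
    have "(\<lambda>x::real^2. x $ 1 ^ i * x $ 2 ^ j * (c * p x)) = (\<lambda>x. c * (x $ 1 ^ i * x $ 2 ^ j * p x))"
      by (simp add: mult_ac)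
    then show ?case using polys_scale[OF scale(2), of c] by simp
  qed
next
  case (add p q) then show ?case using polys_add by (simp add: distrib_right)
next
  case (scale c p) then show ?case using polys_scale[OF scale(2), of c] by (simp add: mult.assoc)
qed

lemma polys1_mult: "p \<in> polys 1 \<Longrightarrow> q \<in> polys 1 \<Longrightarrow> (\<lambda>x. p x * q x) \<in> polys 2"
  using polys_mult[of p 1 q 1] by (simp add: numeral_2_eq_2)

lemma bary_polys: "bary a b c \<in> polys 1"
proof -
  have eq: "bary a b c = (\<lambda>x. (b$1 * c$2 - b$2 * c$1) / det2 (b - a) (c - a)
      + (b$2 - c$2) / det2 (b - a) (c - a) * x$1 + (c$1 - b$1) / det2 (b - a) (c - a) * x$2)"
    unfolding bary_def by (rule ext) (simp add: det2_def[of "b - x" "c - x" for x] add_divide_distrib[symmetric] algebra_simps)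
  show ?thesis unfolding polys1_form by (rule exI, rule exI, rule exI, rule eq)
qed

lemma pd_eqI: "(f has_derivative f') (at x) \<Longrightarrow> pd j f x = f' (axis j 1)"
  unfolding pd_def using frechet_derivative_at by metis

lemma pd_cong:
  assumes "open U" "x \<in> U" "\<And>y. y \<in> U \<Longrightarrow> f y = g y" shows "pd j f x = pd j g x"
proof -
  have "(f has_derivative D) (at x) \<longleftrightarrow> (g has_derivative D) (at x)" for D
    using has_derivative_transform_within_open[OF _ assms(1,2), of f D UNIV g]
      has_derivative_transform_within_open[OF _ assms(1,2), of g D UNIV f] assms(3) by auto
  then show ?thesis unfolding pd_def frechet_derivative_def by simp
qed

lemma has_derivative_pd:
  assumes "f differentiable (at x)"
  shows "(f has_derivative (\<lambda>h. \<Sum>j\<in>UNIV. h $ j * pd j f x)) (at x)"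
proof -
  let ?D = "frechet_derivative f (at x)"
  have D: "(f has_derivative ?D) (at x)" using assms frechet_derivative_works by blast
  then have lin: "linear ?D" by (rule has_derivative_linear)
  have "?D h = (\<Sum>j\<in>UNIV. h $ j * pd j f x)" for h
  proof -
    have "?D h = ?D (\<Sum>j\<in>UNIV. h $ j *\<^sub>R axis j 1)" using basis_expansion[of h] by (simp add: scalar_mult_eq_scaleR)
    then show ?thesis unfolding pd_def using lin by (simp add: linear_sum linear_cmul)
  qed
  then have "?D = (\<lambda>h. \<Sum>j\<in>UNIV. h $ j * pd j f x)" by blast
  then show ?thesis using D by simp
qed

lemma pd_add:
  assumes "f differentiable (at x)" "g differentiable (at x)"
  shows "pd j (\<lambda>y. f y + g y) x = pd j f x + pd j g x"
  using pd_eqI[OF has_derivative_add[OF has_derivative_pd[OF assms(1)] has_derivative_pd[OF assms(2)]]]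
  by (simp add: axis_def if_distrib if_distribR sum.delta cong: if_cong)

lemma pd_mult:
  assumes "f differentiable (at x)" "g differentiable (at x)"
  shows "pd j (\<lambda>y. f y * g y) x = f x * pd j g x + pd j f x * g x"
  using pd_eqI[OF has_derivative_mult[OF has_derivative_pd[OF assms(1)] has_derivative_pd[OF assms(2)]]]
  by (simp add: axis_def if_distrib if_distribR sum.delta cong: if_cong)

lemma pd_const: "pd j (\<lambda>y. c) x = 0"
  using pd_eqI[OF has_derivative_const] by simp

lemma pd_scale:
  assumes "f differentiable (at x)" shows "pd j (\<lambda>y. c * f y) x = c * pd j f x"
  using pd_mult[OF differentiable_const assms, of j c] by (simp add: pd_const)

lemma nth_differentiable: "(\<lambda>y::real^2. y $ i) differentiable (at x)"
  by (intro bounded_linear_imp_differentiable bounded_linear_vec_nth)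

lemma pd_nth: "pd j (\<lambda>y. y $ i) x = (if i = j then 1 else 0)"
  using pd_eqI[OF bounded_linear_imp_has_derivative[OF bounded_linear_vec_nth[of i]], of j x]
  by (simp add: axis_def)

lemma polys_smooth:
  assumes "p \<in> polys m" shows "p differentiable (at x)" "pd j p \<in> polys m"
proof -
  have "(\<forall>x. p differentiable (at x)) \<and> (\<forall>j. pd j p \<in> polys m)"
    using assms
  proof (induction rule: polys_induct)
    case (monom i k)
    have dp: "(\<lambda>y::real^2. y $ l ^ n) differentiable (at x)" for n x l
      by (intro differentiable_power nth_differentiable)
    have pdp: "pd j (\<lambda>y::real^2. y $ l ^ n) x = (if l = j then of_nat n * x $ l ^ (n - 1) else 0)" for n j x l
    proof (induction n)
      case (Suc n)
      then show ?case using pd_mult[OF nth_differentiable[of l x] dp[of l n], of j]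
        by (cases n) (auto simp: pd_nth algebra_simps)
    qed (simp add: pd_const)
    have "pd j (\<lambda>y. y $ 1 ^ i * y $ 2 ^ k) = (if j = 1 then (\<lambda>x. of_nat i * (x $ 1 ^ (i - 1) * x $ 2 ^ k)) else
        (\<lambda>x. of_nat k * (x $ 1 ^ i * x $ 2 ^ (k - 1))))" for j :: 2
      using exhaust_2[of j] by (auto simp: fun_eq_iff pd_mult[OF dp dp] pdp)
    moreover have "(\<lambda>x. real i * (x $ 1 ^ (i - 1) * x $ 2 ^ k)) \<in> polys m"
      "(\<lambda>x. real k * (x $ 1 ^ i * x $ 2 ^ (k - 1))) \<in> polys m"
      using monom by (intro polys_scale polys_monom; simp)+
    ultimately show ?case using dp by (auto intro!: differentiable_mult)
  next
    case (add p q)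
    then have "pd j (\<lambda>y. p y + q y) = (\<lambda>x. pd j p x + pd j q x)" for j by (simp add: fun_eq_iff pd_add)
    then show ?case using add by (auto intro: differentiable_add polys_add)
  next
    case (scale c p)
    then have "pd j (\<lambda>y. c * p y) = (\<lambda>x. c * pd j p x)" for j by (simp add: fun_eq_iff pd_scale)
    then show ?case using scale by (auto intro!: differentiable_mult polys_scale)
  qed
  then show "p differentiable (at x)" "pd j p \<in> polys m" by auto
qed

lemma polys_continuous: "p \<in> polys m \<Longrightarrow> continuous_on S p"
  using polys_smooth(1) by (meson continuous_at_imp_continuous_on differentiable_imp_continuous_within)

lemma pd_linear_form: "pd j (\<lambda>x. k + (m * x$1 + n * x$2)) x = (if j = 1 then m else n)"
proof -
  have d: "(\<lambda>y::real^2. k * y$i) differentiable (at x)" for k i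
    by (intro differentiable_mult differentiable_const nth_differentiable)
  have "pd j (\<lambda>x. k + (m * x$1 + n * x$2)) x = pd j (\<lambda>x. k) x + (pd j (\<lambda>x. m * x$1) x + pd j (\<lambda>x. n * x$2) x)"
    using d by (simp add: pd_add)
  also have "\<dots> = (if j = 1 then m else n)"
    using exhaust_2[of j] by (auto simp: pd_const pd_scale nth_differentiable pd_nth)
  finally show ?thesis .
qed

lemma pd_bary:
  "pd j (bary a b c) x = (if j = 1 then (b$2 - c$2) / det2 (b - a) (c - a) else (c$1 - b$1) / det2 (b - a) (c - a))"
proof -
  have eq: "bary a b c = (\<lambda>x. (b$1 * c$2 - b$2 * c$1) / det2 (b - a) (c - a)
      + ((b$2 - c$2) / det2 (b - a) (c - a) * x$1 + (c$1 - b$1) / det2 (b - a) (c - a) * x$2))"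
    unfolding bary_def by (rule ext) (simp add: det2_def[of "b - x" "c - x" for x] add_divide_distrib[symmetric] algebra_simps)
  show ?thesis unfolding eq by (rule pd_linear_form)
qed

lemma tri_islimpt: assumes "tri a b c K" "x \<in> K" shows "x islimpt interior K"
proof (cases "x \<in> interior K")
  case True
  then show ?thesis using open_interior by (simp add: interior_limit_point)
next
  case False
  have "x \<in> closure (interior K)"
    using convex_closure_interior[of K] tri_basic[OF assms(1)] tri_interior_nonempty[OF assms(1)] assms(2) closure_subset
    by blast
  then show ?thesis using False by (simp add: closure_def)
qed

lemma elem_trace_eq:
  fixes p :: "real^2 \<Rightarrow> 'b::t2_space"
  assumes "tri a b c K" "x \<in> K" "\<And>y. y \<in> interior K \<Longrightarrow> v y = p y" "isCont p x"
  shows "elem_trace K v x = p x"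
  unfolding elem_trace_def
proof (rule tendsto_Lim)
  show "\<not> trivial_limit (at x within interior K)"
    using tri_islimpt[OF assms(1,2)] trivial_limit_within by blast
  have "(p \<longlongrightarrow> p x) (at x within interior K)"
    using assms(4) by (simp add: isCont_def tendsto_within_subset[of _ _ _ UNIV])
  then show "(v \<longlongrightarrow> p x) (at x within interior K)"
    using assms(3) by (simp cong: Lim_cong_within)
qed

section \<open>Integrals over triangles\<close>

lemma bounded_measurable_integrable:
  fixes f :: "'a::euclidean_space \<Rightarrow> 'b::euclidean_space"
  assumes "S \<in> lmeasurable" "f \<in> borel_measurable (lebesgue_on S)" "\<And>x. x \<in> S \<Longrightarrow> norm (f x) \<le> B"
  shows "integrable (lebesgue_on S) f"
proof -
  interpret finite_measure "lebesgue_on S" using assms(1) by (rule finite_measure_lebesgue_on)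
  show ?thesis using assms(2,3) by (intro integrable_const_bound[of _ B]) auto
qed

lemma integrable_lebesgue_on_compact:
  fixes f :: "'a::euclidean_space \<Rightarrow> 'b::euclidean_space"
  assumes "compact S" "continuous_on S f" shows "integrable (lebesgue_on S) f"
proof -
  have "bounded (f ` S)" using assms by (simp add: compact_continuous_image compact_imp_bounded)
  then obtain B where "\<And>x. x \<in> S \<Longrightarrow> norm (f x) \<le> B" by (auto simp: bounded_iff)
  moreover have "S \<in> lmeasurable" using assms(1) by (rule lmeasurable_compact)
  ultimately show ?thesis
    using assms(2) by (intro bounded_measurable_integrable[of S f B] continuous_imp_measurable_on_sets_lebesgue) auto
qed

text \<open>Changing a function on a negligible set preserves integrability and the integral; no measurability of
  the changed function is needed, since the Lebesgue measure is complete.\<close>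

lemma lebesgue_on_spike:
  fixes f g :: "'a::euclidean_space \<Rightarrow> 'b::euclidean_space"
  assumes S: "S \<in> sets lebesgue" and N: "negligible N" "\<And>x. x \<in> S - N \<Longrightarrow> f x = g x"
    and g: "integrable (lebesgue_on S) g"
  shows "integrable (lebesgue_on S) f" "integral\<^sup>L (lebesgue_on S) f = integral\<^sup>L (lebesgue_on S) g"
proof -
  have "g absolutely_integrable_on S"
    using g S by (simp add: integrable_restrict_space set_integrable_def)
  then have "f absolutely_integrable_on S" by (rule absolutely_integrable_spike[OF _ N])
  then show f: "integrable (lebesgue_on S) f" using S by (rule absolutely_integrable_imp_integrable)
  have "integral S f = integral S g" by (rule integral_spike[OF N(1)]) (use N(2) in auto)
  then show "integral\<^sup>L (lebesgue_on S) f = integral\<^sup>L (lebesgue_on S) g"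
    using lebesgue_integral_eq_integral[OF f S] lebesgue_integral_eq_integral[OF g S] by simp
qed

lemma tri_integral_cong:
  fixes f g :: "real^2 \<Rightarrow> 'b::euclidean_space"
  assumes K: "tri a b c K" and eq: "\<And>x. x \<in> interior K \<Longrightarrow> f x = g x" and g: "continuous_on K g"
  shows "integrable (lebesgue_on K) f" "integral\<^sup>L (lebesgue_on K) f = integral\<^sup>L (lebesgue_on K) g"
proof -
  note b = tri_basic[OF K]
  have n: "negligible (frontier K)" using negligible_convex_frontier[OF b(1)] .
  have i: "integrable (lebesgue_on K) g" using b(2) g by (rule integrable_lebesgue_on_compact)
  have e: "f x = g x" if "x \<in> K - frontier K" for x
    using that b(3) eq by (simp add: frontier_def)
  have s: "K \<in> sets lebesgue" using lmeasurable_compact[OF b(2)] by auto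
  show "integrable (lebesgue_on K) f" "integral\<^sup>L (lebesgue_on K) f = integral\<^sup>L (lebesgue_on K) g"
    using lebesgue_on_spike[OF s n e i] by auto
qed

lemma AE_zero_on_open:
  fixes g :: "'a::euclidean_space \<Rightarrow> real"
  assumes U: "open U" "continuous_on U g" "U \<subseteq> S" and S: "S \<in> sets lebesgue"
    and ae: "AE x in lebesgue_on S. g x = 0" and x: "x \<in> U"
  shows "g x = 0"
proof (rule ccontr)
  assume "g x \<noteq> 0"
  have "AE x in lebesgue. x \<in> S \<longrightarrow> g x = 0" using ae AE_restrict_space_iff[of S lebesgue] S by simp
  then have n: "negligible {x. \<not> (x \<in> S \<longrightarrow> g x = 0)}"
    unfolding eventually_ae_filter using negligible_iff_null_sets negligible_subset by auto
  let ?V = "U \<inter> g -` (- {0})"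
  have "open ?V" using U by (intro continuous_open_preimage) auto
  moreover have "?V \<noteq> {}" using x \<open>g x \<noteq> 0\<close> by blast
  moreover have "negligible ?V" using n by (rule negligible_subset) (use U(3) in auto)
  ultimately show False using open_not_negligible by blast
qed

lemma continuous_nonneg_integral_zero:
  fixes g :: "real^2 \<Rightarrow> real"
  assumes "compact K" "continuous_on K g" "\<And>x. x \<in> K \<Longrightarrow> 0 \<le> g x"
    and "integral\<^sup>L (lebesgue_on K) g = 0" and x: "x \<in> interior K"
  shows "g x = 0"
proof -
  have ig: "integrable (lebesgue_on K) g" using assms(1,2) by (rule integrable_lebesgue_on_compact)
  have K: "K \<in> sets lebesgue" using lmeasurable_compact[OF assms(1)] by auto
  have "AE x in lebesgue_on K. g x = 0"
    using integral_nonneg_eq_0_iff_AE[OF ig AE_I2] assms(3,4) by simp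
  then show ?thesis
    using AE_zero_on_open[OF open_interior continuous_on_subset[OF assms(2) interior_subset] interior_subset K _ x]
    by blast
qed

text \<open>The reference triangle.\<close>

definition std2 :: "(real^2) set"
  where "std2 = convex hull {0, axis 1 1, axis 2 1}"

lemma tri_std2: "tri 0 (axis 1 1) (axis 2 1) std2"
  by (simp add: tri_def std2_def det2_def axis_def)

lemma tri_std2_permuted: "tri (axis 1 1) 0 (axis 2 1) std2" "tri (axis 1 1) (axis 2 1) 0 std2"
  using tri_swap[OF tri_std2] tri_rotate[OF tri_std2] .

lemma bary_param:
  assumes "tri a b c K"
  shows "bary a b c (a + s *\<^sub>R (b - a) + t *\<^sub>R (c - a)) = 1 - s - t"
    and "bary b c a (a + s *\<^sub>R (b - a) + t *\<^sub>R (c - a)) = s"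
    and "bary c a b (a + s *\<^sub>R (b - a) + t *\<^sub>R (c - a)) = t"
proof -
  have D: "det2 (b - a) (c - a) \<noteq> 0" using assms by (simp add: tri_def)
  have D': "det2 (c - b) (a - b) \<noteq> 0" "det2 (a - c) (b - c) \<noteq> 0"
    using D det2_rotate[of c b a] det2_rotate[of a c b] by auto
  have e: "a + s *\<^sub>R (b - a) + t *\<^sub>R (c - a) = (1 - s - t) *\<^sub>R a + s *\<^sub>R b + t *\<^sub>R c"
    "a + s *\<^sub>R (b - a) + t *\<^sub>R (c - a) = s *\<^sub>R b + t *\<^sub>R c + (1 - s - t) *\<^sub>R a"
    "a + s *\<^sub>R (b - a) + t *\<^sub>R (c - a) = t *\<^sub>R c + (1 - s - t) *\<^sub>R a + s *\<^sub>R b"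
    by (simp_all add: algebra_simps)
  show "bary a b c (a + s *\<^sub>R (b - a) + t *\<^sub>R (c - a)) = 1 - s - t"
    unfolding e(1) by (rule bary_affine_comb[OF D]) simp
  show "bary b c a (a + s *\<^sub>R (b - a) + t *\<^sub>R (c - a)) = s"
    unfolding e(2) by (rule bary_affine_comb[OF D'(1)]) simp
  show "bary c a b (a + s *\<^sub>R (b - a) + t *\<^sub>R (c - a)) = t"
    unfolding e(3) by (rule bary_affine_comb[OF D'(2)]) simp
qed

text \<open>Affine change of variables from the reference triangle.\<close>

lemma tri_integral_std2:
  fixes f :: "real^2 \<Rightarrow> real"
  assumes K: "tri a b c K" and f: "continuous_on UNIV f"
  shows "integral\<^sup>L (lebesgue_on K) f =
    \<bar>det2 (b - a) (c - a)\<bar> * integral\<^sup>L (lebesgue_on std2) (\<lambda>y. f (a + y$1 *\<^sub>R (b - a) + y$2 *\<^sub>R (c - a)))"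
proof -
  let ?g = "\<lambda>y::real^2. a + y$1 *\<^sub>R (b - a) + y$2 *\<^sub>R (c - a)"
  let ?g' = "\<lambda>y::real^2. y$1 *\<^sub>R (b - a) + y$2 *\<^sub>R (c - a)"
  let ?e = "axis 1 1 :: real^2"
  have D: "det2 (b - a) (c - a) \<noteq> 0" using K by (simp add: tri_def)
  have lin: "linear ?g'" by (rule linearI) (simp_all add: algebra_simps)
  have bl: "bounded_linear ?g'" using lin by (simp add: linear_conv_bounded_linear)
  have der: "(?g has_derivative ?g') (at y within S)" for y S
  proof -
    have "((\<lambda>y. a + ?g' y) has_derivative (\<lambda>y. 0 + ?g' y)) (at y within S)"
      by (intro has_derivative_add has_derivative_const bounded_linear_imp_has_derivative bl)
    then show ?thesis by (simp add: add.assoc)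
  qed
  have det: "det (matrix ?g') = det2 (b - a) (c - a)"
    by (simp add: det_2 matrix_def det2_def axis_def algebra_simps)
  note bg = bary_param(2,3)[OF K]
  have inj: "inj_on ?g std2"
  proof (rule inj_onI)
    fix y z assume e: "?g y = ?g z"
    show "y = z" using arg_cong[OF e, of "bary b c a"] arg_cong[OF e, of "bary c a b"]
      unfolding bg by (simp add: vec_eq_iff forall_2)
  qed
  have img: "?g ` std2 = K"
  proof -
    have "?g ` std2 = (\<lambda>y. a + y) ` (?g' ` std2)" by (simp add: image_image add.assoc)
    also have "?g' ` std2 = convex hull (?g' ` {0, axis 1 1, axis 2 1})"
      unfolding std2_def using lin by (rule convex_hull_linear_image)
    also have "?g' ` {0, axis 1 1, axis 2 1} = {0, b - a, c - a}" by (simp add: axis_def)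
    also have "(\<lambda>y. a + y) ` (convex hull {0, b - a, c - a}) = convex hull ((\<lambda>y. a + y) ` {0, b - a, c - a})"
      by (rule convex_hull_translation[symmetric])
    also have "(\<lambda>y. a + y) ` {0, b - a, c - a} = {a, b, c}" by simp
    finally show ?thesis using K by (simp add: tri_def)
  qed
  have s: "std2 \<in> sets lebesgue" "compact std2" using tri_basic[OF tri_std2] lmeasurable_compact by blast+
  have sK: "K \<in> sets lebesgue" "compact K" using tri_basic[OF K] lmeasurable_compact by blast+
  have cg: "continuous_on std2 (\<lambda>y. f (?g y))"
    by (rule continuous_on_compose2[OF f]) (auto intro!: continuous_intros)
  have iK: "integrable (lebesgue_on K) f" and iS: "integrable (lebesgue_on std2) (\<lambda>y. f (?g y))"
    using integrable_lebesgue_on_compact[OF sK(2) continuous_on_subset[OF f]] integrable_lebesgue_on_compact[OF s(2) cg]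
    by auto
  have "f absolutely_integrable_on K"
    using iK sK by (simp add: integrable_restrict_space set_integrable_def)
  then have "((\<lambda>t. t *\<^sub>R ?e) \<circ> f) absolutely_integrable_on (?g ` std2)"
    unfolding img by (rule absolutely_integrable_linear) (rule bounded_linear_scaleR_left)
  then have "(\<lambda>y. \<bar>det (matrix ?g')\<bar> *\<^sub>R (f (?g y) *\<^sub>R ?e)) absolutely_integrable_on std2 \<and>
      integral std2 (\<lambda>y. \<bar>det (matrix ?g')\<bar> *\<^sub>R (f (?g y) *\<^sub>R ?e)) = integral (?g ` std2) (\<lambda>x. f x *\<^sub>R ?e)"
    using has_absolute_integral_change_of_variables[OF s(1) der inj, of "\<lambda>x. f x *\<^sub>R ?e" "integral (?g ` std2) (\<lambda>x. f x *\<^sub>R ?e)"]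
    by (simp add: o_def)
  then have eq: "integral std2 (\<lambda>y. (\<bar>det (matrix ?g')\<bar> * f (?g y)) *\<^sub>R ?e) = integral K (\<lambda>x. f x *\<^sub>R ?e)"
    using img by simp
  have a1: "integral K (\<lambda>x. f x *\<^sub>R ?e) = integral K f *\<^sub>R ?e"
    using integrable_on_lebesgue_on[OF iK sK(1)] by (intro integral_unique has_integral_scaleR_left integrable_integral)
  have a2: "integral std2 (\<lambda>y. (\<bar>det (matrix ?g')\<bar> * f (?g y)) *\<^sub>R ?e) = (\<bar>det (matrix ?g')\<bar> * integral std2 (\<lambda>y. f (?g y))) *\<^sub>R ?e"
    using integrable_on_lebesgue_on[OF iS s(1)]
    by (intro integral_unique has_integral_scaleR_left has_integral_mult_right integrable_integral)
  have "integral K f *\<^sub>R ?e = (\<bar>det (matrix ?g')\<bar> * integral std2 (\<lambda>y. f (?g y))) *\<^sub>R ?e"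
    by (rule trans[OF trans[OF a1[symmetric] eq[symmetric]] a2])
  then have "integral K f = \<bar>det (matrix ?g')\<bar> * integral std2 (\<lambda>y. f (?g y))"
    by (simp only: scaleR_cancel_right axis_eq_0_iff one_neq_zero disj_not1 simp_thms)
  then show ?thesis
    using lebesgue_integral_eq_integral[OF iK sK(1)] lebesgue_integral_eq_integral[OF iS s(1)] det by simp
qed

text \<open>The integral over the reference triangle of a function of the barycentric coordinates.\<close>

definition moment :: "(real \<Rightarrow> real \<Rightarrow> real \<Rightarrow> real) \<Rightarrow> real"
  where "moment F = integral\<^sup>L (lebesgue_on std2) (\<lambda>y. F (1 - y$1 - y$2) (y$1) (y$2))"

lemma tri_integral_moment:
  assumes K: "tri a b c K" and F: "continuous_on UNIV (\<lambda>x. F (bary a b c x) (bary b c a x) (bary c a b x))"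
  shows "integral\<^sup>L (lebesgue_on K) (\<lambda>x. F (bary a b c x) (bary b c a x) (bary c a b x))
    = \<bar>det2 (b - a) (c - a)\<bar> * moment F"
  using tri_integral_std2[OF K F] by (simp add: moment_def bary_param[OF K])

text \<open>Relabelling the vertices of the reference triangle gives the symmetries of its moments.\<close>

lemma moment_permute:
  assumes "continuous_on UNIV (\<lambda>y::real^2. F (1 - y$1 - y$2) (y$1) (y$2))"
  shows "moment (\<lambda>u v w. F v u w) = moment F" "moment (\<lambda>u v w. F w u v) = moment F"
proof -
  let ?e1 = "axis 1 1 :: real^2" and ?e2 = "axis 2 1 :: real^2"
  have p1: "(?e1 + s *\<^sub>R (0 - ?e1) + t *\<^sub>R (?e2 - ?e1)) $ 1 = 1 - s - t"
    "(?e1 + s *\<^sub>R (0 - ?e1) + t *\<^sub>R (?e2 - ?e1)) $ 2 = t" for s t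
    by (simp_all add: axis_def)
  have p2: "(?e1 + s *\<^sub>R (?e2 - ?e1) + t *\<^sub>R (0 - ?e1)) $ 1 = 1 - s - t"
    "(?e1 + s *\<^sub>R (?e2 - ?e1) + t *\<^sub>R (0 - ?e1)) $ 2 = s" for s t
    by (simp_all add: axis_def)
  have d: "\<bar>det2 (0 - ?e1) (?e2 - ?e1)\<bar> = 1" "\<bar>det2 (?e2 - ?e1) (0 - ?e1)\<bar> = 1"
    by (simp_all add: det2_def axis_def)
  have x: "1 - (1 - s - t) - t = s" "1 - (1 - s - t) - s = t" for s t :: real by simp_all
  show "moment (\<lambda>u v w. F v u w) = moment F"
    using tri_integral_std2[OF tri_std2_permuted(1) assms] unfolding p1 d x by (simp only: moment_def mult_1)
  show "moment (\<lambda>u v w. F w u v) = moment F"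
    using tri_integral_std2[OF tri_std2_permuted(2) assms] unfolding p2 d x by (simp only: moment_def mult_1)
qed

text \<open>The integrals of \<open>\<lambda>\<^sub>1\<close>, \<open>\<lambda>\<^sub>1\<^sup>2\<close> and \<open>\<lambda>\<^sub>1 \<lambda>\<^sub>2\<close>.  Their values are irrelevant; only their symmetry under
  relabelling and the inequalities \<open>moment1 > 0\<close>, \<open>moment_sq > moment_mixed\<close> are used.\<close>

definition moment1 where "moment1 = moment (\<lambda>u v w. u)"
definition moment_sq where "moment_sq = moment (\<lambda>u v w. u * u)"
definition moment_mixed where "moment_mixed = moment (\<lambda>u v w. u * v)"

lemma moments:
  shows "moment (\<lambda>u v w. v) = moment1" "moment (\<lambda>u v w. w) = moment1"
    and "moment (\<lambda>u v w. v * v) = moment_sq" "moment (\<lambda>u v w. v * u) = moment_mixed" "moment (\<lambda>u v w. w * u) = moment_mixed" "moment (\<lambda>u v w. w * v) = moment_mixed"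
proof -
  have c: "continuous_on UNIV (\<lambda>y::real^2. 1 - y$1 - y$2)" "continuous_on UNIV (\<lambda>y::real^2. (1 - y$1 - y$2) * (1 - y$1 - y$2))"
    "continuous_on UNIV (\<lambda>y::real^2. (1 - y$1 - y$2) * y$1)" "continuous_on UNIV (\<lambda>y::real^2. y$2 * (1 - y$1 - y$2))"
    by (intro continuous_intros)+
  note p = moment_permute
  show "moment (\<lambda>u v w. v) = moment1" "moment (\<lambda>u v w. w) = moment1"
    unfolding moment1_def using p[of "\<lambda>u v w. u"] c by auto
  show "moment (\<lambda>u v w. v * v) = moment_sq" unfolding moment_sq_def using p[of "\<lambda>u v w. u * u"] c by auto
  show "moment (\<lambda>u v w. v * u) = moment_mixed" unfolding moment_mixed_def using p[of "\<lambda>u v w. u * v"] c by auto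
  show w: "moment (\<lambda>u v w. w * u) = moment_mixed" unfolding moment_mixed_def using p(2)[of "\<lambda>u v w. u * v"] c by auto
  show "moment (\<lambda>u v w. w * v) = moment_mixed" using p(1)[of "\<lambda>u v w. w * u"] c w by auto
qed

lemma moment_pos:
  assumes c: "continuous_on UNIV (\<lambda>y::real^2. F (1 - y$1 - y$2) (y$1) (y$2))"
    and nn: "\<And>u v w. 0 \<le> u \<Longrightarrow> 0 \<le> v \<Longrightarrow> 0 \<le> w \<Longrightarrow> 0 \<le> F u v w" and nz: "F (1/6) (1/3) (1/2) \<noteq> 0"
  shows "moment F > 0"
proof -
  let ?f = "\<lambda>y::real^2. F (1 - y$1 - y$2) (y$1) (y$2)"
  note K = tri_std2
  have nn': "0 \<le> ?f y" if "y \<in> std2" for y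
  proof -
    have "bary 0 (axis 1 1) (axis 2 1) y = 1 - y$1 - y$2" "bary (axis 1 1) (axis 2 1) 0 y = y$1" "bary (axis 2 1) 0 (axis 1 1) y = y$2"
      by (simp_all add: bary_def det2_def axis_def algebra_simps)
    then show ?thesis using tri_mem[OF K, of y] that nn by auto
  qed
  have "moment F \<ge> 0" unfolding moment_def by (rule integral_nonneg_AE) (use nn' in auto)
  moreover have "moment F \<noteq> 0"
  proof
    assume "moment F = 0"
    let ?x = "vector [1/3, 1/2] :: real^2"
    have "?x \<in> interior std2" unfolding tri_interior[OF K] by (simp add: bary_def det2_def axis_def)
    then have "?f ?x = 0"
      using \<open>moment F = 0\<close>
      by (intro continuous_nonneg_integral_zero[OF tri_basic(2)[OF K] continuous_on_subset[OF c] nn'])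
         (auto simp: moment_def)
    then show False using nz by simp
  qed
  ultimately show ?thesis by simp
qed

lemma moment1_pos: "moment1 > 0" unfolding moment1_def by (rule moment_pos) (auto intro!: continuous_intros)

text \<open>The integral of \<open>(\<lambda>\<^sub>1 - \<lambda>\<^sub>2)\<^sup>2\<close> is positive.\<close>

lemma moment_sq_gt_mixed: "moment_sq - moment_mixed > 0"
proof -
  have "moment (\<lambda>u v w. (u - v) * (u - v)) > 0" by (rule moment_pos) (auto intro!: continuous_intros)
  moreover have "moment (\<lambda>u v w. (u - v) * (u - v)) = moment (\<lambda>u v w. u * u) - moment (\<lambda>u v w. u * v) - moment (\<lambda>u v w. v * u) + moment (\<lambda>u v w. v * v)"
  proof -
    have i: "integrable (lebesgue_on std2) f" if "continuous_on std2 f" for f :: "real^2 \<Rightarrow> real"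
      using integrable_lebesgue_on_compact[OF tri_basic(2)[OF tri_std2] that] .
    show ?thesis
      unfolding moment_def
      by (subst Bochner_Integration.integral_diff[symmetric] Bochner_Integration.integral_add[symmetric];
          (intro i continuous_intros Bochner_Integration.integrable_diff)?)+ (simp add: algebra_simps)
  qed
  ultimately show ?thesis using moments by (simp add: moment_sq_def moment_mixed_def)
qed

lemma tri_first_moment:
  assumes "tri a b c K" shows "integral\<^sup>L (lebesgue_on K) (bary a b c) = \<bar>det2 (b - a) (c - a)\<bar> * moment1"
  using tri_integral_moment[OF assms, of "\<lambda>u v w. u"] polys_continuous[OF bary_polys]
  by (simp add: moment1_def)

lemma tri_second_moment:
  assumes K: "tri a b c K"
  shows "integral\<^sup>L (lebesgue_on K) (\<lambda>x. (q1 * bary a b c x + q2 * bary b c a x + q3 * bary c a b x) * (bary a b c x - bary b c a x))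
    = \<bar>det2 (b - a) (c - a)\<bar> * ((q1 - q2) * (moment_sq - moment_mixed))"
proof -
  note cb = polys_continuous[OF bary_polys]
  have i: "integrable (lebesgue_on K) f" if "continuous_on K f" for f :: "real^2 \<Rightarrow> real"
    using integrable_lebesgue_on_compact[OF tri_basic(2)[OF K] that] .
  let ?a = "bary a b c" and ?b = "bary b c a" and ?c = "bary c a b"
  let ?I = "integral\<^sup>L (lebesgue_on K)" and ?D = "\<bar>det2 (b - a) (c - a)\<bar>"
  have m: "?I (\<lambda>x. ?a x * ?a x) = ?D * moment_sq" "?I (\<lambda>x. ?b x * ?b x) = ?D * moment_sq" "?I (\<lambda>x. ?b x * ?a x) = ?D * moment_mixed"
    "?I (\<lambda>x. ?c x * ?a x) = ?D * moment_mixed" "?I (\<lambda>x. ?c x * ?b x) = ?D * moment_mixed"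
    using tri_integral_moment[OF K, of "\<lambda>u v w. u * u"] tri_integral_moment[OF K, of "\<lambda>u v w. v * v"]
      tri_integral_moment[OF K, of "\<lambda>u v w. v * u"] tri_integral_moment[OF K, of "\<lambda>u v w. w * u"]
      tri_integral_moment[OF K, of "\<lambda>u v w. w * v"] moments
    by (auto simp: moment_sq_def intro!: continuous_intros cb)
  have cm: "integrable (lebesgue_on K) (\<lambda>x. k * (bary p q r x * bary p' q' r' x))" for k p q r p' q' r'
    by (intro i continuous_intros cb)
  have "?I (\<lambda>x. (q1 * ?a x + q2 * ?b x + q3 * ?c x) * (?a x - ?b x))
    = ?I (\<lambda>x. q1 * (?a x * ?a x) + ((q2 - q1) * (?b x * ?a x) + (- q2 * (?b x * ?b x) + (q3 * (?c x * ?a x) + - q3 * (?c x * ?b x)))))"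
    by (rule Bochner_Integration.integral_cong) (simp_all add: algebra_simps)
  also have "\<dots> = q1 * ?I (\<lambda>x. ?a x * ?a x) + ((q2 - q1) * ?I (\<lambda>x. ?b x * ?a x)
      + (- q2 * ?I (\<lambda>x. ?b x * ?b x) + (q3 * ?I (\<lambda>x. ?c x * ?a x) + - q3 * ?I (\<lambda>x. ?c x * ?b x))))"
    by (simp only: Bochner_Integration.integral_add cm Bochner_Integration.integrable_add integral_mult_right_zero)
  also have "\<dots> = ?D * ((q1 - q2) * (moment_sq - moment_mixed))" unfolding m by (simp add: algebra_simps)
  finally show ?thesis .
qed

lemma polys1_interpolation:
  assumes K: "tri a b c K" and q: "q \<in> polys 1"
  shows "q x = q a * bary a b c x + q b * bary b c a x + q c * bary c a b x"
proof -
  obtain k m n where form: "q = (\<lambda>x. k + m * x$1 + n * x$2)" using q unfolding polys1_form by blast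
  have D: "det2 (b - a) (c - a) \<noteq> 0" using K by (simp add: tri_def)
  let ?a = "bary a b c x" and ?b = "bary b c a x" and ?c = "bary c a b x"
  have s: "?a + ?b + ?c = 1" using bary_sum[OF D] .
  have x: "x = ?a *\<^sub>R a + ?b *\<^sub>R b + ?c *\<^sub>R c" using bary_comb[OF D, of x] by simp
  have x12: "x$i = ?a * a$i + ?b * b$i + ?c * c$i" for i by (subst x) simp
  have "q x = k * (?a + ?b + ?c) + m * (?a * a$1 + ?b * b$1 + ?c * c$1) + n * (?a * a$2 + ?b * b$2 + ?c * c$2)"
    unfolding form s x12[symmetric] by simp
  then show ?thesis unfolding form by (simp add: algebra_simps)
qed

section \<open>Piecewise polynomials and the Fortin--Soulie spaces\<close>

text \<open>The function equal to \<open>P K\<close> on the interior of each triangle \<open>K\<close> and zero elsewhere.  The interiors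
  are disjoint, so the sum has at most one nonzero term.\<close>

definition piecewise :: "(real^2) set set \<Rightarrow> ((real^2) set \<Rightarrow> real^2 \<Rightarrow> real) \<Rightarrow> real^2 \<Rightarrow> real"
  where "piecewise T P x = (\<Sum>K\<in>T. if x \<in> interior K then P K x else 0)"

lemma fun_sum_apply: "(\<Sum>i\<in>I. f i) x = (\<Sum>i\<in>I. f i x)"
  for f :: "'i \<Rightarrow> 'a \<Rightarrow> 'b::comm_monoid_add"
  by (induction I rule: infinite_finite_induct) auto

lemma edge_integral_cong:
  assumes "\<And>x. x \<in> closed_segment a b \<Longrightarrow> f x = g x"
  shows "edge_integral a b f = edge_integral a b g"
proof -
  have "f (linepath a b t) = g (linepath a b t)" if "t \<in> {0..1}" for t
    using assms linepath_in_path that by blast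
  then show ?thesis unfolding edge_integral_def by (metis (no_types, lifting) integral_cong)
qed

lemma continuous_linepath:
  assumes "continuous_on UNIV f" shows "continuous_on S (\<lambda>t. f (linepath a b t))"
  by (rule continuous_on_compose2[OF assms]) (auto intro: continuous_on_linepath)

lemma edge_integral_add:
  assumes "continuous_on UNIV f" "continuous_on UNIV g"
  shows "edge_integral a b (\<lambda>x. f x + g x) = edge_integral a b f + edge_integral a b g"
  unfolding edge_integral_def
  by (subst integral_add) (auto intro!: integrable_continuous_real continuous_linepath assms simp: algebra_simps)

lemma edge_integral_scale: "edge_integral a b (\<lambda>x. c * f x) = c * edge_integral a b f"
  unfolding edge_integral_def by simp

lemma edge_integral_const: "edge_integral a b (\<lambda>x. c) = dist a b * c"
  unfolding edge_integral_def by simp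

context mesh begin

lemma piecewise_in: assumes "K \<in> T" "x \<in> interior K" shows "piecewise T P x = P K x"
proof -
  have "(if x \<in> interior K' then P K' x else 0) = (if K' = K then P K x else 0)" if "K' \<in> T" for K'
    using interior_meets[OF assms(1) that assms(2)] interior_subset assms(2) by auto
  then have "piecewise T P x = (\<Sum>K'\<in>T. if K' = K then P K x else 0)" unfolding piecewise_def by (rule sum.cong[OF refl])
  then show ?thesis using finite_T assms(1) by simp
qed

lemma piecewise_out: assumes "x \<notin> (\<Union>K\<in>T. interior K)" shows "piecewise T P x = 0"
  unfolding piecewise_def by (rule sum.neutral) (use assms in auto)

lemma piecewise_eqI:
  assumes "\<And>K x. K \<in> T \<Longrightarrow> x \<in> interior K \<Longrightarrow> q x = P K x" "\<And>x. x \<notin> (\<Union>K\<in>T. interior K) \<Longrightarrow> q x = 0"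
  shows "q = piecewise T P"
proof
  fix x show "q x = piecewise T P x"
    using assms piecewise_in[of _ x P] piecewise_out[of x P] by (cases "x \<in> (\<Union>K\<in>T. interior K)") force+
qed

lemma Omega_lmeasurable: "\<Omega> \<in> lmeasurable" using Omega by (simp add: lmeasurable_open)

lemma Omega_sets: "\<Omega> \<in> sets lebesgue" using Omega_lmeasurable by blast

lemma piecewise_measurable: 
  assumes "\<And>K. K \<in> T \<Longrightarrow> P K \<in> polys m" shows "piecewise T P \<in> borel_measurable (lebesgue_on \<Omega>)"
proof -
  have "(\<lambda>x. if x \<in> interior K then P K x else 0) \<in> borel_measurable borel" if "K \<in> T" for K
    using borel_measurable_continuous_onI[OF polys_continuous[OF assms[OF that]]]
    by (intro measurable_If_set) auto
  then have "(\<lambda>x. \<Sum>K\<in>T. if x \<in> interior K then P K x else 0) \<in> borel_measurable borel"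
    by (rule borel_measurable_sum)
  then have "piecewise T P \<in> borel_measurable lborel" unfolding piecewise_def[abs_def] by simp
  then show ?thesis by (intro measurable_restrict_space1 measurable_completion)
qed

lemma piecewise_bounded:
  assumes "\<And>K. K \<in> T \<Longrightarrow> P K \<in> polys m" shows "\<exists>B. \<forall>x. \<bar>piecewise T P x\<bar> \<le> B"
proof -
  have "\<exists>B. \<forall>x\<in>K. \<bar>P K x\<bar> \<le> B" if "K \<in> T" for K
    using compact_imp_bounded[OF compact_continuous_image[OF polys_continuous[OF assms[OF that]] basic_T(2)[OF that]]]
    by (auto simp: bounded_iff)
  then obtain B where B: "\<And>K x. K \<in> T \<Longrightarrow> x \<in> K \<Longrightarrow> \<bar>P K x\<bar> \<le> B K" by metis
  have "\<bar>piecewise T P x\<bar> \<le> (\<Sum>K\<in>T. \<bar>B K\<bar>)" for x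
    unfolding piecewise_def
  proof (rule order_trans[OF sum_abs sum_mono])
    fix K assume "K \<in> T"
    then show "\<bar>if x \<in> interior K then P K x else 0\<bar> \<le> \<bar>B K\<bar>"
      using B[of K x] interior_subset[of K] by auto
  qed
  then show ?thesis by blast
qed

lemma P_disc_iff: "q \<in> P_disc m \<Omega> T \<longleftrightarrow> (\<exists>P. (\<forall>K\<in>T. P K \<in> polys m) \<and> q = piecewise T P)"
proof
  assume q: "q \<in> P_disc m \<Omega> T"
  then have "\<forall>K\<in>T. \<exists>p. p \<in> polys m \<and> (\<forall>x\<in>interior K. q x = p x)" unfolding P_disc_def by blast
  from bchoice[OF this] obtain P where "\<forall>K\<in>T. P K \<in> polys m \<and> (\<forall>x\<in>interior K. q x = P K x)" by blast
  then show "\<exists>P. (\<forall>K\<in>T. P K \<in> polys m) \<and> q = piecewise T P"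
    using piecewise_eqI[of q P] q unfolding P_disc_def by blast
next
  assume "\<exists>P. (\<forall>K\<in>T. P K \<in> polys m) \<and> q = piecewise T P"
  then obtain P where P: "\<And>K. K \<in> T \<Longrightarrow> P K \<in> polys m" and q: "q = piecewise T P" by blast
  note meas = piecewise_measurable[of P m, OF P]
  obtain B where B: "\<And>x. \<bar>piecewise T P x\<bar> \<le> B" using piecewise_bounded[of P m, OF P] by blast
  have "(piecewise T P x)\<^sup>2 \<le> B\<^sup>2" for x using B[of x] by (metis abs_ge_zero power2_abs power_mono)
  then have "integrable (lebesgue_on \<Omega>) (\<lambda>x. (norm (piecewise T P x))\<^sup>2)"
    using borel_measurable_power[OF meas, of 2]
    by (intro bounded_measurable_integrable[OF Omega_lmeasurable, of _ "B\<^sup>2"]) auto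
  then show "q \<in> P_disc m \<Omega> T"
    unfolding P_disc_def L2_space_def q using meas P piecewise_in piecewise_out by fastforce
qed

lemma piecewise_add: "piecewise T P x + piecewise T Q x = piecewise T (\<lambda>K x. P K x + Q K x) x"
  unfolding piecewise_def sum.distrib[symmetric] by (rule sum.cong) auto

lemma piecewise_scale: "c * piecewise T P x = piecewise T (\<lambda>K x. c * P K x) x"
  unfolding piecewise_def sum_distrib_left by (rule sum.cong) auto

lemma subspace_P_disc: "subspace (P_disc m \<Omega> T)"
  unfolding subspace_def
proof (intro conjI ballI allI)
  have "(0::real^2\<Rightarrow>real) = piecewise T (\<lambda>K x. 0)" by (simp add: piecewise_def fun_eq_iff)
  then show "0 \<in> P_disc m \<Omega> T" unfolding P_disc_iff
    by (intro exI[of _ "\<lambda>K x. 0"]) (auto intro: polys_const)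
next
  fix x y assume "x \<in> P_disc m \<Omega> T" "y \<in> P_disc m \<Omega> T"
  then obtain P Q where "\<forall>K\<in>T. P K \<in> polys m" "x = piecewise T P" "\<forall>K\<in>T. Q K \<in> polys m" "y = piecewise T Q"
    unfolding P_disc_iff by blast
  then show "x + y \<in> P_disc m \<Omega> T" unfolding P_disc_iff
    by (intro exI[of _ "\<lambda>K x. P K x + Q K x"]) (auto simp: piecewise_add plus_fun_def polys_add)
next
  fix c x assume "x \<in> P_disc m \<Omega> T"
  then obtain P where "\<forall>K\<in>T. P K \<in> polys m" "x = piecewise T P" unfolding P_disc_iff by blast
  then show "c *\<^sub>R x \<in> P_disc m \<Omega> T" unfolding P_disc_iff
    by (intro exI[of _ "\<lambda>K x. c * P K x"]) (auto simp: piecewise_scale scaleR_fun_def polys_scale)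
qed

lemma P_disc_finite_dim: "\<exists>B. finite B \<and> P_disc m \<Omega> T \<subseteq> span B"
proof -
  define mn where "mn i j x = x $ 1 ^ i * x $ 2 ^ j" for i j and x :: "real^2"
  define e where "e = (\<lambda>(K0, i, j). piecewise T (\<lambda>K x. if K = K0 then mn i j x else 0))"
  let ?B = "e ` (T \<times> {..m} \<times> {..m})"
  have one: "piecewise T (\<lambda>K x. if K = K0 then p x else 0) \<in> span ?B" if "K0 \<in> T" "p \<in> polys m" for K0 p
    using that(2)
  proof (induction rule: polys_induct)
    case (monom i j)
    then have "e (K0, i, j) \<in> span ?B" using that by (intro span_base) auto
    moreover have "e (K0, i, j) = piecewise T (\<lambda>K x. if K = K0 then x $ 1 ^ i * x $ 2 ^ j else 0)"
      by (simp add: e_def mn_def cong: if_cong)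
    ultimately show ?case by simp
  next
    case (add p q)
    have eq: "piecewise T (\<lambda>K x. if K = K0 then p x + q x else 0)
      = piecewise T (\<lambda>K x. if K = K0 then p x else 0) + piecewise T (\<lambda>K x. if K = K0 then q x else 0)"
      by (simp add: fun_eq_iff piecewise_add if_distrib cong: if_cong)
    show ?case unfolding eq by (rule span_add[OF add(3,4)])
  next
    case (scale c p)
    have eq: "piecewise T (\<lambda>K x. if K = K0 then c * p x else 0) = c *\<^sub>R piecewise T (\<lambda>K x. if K = K0 then p x else 0)"
      by (simp add: fun_eq_iff piecewise_scale scaleR_fun_def if_distrib cong: if_cong)
    show ?case unfolding eq by (rule span_scale[OF scale(2)])
  qed
  have "P_disc m \<Omega> T \<subseteq> span ?B"
  proof
    fix q assume "q \<in> P_disc m \<Omega> T"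
    then obtain P where P: "\<forall>K\<in>T. P K \<in> polys m" "q = piecewise T P" unfolding P_disc_iff by blast
    have "piecewise T P x = (\<Sum>K0\<in>T. piecewise T (\<lambda>K x. if K = K0 then P K0 x else 0) x)" for x
    proof -
      have "(\<Sum>K0\<in>T. piecewise T (\<lambda>K x. if K = K0 then P K0 x else 0) x)
        = (\<Sum>K\<in>T. \<Sum>K0\<in>T. if x \<in> interior K then if K = K0 then P K0 x else 0 else 0)"
        unfolding piecewise_def by (rule sum.swap)
      also have "\<dots> = piecewise T P x" unfolding piecewise_def
        by (rule sum.cong) (use finite_T in auto)
      finally show ?thesis by simp
    qed
    then have q: "q = (\<Sum>K0\<in>T. piecewise T (\<lambda>K x. if K = K0 then P K0 x else 0))"
      unfolding P(2) by (simp add: fun_eq_iff fun_sum_apply)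
    have "(\<Sum>K0\<in>T. piecewise T (\<lambda>K x. if K = K0 then P K0 x else 0)) \<in> span ?B"
    proof (rule span_sum)
      fix K0 assume K0: "K0 \<in> T"
      show "piecewise T (\<lambda>K x. if K = K0 then P K0 x else 0) \<in> span ?B"
        by (rule one[OF K0 bspec[OF P(1) K0]])
    qed
    then show "q \<in> span ?B" by (simp only: q)
  qed
  moreover have "finite ?B" using finite_T by simp
  ultimately show ?thesis by blast
qed

lemma trace_piecewise:
  assumes "\<And>K. K \<in> T \<Longrightarrow> P K \<in> polys m" "K \<in> T" "x \<in> K" shows "elem_trace K (piecewise T P) x = P K x"
proof -
  obtain a b c where K: "tri a b c K" using tri_T[OF assms(2)] .
  show ?thesis
    using piecewise_in[OF assms(2)] polys_continuous[OF assms(1)[OF assms(2)], of UNIV] assms(3)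
    by (intro elem_trace_eq[OF K]) (auto simp: continuous_on_eq_continuous_at)
qed

text \<open>The edge conditions of the Fortin--Soulie space with homogeneous boundary values, expressed by the
  polynomial pieces instead of the traces.\<close>

definition X0_cond :: "((real^2) set \<Rightarrow> real^2 \<Rightarrow> real) \<Rightarrow> bool"
  where "X0_cond P \<longleftrightarrow>
    (\<forall>a b. closed_segment a b \<in> interior_edges \<Omega> T \<longrightarrow>
      (\<forall>K\<in>T. \<forall>K'\<in>T. K \<noteq> K' \<and> closed_segment a b edge_of K \<and> closed_segment a b edge_of K' \<longrightarrow>
        (\<forall>q\<in>polys 1. edge_integral a b (\<lambda>x. (P K x - P K' x) * q x) = 0))) \<and>
    (\<forall>a b. closed_segment a b \<in> boundary_edges \<Omega> T \<longrightarrow>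
      (\<forall>K\<in>T. closed_segment a b edge_of K \<longrightarrow>
        (\<forall>q\<in>polys 1. edge_integral a b (\<lambda>x. P K x * q x) = 0)))"

lemma X0_condD:
  assumes "X0_cond P"
  shows "closed_segment a b \<in> interior_edges \<Omega> T \<Longrightarrow> K \<in> T \<Longrightarrow> K' \<in> T \<Longrightarrow> K \<noteq> K' \<Longrightarrow> closed_segment a b edge_of K
      \<Longrightarrow> closed_segment a b edge_of K' \<Longrightarrow> q \<in> polys 1 \<Longrightarrow> edge_integral a b (\<lambda>x. (P K x - P K' x) * q x) = 0"
    and "closed_segment a b \<in> boundary_edges \<Omega> T \<Longrightarrow> K \<in> T \<Longrightarrow> closed_segment a b edge_of K
      \<Longrightarrow> q \<in> polys 1 \<Longrightarrow> edge_integral a b (\<lambda>x. P K x * q x) = 0"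
  using assms unfolding X0_cond_def by auto

lemma X0_FS_piecewise:
  assumes P: "\<And>K. K \<in> T \<Longrightarrow> P K \<in> polys 2"
  shows "piecewise T P \<in> X0_FS \<Omega> T \<longleftrightarrow> X0_cond P"
proof -
  have "piecewise T P \<in> P_disc 2 \<Omega> T" unfolding P_disc_iff using P by blast
  moreover have "elem_trace K (piecewise T P) x = P K x"
    if "K \<in> T" "closed_segment a b edge_of K" "x \<in> closed_segment a b" for K a b x
    using trace_piecewise[of P 2, OF P that(1)] edge_of_imp_subset[OF that(2)] that(3) by blast
  then have "edge_integral a b (\<lambda>x. (elem_trace K (piecewise T P) x - elem_trace K' (piecewise T P) x) * q x)
      = edge_integral a b (\<lambda>x. (P K x - P K' x) * q x)"
      "edge_integral a b (\<lambda>x. elem_trace K (piecewise T P) x * q x) = edge_integral a b (\<lambda>x. P K x * q x)"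
    if "K \<in> T" "K' \<in> T" "closed_segment a b edge_of K" "closed_segment a b edge_of K'" for K K' a b q
    by (intro edge_integral_cong; use that in simp)+
  ultimately show ?thesis unfolding X0_FS_def X_FS_def X0_cond_def by auto
qed

lemma X0_FS_iff: "v \<in> X0_FS \<Omega> T \<longleftrightarrow> (\<exists>P. (\<forall>K\<in>T. P K \<in> polys 2) \<and> X0_cond P \<and> v = piecewise T P)"
proof
  assume v: "v \<in> X0_FS \<Omega> T"
  then have "v \<in> P_disc 2 \<Omega> T" by (simp add: X0_FS_def X_FS_def)
  then obtain P where P: "\<forall>K\<in>T. P K \<in> polys 2" "v = piecewise T P" unfolding P_disc_iff by blast
  then show "\<exists>P. (\<forall>K\<in>T. P K \<in> polys 2) \<and> X0_cond P \<and> v = piecewise T P" using v X0_FS_piecewise[of P] by blast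
next
  assume "\<exists>P. (\<forall>K\<in>T. P K \<in> polys 2) \<and> X0_cond P \<and> v = piecewise T P"
  then show "v \<in> X0_FS \<Omega> T" using X0_FS_piecewise by blast
qed

lemma X0_FS_P_disc: "X0_FS \<Omega> T \<subseteq> P_disc 2 \<Omega> T" by (auto simp: X0_FS_def X_FS_def)

lemma subspace_X0_FS: "subspace (X0_FS \<Omega> T)"
  unfolding subspace_def
proof (intro conjI ballI allI)
  have "(0::real^2\<Rightarrow>real) = piecewise T (\<lambda>K x. 0)" by (simp add: piecewise_def fun_eq_iff)
  moreover have "X0_cond (\<lambda>K x. 0)" by (simp add: X0_cond_def edge_integral_const)
  ultimately show "0 \<in> X0_FS \<Omega> T" unfolding X0_FS_iff
    by (intro exI[of _ "\<lambda>K x. 0"]) (auto intro: polys_const)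
next
  fix x y assume "x \<in> X0_FS \<Omega> T" "y \<in> X0_FS \<Omega> T"
  then obtain P Q where P: "\<forall>K\<in>T. P K \<in> polys 2" "X0_cond P" "x = piecewise T P"
    and Q: "\<forall>K\<in>T. Q K \<in> polys 2" "X0_cond Q" "y = piecewise T Q"
    unfolding X0_FS_iff by blast
  have c: "continuous_on UNIV (P K)" "continuous_on UNIV (Q K)" if "K \<in> T" for K
    using polys_continuous P(1) Q(1) that by blast+
  have cq: "continuous_on UNIV q" if "q \<in> polys 1" for q using polys_continuous that by blast
  have 1: "edge_integral a b (\<lambda>x. (P K x + Q K x - (P K' x + Q K' x)) * q x)
    = edge_integral a b (\<lambda>x. (P K x - P K' x) * q x) + edge_integral a b (\<lambda>x. (Q K x - Q K' x) * q x)"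
    if "K \<in> T" "K' \<in> T" "q \<in> polys 1" for K K' q a b
    using c that(1) that(2) cq[OF that(3)] by (subst edge_integral_add[symmetric]) (auto intro!: continuous_intros simp: algebra_simps)
  have 2: "edge_integral a b (\<lambda>x. (P K x + Q K x) * q x)
    = edge_integral a b (\<lambda>x. P K x * q x) + edge_integral a b (\<lambda>x. Q K x * q x)"
    if "K \<in> T" "q \<in> polys 1" for K q a b
    using c that(1) that(2) cq[OF that(2)] by (subst edge_integral_add[symmetric]) (auto intro!: continuous_intros simp: algebra_simps)
  have "X0_cond (\<lambda>K x. P K x + Q K x)"
    using P(2) Q(2) unfolding X0_cond_def by (simp add: 1 2)
  then show "x + y \<in> X0_FS \<Omega> T" unfolding X0_FS_iff using P Q
    by (intro exI[of _ "\<lambda>K x. P K x + Q K x"]) (auto simp: piecewise_add plus_fun_def polys_add)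
next
  fix c x assume "x \<in> X0_FS \<Omega> T"
  then obtain P where P: "\<forall>K\<in>T. P K \<in> polys 2" "X0_cond P" "x = piecewise T P" unfolding X0_FS_iff by blast
  have "edge_integral a b (\<lambda>x. (c * P K x - c * P K' x) * q x) = c * edge_integral a b (\<lambda>x. (P K x - P K' x) * q x)"
    "edge_integral a b (\<lambda>x. (c * P K x) * q x) = c * edge_integral a b (\<lambda>x. P K x * q x)" for a b K K' q
    unfolding edge_integral_scale[symmetric] by (rule edge_integral_cong; simp add: algebra_simps)+
  then have "X0_cond (\<lambda>K x. c * P K x)"
    using P(2) unfolding X0_cond_def by simp
  then show "c *\<^sub>R x \<in> X0_FS \<Omega> T" unfolding X0_FS_iff using P
    by (intro exI[of _ "\<lambda>K x. c * P K x"]) (auto simp: piecewise_scale scaleR_fun_def polys_scale)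
qed

lemma X0_FS_gradient_zero:
  assumes v: "v \<in> X0_FS \<Omega> T" and g: "\<And>K x j. K \<in> T \<Longrightarrow> x \<in> interior K \<Longrightarrow> pd j v x = 0"
  shows "v = 0"
proof -
  obtain P where P: "\<And>K. K \<in> T \<Longrightarrow> P K \<in> polys 2" "X0_cond P" "v = piecewise T P"
    using v unfolding X0_FS_iff by blast
  have "\<exists>c. \<forall>x\<in>interior K. P K x = c" if K: "K \<in> T" for K
  proof -
    have "(P K has_derivative (\<lambda>h. 0)) (at x within interior K)" if x: "x \<in> interior K" for x
    proof -
      have "pd j (P K) x = 0" for j
        using pd_cong[OF open_interior x, of "P K" v j] piecewise_in[OF K, of _ P] g[OF K x] P(3) by simp
      then show ?thesis
        using has_derivative_pd[OF polys_smooth(1)[OF P(1)[OF K]], of x] has_derivative_at_withinI by fastforce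
    qed
    then show ?thesis
      using has_derivative_zero_constant[of "interior K" "P K"] basic_T(1)[OF K] by (simp add: convex_interior)
  qed
  then obtain c where c: "\<And>K x. K \<in> T \<Longrightarrow> x \<in> interior K \<Longrightarrow> P K x = c K" by metis
  have cK: "P K x = c K" if KT: "K \<in> T" "x \<in> K" for K x
  proof -
    obtain p q r where K: "tri p q r K" using tri_T[OF KT(1)] .
    have "elem_trace K v x = P K x" using trace_piecewise[of P 2] P KT by simp
    moreover have "elem_trace K v x = c K"
      by (rule elem_trace_eq[OF K KT(2)]) (use c piecewise_in[OF KT(1)] P(3) KT in auto)
    ultimately show ?thesis by simp
  qed
  have cc: "c K = c K'" if KK: "K \<in> T" "K' \<in> T" "K \<noteq> K'" "F \<in> interior_edges \<Omega> T" "F edge_of K" "F edge_of K'" for K K' F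
  proof -
    obtain p q r where K: "tri p q r K" using tri_T[OF KK(1)] .
    obtain a b where ab: "F = closed_segment a b" "a \<noteq> b"
      using KK(5) tri_edges[OF K] tri_distinct[OF K] by blast
    have "edge_integral a b (\<lambda>x. (P K x - P K' x) * 1) = 0"
      by (rule X0_condD(1)[OF P(2)]) (use KK ab polys_const[of 1 1] in auto)
    moreover have "edge_integral a b (\<lambda>x. (P K x - P K' x) * 1) = edge_integral a b (\<lambda>x. c K - c K')"
    proof (rule edge_integral_cong)
      fix x assume "x \<in> closed_segment a b"
      then have "x \<in> K" "x \<in> K'" using edge_of_imp_subset[OF KK(5)] edge_of_imp_subset[OF KK(6)] ab by auto
      then show "(P K x - P K' x) * 1 = c K - c K'" using cK KK by simp
    qed
    ultimately show ?thesis using ab by (simp add: edge_integral_const)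
  qed
  have const: "c K = c K'" if "K \<in> T" "K' \<in> T" for K K'
    by (rule constant_across_edges[of c, OF _ that]) (rule cc)
  obtain K a b r where K: "K \<in> T" "tri a b r K" "closed_segment a b \<in> boundary_edges \<Omega> T"
    using exists_boundary_edge .
  have e: "closed_segment a b edge_of K" using tri_edge_face[OF K(2)] by blast
  have "edge_integral a b (\<lambda>x. P K x * 1) = 0"
    by (rule X0_condD(2)[OF P(2)]) (use K e polys_const[of 1 1] in auto)
  moreover have "edge_integral a b (\<lambda>x. P K x * 1) = edge_integral a b (\<lambda>x. c K)"
    by (rule edge_integral_cong) (use cK[OF K(1)] edge_of_imp_subset[OF e] in auto)
  ultimately have "c K = 0" using tri_distinct[OF K(2)] by (simp add: edge_integral_const)
  then have "P K' x = 0" if "K' \<in> T" "x \<in> interior K'" for K' x using c[OF that] const[OF that(1) K(1)] by simp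
  then have "0 = piecewise T P" by (intro piecewise_eqI) auto
  then show ?thesis using P(3) by simp
qed

end

section \<open>The discrete gradient and divergence\<close>

lemma inner_mat2: "(A :: real^2^2) \<bullet> B = (\<Sum>i\<in>UNIV. \<Sum>j\<in>UNIV. A $ i $ j * B $ i $ j)"
  by (simp add: inner_vec_def)

lemma vector_fields_subspace:
  assumes "subspace X" shows "subspace (vector_fields X)"
  unfolding subspace_def
proof (intro conjI ballI allI)
  show "0 \<in> vector_fields X"
    using subspace_0[OF assms] by (simp add: vector_fields_def zero_fun_def)
  show "v + w \<in> vector_fields X" if "v \<in> vector_fields X" "w \<in> vector_fields X" for v w
    using that subspace_add[OF assms] by (fastforce simp: vector_fields_def plus_fun_def)
  show "c *\<^sub>R v \<in> vector_fields X" if "v \<in> vector_fields X" for c v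
    using that subspace_scale[OF assms] by (fastforce simp: vector_fields_def scaleR_fun_def)
qed

lemma vector_fields_span:
  assumes "X \<subseteq> span B"
  shows "vector_fields X \<subseteq> span ((\<lambda>(i, f) x. f x *\<^sub>R axis i 1) ` (UNIV \<times> B))"
proof
  let ?S = "span ((\<lambda>(i, f) x. f x *\<^sub>R axis i 1) ` (UNIV \<times> B)) :: (real^2 \<Rightarrow> real^2) set"
  have comp: "(\<lambda>x. f x *\<^sub>R axis i 1) \<in> ?S" if "f \<in> span B" for i f
    using that
  proof (induction rule: span_induct_alt)
    case base
    have "(\<lambda>x. (0::real^2 \<Rightarrow> real) x *\<^sub>R axis i (1::real)) = (0 :: real^2 \<Rightarrow> real^2)" by (simp add: fun_eq_iff)
    then show ?case using span_0 by metis
  next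
    case (step c f g)
    have "(\<lambda>x. f x *\<^sub>R axis i 1) \<in> ?S" using step(1) by (intro span_base) auto
    then have "c *\<^sub>R (\<lambda>x. f x *\<^sub>R axis i 1) + (\<lambda>x. g x *\<^sub>R axis i 1) \<in> ?S"
      using step(2) by (intro span_add span_scale)
    moreover have "c *\<^sub>R (\<lambda>x. f x *\<^sub>R axis i (1::real)) + (\<lambda>x. g x *\<^sub>R axis i 1) = (\<lambda>x. (c *\<^sub>R f + g) x *\<^sub>R axis i 1)"
      by (simp add: fun_eq_iff scaleR_fun_def scaleR_add_left)
    ultimately show ?case by simp
  qed
  fix v assume "v \<in> vector_fields X"
  then have "(\<lambda>x. v x $ i *\<^sub>R axis i 1) \<in> ?S" for i
    using comp assms by (auto simp: vector_fields_def)
  then have "(\<Sum>i\<in>UNIV. (\<lambda>x. v x $ i *\<^sub>R axis i 1)) \<in> ?S" by (intro span_sum)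
  moreover have "(\<Sum>i\<in>UNIV. (\<lambda>x. v x $ i *\<^sub>R axis i 1)) = v"
    using basis_expansion[of "v _"] by (simp add: fun_eq_iff fun_sum_apply scalar_mult_eq_scaleR)
  ultimately show "v \<in> ?S" by simp
qed

lemma Times_span:
  assumes "X \<subseteq> span B" "Y \<subseteq> span C"
  shows "X \<times> Y \<subseteq> span ((\<lambda>x. (x, 0)) ` B \<union> (\<lambda>y. (0, y)) ` C)"
proof -
  let ?S = "span ((\<lambda>x. (x, 0)) ` B \<union> (\<lambda>y. (0, y)) ` C)"
  have 1: "(x, 0) \<in> ?S" if "x \<in> span B" for x
    using that
  proof (induction rule: span_induct_alt)
    case base then show ?case using span_0 by (metis zero_prod_def)
  next
    case (step c x y)
    then have "c *\<^sub>R (x, 0) + (y, 0) \<in> ?S" by (intro span_add span_scale) (auto intro: span_base)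
    then show ?case by simp
  qed
  have 2: "(0, x) \<in> ?S" if "x \<in> span C" for x
    using that
  proof (induction rule: span_induct_alt)
    case base then show ?case using span_0 by (metis zero_prod_def)
  next
    case (step c x y)
    then have "c *\<^sub>R (0, x) + (0, y) \<in> ?S" by (intro span_add span_scale) (auto intro: span_base)
    then show ?case by simp
  qed
  have "(x, y) \<in> ?S" if "x \<in> X" "y \<in> Y" for x y
  proof -
    have "(x, 0) + (0, y) \<in> ?S" using 1 2 that assms by (intro span_add) auto
    then show ?thesis by simp
  qed
  then show ?thesis by auto
qed

text \<open>The derivative of \<open>p\<close> at \<open>x\<close> in direction \<open>d\<close>; it is the divergence of the field \<open>p d\<close>.\<close>

definition dir_deriv :: "(real^2 \<Rightarrow> real) \<Rightarrow> real^2 \<Rightarrow> real^2 \<Rightarrow> real"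
  where "dir_deriv p d x = (\<Sum>i\<in>UNIV. d $ i * pd i p x)"

lemma dir_deriv_mult:
  assumes "f differentiable (at x)" "g differentiable (at x)"
  shows "dir_deriv (\<lambda>y. f y * g y) d x = f x * dir_deriv g d x + dir_deriv f d x * g x"
  unfolding dir_deriv_def by (simp add: pd_mult[OF assms] sum_2 algebra_simps)

lemma dir_deriv_bary: "dir_deriv (bary a b c) d x = det2 d (b - c) / det2 (b - a) (c - a)"
proof -
  have "d$1 * (b$2 - c$2) + d$2 * (c$1 - b$1) = det2 d (b - c)" by (simp add: det2_def algebra_simps)
  then show ?thesis unfolding dir_deriv_def by (simp add: pd_bary sum_2 add_divide_distrib[symmetric])
qed

text \<open>The nonconforming bubble.  On every edge it vanishes at the two Gauss points and is therefore
  orthogonal to the affine functions.\<close>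

definition bubble :: "real^2 \<Rightarrow> real^2 \<Rightarrow> real^2 \<Rightarrow> real^2 \<Rightarrow> real"
  where "bubble a b c x = 2 + (-3) * ((bary a b c x * bary a b c x + bary b c a x * bary b c a x) + bary c a b x * bary c a b x)"

lemma bubble_polys: "bubble a b c \<in> polys 2"
  unfolding bubble_def[abs_def] by (intro polys_add polys_scale polys_const polys1_mult bary_polys)

lemma bubble_rotate: "bubble b c a = bubble a b c" by (rule ext) (simp add: bubble_def)

lemma bubble_swap: "bubble b a c = bubble a b c"
  by (rule ext) (simp add: bubble_def bary_swap[of b] bary_swap[of a] bary_swap[of c])

lemma bubble_edge:
  assumes K: "tri a b c K" and q: "q \<in> polys 1"
  shows "edge_integral a b (\<lambda>x. bubble a b c x * q x) = 0"
proof -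
  note rot = tri_rotate[OF K] tri_rotate[OF tri_rotate[OF K]]
  have l: "bary a b c (linepath a b t) = 1 - t" "bary b c a (linepath a b t) = t" "bary c a b (linepath a b t) = 0" for t
    using bary_add_scale[of "1-t" t _ _ _ a b] tri_bary_vertices[OF K] tri_bary_vertices[OF rot(1)] tri_bary_vertices[OF rot(2)]
    by (simp_all add: linepath_def)
  let ?f = "\<lambda>t. (6 * t - 6 * t\<^sup>2 - 1) * ((1 - t) * q a + t * q b)"
  let ?F = "\<lambda>t::real. q a * (3 * t\<^sup>2 - 2 * t ^ 3 - t) + (q b - q a) / 2 * (4 * t ^ 3 - 3 * t ^ 4 - t\<^sup>2)"
  have "(\<lambda>t. bubble a b c (linepath a b t) * q (linepath a b t)) = ?f"
    unfolding bubble_def l polys1_interpolation[OF K q, of "linepath a b t" for t]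
    by (simp add: fun_eq_iff power2_eq_square algebra_simps)
  moreover have "(?f has_integral (?F 1 - ?F 0)) {0..1}"
  proof (rule fundamental_theorem_of_calculus)
    fix t :: real assume "t \<in> {0..1}"
    have "(?F has_real_derivative ?f t) (at t within {0..1})"
      by (auto intro!: derivative_eq_intros simp: power2_eq_square power3_eq_cube field_simps)
    then show "(?F has_vector_derivative ?f t) (at t within {0..1})"
      by (simp add: has_real_derivative_iff_has_vector_derivative)
  qed simp
  ultimately show ?thesis unfolding edge_integral_def by (simp add: integral_unique)
qed

lemma dir_deriv_bubble:
  assumes K: "tri a b c K" shows "dir_deriv (bubble a b c) (b - a) x = 6 * (bary a b c x - bary b c a x)"
proof -
  have D: "det2 (b - a) (c - a) \<noteq> 0" using K by (simp add: tri_def)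
  note sm = polys_smooth(1)[OF bary_polys]
  have d: "dir_deriv (bary a b c) (b - a) x = -1" "dir_deriv (bary b c a) (b - a) x = 1" "dir_deriv (bary c a b) (b - a) x = 0"
  proof -
    have "det2 (b - a) (b - c) = - det2 (b - a) (c - a)" "det2 (b - a) (c - a) = det2 (c - b) (a - b)" 
      "det2 (b - a) (a - b) = 0"
      by (simp_all add: det2_def algebra_simps)
    then show "dir_deriv (bary a b c) (b - a) x = -1" "dir_deriv (bary b c a) (b - a) x = 1" "dir_deriv (bary c a b) (b - a) x = 0"
      unfolding dir_deriv_bary using D by auto
  qed
  have sq: "dir_deriv (\<lambda>y. bary p q r y * bary p q r y) (b - a) x = 2 * bary p q r x * dir_deriv (bary p q r) (b - a) x" for p q r
    by (simp add: dir_deriv_mult[OF sm sm])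
  have p: "pd j (bubble a b c) x = (-3) * ((pd j (\<lambda>y. bary a b c y * bary a b c y) x + pd j (\<lambda>y. bary b c a y * bary b c a y) x)
      + pd j (\<lambda>y. bary c a b y * bary c a b y) x)" for j
    unfolding bubble_def[abs_def]
    by (subst pd_add pd_scale; (intro differentiable_add differentiable_mult differentiable_const sm)?)+ (simp add: pd_const)
  have "dir_deriv (bubble a b c) (b - a) x = (-3) * ((dir_deriv (\<lambda>y. bary a b c y * bary a b c y) (b - a) x
    + dir_deriv (\<lambda>y. bary b c a y * bary b c a y) (b - a) x) + dir_deriv (\<lambda>y. bary c a b y * bary c a b y) (b - a) x)"
    unfolding dir_deriv_def p by (simp add: sum_2 algebra_simps)
  then show ?thesis unfolding sq d by simp
qed

lemma constant_of_equal_vertex_values: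
  assumes "tri a b c K" "q \<in> polys 1"
    and "\<And>a b c. tri a b c K \<Longrightarrow> q a = q b"
  shows "q x = q a"
proof -
  have D: "det2 (b - a) (c - a) \<noteq> 0" using assms(1) by (simp add: tri_def)
  have "q a = q b" "q b = q c" using assms(3)[OF assms(1)] assms(3)[OF tri_rotate[OF assms(1)]] by auto
  then have "q x = q a * (bary a b c x + bary b c a x + bary c a b x)"
    using polys1_interpolation[OF assms(1,2), of x] by (simp add: algebra_simps)
  then show ?thesis using bary_sum[OF D] by simp
qed

context mesh begin

text \<open>The velocity space, the broken quadratic vector fields, and the pressure space.\<close>

abbreviation "VX \<equiv> vector_fields (X0_FS \<Omega> T)"
abbreviation "VP \<equiv> vector_fields (P_disc 2 \<Omega> T)"
abbreviation "QX \<equiv> Q_FS \<Omega> T"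

lemma VX_VP: "VX \<subseteq> VP" using X0_FS_P_disc by (auto simp: vector_fields_def)

lemma P_disc_local:
  assumes "v \<in> P_disc m \<Omega> T" "K \<in> T"
  obtains p where "p \<in> polys m" "\<And>x. x \<in> interior K \<Longrightarrow> v x = p x" "\<And>x j. x \<in> interior K \<Longrightarrow> pd j v x = pd j p x"
    "\<And>x. x \<in> interior K \<Longrightarrow> v differentiable (at x)"
proof -
  have "\<exists>p\<in>polys m. \<forall>x\<in>interior K. v x = p x" using assms by (simp add: P_disc_def)
  then obtain p where p: "p \<in> polys m" "\<And>x. x \<in> interior K \<Longrightarrow> v x = p x" by blast
have d: "v differentiable (at x)" if x: "x \<in> interior K" for x
  proof -
    have "(p has_derivative frechet_derivative p (at x)) (at x)"
      using polys_smooth(1)[OF p(1)] frechet_derivative_works by blast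
    then have "(v has_derivative frechet_derivative p (at x)) (at x)"
      using has_derivative_transform_within_open[OF _ open_interior x] p(2) by metis
    then show ?thesis unfolding differentiable_def by blast
  qed
  have "pd j v x = pd j p x" if x: "x \<in> interior K" for x j
    by (rule pd_cong[OF open_interior x p(2)])
  then show thesis using p d by (intro that[of p])
qed

lemma VP_local:
  assumes "v \<in> VP" "K \<in> T"
  obtains p where "\<And>i. p i \<in> polys 2" "\<And>x i j. x \<in> interior K \<Longrightarrow> Grad v x $ i $ j = pd j (p i) x"
    "\<And>x i. x \<in> interior K \<Longrightarrow> (\<lambda>y. v y $ i) differentiable (at x)"
proof -
  have "\<forall>i. \<exists>p. p \<in> polys 2 \<and> (\<forall>x\<in>interior K. \<forall>j. pd j (\<lambda>y. v y $ i) x = pd j p x) \<and>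
    (\<forall>x\<in>interior K. (\<lambda>y. v y $ i) differentiable (at x))"
    using assms P_disc_local[OF _ assms(2)] unfolding vector_fields_def by (metis (mono_tags, lifting) mem_Collect_eq)
  then obtain p where "\<forall>i. p i \<in> polys 2 \<and> (\<forall>x\<in>interior K. \<forall>j. pd j (\<lambda>y. v y $ i) x = pd j (p i) x) \<and>
    (\<forall>x\<in>interior K. (\<lambda>y. v y $ i) differentiable (at x))" by metis
  then show thesis by (intro that[of p]) (auto simp: Grad_def)
qed

lemma Grad_add: "v \<in> VP \<Longrightarrow> w \<in> VP \<Longrightarrow> K \<in> T \<Longrightarrow> x \<in> interior K \<Longrightarrow> Grad (v + w) x = Grad v x + Grad w x"
proof -
  assume a: "v \<in> VP" "w \<in> VP" "K \<in> T" "x \<in> interior K"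
  have "(\<lambda>y. v y $ i) differentiable (at x)" "(\<lambda>y. w y $ i) differentiable (at x)" for i
    using VP_local[OF a(1,3)] VP_local[OF a(2,3)] a(4) by metis+
  then show ?thesis by (simp add: Grad_def vec_eq_iff pd_add)
qed

lemma Grad_scale: "v \<in> VP \<Longrightarrow> K \<in> T \<Longrightarrow> x \<in> interior K \<Longrightarrow> Grad (c *\<^sub>R v) x = c *\<^sub>R Grad v x"
proof -
  assume a: "v \<in> VP" "K \<in> T" "x \<in> interior K"
  have "(\<lambda>y. v y $ i) differentiable (at x)" for i
    using VP_local[OF a(1,2)] a(3) by metis
  then show ?thesis by (simp add: Grad_def vec_eq_iff scaleR_fun_def pd_scale)
qed

text \<open>Almost every point of a triangle is an interior point.\<close>

lemma integral_interior_cong: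
  fixes f g :: "real^2 \<Rightarrow> real"
  assumes "K \<in> T" "\<And>x. x \<in> interior K \<Longrightarrow> f x = g x" "integrable (lebesgue_on K) g"
  shows "integral\<^sup>L (lebesgue_on K) f = integral\<^sup>L (lebesgue_on K) g"
proof -
  have s: "K \<in> sets lebesgue" using lmeasurable_compact[OF basic_T(2)[OF assms(1)]] by auto
  show ?thesis
    using lebesgue_on_spike(2)[OF s negligible_convex_frontier[OF basic_T(1)[OF assms(1)]] _ assms(3), of f]
      assms(2) basic_T(3)[OF assms(1)] by (auto simp: frontier_def)
qed

lemma Grad_inner_integrable:
  assumes "v \<in> VP" "w \<in> VP" "K \<in> T" shows "integrable (lebesgue_on K) (\<lambda>x. Grad v x \<bullet> Grad w x)"
proof -
  obtain a b c where K: "tri a b c K" using tri_T[OF assms(3)] .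
  obtain p where p: "\<And>i. p i \<in> polys 2" "\<And>x i j. x \<in> interior K \<Longrightarrow> Grad v x $ i $ j = pd j (p i) x"
    using VP_local[OF assms(1,3)] by metis
  obtain q where q: "\<And>i. q i \<in> polys 2" "\<And>x i j. x \<in> interior K \<Longrightarrow> Grad w x $ i $ j = pd j (q i) x"
    using VP_local[OF assms(2,3)] by metis
  have c: "continuous_on K (pd j (p i))" "continuous_on K (pd j (q i))" for i j
    using p(1) q(1) polys_continuous polys_smooth(2) by blast+
  show ?thesis
    by (rule tri_integral_cong(1)[OF K, of _ "\<lambda>x. \<Sum>i\<in>UNIV. \<Sum>j\<in>UNIV. pd j (p i) x * pd j (q i) x"])
       (auto simp: inner_mat2 p q intro!: continuous_intros c)
qed

lemma div_integrable:
  assumes "v \<in> VP" "q \<in> P_disc m \<Omega> T" "K \<in> T"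
  shows "integrable (lebesgue_on K) (\<lambda>x. q x * (\<Sum>i\<in>UNIV. Grad v x $ i $ i))"
proof -
  obtain a b c where K: "tri a b c K" using tri_T[OF assms(3)] .
  obtain p where p: "\<And>i. p i \<in> polys 2" "\<And>x i j. x \<in> interior K \<Longrightarrow> Grad v x $ i $ j = pd j (p i) x"
    using VP_local[OF assms(1,3)] by metis
  obtain r where r: "r \<in> polys m" "\<And>x. x \<in> interior K \<Longrightarrow> q x = r x"
    using P_disc_local[OF assms(2,3)] by metis
  have c: "continuous_on K (pd j (p i))" "continuous_on K r" for i j
    using p(1) r(1) polys_continuous polys_smooth(2) by blast+
  show ?thesis
    by (rule tri_integral_cong(1)[OF K, of _ "\<lambda>x. r x * (\<Sum>i\<in>UNIV. pd i (p i) x)"])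
       (auto simp: p r intro!: continuous_intros c)
qed

lemma grad_inner_linear: assumes "u \<in> VP" shows "linear_on VP (grad_inner_h T u)"
  unfolding linear_on_def
proof (intro conjI ballI allI)
  fix v w assume vw: "v \<in> VP" "w \<in> VP"
  have "(\<integral>x. Grad u x \<bullet> Grad (v + w) x \<partial>lebesgue_on K)
    = (\<integral>x. Grad u x \<bullet> Grad v x \<partial>lebesgue_on K) + (\<integral>x. Grad u x \<bullet> Grad w x \<partial>lebesgue_on K)" if K: "K \<in> T" for K
  proof -
    note i = Grad_inner_integrable[OF assms vw(1) K] Grad_inner_integrable[OF assms vw(2) K]
    have "(\<integral>x. Grad u x \<bullet> Grad (v + w) x \<partial>lebesgue_on K) = (\<integral>x. Grad u x \<bullet> Grad v x + Grad u x \<bullet> Grad w x \<partial>lebesgue_on K)"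
      by (rule integral_interior_cong[OF K _ Bochner_Integration.integrable_add[OF i]])
         (simp add: Grad_add[OF vw K] inner_add_right)
    then show ?thesis using Bochner_Integration.integral_add[OF i] by simp
  qed
  then show "grad_inner_h T u (v + w) = grad_inner_h T u v + grad_inner_h T u w"
    unfolding grad_inner_h_def by (simp add: sum.distrib)
next
  fix c v assume v: "v \<in> VP"
  have "(\<integral>x. Grad u x \<bullet> Grad (c *\<^sub>R v) x \<partial>lebesgue_on K) = c * (\<integral>x. Grad u x \<bullet> Grad v x \<partial>lebesgue_on K)" if K: "K \<in> T" for K
  proof -
    have "(\<integral>x. Grad u x \<bullet> Grad (c *\<^sub>R v) x \<partial>lebesgue_on K) = (\<integral>x. c * (Grad u x \<bullet> Grad v x) \<partial>lebesgue_on K)"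
      by (rule integral_interior_cong[OF K _ integrable_mult_right[OF Grad_inner_integrable[OF assms v K]]])
         (simp add: Grad_scale[OF v K])
    then show ?thesis by simp
  qed
  then show "grad_inner_h T u (c *\<^sub>R v) = c *\<^sub>R grad_inner_h T u v"
    unfolding grad_inner_h_def by (simp add: sum_distrib_left)
qed

lemma grad_inner_sym: "grad_inner_h T v w = grad_inner_h T w v"
  unfolding grad_inner_h_def by (simp add: inner_commute)

lemma div_linear_left: assumes "q \<in> P_disc m \<Omega> T" shows "linear_on VP (\<lambda>v. div_h T v q)"
  unfolding linear_on_def
proof (intro conjI ballI allI)
  fix v w assume vw: "v \<in> VP" "w \<in> VP"
  have "(\<integral>x. q x * (\<Sum>i\<in>UNIV. Grad (v + w) x $ i $ i) \<partial>lebesgue_on K)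
    = (\<integral>x. q x * (\<Sum>i\<in>UNIV. Grad v x $ i $ i) \<partial>lebesgue_on K) + (\<integral>x. q x * (\<Sum>i\<in>UNIV. Grad w x $ i $ i) \<partial>lebesgue_on K)"
    if K: "K \<in> T" for K
  proof -
    note i = div_integrable[OF vw(1) assms K] div_integrable[OF vw(2) assms K]
    have "(\<integral>x. q x * (\<Sum>i\<in>UNIV. Grad (v + w) x $ i $ i) \<partial>lebesgue_on K)
      = (\<integral>x. q x * (\<Sum>i\<in>UNIV. Grad v x $ i $ i) + q x * (\<Sum>i\<in>UNIV. Grad w x $ i $ i) \<partial>lebesgue_on K)"
      by (rule integral_interior_cong[OF K _ Bochner_Integration.integrable_add[OF i]])
         (simp add: Grad_add[OF vw K] sum.distrib distrib_left)
    then show ?thesis using Bochner_Integration.integral_add[OF i] by simp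
  qed
  then show "div_h T (v + w) q = div_h T v q + div_h T w q"
    unfolding div_h_def by (simp add: sum.distrib)
next
  fix c v assume v: "v \<in> VP"
  have "(\<integral>x. q x * (\<Sum>i\<in>UNIV. Grad (c *\<^sub>R v) x $ i $ i) \<partial>lebesgue_on K)
    = c * (\<integral>x. q x * (\<Sum>i\<in>UNIV. Grad v x $ i $ i) \<partial>lebesgue_on K)" if K: "K \<in> T" for K
  proof -
    have "(\<integral>x. q x * (\<Sum>i\<in>UNIV. Grad (c *\<^sub>R v) x $ i $ i) \<partial>lebesgue_on K)
      = (\<integral>x. c * (q x * (\<Sum>i\<in>UNIV. Grad v x $ i $ i)) \<partial>lebesgue_on K)"
      by (rule integral_interior_cong[OF K _ integrable_mult_right[OF div_integrable[OF v assms K]]])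
         (simp add: Grad_scale[OF v K] sum_distrib_left mult_ac)
    then show ?thesis by simp
  qed
  then show "div_h T (c *\<^sub>R v) q = c *\<^sub>R div_h T v q"
    unfolding div_h_def real_scaleR_def by (subst sum_distrib_left) (rule sum.cong[OF refl])
qed

lemma div_linear_right: assumes v: "v \<in> VP" shows "linear_on (P_disc m \<Omega> T) (div_h T v)"
  unfolding linear_on_def
proof (intro conjI ballI allI)
  fix p q assume pq: "p \<in> P_disc m \<Omega> T" "q \<in> P_disc m \<Omega> T"
  then have "(\<integral>x. (p + q) x * (\<Sum>i\<in>UNIV. Grad v x $ i $ i) \<partial>lebesgue_on K)
    = (\<integral>x. p x * (\<Sum>i\<in>UNIV. Grad v x $ i $ i) \<partial>lebesgue_on K) + (\<integral>x. q x * (\<Sum>i\<in>UNIV. Grad v x $ i $ i) \<partial>lebesgue_on K)"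
    if K: "K \<in> T" for K
    using Bochner_Integration.integral_add[OF div_integrable[OF v pq(1) K] div_integrable[OF v pq(2) K]]
    by (simp only: plus_fun_apply distrib_right)
  then show "div_h T v (p + q) = div_h T v p + div_h T v q"
    unfolding div_h_def by (simp add: sum.distrib)
next
  fix c p
  show "div_h T v (c *\<^sub>R p) = c *\<^sub>R div_h T v p"
  proof -
    have "(\<integral>x. (c *\<^sub>R p) x * (\<Sum>i\<in>UNIV. Grad v x $ i $ i) \<partial>lebesgue_on K)
      = c * (\<integral>x. p x * (\<Sum>i\<in>UNIV. Grad v x $ i $ i) \<partial>lebesgue_on K)" for K
      by (simp add: scaleR_fun_def mult.assoc)
    then show ?thesis unfolding div_h_def real_scaleR_def by (subst sum_distrib_left) (rule sum.cong[OF refl])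
  qed
qed

lemma grad_inner_nonneg: "0 \<le> grad_inner_h T v v"
  unfolding grad_inner_h_def by (intro sum_nonneg integral_nonneg_AE) auto

lemma grad_inner_zero:
  assumes v: "v \<in> VX" "grad_inner_h T v v = 0" shows "v = 0"
proof -
  have vP: "v \<in> VP" using v VX_VP by blast
  have Gz: "Grad v x = 0" if K: "K \<in> T" "x \<in> interior K" for K x
  proof -
    obtain a b c where t: "tri a b c K" using tri_T[OF K(1)] .
    obtain p where p: "\<And>i. p i \<in> polys 2" "\<And>x i j. x \<in> interior K \<Longrightarrow> Grad v x $ i $ j = pd j (p i) x"
      using VP_local[OF vP K(1)] by metis
    let ?g = "\<lambda>x. \<Sum>i\<in>UNIV. \<Sum>j\<in>UNIV. pd j (p i) x * pd j (p i) x"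
    have "continuous_on K (pd j (p i))" for i j
      using p(1) polys_continuous polys_smooth(2) by blast
    then have c: "continuous_on K ?g" by (intro continuous_intros)
    have g: "Grad v x \<bullet> Grad v x = ?g x" if "x \<in> interior K" for x
      using p(2)[OF that] by (simp add: inner_mat2)
    have "(\<integral>x. Grad v x \<bullet> Grad v x \<partial>lebesgue_on K) = 0"
      using v(2) K(1) finite_T unfolding grad_inner_h_def by (subst (asm) sum_nonneg_eq_0_iff) auto
    then have "integral\<^sup>L (lebesgue_on K) ?g = 0"
      using tri_integral_cong(2)[OF t g c] by simp
    then have "?g x = 0"
      by (intro continuous_nonneg_integral_zero[OF basic_T(2)[OF K(1)] c _ _ K(2)]) (auto intro!: sum_nonneg)
    then show ?thesis using g[OF K(2)] by simp
  qed
  have "(\<lambda>x. v x $ i) = 0" for i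
  proof (rule X0_FS_gradient_zero)
    show "(\<lambda>x. v x $ i) \<in> X0_FS \<Omega> T" using v(1) by (simp add: vector_fields_def)
    show "pd j (\<lambda>x. v x $ i) x = 0" if "K \<in> T" "x \<in> interior K" for K x j
      using Gz[OF that] by (simp add: Grad_def vec_eq_iff)
  qed
  then show ?thesis by (simp add: fun_eq_iff vec_eq_iff)
qed

end

section \<open>Nondegeneracy of the discrete Stokes form\<close>

lemma bubble_edges:
  assumes K: "tri a b c K" and e: "closed_segment p r edge_of K" and q: "q \<in> polys 1"
  shows "edge_integral p r (\<lambda>x. bubble a b c x * q x) = 0"
proof -
  have 1: "edge_integral a b (\<lambda>x. bubble a b c x * q x) = 0 \<and> edge_integral b a (\<lambda>x. bubble a b c x * q x) = 0" if "tri a b c K" for a b c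
    using bubble_edge[OF that q] bubble_edge[OF tri_swap[OF that] q] by (simp add: bubble_swap)
  have "closed_segment p r \<in> {closed_segment a b, closed_segment b c, closed_segment c a}"
    using tri_edges[OF K] e by blast
  then have "{p, r} = {a, b} \<or> {p, r} = {b, c} \<or> {p, r} = {c, a}" by simp
  then show ?thesis
    using 1[OF K] 1[OF tri_rotate[OF K]] 1[OF tri_rotate[OF tri_rotate[OF K]]]
    by (auto simp: doubleton_eq_iff bubble_rotate[of b c a] bubble_rotate[of a b c])
qed

text \<open>The quadratic function that is nonzero on the interior of the edge \<open>[a, b]\<close> and vanishes on the other
  two edges.\<close>

definition edge_bubble :: "real^2 \<Rightarrow> real^2 \<Rightarrow> real^2 \<Rightarrow> real^2 \<Rightarrow> real"
  where "edge_bubble a b c x = bary a b c x * bary b c a x"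

lemma edge_bubble_polys: "edge_bubble a b c \<in> polys 2"
  unfolding edge_bubble_def[abs_def] by (intro polys1_mult bary_polys)

lemma edge_bubble_on_edge:
  assumes "tri a b c K" shows "edge_bubble a b c ((1 - t) *\<^sub>R a + t *\<^sub>R b) = (1 - t) * t"
  using bary_add_scale[of "1-t" t _ _ _ a b] tri_bary_vertices[OF assms] tri_bary_vertices[OF tri_rotate[OF assms]]
  by (simp add: edge_bubble_def)

lemma edge_bubble_off_edge:
  assumes K: "tri a b c K" and F: "F edge_of K" "F \<noteq> closed_segment a b" and x: "x \<in> F"
  shows "edge_bubble a b c x = 0"
proof -
  have "F = closed_segment b c \<or> F = closed_segment c a" using tri_edges[OF K] F by blast
  then show ?thesis
    using x bary_edge[OF tri_rotate[OF K], of x] bary_edge[OF tri_rotate[OF tri_rotate[OF K]], of x]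
    by (auto simp: edge_bubble_def)
qed

text \<open>The value depends on the triangle only through the side of the edge on which it lies.\<close>

lemma edge_bubble_integral:
  assumes K: "tri a b c K"
  shows "integral\<^sup>L (lebesgue_on K) (dir_deriv (edge_bubble a b c) d) = moment1 * (sgn (det2 (b - a) (c - a)) * det2 d (b - a))"
proof -
  let ?D = "det2 (b - a) (c - a)"
  have D: "?D \<noteq> 0" using K by (simp add: tri_def)
  note sm = polys_smooth(1)[OF bary_polys]
  have rot: "det2 (c - b) (a - b) = ?D" by (rule det2_rotate)
  have i: "integrable (lebesgue_on K) (bary p q r)" for p q r
    by (intro integrable_lebesgue_on_compact[OF tri_basic(2)[OF K]] polys_continuous[OF bary_polys])
  have "dir_deriv (edge_bubble a b c) d = (\<lambda>x. (det2 d (c - a) / ?D) * bary a b c x + (det2 d (b - c) / ?D) * bary b c a x)"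
    unfolding edge_bubble_def[abs_def] by (rule ext) (simp add: dir_deriv_mult[OF sm sm] dir_deriv_bary rot)
  then have "integral\<^sup>L (lebesgue_on K) (dir_deriv (edge_bubble a b c) d)
    = (det2 d (c - a) / ?D) * (\<bar>?D\<bar> * moment1) + (det2 d (b - c) / ?D) * (\<bar>?D\<bar> * moment1)"
    using tri_first_moment[OF K] tri_first_moment[OF tri_rotate[OF K]]
    by (simp add: i Bochner_Integration.integral_add integrable_mult_right rot)
  also have "\<dots> = moment1 * ((\<bar>?D\<bar> / ?D) * (det2 d (c - a) + det2 d (b - c)))"
    by (simp add: algebra_simps add_divide_distrib)
  also have "det2 d (c - a) + det2 d (b - c) = det2 d (b - a)" by (simp add: det2_def algebra_simps)
  also have "\<bar>?D\<bar> / ?D = sgn ?D" using D by (simp add: sgn_if)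
  finally show ?thesis .
qed

context mesh begin

lemma QX_P_disc: "QX \<subseteq> P_disc 1 \<Omega> T" by (auto simp: Q_FS_def)

lemma P_disc_meas: "q \<in> P_disc m \<Omega> T \<Longrightarrow> q \<in> borel_measurable (lebesgue_on \<Omega>)"
  by (auto simp: P_disc_def L2_space_def)

lemma P_disc_bounded: assumes "q \<in> P_disc m \<Omega> T" shows "\<exists>B. \<forall>x. \<bar>q x\<bar> \<le> B"
  using assms piecewise_bounded[of _ m] unfolding P_disc_iff by blast

lemma P_disc_integrable:
  assumes "q \<in> P_disc m \<Omega> T" shows "integrable (lebesgue_on \<Omega>) q"
proof -
  obtain B where "\<forall>x. \<bar>q x\<bar> \<le> B" using P_disc_bounded[OF assms] by blast
  then show ?thesis
    by (intro bounded_measurable_integrable[OF Omega_lmeasurable P_disc_meas[OF assms], of B]) auto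
qed

lemma P_disc_mult_integrable:
  assumes "p \<in> P_disc m \<Omega> T" "q \<in> P_disc n \<Omega> T" shows "integrable (lebesgue_on \<Omega>) (\<lambda>x. p x * q x)"
proof -
  obtain A where A: "\<And>x. \<bar>p x\<bar> \<le> A" using P_disc_bounded[OF assms(1)] by blast
  obtain B where B: "\<And>x. \<bar>q x\<bar> \<le> B" using P_disc_bounded[OF assms(2)] by blast
  have "\<bar>p x * q x\<bar> \<le> A * B" for x
    unfolding abs_mult using A[of x] B[of x] by (intro mult_mono) auto
  then show ?thesis
    by (intro bounded_measurable_integrable[OF Omega_lmeasurable, of _ "A * B"] borel_measurable_times P_disc_meas[OF assms(1)] P_disc_meas[OF assms(2)]) auto
qed

lemma subspace_QX: "subspace QX"
  unfolding subspace_def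
proof (intro conjI ballI allI)
  have sub: "q \<in> QX \<longleftrightarrow> q \<in> P_disc 1 \<Omega> T \<and> (\<integral>x. q x \<partial>lebesgue_on \<Omega>) = 0" for q
    by (auto simp: Q_FS_def L2_zmv_def P_disc_def)
  show "0 \<in> QX" unfolding sub using subspace_0[OF subspace_P_disc] by (simp add: zero_fun_def)
  show "p + q \<in> QX" if "p \<in> QX" "q \<in> QX" for p q
  proof -
    have "(\<integral>x. p x + q x \<partial>lebesgue_on \<Omega>) = (\<integral>x. p x \<partial>lebesgue_on \<Omega>) + (\<integral>x. q x \<partial>lebesgue_on \<Omega>)"
      using that sub P_disc_integrable by (intro Bochner_Integration.integral_add) auto
    also have "\<dots> = 0" using that sub by simp
    finally have "(\<integral>x. (p + q) x \<partial>lebesgue_on \<Omega>) = 0" unfolding plus_fun_apply .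
    then show ?thesis unfolding sub using that[unfolded sub] subspace_add[OF subspace_P_disc] by blast
  qed
  show "c *\<^sub>R p \<in> QX" if "p \<in> QX" for p c
    using that subspace_scale[OF subspace_P_disc, of p 1 c] unfolding sub by (simp add: scaleR_fun_def)
qed

lemma negligible_skeleton: "negligible (\<Omega> - (\<Union>K\<in>T. interior K))"
proof (rule negligible_subset)
  show "negligible (\<Union>K\<in>T. frontier K)"
    using finite_T basic_T(1) negligible_convex_frontier by (intro negligible_Union) auto
  show "\<Omega> - (\<Union>K\<in>T. interior K) \<subseteq> (\<Union>K\<in>T. frontier K)"
    using Union_T closure_subset[of \<Omega>] basic_T(3) by (fastforce simp: frontier_def)
qed

lemma scalar_X0_vector: "f \<in> X0_FS \<Omega> T \<Longrightarrow> (\<lambda>x. f x *\<^sub>R d) \<in> VX"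
  using subspace_scale[OF subspace_X0_FS, of f "d $ i" for i]
  by (simp add: vector_fields_def scaleR_fun_def mult.commute)

lemma div_h_piecewise:
  assumes P: "\<And>K. K \<in> T \<Longrightarrow> P K \<in> polys 2" and R: "\<And>K. K \<in> T \<Longrightarrow> R K \<in> polys m"
  shows "div_h T (\<lambda>x. piecewise T P x *\<^sub>R d) (piecewise T R) = (\<Sum>K\<in>T. \<integral>x. R K x * dir_deriv (P K) d x \<partial>lebesgue_on K)"
  unfolding div_h_def
proof (rule sum.cong[OF refl])
  fix K assume K: "K \<in> T"
  obtain a b c where t: "tri a b c K" using tri_T[OF K] .
  have "continuous_on K (pd i (P K))" "continuous_on K (R K)" for i
    using polys_continuous polys_smooth(2)[OF P[OF K]] R[OF K] by blast+
  then have c: "continuous_on K (\<lambda>x. R K x * dir_deriv (P K) d x)"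
    unfolding dir_deriv_def by (intro continuous_intros)
  have "piecewise T R x * (\<Sum>i\<in>UNIV. Grad (\<lambda>x. piecewise T P x *\<^sub>R d) x $ i $ i) = R K x * dir_deriv (P K) d x" if x: "x \<in> interior K" for x
  proof -
    have "pd i (\<lambda>y. piecewise T P y * d $ i) x = d $ i * pd i (P K) x" for i
    proof -
      have "pd i (\<lambda>y. piecewise T P y * d $ i) x = pd i (\<lambda>y. d $ i * P K y) x"
        by (rule pd_cong[OF open_interior x]) (simp add: piecewise_in[OF K])
      then show ?thesis using pd_scale[OF polys_smooth(1)[OF P[OF K]]] by simp
    qed
    then show ?thesis by (simp add: Grad_def piecewise_in[OF K x] dir_deriv_def)
  qed
  then show "(\<integral>x. piecewise T R x * (\<Sum>i\<in>UNIV. Grad (\<lambda>x. piecewise T P x *\<^sub>R d) x $ i $ i) \<partial>lebesgue_on K)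
    = (\<integral>x. R K x * dir_deriv (P K) d x \<partial>lebesgue_on K)"
    by (rule tri_integral_cong(2)[OF t _ c])
qed

lemma bubble_X0:
  assumes t: "tri a b c K" and PK: "P K = bubble a b c" and P0: "\<And>L. L \<noteq> K \<Longrightarrow> P L = (\<lambda>x. 0)"
  shows "X0_cond P"
proof -
  have z: "edge_integral p r (\<lambda>x. P L x * q x) = 0" if "closed_segment p r edge_of L" "q \<in> polys 1" for L p r q
    using bubble_edges[OF t _ that(2)] that(1) PK P0 by (cases "L = K") (auto simp: edge_integral_const)
  have c: "continuous_on UNIV (P L)" for L
    using polys_continuous[OF bubble_polys] PK P0 by (cases "L = K") auto
  have "edge_integral p r (\<lambda>x. (P L x - P L' x) * q x) = 0"
    if "closed_segment p r edge_of L" "closed_segment p r edge_of L'" "q \<in> polys 1" for L L' p r q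
  proof -
    have q: "continuous_on UNIV q" using polys_continuous[OF that(3)] .
    have "edge_integral p r (\<lambda>x. (P L x - P L' x) * q x) = edge_integral p r (\<lambda>x. P L x * q x + (-1) * (P L' x * q x))"
      by (rule edge_integral_cong) (simp add: algebra_simps)
    also have "\<dots> = edge_integral p r (\<lambda>x. P L x * q x) + edge_integral p r (\<lambda>x. (-1) * (P L' x * q x))"
      by (rule edge_integral_add) (intro continuous_intros c q)+
    also have "\<dots> = 0" unfolding edge_integral_scale z[OF that(1,3)] z[OF that(2,3)] by simp
    finally show ?thesis .
  qed
  then show ?thesis using z unfolding X0_cond_def by blast
qed

text \<open>The two pieces agree on the common edge, because there both are \<open>t (1 - t)\<close>; on all other edges they
  vanish.  No third triangle contains the edge.\<close>

lemma edge_bubble_X0: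
  assumes K: "K \<in> T" "tri a b c K" and K': "K' \<in> T" "tri a b c' K'" and ne: "K \<noteq> K'"
    and int: "closed_segment a b \<in> interior_edges \<Omega> T"
    and PK: "P K = edge_bubble a b c" "P K' = edge_bubble a b c'" and P0: "\<And>L. L \<noteq> K \<Longrightarrow> L \<noteq> K' \<Longrightarrow> P L = (\<lambda>x. 0)"
  shows "X0_cond P"
proof -
  let ?F = "closed_segment a b"
  have off: "P L x = 0" if "G edge_of L" "G \<noteq> ?F" "x \<in> G" for L G x
  proof -
    consider "L = K" | "L = K'" | "L \<noteq> K" "L \<noteq> K'" by blast
    then show ?thesis
      using edge_bubble_off_edge[OF K(2) _ that(2,3)] edge_bubble_off_edge[OF K'(2) _ that(2,3)] that(1) PK P0 by cases auto
  qed
  have on: "edge_bubble a b c x = edge_bubble a b c' x" if x: "x \<in> ?F" for x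
    using x edge_bubble_on_edge[OF K(2)] edge_bubble_on_edge[OF K'(2)] by (auto simp: closed_segment_def)
  have e: "?F edge_of K" "?F edge_of K'" using tri_edge_face K(2) K'(2) by blast+
  have val: "P L x = edge_bubble a b c x" if L: "L \<in> T" "?F edge_of L" and x: "x \<in> ?F" for L x
  proof -
    have "L = K \<or> L = K'" using at_most_two[OF K(1) K'(1) L(1) e L(2) refl ne] by blast
    then show ?thesis using on[OF x] PK by auto
  qed
  have jump: "P L x = P L' x" if "G edge_of L" "G edge_of L'" "L \<in> T" "L' \<in> T" "x \<in> G" for L L' G x
  proof (cases "G = ?F")
    case True
    then show ?thesis using val[of L x] val[of L' x] that by simp
  next
    case False
    then show ?thesis using off[OF that(1) _ that(5)] off[OF that(2) _ that(5)] by simp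
  qed
  have bd: "P L x = 0" if "G edge_of L" "G \<in> boundary_edges \<Omega> T" "x \<in> G" for L G x
  proof -
    have "G \<noteq> ?F" using that(2) int by (auto simp: interior_edges_def)
    then show ?thesis using off[OF that(1) _ that(3)] by blast
  qed
  show ?thesis
    unfolding X0_cond_def
  proof (intro conjI allI impI ballI)
    fix p r L L' q
    assume L: "L \<in> T" "L' \<in> T" "L \<noteq> L' \<and> closed_segment p r edge_of L \<and> closed_segment p r edge_of L'"
    have "edge_integral p r (\<lambda>x. (P L x - P L' x) * q x) = edge_integral p r (\<lambda>x. 0)"
    proof (rule edge_integral_cong)
      fix x assume "x \<in> closed_segment p r"
      then have "P L x = P L' x" using jump[of "closed_segment p r" L L' x] L by blast
      then show "(P L x - P L' x) * q x = 0" by simp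
    qed
    then show "edge_integral p r (\<lambda>x. (P L x - P L' x) * q x) = 0" by (simp add: edge_integral_const)
  next
    fix p r L q
    assume L: "closed_segment p r \<in> boundary_edges \<Omega> T" "L \<in> T" "closed_segment p r edge_of L"
    have "edge_integral p r (\<lambda>x. P L x * q x) = edge_integral p r (\<lambda>x. 0)"
      by (rule edge_integral_cong) (simp add: bd[OF L(3,1)])
    then show "edge_integral p r (\<lambda>x. P L x * q x) = 0" by (simp add: edge_integral_const)
  qed
qed

text \<open>The qualitative inf-sup condition.\<close>

lemma orthogonal_to_divergences:
  assumes q: "q \<in> QX" and H: "\<And>v. v \<in> VX \<Longrightarrow> div_h T v q = 0"
  shows "q = 0"
proof -
  have "q \<in> P_disc 1 \<Omega> T" using q QX_P_disc by blast
  then obtain R where R: "\<And>K. K \<in> T \<Longrightarrow> R K \<in> polys 1" "q = piecewise T R"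
    unfolding P_disc_iff by blast
  have van: "(\<Sum>K\<in>T. \<integral>x. R K x * dir_deriv (P K) d x \<partial>lebesgue_on K) = 0"
    if P: "\<And>K. K \<in> T \<Longrightarrow> P K \<in> polys 2" "X0_cond P" for P d
  proof -
    have "piecewise T P \<in> X0_FS \<Omega> T" using X0_FS_piecewise[of P] P by blast
    then have "div_h T (\<lambda>x. piecewise T P x *\<^sub>R d) (piecewise T R) = 0" using H scalar_X0_vector R(2) by blast
    then show ?thesis using div_h_piecewise[of P R 1 d] P(1) R(1) by simp
  qed
  have dz: "dir_deriv (\<lambda>x. 0) d x = 0" for d x by (simp add: dir_deriv_def pd_const)
  have const1: "R K x = R K y" if K: "K \<in> T" for K x y
  proof -
    have ab: "R K a = R K b" if t: "tri a b c K" for a b c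
    proof -
      \<comment> \<open>along \<open>b - a\<close> the derivative of the bubble is \<open>6 (\<lambda>\<^sub>a - \<lambda>\<^sub>b)\<close>, which isolates \<open>R K a - R K b\<close>\<close>
      define P where "P = (\<lambda>L. if L = K then bubble a b c else (\<lambda>x. 0))"
      have P: "P K = bubble a b c" "\<And>L. L \<noteq> K \<Longrightarrow> P L = (\<lambda>x. 0)" by (auto simp: P_def)
      have "P L \<in> polys 2" for L using P bubble_polys polys_const by (cases "L = K") auto
      then have "(\<Sum>L\<in>T. \<integral>x. R L x * dir_deriv (P L) (b - a) x \<partial>lebesgue_on L) = 0"
        using bubble_X0[of a b c K P, OF t P] by (intro van)
      moreover have "(\<integral>x. R L x * dir_deriv (P L) (b - a) x \<partial>lebesgue_on L)
          = (if L = K then \<integral>x. R K x * dir_deriv (bubble a b c) (b - a) x \<partial>lebesgue_on K else 0)" for L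
        using P by (cases "L = K") (simp_all add: dz)
      ultimately have "(\<integral>x. R K x * dir_deriv (bubble a b c) (b - a) x \<partial>lebesgue_on K) = 0"
        using finite_T K by simp
      moreover have "R K x * dir_deriv (bubble a b c) (b - a) x
        = 6 * ((R K a * bary a b c x + R K b * bary b c a x + R K c * bary c a b x) * (bary a b c x - bary b c a x))" for x
        unfolding dir_deriv_bubble[OF t] polys1_interpolation[OF t R(1)[OF K], of x] by simp
      ultimately have "\<bar>det2 (b - a) (c - a)\<bar> * ((R K a - R K b) * (moment_sq - moment_mixed)) = 0"
        using tri_second_moment[OF t, of "R K a" "R K b" "R K c"] by simp
      then show ?thesis using t moment_sq_gt_mixed by (simp add: tri_def)
    qed
    obtain a b c where t: "tri a b c K" using tri_T[OF K] .
    have "R K x = R K a" for x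
      by (rule constant_of_equal_vertex_values[OF t R(1)[OF K]]) (rule ab)
    then show ?thesis by metis
  qed
  define k where "k K = R K 0" for K
  have Rk: "R K x = k K" if "K \<in> T" for K x using const1[OF that] by (simp add: k_def)
  have cross: "k K = k K'" if KK: "K \<in> T" "K' \<in> T" "K \<noteq> K'" "F \<in> interior_edges \<Omega> T" "F edge_of K" "F edge_of K'" for K K' F
  proof -
    obtain p q r where "tri p q r K" using tri_T[OF KK(1)] .
    then obtain a b where ab: "F = closed_segment a b" using KK(5) tri_edges by blast
    obtain c where t: "tri a b c K" using edge_tri[OF simplex_T[OF KK(1)]] KK(5) ab by blast
    obtain c' where t': "tri a b c' K'" using edge_tri[OF simplex_T[OF KK(2)]] KK(6) ab by blast
    define P where "P = (\<lambda>L. if L = K then edge_bubble a b c else if L = K' then edge_bubble a b c' else (\<lambda>x. 0))"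
    have P: "P K = edge_bubble a b c" "P K' = edge_bubble a b c'" "\<And>L. L \<noteq> K \<Longrightarrow> L \<noteq> K' \<Longrightarrow> P L = (\<lambda>x. 0)"
      using KK(3) by (auto simp: P_def)
    let ?D = "det2 (b - a) (c - a)" and ?D' = "det2 (b - a) (c' - a)"
    \<comment> \<open>any direction not parallel to the edge\<close>
    define d where "d = c - a"
    have "P L \<in> polys 2" for L unfolding P_def using edge_bubble_polys polys_const by auto
    moreover have "X0_cond P" using edge_bubble_X0[of K a b c K' c' P, OF KK(1) t KK(2) t' KK(3) _ P] KK(4) ab by simp
    ultimately have "(\<Sum>L\<in>T. \<integral>x. R L x * dir_deriv (P L) d x \<partial>lebesgue_on L) = 0" by (intro van)
    moreover have "(\<integral>x. R L x * dir_deriv (P L) d x \<partial>lebesgue_on L)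
        = (if L = K then k K * (moment1 * (sgn ?D * det2 d (b - a))) else 0) + (if L = K' then k K' * (moment1 * (sgn ?D' * det2 d (b - a))) else 0)"
      if "L \<in> T" for L
    proof -
      consider "L = K" | "L = K'" | "L \<noteq> K" "L \<noteq> K'" by blast
      then show ?thesis
        using KK(3) Rk[OF that] P edge_bubble_integral[OF t, of d] edge_bubble_integral[OF t', of d] by cases (simp_all add: dz)
    qed
    ultimately have s: "k K * (moment1 * (sgn ?D * det2 d (b - a))) + k K' * (moment1 * (sgn ?D' * det2 d (b - a))) = 0"
      using finite_T KK(1,2) by (simp add: sum.distrib)
    have "?D * ?D' < 0" using edge_opposite_sides[OF KK(1-3) t t'] .
    then have "sgn ?D' = - sgn ?D" by (auto simp: mult_less_0_iff)
    then have "moment1 * (sgn ?D * det2 d (b - a)) * (k K - k K') = 0" using s by (simp add: algebra_simps)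
    moreover have "det2 d (b - a) = - ?D" by (simp add: d_def det2_def)
    then have "det2 d (b - a) \<noteq> 0" "?D \<noteq> 0" using t by (auto simp: tri_def)
    ultimately show ?thesis using moment1_pos by (simp add: sgn_zero_iff)
  qed
  obtain K0 where K0: "K0 \<in> T" using T_nonempty by blast
  have kk: "k K = k K0" if "K \<in> T" for K
    by (rule constant_across_edges[of k, OF _ that K0]) (rule cross)
  have qk: "q x = k K0" if "x \<in> (\<Union>K\<in>T. interior K)" for x
  proof -
    obtain K where K: "K \<in> T" "x \<in> interior K" using \<open>x \<in> (\<Union>K\<in>T. interior K)\<close> by blast
    then show ?thesis using R(2) piecewise_in[OF K, of R] Rk[OF K(1)] kk[OF K(1)] by simp
  qed
  have "(\<integral>x. q x \<partial>lebesgue_on \<Omega>) = (\<integral>x. k K0 \<partial>lebesgue_on \<Omega>)"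
    by (rule lebesgue_on_spike(2)[OF Omega_sets negligible_skeleton])
       (use qk bounded_measurable_integrable[OF Omega_lmeasurable, of "\<lambda>x. k K0" "\<bar>k K0\<bar>"] in auto)
  moreover have "(\<integral>x. q x \<partial>lebesgue_on \<Omega>) = 0" using q by (simp add: Q_FS_def L2_zmv_def)
  moreover have "measure lebesgue \<Omega> > 0"
    using Omega open_not_negligible Omega_lmeasurable by (metis measure_nonneg negligible_iff_measure order_le_less)
  ultimately have "k K0 = 0" using Omega_sets by (simp add: measure_restrict_space)
  then have "0 = piecewise T R" using piecewise_out kk Rk by (intro piecewise_eqI) auto
  then show ?thesis using R(2) by simp
qed

lemma L2_norm_sq: "L2_norm \<Omega> q = sqrt (\<integral>x. q x * q x \<partial>lebesgue_on \<Omega>)" for q :: "real^2 \<Rightarrow> real"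
  by (simp add: L2_norm_def power2_eq_square)

lemma L2_zero:
  assumes q: "q \<in> P_disc m \<Omega> T" and z: "(\<integral>x. q x * q x \<partial>lebesgue_on \<Omega>) = 0" shows "q = 0"
proof -
  have "AE x in lebesgue_on \<Omega>. q x * q x = 0"
    using integral_nonneg_eq_0_iff_AE[OF P_disc_mult_integrable[OF q q]] z by simp
  then have ae: "AE x in lebesgue_on \<Omega>. q x = 0" by simp
  have "q x = 0" if K: "K \<in> T" "x \<in> interior K" for K x
  proof (rule AE_zero_on_open[OF open_interior _ interior_Omega[OF K(1)] Omega_sets ae K(2)])
    obtain p where p: "p \<in> polys m" "\<And>x. x \<in> interior K \<Longrightarrow> q x = p x" using P_disc_local[OF q K(1)] by metis
    show "continuous_on (interior K) q"
      using polys_continuous[OF p(1)] p(2) by (simp cong: continuous_on_cong)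
  qed
  moreover have "q x = 0" if "x \<notin> (\<Union>K\<in>T. interior K)" for x using q that by (simp add: P_disc_def)
  ultimately show ?thesis by (metis UN_E ext zero_fun_apply)
qed

text \<open>The inner product on the mixed space.\<close>

definition mixed_inner :: "real \<Rightarrow> mixed \<Rightarrow> mixed \<Rightarrow> real"
  where "mixed_inner \<nu> = (\<lambda>(u, p) (v, q). grad_inner_h T u v + (inverse \<nu>)\<^sup>2 * (\<integral>x. p x * q x \<partial>lebesgue_on \<Omega>))"

lemma normed_inner_mixed:
  assumes nu: "\<nu> > 0"
  shows "normed_inner_on (mixed_FS \<Omega> T) (mixed_inner \<nu>) (mixed_norm \<nu> \<Omega> T) (a_S \<nu> T)"
proof
  note [simp] = mixed_FS_def
  have VP: "v \<in> VP" if "v \<in> VX" for v using that VX_VP by blast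
  have QP: "q \<in> P_disc 1 \<Omega> T" if "q \<in> QX" for q using that QX_P_disc by blast
  note gl = linear_on_add[OF grad_inner_linear] linear_on_scale[OF grad_inner_linear]
  note dl = linear_on_add[OF div_linear_left] linear_on_scale[OF div_linear_left]
  note dr = linear_on_add[OF div_linear_right] linear_on_scale[OF div_linear_right]
  have sV: "subspace VX" using vector_fields_subspace[OF subspace_X0_FS] .
  show sub: "subspace (mixed_FS \<Omega> T)"
    unfolding mixed_FS_def using sV subspace_QX by (rule subspace_Times)
  show "linear_on (mixed_FS \<Omega> T) (mixed_inner \<nu> x)" if x: "x \<in> mixed_FS \<Omega> T" for x
  proof -
    obtain u p where xx: "x = (u, p)" "u \<in> VX" "p \<in> QX" using x by auto
    show ?thesis
      unfolding linear_on_def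
    proof (intro conjI ballI allI)
      fix y z assume "y \<in> mixed_FS \<Omega> T" "z \<in> mixed_FS \<Omega> T"
      then obtain v q w r where yz: "y = (v, q)" "z = (w, r)" "v \<in> VX" "q \<in> QX" "w \<in> VX" "r \<in> QX" by auto
      have "(\<integral>s. p s * (q + r) s \<partial>lebesgue_on \<Omega>) = (\<integral>s. p s * q s \<partial>lebesgue_on \<Omega>) + (\<integral>s. p s * r s \<partial>lebesgue_on \<Omega>)"
        using P_disc_mult_integrable[OF QP QP] xx yz by (simp add: distrib_left Bochner_Integration.integral_add)
      then show "mixed_inner \<nu> x (y + z) = mixed_inner \<nu> x y + mixed_inner \<nu> x z"
        using gl(1)[OF VP VP VP] xx yz by (simp add: mixed_inner_def algebra_simps)
    next
      fix c y assume "y \<in> mixed_FS \<Omega> T"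
      then obtain v q where yz: "y = (v, q)" "v \<in> VX" "q \<in> QX" by auto
      have "(\<integral>s. p s * (c *\<^sub>R q) s \<partial>lebesgue_on \<Omega>) = c * (\<integral>s. p s * q s \<partial>lebesgue_on \<Omega>)"
        by (simp add: scaleR_fun_def mult.left_commute)
      then show "mixed_inner \<nu> x (c *\<^sub>R y) = c *\<^sub>R mixed_inner \<nu> x y"
        using gl(2)[OF VP VP] xx yz by (simp add: mixed_inner_def algebra_simps)
    qed
  qed
  have nn: "0 \<le> (\<integral>s. p s * p s \<partial>lebesgue_on \<Omega>)" for p :: "real^2 \<Rightarrow> real" by (rule integral_nonneg_AE) auto
  show "mixed_inner \<nu> x y = mixed_inner \<nu> y x" for x y
    by (cases x; cases y) (simp add: mixed_inner_def grad_inner_sym mult.commute)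
  show "mixed_inner \<nu> x x > 0" if "x \<in> mixed_FS \<Omega> T" "x \<noteq> 0" for x
  proof -
    obtain u p where xx: "x = (u, p)" "u \<in> VX" "p \<in> QX" using \<open>x \<in> mixed_FS \<Omega> T\<close> by auto
    have "u \<noteq> 0 \<or> p \<noteq> 0" using xx \<open>x \<noteq> 0\<close> by (auto simp: zero_prod_def)
    then have "grad_inner_h T u u > 0 \<or> (\<integral>s. p s * p s \<partial>lebesgue_on \<Omega>) > 0"
      using grad_inner_zero[OF xx(2)] L2_zero[OF QP[OF xx(3)]] grad_inner_nonneg[of u] nn[of p] by force
    moreover have "(inverse \<nu>)\<^sup>2 > 0" using nu by simp
    ultimately show ?thesis
      using grad_inner_nonneg[of u] nn[of p] xx(1)
      by (auto simp: mixed_inner_def intro: add_pos_nonneg add_nonneg_pos)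
  qed
  show "\<exists>B. finite B \<and> mixed_FS \<Omega> T \<subseteq> span B"
  proof -
    obtain B where B: "finite B" "P_disc 2 \<Omega> T \<subseteq> span B" using P_disc_finite_dim by blast
    obtain C where C: "finite C" "P_disc 1 \<Omega> T \<subseteq> span C" using P_disc_finite_dim by blast
    have "VX \<subseteq> span ((\<lambda>(i, f) x. f x *\<^sub>R axis i 1) ` (UNIV \<times> B))"
      using vector_fields_span[OF B(2)] VX_VP by blast
    moreover have "QX \<subseteq> span C" using C(2) QX_P_disc by blast
    ultimately have "mixed_FS \<Omega> T \<subseteq> span ((\<lambda>x. (x, 0)) ` (\<lambda>(i, f) x. f x *\<^sub>R axis i 1) ` (UNIV \<times> B) \<union> (\<lambda>y. (0, y)) ` C)"
      unfolding mixed_FS_def by (rule Times_span)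
    moreover have "finite ((\<lambda>x. (x, 0)) ` (\<lambda>(i, f) x. f x *\<^sub>R axis i 1) ` ((UNIV :: 2 set) \<times> B) \<union> (\<lambda>y. (0, y)) ` C)"
      using B(1) C(1) by simp
    ultimately show ?thesis by blast
  qed
  have N: "mixed_norm \<nu> \<Omega> T (u, p) = sqrt (grad_inner_h T u u) + sqrt ((inverse \<nu>)\<^sup>2 * (\<integral>s. p s * p s \<partial>lebesgue_on \<Omega>))" for u p
    using nu by (simp add: mixed_norm_def L2_norm_sq real_sqrt_mult)
  have Gnn: "0 \<le> (inverse \<nu>)\<^sup>2 * (\<integral>s. p s * p s \<partial>lebesgue_on \<Omega>)" for p using nn[of p] by simp
  show "sqrt (mixed_inner \<nu> x x) \<le> mixed_norm \<nu> \<Omega> T x" if "x \<in> mixed_FS \<Omega> T" for x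
    using sqrt_add_le_add_sqrt[OF grad_inner_nonneg Gnn] by (cases x) (simp add: mixed_inner_def N)
  show "mixed_norm \<nu> \<Omega> T x \<le> 2 * sqrt (mixed_inner \<nu> x x)" if "x \<in> mixed_FS \<Omega> T" for x
  proof (cases x)
    case (Pair u p)
    have "sqrt (grad_inner_h T u u) \<le> sqrt (mixed_inner \<nu> x x)" "sqrt ((inverse \<nu>)\<^sup>2 * (\<integral>s. p s * p s \<partial>lebesgue_on \<Omega>)) \<le> sqrt (mixed_inner \<nu> x x)"
      using Gnn[of p] grad_inner_nonneg[of u] unfolding Pair mixed_inner_def by (auto intro!: real_sqrt_le_mono)
    then show ?thesis unfolding Pair N by linarith
  qed
  show "mixed_norm \<nu> \<Omega> T (c *\<^sub>R x) = \<bar>c\<bar> * mixed_norm \<nu> \<Omega> T x" if "x \<in> mixed_FS \<Omega> T" for x c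
  proof -
    obtain u p where xx: "x = (u, p)" "u \<in> VX" "p \<in> QX" using \<open>x \<in> mixed_FS \<Omega> T\<close> by auto
    have cu: "c *\<^sub>R u \<in> VP" using xx VP subspace_scale[OF sV] by blast
    have "grad_inner_h T (c *\<^sub>R u) (c *\<^sub>R u) = c * grad_inner_h T (c *\<^sub>R u) u"
      using gl(2)[OF cu VP[OF xx(2)]] by simp
    also have "grad_inner_h T (c *\<^sub>R u) u = c * grad_inner_h T u u"
      using gl(2)[OF VP[OF xx(2)] VP[OF xx(2)], of c] grad_inner_sym by simp
    finally have "sqrt (grad_inner_h T (c *\<^sub>R u) (c *\<^sub>R u)) = \<bar>c\<bar> * sqrt (grad_inner_h T u u)"
      by (simp add: real_sqrt_mult mult.assoc[symmetric])
    moreover have "(\<integral>s. (c *\<^sub>R p) s * (c *\<^sub>R p) s \<partial>lebesgue_on \<Omega>) = c * c * (\<integral>s. p s * p s \<partial>lebesgue_on \<Omega>)"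
      unfolding integral_mult_right_zero[symmetric]
      by (rule Bochner_Integration.integral_cong) (simp_all add: scaleR_fun_def mult_ac)
    then have "L2_norm \<Omega> (c *\<^sub>R p) = \<bar>c\<bar> * L2_norm \<Omega> p"
      unfolding L2_norm_sq by (simp add: real_sqrt_mult)
    ultimately show ?thesis by (simp add: xx(1) mixed_norm_def algebra_simps)
  qed
  show "linear_on (mixed_FS \<Omega> T) (a_S \<nu> T x)" if x: "x \<in> mixed_FS \<Omega> T" for x
  proof -
    obtain u p where xx: "x = (u, p)" "u \<in> VX" "p \<in> QX" using x by auto
    show ?thesis
      unfolding linear_on_def
    proof (intro conjI ballI allI)
      fix y z assume "y \<in> mixed_FS \<Omega> T" "z \<in> mixed_FS \<Omega> T"
      then obtain v q w r where yz: "y = (v, q)" "z = (w, r)" "v \<in> VX" "q \<in> QX" "w \<in> VX" "r \<in> QX" by auto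
      show "a_S \<nu> T x (y + z) = a_S \<nu> T x y + a_S \<nu> T x z"
        using gl(1)[OF VP[OF xx(2)] VP[OF yz(3)] VP[OF yz(5)]] dl(1)[OF QP[OF xx(3)] VP[OF yz(3)] VP[OF yz(5)]]
          dr(1)[OF VP[OF xx(2)] QP[OF yz(4)] QP[OF yz(6)]] xx yz
        by (simp add: a_S_def algebra_simps)
    next
      fix c y assume "y \<in> mixed_FS \<Omega> T"
      then obtain v q where yz: "y = (v, q)" "v \<in> VX" "q \<in> QX" by auto
      show "a_S \<nu> T x (c *\<^sub>R y) = c *\<^sub>R a_S \<nu> T x y"
        using gl(2)[OF VP[OF xx(2)] VP[OF yz(2)]] dl(2)[OF QP[OF xx(3)] VP[OF yz(2)]]
          dr(2)[OF VP[OF xx(2)] QP[OF yz(3)]] xx yz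
        by (simp add: a_S_def algebra_simps)
    qed
  qed
  show "a_S \<nu> T x y = a_S \<nu> T y x" for x y
    by (cases x; cases y) (simp add: a_S_def grad_inner_sym)
  show "x = 0" if x: "x \<in> mixed_FS \<Omega> T" and z: "\<And>y. y \<in> mixed_FS \<Omega> T \<Longrightarrow> a_S \<nu> T x y = 0" for x
  proof -
    obtain u p where xx: "x = (u, p)" "u \<in> VX" "p \<in> QX" using x by auto
    have lr: "linear_on (P_disc 1 \<Omega> T) (div_h T u)" using div_linear_right[OF VP[OF xx(2)]] .
    have mp: "(-1) *\<^sub>R p \<in> QX" using subspace_scale[OF subspace_QX xx(3)] .
    \<comment> \<open>testing with \<open>(u, -p)\<close> cancels the two divergence terms\<close>
    have "div_h T u ((-1) *\<^sub>R p) = - div_h T u p" using linear_on_scale[OF lr QP[OF xx(3)], of "-1"] by simp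
    then have "\<nu> * grad_inner_h T u u = 0"
      using z[of "(u, (-1) *\<^sub>R p)"] xx mp by (simp add: a_S_def)
    then have u0: "u = 0" using grad_inner_zero[OF xx(2)] nu by simp
    have z0: "grad_inner_h T 0 v = 0" if "v \<in> VX" for v
      using linear_on_0[OF grad_inner_linear[OF VP[OF that]] vector_fields_subspace[OF subspace_P_disc]] grad_inner_sym by metis
    have d0: "div_h T u 0 = 0" using linear_on_0[OF lr subspace_P_disc] .
    have "div_h T v p = 0" if v: "v \<in> VX" for v
      using z[of "(v, 0)"] xx v u0 z0[OF v] d0 subspace_0[OF subspace_QX] by (simp add: a_S_def)
    then have "p = 0" using orthogonal_to_divergences[OF xx(3)] by blast
    then show ?thesis using xx u0 by (simp add: zero_prod_def)
  qed
qed

end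

section \<open>Smooth functions and the fundamental lemma of the calculus of variations\<close>

lemma Ck_continuous: "Ck k f \<Longrightarrow> continuous_on UNIV f"
  by (cases k) (auto simp: continuous_on_eq_continuous_at differentiable_imp_continuous_within)

lemma Ck_SucD: "Ck (Suc k) f \<Longrightarrow> Ck k f"
proof (induction k arbitrary: f)
  case 0
  then show ?case using Ck_continuous[of "Suc 0"] by simp
next
  case (Suc k)
  then show ?case using Suc.IH by (metis Ck.simps(2))
qed

lemma Ck_add: "Ck k f \<Longrightarrow> Ck k g \<Longrightarrow> Ck k (\<lambda>x. f x + g x)"
proof (induction k arbitrary: f g)
  case 0
  then show ?case by (auto intro: continuous_on_add)
next
  case (Suc k)
  then have d: "f differentiable (at x)" "g differentiable (at x)" for x by auto
  then have "pd j (\<lambda>x. f x + g x) = (\<lambda>x. pd j f x + pd j g x)" for j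
    by (simp add: fun_eq_iff pd_add)
  then show ?case using Suc d by (auto intro: differentiable_add)
qed

lemma Ck_mult: "Ck k f \<Longrightarrow> Ck k g \<Longrightarrow> Ck k (\<lambda>x. f x * g x)"
proof (induction k arbitrary: f g)
  case 0
  then show ?case by (auto intro: continuous_on_mult)
next
  case (Suc k)
  then have d: "f differentiable (at x)" "g differentiable (at x)" for x by auto
  then have p: "pd j (\<lambda>x. f x * g x) = (\<lambda>x. f x * pd j g x + pd j f x * g x)" for j
    by (simp add: fun_eq_iff pd_mult)
  have "Ck k (\<lambda>x. f x * pd j g x + pd j f x * g x)" for j
    using Suc Ck_SucD[of k] by (intro Ck_add Suc.IH) auto
  then show ?case using p d by (auto intro: differentiable_mult)
qed

lemma Ck_polys: "p \<in> polys m \<Longrightarrow> Ck k p"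
proof (induction k arbitrary: p)
  case 0
  then show ?case using polys_continuous by simp
next
  case (Suc k)
  then show ?case using polys_smooth by simp
qed

lemma Ck_const: "Ck k (\<lambda>x. c)" using Ck_polys polys_const by blast

lemma Ck_sum: "finite I \<Longrightarrow> (\<And>i. i \<in> I \<Longrightarrow> Ck k (f i)) \<Longrightarrow> Ck k (\<lambda>x. \<Sum>i\<in>I. f i x)"
  by (induction I rule: finite_induct) (auto intro: Ck_add Ck_const)

lemma Ck_diff: "Ck k f \<Longrightarrow> Ck k g \<Longrightarrow> Ck k (\<lambda>x. f x - g x)"
  using Ck_add[of k f "\<lambda>x. -1 * g x"] Ck_mult[OF Ck_const[of k "-1"]] by simp

text \<open>Chain rule for an outer function of one real variable.\<close>

lemma comp_pd:
  assumes "(\<phi> has_real_derivative \<phi>') (at (s x))" "s differentiable (at x)"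
  shows "(\<lambda>y. \<phi> (s y)) differentiable (at x)" "pd j (\<lambda>y. \<phi> (s y)) x = \<phi>' * pd j s x"
proof -
  have "((\<lambda>y. \<phi> (s y)) has_derivative (\<lambda>h. \<phi>' * (\<Sum>j\<in>UNIV. h $ j * pd j s x))) (at x)"
    using has_derivative_compose[OF has_derivative_pd[OF assms(2)], of \<phi> "(*) \<phi>'"] assms(1)
    by (simp add: has_field_derivative_def)
  then show "(\<lambda>y. \<phi> (s y)) differentiable (at x)" "pd j (\<lambda>y. \<phi> (s y)) x = \<phi>' * pd j s x"
    using pd_eqI[of "\<lambda>y. \<phi> (s y)" _ x j]
    by (auto simp: differentiable_def axis_def if_distrib if_distribR sum.delta cong: if_cong)
qed

lemma Ck_exp: assumes "\<And>k. Ck k s" shows "Ck k (\<lambda>x. exp (s x))"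
proof (induction k)
  case 0
  show ?case using Ck_continuous[OF assms] by (auto intro: continuous_on_exp)
next
  case (Suc k)
  have s: "s differentiable (at x)" "Ck k (pd j s)" for x j using assms[of "Suc k"] by auto
  note c = comp_pd[OF DERIV_exp s(1)]
  have "pd j (\<lambda>x. exp (s x)) = (\<lambda>x. exp (s x) * pd j s x)" for j using c(2) by (simp add: fun_eq_iff)
  then show ?case using c(1) Ck_mult[OF Suc s(2)] by simp
qed

text \<open>The functions \<open>exp (-1/t) / t\<^sup>n\<close>, extended by zero to \<open>t \<le> 0\<close>; they span a space closed under
  differentiation.\<close>

definition flat_exp :: "nat \<Rightarrow> real \<Rightarrow> real"
  where "flat_exp n t = (if t > 0 then exp (- (1 / t)) / t ^ n else 0)"

lemma flat_exp_tendsto_0: "(flat_exp n \<longlongrightarrow> 0) (at 0)"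
proof -
  have "((\<lambda>t::real. (1/t) ^ n / exp (1/t)) \<longlongrightarrow> 0) (at_right 0)"
    using filterlim_compose[OF tendsto_power_div_exp_0 filterlim_inverse_at_top_right, of n]
    by (simp add: inverse_eq_divide)
  moreover have "\<forall>\<^sub>F t in at_right 0. (1/t) ^ n / exp (1/t) = flat_exp n t"
    by (simp add: eventually_at_filter flat_exp_def exp_minus field_simps power_one_over)
  ultimately have r: "(flat_exp n \<longlongrightarrow> 0) (at_right 0)" using Lim_transform_eventually by fast
  have "\<forall>\<^sub>F t in at_left 0. 0 = flat_exp n t" by (simp add: eventually_at_filter flat_exp_def)
  then have "(flat_exp n \<longlongrightarrow> 0) (at_left 0)" using Lim_transform_eventually[OF tendsto_const] by fast
  then show ?thesis using r by (simp add: filterlim_split_at)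
qed

lemma flat_exp_deriv: "(flat_exp n has_real_derivative (flat_exp (n + 2) t - of_nat n * flat_exp (n + 1) t)) (at t)"
proof -
  consider "t > 0" | "t < 0" | "t = 0" by linarith
  then show ?thesis
  proof cases
    case 1
    have "((\<lambda>t. exp (- (1 / t)) / t ^ n) has_real_derivative (flat_exp (n + 2) t - of_nat n * flat_exp (n + 1) t)) (at t)"
      using 1 by (auto intro!: derivative_eq_intros simp: flat_exp_def field_simps power_add power2_eq_square power_Suc[symmetric] simp del: power_Suc)
        (cases n, auto simp: field_simps power2_eq_square)
    then show ?thesis
      by (rule has_field_derivative_transform_within_open[of _ _ _ "{0<..}"]) (use 1 in \<open>auto simp: flat_exp_def\<close>)
  next
    case 2
    have "((\<lambda>t. 0) has_real_derivative (flat_exp (n + 2) t - of_nat n * flat_exp (n + 1) t)) (at t)"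
      using 2 by (simp add: flat_exp_def)
    then show ?thesis
      by (rule has_field_derivative_transform_within_open[of _ _ _ "{..<0}"]) (use 2 in \<open>auto simp: flat_exp_def\<close>)
  next
    case 3
    have "(\<lambda>h. (flat_exp n (0 + h) - flat_exp n 0) / h) = flat_exp (n + 1)" by (auto simp: flat_exp_def)
    moreover have "flat_exp (n + 2) 0 - of_nat n * flat_exp (n + 1) 0 = 0" by (simp add: flat_exp_def)
    ultimately show ?thesis unfolding DERIV_def 3 using flat_exp_tendsto_0[of "n + 1"] by (simp only:)
  qed
qed

lemma Ck_flat_exp: assumes s: "\<And>k. Ck k s" shows "Ck k (\<lambda>x. flat_exp n (s x))"
proof (induction k arbitrary: n)
  case 0
  have "continuous_on UNIV (flat_exp n)"
    using DERIV_isCont[OF flat_exp_deriv] by (simp add: continuous_on_eq_continuous_at)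
  then have "continuous_on UNIV (\<lambda>x. flat_exp n (s x))"
    by (rule continuous_on_compose2[OF _ Ck_continuous[OF s]]) simp
  then show ?case by simp
next
  case (Suc k)
  have d: "s differentiable (at x)" "Ck k (pd j s)" for x j using s[of "Suc k"] by auto
  note c = comp_pd[OF flat_exp_deriv d(1)]
  have "pd j (\<lambda>x. flat_exp n (s x)) = (\<lambda>x. (flat_exp (n + 2) (s x) - of_nat n * flat_exp (n + 1) (s x)) * pd j s x)" for j
    using c(2) by (simp add: fun_eq_iff)
  then show ?case using c(1) Ck_mult[OF Ck_diff[OF Suc Ck_mult[OF Ck_const Suc]] d(2)] by simp
qed

text \<open>A smooth function that is positive exactly on the ball with centre \<open>c\<close> and radius \<open>r\<close>.\<close>

definition bump :: "real^2 \<Rightarrow> real \<Rightarrow> real^2 \<Rightarrow> real"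
  where "bump c r x = flat_exp 0 (r\<^sup>2 - (dist x c)\<^sup>2)"

lemma dist_sq: "(dist x c)\<^sup>2 = (x$1 - c$1)\<^sup>2 + (x$2 - c$2)\<^sup>2" for x c :: "real^2"
proof -
  have "(dist x c)\<^sup>2 = (x - c) \<bullet> (x - c)" by (simp add: dist_norm power2_norm_eq_inner)
  then show ?thesis by (simp add: inner_vec_def sum_2 power2_eq_square)
qed

lemma Ck_bump: "Ck k (bump c r)"
proof -
  have n: "(\<lambda>x::real^2. x$i) \<in> polys 1" for i
    using exhaust_2[of i] polys_monom[of 1 0 1] polys_monom[of 0 1 1] by auto
  have "(\<lambda>x. r\<^sup>2 - ((x$1 - c$1) * (x$1 - c$1) + (x$2 - c$2) * (x$2 - c$2))) \<in> polys 2"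
    by (intro polys_diff polys_const polys_add polys1_mult n)
  then have "Ck k (\<lambda>x. r\<^sup>2 - (dist x c)\<^sup>2)" for k
    unfolding dist_sq power2_eq_square[of "u $ i - v" for u :: "real^2" and i v] by (rule Ck_polys)
  then show ?thesis unfolding bump_def[abs_def] by (rule Ck_flat_exp)
qed

lemma bump_pos: "r > 0 \<Longrightarrow> bump c r x > 0 \<longleftrightarrow> x \<in> ball c r"
proof -
  assume r: "r > 0"
  have "r\<^sup>2 - (dist x c)\<^sup>2 > 0 \<longleftrightarrow> dist x c < r"
    using r by (metis abs_le_square_iff abs_of_nonneg abs_of_pos diff_gt_0_iff_gt not_le zero_le_dist)
  then show ?thesis by (simp add: bump_def flat_exp_def dist_commute)
qed

lemma bump_nonneg: "bump c r x \<ge> 0" by (simp add: bump_def flat_exp_def)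

lemma bump_zero: "r > 0 \<Longrightarrow> x \<notin> ball c r \<Longrightarrow> bump c r x = 0"
  using bump_pos[of r c x] bump_nonneg[of c r x] by linarith

lemma test_functionsI:
  assumes "\<And>k. Ck k \<phi>" "compact C" "C \<subseteq> \<Omega>" "\<And>x. x \<notin> C \<Longrightarrow> \<phi> x = 0"
  shows "\<phi> \<in> test_functions \<Omega>"
proof -
  have "closure {x. \<phi> x \<noteq> 0} \<subseteq> C"
    using assms(2,4) by (intro closure_minimal) (auto simp: compact_imp_closed)
  moreover from this have "compact (closure {x. \<phi> x \<noteq> 0})"
    using assms(2) by (meson bounded_subset closed_closure compact_eq_bounded_closed)
  ultimately show ?thesis using assms(1,3) by (auto simp: test_functions_def)
qed

lemma test_functions_supp:
  assumes "\<phi> \<in> test_functions \<Omega>"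
  shows "\<exists>C. compact C \<and> C \<subseteq> \<Omega> \<and> (\<forall>x. x \<notin> C \<longrightarrow> \<phi> x = 0)"
proof -
  have "\<phi> x = 0" if "x \<notin> closure {x. \<phi> x \<noteq> 0}" for x
    using that closure_subset[of "{x. \<phi> x \<noteq> 0}"] by blast
  then show ?thesis using assms unfolding test_functions_def by blast
qed

lemma test_functions_mult:
  assumes "\<phi> \<in> test_functions \<Omega>" "\<And>k. Ck k \<psi>" shows "(\<lambda>x. \<phi> x * \<psi> x) \<in> test_functions \<Omega>"
proof -
  obtain C where "compact C" "C \<subseteq> \<Omega>" "\<forall>x. x \<notin> C \<longrightarrow> \<phi> x = 0"
    using test_functions_supp[OF assms(1)] by blast
  then show ?thesis
    using assms by (intro test_functionsI[of _ C] Ck_mult) (auto simp: test_functions_def)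
qed

text \<open>A smooth function with values in \<open>[0, 1]\<close>, close to \<open>1\<close> on a compact set and supported in a
  small neighbourhood of it.\<close>

lemma smooth_cutoff:
  fixes C :: "(real^2) set"
  assumes C: "compact C" and d: "d > 0" "e > 0" and sub: "\<And>x. x \<in> C \<Longrightarrow> cball x d \<subseteq> \<Omega>"
  obtains \<phi> where "\<phi> \<in> test_functions \<Omega>" "\<And>x. 0 \<le> \<phi> x" "\<And>x. \<phi> x \<le> 1"
    "\<And>x. x \<in> C \<Longrightarrow> 1 - e \<le> \<phi> x" "\<And>x. (\<And>y. y \<in> C \<Longrightarrow> dist y x \<ge> d) \<Longrightarrow> \<phi> x = 0"
proof -
  have "C \<subseteq> (\<Union>c\<in>C. ball c d)" using d by force
  then obtain S where S: "finite S" "S \<subseteq> C" "C \<subseteq> (\<Union>c\<in>S. ball c d)"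
    using compactE_image[OF C, of C "\<lambda>c. ball c d"] open_ball by metis
  define m where "m x = (\<Sum>c\<in>S. bump c d x)" for x
  have m0: "m x \<ge> 0" for x unfolding m_def by (intro sum_nonneg bump_nonneg)
  have mC: "m x > 0" if xC: "x \<in> C" for x
  proof -
    obtain c where "c \<in> S" "x \<in> ball c d" using S(3) xC by blast
    then show ?thesis unfolding m_def
      using S(1) bump_pos[OF d(1)] bump_nonneg by (intro sum_pos2[of S c]) auto
  qed
  have Cm: "Ck k m" for k unfolding m_def[abs_def] using S(1) Ck_bump by (intro Ck_sum)
  obtain \<mu> where mu: "\<mu> > 0" "\<And>x. x \<in> C \<Longrightarrow> \<mu> \<le> m x"
  proof (cases "C = {}")
    case False
    obtain x0 where "x0 \<in> C" "\<forall>x\<in>C. m x0 \<le> m x"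
      using continuous_attains_inf[OF C False continuous_on_subset[OF Ck_continuous[OF Cm]]] by blast
    then show ?thesis using that[of "m x0"] mC by blast
  qed (use that[of 1] in auto)
  \<comment> \<open>chosen so that \<open>exp (- N m)\<close> is at most \<open>e\<close> wherever \<open>m\<close> is at least \<open>\<mu>\<close>\<close>
  define N where "N = max 0 (- ln e) / \<mu>"
  have N: "N \<ge> 0" "exp (- (N * \<mu>)) \<le> e"
  proof -
    show "N \<ge> 0" using mu by (simp add: N_def)
    have "- (N * \<mu>) \<le> ln e" using mu by (simp add: N_def)
    then have "exp (- (N * \<mu>)) \<le> exp (ln e)" by simp
    then show "exp (- (N * \<mu>)) \<le> e" using d by simp
  qed
  define \<phi> where "\<phi> x = 1 - exp (- N * m x)" for x
  have C\<phi>: "Ck k \<phi>" for k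
    unfolding \<phi>_def[abs_def] by (intro Ck_diff Ck_const Ck_exp Ck_mult Cm)
  have z: "\<phi> x = 0" if "x \<notin> (\<Union>c\<in>S. ball c d)" for x
  proof -
    have "m x = 0" unfolding m_def using that bump_zero[OF d(1)] by (intro sum.neutral) auto
    then show ?thesis by (simp add: \<phi>_def)
  qed
  show thesis
  proof (rule that[of \<phi>])
    show "\<phi> \<in> test_functions \<Omega>"
    proof (rule test_functionsI[OF C\<phi>])
      show "compact (\<Union>c\<in>S. cball c d)" using S(1) by (intro compact_UN) auto
      show "(\<Union>c\<in>S. cball c d) \<subseteq> \<Omega>" using sub S(2) by blast
      show "\<phi> x = 0" if "x \<notin> (\<Union>c\<in>S. cball c d)" for x using z that ball_subset_cball by blast
    qed
    show "0 \<le> \<phi> x" "\<phi> x \<le> 1" for x using N(1) m0[of x] by (auto simp: \<phi>_def)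
    show "1 - e \<le> \<phi> x" if "x \<in> C" for x
    proof -
      have "N * \<mu> \<le> N * m x" using N(1) mu(2)[OF that] by (rule mult_left_mono[rotated])
      then have "exp (- N * m x) \<le> exp (- (N * \<mu>))" by simp
      then have "exp (- N * m x) \<le> e" using N(2) by linarith
      then show ?thesis by (simp add: \<phi>_def)
    qed
    show "\<phi> x = 0" if "\<And>y. y \<in> C \<Longrightarrow> dist y x \<ge> d" for x
      using z[of x] that S(2) by (force simp: not_less)
  qed
qed

lemma integrable_mult_bounded:
  fixes f g :: "real^2 \<Rightarrow> real"
  assumes "integrable M f" "g \<in> borel_measurable M" "\<And>x. \<bar>g x\<bar> \<le> B"
  shows "integrable M (\<lambda>x. f x * g x)"
proof (rule Bochner_Integration.integrable_bound[of M "\<lambda>x. B * \<bar>f x\<bar>"])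
  show "integrable M (\<lambda>x. B * \<bar>f x\<bar>)" using assms(1) by simp
  show "(\<lambda>x. f x * g x) \<in> borel_measurable M" using assms by measurable
  have "\<bar>f x\<bar> * \<bar>g x\<bar> \<le> \<bar>f x\<bar> * B" for x using assms(3) by (intro mult_left_mono) auto
  then show "AE x in M. norm (f x * g x) \<le> norm (B * \<bar>f x\<bar>)"
    by (intro AE_I2) (metis abs_ge_self abs_mult mult.commute order_trans real_norm_def)
qed

lemma continuous_measurable_lebesgue_on:
  fixes f :: "'a::euclidean_space \<Rightarrow> 'b::euclidean_space"
  assumes "continuous_on UNIV f" shows "f \<in> borel_measurable (lebesgue_on S)"
proof -
  have "f \<in> borel_measurable lborel" using borel_measurable_continuous_onI[OF assms] by simp
  then show ?thesis by (intro measurable_restrict_space1 measurable_completion)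
qed

lemma fundamental_compact:
  assumes \<Omega>: "open \<Omega>" and h: "integrable (lebesgue_on \<Omega>) h"
    and z: "\<And>\<phi>. \<phi> \<in> test_functions \<Omega> \<Longrightarrow> (\<integral>x. h x * \<phi> x \<partial>lebesgue_on \<Omega>) = 0"
    and C: "compact C" "C \<subseteq> \<Omega>"
  shows "(\<integral>x. h x * indicator C x \<partial>lebesgue_on \<Omega>) = 0"
proof -
  obtain d where d: "d > 0" "(\<Union>x\<in>C. cball x d) \<subseteq> \<Omega>"
    using compact_subset_open_imp_cball_epsilon_subset[OF C(1) \<Omega> C(2)] by blast
  define dn where "dn n = min d (1 / real (Suc n))" for n
  have "\<exists>\<phi>. \<phi> \<in> test_functions \<Omega> \<and> (\<forall>x. 0 \<le> \<phi> x \<and> \<phi> x \<le> 1) \<and> (\<forall>x\<in>C. 1 - 1 / real (Suc n) \<le> \<phi> x) \<and>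
      (\<forall>x. (\<forall>y\<in>C. dist y x \<ge> dn n) \<longrightarrow> \<phi> x = 0)" for n
  proof -
    have p: "dn n > 0" "1 / real (Suc n) > 0" using d by (auto simp: dn_def)
    have "cball x (dn n) \<subseteq> \<Omega>" if "x \<in> C" for x
    proof -
      have "cball x (dn n) \<subseteq> cball x d" by (rule subset_cball) (simp add: dn_def)
      then show ?thesis using d(2) that by blast
    qed
    then show ?thesis using smooth_cutoff[OF C(1) p, of \<Omega>] by metis
  qed
  then obtain \<phi> where \<phi>: "\<And>n. \<phi> n \<in> test_functions \<Omega>" "\<And>n x. 0 \<le> \<phi> n x" "\<And>n x. \<phi> n x \<le> 1"
    "\<And>n x. x \<in> C \<Longrightarrow> 1 - 1 / real (Suc n) \<le> \<phi> n x" "\<And>n x. (\<forall>y\<in>C. dist y x \<ge> dn n) \<Longrightarrow> \<phi> n x = 0" by metis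
  have m: "\<phi> n \<in> borel_measurable (lebesgue_on \<Omega>)" for n
    using \<phi>(1)[of n] Ck_continuous by (intro continuous_measurable_lebesgue_on) (auto simp: test_functions_def)
  have hm: "h \<in> borel_measurable (lebesgue_on \<Omega>)" using h by auto
  have Cs: "C \<in> sets lebesgue" using lmeasurable_compact[OF C(1)] by blast
  have lim: "(\<lambda>n. \<phi> n x) \<longlonglongrightarrow> indicator C x" for x
  proof (cases "x \<in> C")
    case True
    have "(\<lambda>n. 1 - 1 / real (Suc n)) \<longlonglongrightarrow> 1 - 0" by (intro tendsto_intros LIMSEQ_Suc lim_1_over_n)
    then have l: "(\<lambda>n. 1 - 1 / real (Suc n)) \<longlonglongrightarrow> 1" by simp
    have "(\<lambda>n. \<phi> n x) \<longlonglongrightarrow> 1"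
      by (rule tendsto_sandwich[OF always_eventually always_eventually l tendsto_const])
         (use \<phi>(3) \<phi>(4)[OF True] in blast)+
    then show ?thesis using True by simp
  next
    case False
    obtain e where e: "e > 0" "\<forall>y\<in>C. e \<le> dist x y"
      using separate_point_closed[OF compact_imp_closed[OF C(1)] False] by blast
    have "(\<lambda>n. 1 / real (Suc n)) \<longlonglongrightarrow> 0" by (intro LIMSEQ_Suc lim_1_over_n)
    then have "\<forall>\<^sub>F n in sequentially. 1 / real (Suc n) < e" using e(1) by (rule order_tendstoD)
    then have ev: "\<forall>\<^sub>F n in sequentially. 0 = \<phi> n x"
    proof eventually_elim
      case (elim n)
      have "dn n \<le> dist y x" if "y \<in> C" for y
      proof -
        have "e \<le> dist y x" using e(2) that dist_commute by metis
        then show ?thesis using elim by (simp add: dn_def)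
      qed
      then have "\<phi> n x = 0" using \<phi>(5) by blast
      then show ?case by simp
    qed
    have "(\<lambda>n. \<phi> n x) \<longlonglongrightarrow> 0" using Lim_transform_eventually[OF tendsto_const ev] .
    then show ?thesis using False by simp
  qed
  have "(\<lambda>n. \<integral>x. h x * \<phi> n x \<partial>lebesgue_on \<Omega>) \<longlonglongrightarrow> (\<integral>x. h x * indicator C x \<partial>lebesgue_on \<Omega>)"
  proof (rule integral_dominated_convergence[where w="\<lambda>x. \<bar>h x\<bar>"])
    show "(\<lambda>x. h x * indicator C x) \<in> borel_measurable (lebesgue_on \<Omega>)"
      using hm Cs by (intro borel_measurable_times) (auto intro!: measurable_restrict_space1)
    show "(\<lambda>x. h x * \<phi> n x) \<in> borel_measurable (lebesgue_on \<Omega>)" for n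
      using hm m by (intro borel_measurable_times)
    show "integrable (lebesgue_on \<Omega>) (\<lambda>x. \<bar>h x\<bar>)" using h by simp
    show "AE x in lebesgue_on \<Omega>. (\<lambda>n. h x * \<phi> n x) \<longlonglongrightarrow> h x * indicator C x"
      by (intro AE_I2 tendsto_intros lim)
    show "AE x in lebesgue_on \<Omega>. norm (h x * \<phi> n x) \<le> \<bar>h x\<bar>" for n
      using \<phi>(2,3) by (intro AE_I2) (simp add: abs_mult mult_left_le)
  qed
  then have "(\<lambda>n::nat. 0::real) \<longlonglongrightarrow> (\<integral>x. h x * indicator C x \<partial>lebesgue_on \<Omega>)"
    unfolding z[OF \<phi>(1)] .
  then show ?thesis by (simp add: LIMSEQ_const_iff)
qed

text \<open>By inner regularity the set where \<open>h\<close> is positive would contain a compact set of positive measure, on which the integral of \<open>h\<close> vanishes by the previous lemma.\<close>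

lemma fundamental_pos_part:
  assumes \<Omega>: "open \<Omega>" "bounded \<Omega>" and h: "integrable (lebesgue_on \<Omega>) h"
    and z: "\<And>\<phi>. \<phi> \<in> test_functions \<Omega> \<Longrightarrow> (\<integral>x. h x * \<phi> x \<partial>lebesgue_on \<Omega>) = 0"
  shows "negligible {x \<in> \<Omega>. h x > 0}"
proof (rule ccontr)
  let ?A = "{x \<in> \<Omega>. h x > 0}"
  assume "\<not> negligible ?A"
  have \<Omega>s: "\<Omega> \<in> sets lebesgue" using lmeasurable_open[OF \<Omega>(2,1)] by (rule fmeasurableD)
  have "h \<in> borel_measurable (lebesgue_on \<Omega>)" using h by auto
  then have "{x \<in> space (lebesgue_on \<Omega>). 0 < h x} \<in> sets (lebesgue_on \<Omega>)" by measurable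
  then have A: "?A \<in> sets lebesgue" using \<Omega>s by (simp add: sets_restrict_space_iff)
  have Am: "?A \<in> lmeasurable" using A \<Omega>(2) bounded_subset[of \<Omega> ?A]
    by (intro bounded_set_imp_lmeasurable) auto
  then have "measure lebesgue ?A \<noteq> 0" using \<open>\<not> negligible ?A\<close> negligible_iff_measure by blast
  then have pos: "measure lebesgue ?A > 0" using measure_nonneg[of lebesgue ?A] by linarith
  obtain T where T: "closed T" "T \<subseteq> ?A" "?A - T \<in> lmeasurable" "emeasure lebesgue (?A - T) < ennreal (measure lebesgue ?A)"
    by (rule sets_lebesgue_inner_closed[OF A pos])
  have Tc: "compact T" using T \<Omega>(2) bounded_subset[of \<Omega> T] by (auto simp: compact_eq_bounded_closed)
  have Tm: "T \<in> lmeasurable" using Tc by (rule lmeasurable_compact)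
  have iT: "integrable (lebesgue_on \<Omega>) (\<lambda>x. h x * indicator T x)"
    using Tm by (intro integrable_mult_bounded[OF h, of _ 1]) (auto intro!: measurable_restrict_space1 simp: indicator_def)
  have "(\<integral>x. h x * indicator T x \<partial>lebesgue_on \<Omega>) = 0"
    using T(2) by (intro fundamental_compact[OF \<Omega>(1) h z Tc]) auto
  moreover have "AE x in lebesgue_on \<Omega>. 0 \<le> h x * indicator T x"
    using T(2) by (intro AE_I2) (auto simp: indicator_def)
  ultimately have "AE x in lebesgue_on \<Omega>. h x * indicator T x = 0"
    using integral_nonneg_eq_0_iff_AE[OF iT] by blast
  then have "AE x in lebesgue. x \<in> \<Omega> \<longrightarrow> h x * indicator T x = 0"
    using AE_restrict_space_iff[of \<Omega> lebesgue] \<Omega>s by simp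
  then have "AE x in lebesgue. x \<notin> T" by eventually_elim (use T(2) in \<open>auto simp: indicator_def split: if_splits\<close>)
  then have "negligible T" using Tm AE_iff_null_sets[of T lebesgue] by (auto simp: negligible_iff_null_sets)
  then have "measure lebesgue T = 0" by (simp add: negligible_imp_measure0)
  moreover have "measure lebesgue ?A = measure lebesgue T + measure lebesgue (?A - T)"
    using measure_Un2[of T lebesgue ?A] T(2) Tm Am by (simp add: Un_absorb1)
  moreover have "measure lebesgue (?A - T) < measure lebesgue ?A"
    using T(3,4) pos by (simp add: emeasure_eq_measure2 ennreal_less_iff)
  ultimately show False by simp
qed

lemma fundamental_lemma:
  assumes \<Omega>: "open \<Omega>" "bounded \<Omega>" and h: "integrable (lebesgue_on \<Omega>) h"
    and z: "\<And>\<phi>. \<phi> \<in> test_functions \<Omega> \<Longrightarrow> (\<integral>x. h x * \<phi> x \<partial>lebesgue_on \<Omega>) = 0"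
  shows "negligible {x \<in> \<Omega>. h x \<noteq> 0}"
proof -
  have "negligible {x \<in> \<Omega>. h x > 0}" by (rule fundamental_pos_part[OF \<Omega> h z])
  moreover have "negligible {x \<in> \<Omega>. - h x > 0}"
    using z h by (intro fundamental_pos_part[OF \<Omega>]) auto
  ultimately have "negligible ({x \<in> \<Omega>. h x > 0} \<union> {x \<in> \<Omega>. - h x > 0})" by (rule negligible_Un)
  moreover have "{x \<in> \<Omega>. h x > 0} \<union> {x \<in> \<Omega>. - h x > 0} = {x \<in> \<Omega>. h x \<noteq> 0}" by auto
  ultimately show ?thesis by (simp only:)
qed

section \<open>Weak gradients and limits of test functions\<close>

lemma axis_sum: "(\<Sum>i\<in>UNIV. (h *\<^sub>R axis j (1::real)) $ i * c i) = h * c (j :: 2)"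
  using exhaust_2[of j] by (auto simp: sum_2 axis_def)

lemma pd_deriv_line:
  assumes "f differentiable (at (x + s *\<^sub>R axis j 1))"
  shows "((\<lambda>s. f (x + s *\<^sub>R axis j 1)) has_real_derivative pd j f (x + s *\<^sub>R axis j 1)) (at s)"
proof -
  have "((\<lambda>s. x + s *\<^sub>R axis j 1) has_derivative (\<lambda>h. 0 + h *\<^sub>R axis j (1::real))) (at s)"
    by (intro has_derivative_add has_derivative_const has_derivative_scaleR_left has_derivative_ident)
  then have "((\<lambda>s. x + s *\<^sub>R axis j 1) has_derivative (\<lambda>h. h *\<^sub>R axis j (1::real))) (at s)" by simp
  from has_derivative_compose[OF this has_derivative_pd[OF assms]]
  have "((\<lambda>s. f (x + s *\<^sub>R axis j 1)) has_derivative (\<lambda>h. h * pd j f (x + s *\<^sub>R axis j 1))) (at s)"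
    unfolding axis_sum .
  moreover have "(\<lambda>h. h * pd j f (x + s *\<^sub>R axis j 1)) = (*) (pd j f (x + s *\<^sub>R axis j 1))"
    by (rule ext) (rule mult.commute)
  ultimately show ?thesis unfolding has_field_derivative_def by (simp only:)
qed

lemma test_pd:
  assumes "\<phi> \<in> test_functions \<Omega>" shows "pd j \<phi> \<in> test_functions \<Omega>"
proof -
  obtain C where C: "compact C" "C \<subseteq> \<Omega>" "\<forall>x. x \<notin> C \<longrightarrow> \<phi> x = 0" using test_functions_supp[OF assms] by blast
  have "pd j \<phi> x = 0" if "x \<notin> C" for x
  proof -
    have "pd j \<phi> x = pd j (\<lambda>x. 0) x"
      by (rule pd_cong[of "- C"]) (use C that in \<open>auto simp: compact_imp_closed open_Compl\<close>)
    then show ?thesis by (simp add: pd_const)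
  qed
  moreover have "Ck k (pd j \<phi>)" for k using assms by (auto simp: test_functions_def dest: spec[of _ "Suc k"])
  ultimately show ?thesis using C by (intro test_functionsI[of _ C])
qed

lemma test_continuous: "\<phi> \<in> test_functions \<Omega> \<Longrightarrow> continuous_on UNIV \<phi>"
  using Ck_continuous[of 0] by (auto simp: test_functions_def dest: spec[of _ 0])

lemma test_differentiable: "\<phi> \<in> test_functions \<Omega> \<Longrightarrow> \<phi> differentiable (at x)"
  by (auto simp: test_functions_def dest: spec[of _ "Suc 0"])

lemma compact_support_bounded:
  fixes f :: "'a::euclidean_space \<Rightarrow> real"
  assumes "continuous_on UNIV f" "compact C" "\<And>x. x \<notin> C \<Longrightarrow> f x = 0"
  obtains B where "B \<ge> 0" "\<And>x. \<bar>f x\<bar> \<le> B"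
proof -
  have "bounded (f ` C)"
    using assms by (meson compact_continuous_image compact_imp_bounded continuous_on_subset top_greatest)
  then obtain B where B: "\<And>x. x \<in> C \<Longrightarrow> \<bar>f x\<bar> \<le> B" by (auto simp: bounded_iff)
  have "\<bar>f x\<bar> \<le> \<bar>B\<bar>" for x using B[of x] assms(3)[of x] by (cases "x \<in> C") auto
  then show thesis using that[of "\<bar>B\<bar>"] by simp
qed

lemma test_bounded: assumes "\<phi> \<in> test_functions \<Omega>" shows "\<exists>B\<ge>0. \<forall>x. \<bar>\<phi> x\<bar> \<le> B"
  using test_functions_supp[OF assms] compact_support_bounded[OF test_continuous[OF assms]] by metis

lemma compact_support_integrable:
  fixes f :: "'a::euclidean_space \<Rightarrow> real"
  assumes "continuous_on UNIV f" "compact C" "\<And>x. x \<notin> C \<Longrightarrow> f x = 0"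
  shows "integrable lborel f"
proof -
  have "integrable lborel (\<lambda>x. indicator C x *\<^sub>R f x)"
    by (rule borel_integrable_compact[OF assms(2) continuous_on_subset[OF assms(1) subset_UNIV]])
  moreover have "(\<lambda>x. indicator C x *\<^sub>R f x) = f"
  proof (rule ext)
    show "indicator C x *\<^sub>R f x = f x" for x using assms(3)[of x] by (cases "x \<in> C") simp_all
  qed
  ultimately show ?thesis by (simp only:)
qed

lemma integral_lebesgue_on_support:
  fixes f :: "'a::euclidean_space \<Rightarrow> real"
  assumes "continuous_on UNIV f" "S \<in> sets lebesgue" "\<And>x. x \<notin> S \<Longrightarrow> f x = 0"
  shows "integral\<^sup>L (lebesgue_on S) f = integral\<^sup>L lborel f"
proof -
  have "integral\<^sup>L (lebesgue_on S) f = (\<integral>x. indicator S x *\<^sub>R f x \<partial>lebesgue)"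
    using assms(2) by (intro integral_restrict_space) auto
  also have "\<dots> = integral\<^sup>L lebesgue f"
  proof (rule Bochner_Integration.integral_cong[OF refl])
    show "indicator S x *\<^sub>R f x = f x" for x using assms(3)[of x] by (cases "x \<in> S") auto
  qed
  also have "integral\<^sup>L lebesgue f = integral\<^sup>L lborel f"
    using borel_measurable_continuous_onI[OF assms(1)] by (intro integral_completion) simp
  finally show ?thesis .
qed

lemma integral_lborel_shift:
  fixes f :: "'a::euclidean_space \<Rightarrow> real"
  assumes "f \<in> borel_measurable borel"
  shows "(\<integral>x. f (c + x) \<partial>lborel) = (\<integral>x. f x \<partial>lborel)"
proof -
  have "(\<integral>x. f x \<partial>lborel) = (\<integral>x. f x \<partial>distr lborel borel ((+) c))" by (simp add: lborel_distr_plus)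
  also have "\<dots> = (\<integral>x. f (c + x) \<partial>lborel)" by (rule integral_distr) (use assms in auto)
  finally show ?thesis by simp
qed

text \<open>Difference quotients of a compactly supported function have integral zero by translation invariance.\<close>

lemma integral_pd_test:
  assumes t: "\<theta> \<in> test_functions \<Omega>" and \<Omega>: "\<Omega> \<in> sets lebesgue"
  shows "(\<integral>x. pd j \<theta> x \<partial>lebesgue_on \<Omega>) = 0"
proof -
  let ?e = "axis j 1 :: real^2"
  obtain C where C: "compact C" "C \<subseteq> \<Omega>" "\<forall>x. x \<notin> C \<longrightarrow> \<theta> x = 0" using test_functions_supp[OF t] by blast
  obtain R where "\<And>x. x \<in> C \<Longrightarrow> norm x \<le> R" using compact_imp_bounded[OF C(1)] by (auto simp: bounded_iff)
  then have R: "C \<subseteq> cball 0 R" by auto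
  obtain B where B: "B \<ge> 0" "\<forall>x. \<bar>pd j \<theta> x\<bar> \<le> B" using test_bounded[OF test_pd[OF t]] by blast
  define tn where "tn n = 1 / real (Suc n)" for n
  define q where "q n x = (\<theta> (x + tn n *\<^sub>R ?e) - \<theta> x) / tn n" for n x
  have tn: "tn n > 0" "tn n \<le> 1" for n by (auto simp: tn_def)
  have tn0: "tn \<longlonglongrightarrow> 0" unfolding tn_def[abs_def] by (intro LIMSEQ_Suc lim_1_over_n)
  have cont: "continuous_on UNIV \<theta>" by (rule test_continuous[OF t])
  have meas: "\<theta> \<in> borel_measurable borel" by (rule borel_measurable_continuous_onI[OF cont])
  have line: "((\<lambda>s. \<theta> (x + s *\<^sub>R ?e)) has_real_derivative pd j \<theta> (x + s *\<^sub>R ?e)) (at s)" for x s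
    by (rule pd_deriv_line[OF test_differentiable[OF t]])
  have i\<theta>: "integrable lborel \<theta>" using C by (intro compact_support_integrable[OF cont C(1)]) auto
  have i\<theta>s: "integrable lborel (\<lambda>x. \<theta> (x + s))" for s
  proof (rule compact_support_integrable)
    show "continuous_on UNIV (\<lambda>x. \<theta> (x + s))"
      by (rule continuous_on_compose2[OF cont]) (auto intro!: continuous_intros)
    show "compact ((\<lambda>x. x - s) ` C)" using C(1) by (intro compact_continuous_image continuous_intros)
    show "\<theta> (x + s) = 0" if "x \<notin> (\<lambda>x. x - s) ` C" for x
    proof -
      have "x + s \<notin> C" using that by (metis add_diff_cancel_right' image_eqI)
      then show ?thesis using C(3) by blast
    qed
  qed
  have q0: "(\<integral>x. q n x \<partial>lborel) = 0" for n
  proof -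
    have "(\<integral>x. q n x \<partial>lborel) = ((\<integral>x. \<theta> (x + tn n *\<^sub>R ?e) \<partial>lborel) - (\<integral>x. \<theta> x \<partial>lborel)) / tn n"
      unfolding q_def using i\<theta> i\<theta>s by simp
    also have "(\<integral>x. \<theta> (x + tn n *\<^sub>R ?e) \<partial>lborel) = (\<integral>x. \<theta> x \<partial>lborel)"
      using integral_lborel_shift[OF meas, of "tn n *\<^sub>R ?e"] by (simp add: add.commute)
    finally show ?thesis by simp
  qed
  have "(\<lambda>n. \<integral>x. q n x \<partial>lborel) \<longlonglongrightarrow> (\<integral>x. pd j \<theta> x \<partial>lborel)"
  proof (rule integral_dominated_convergence[where w="\<lambda>x. indicator (cball 0 (R + 1)) x *\<^sub>R B"])
    show "pd j \<theta> \<in> borel_measurable lborel"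
      using borel_measurable_continuous_onI[OF test_continuous[OF test_pd[OF t]]] by simp
    show "q n \<in> borel_measurable lborel" for n
      unfolding q_def[abs_def] using i\<theta> i\<theta>s by (intro borel_measurable_divide borel_measurable_diff) auto
    show "integrable lborel (\<lambda>x. indicator (cball 0 (R + 1)) x *\<^sub>R B)"
      by (intro borel_integrable_compact) auto
    show "AE x in lborel. (\<lambda>n. q n x) \<longlonglongrightarrow> pd j \<theta> x"
    proof (rule AE_I2)
      fix x
      have "((\<lambda>h. (\<theta> (x + h *\<^sub>R ?e) - \<theta> x) / h) \<longlongrightarrow> pd j \<theta> x) (at 0)"
        using line[of x 0] unfolding DERIV_def by simp
      moreover have "filterlim tn (at 0) sequentially"
        using tn0 tn(1) by (auto simp: filterlim_at intro!: always_eventually less_imp_neq[symmetric])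
      ultimately show "(\<lambda>n. q n x) \<longlonglongrightarrow> pd j \<theta> x" unfolding q_def by (rule filterlim_compose)
    qed
    show "AE x in lborel. norm (q n x) \<le> indicator (cball 0 (R + 1)) x *\<^sub>R B" for n
    proof (rule AE_I2)
      fix x
      show "norm (q n x) \<le> indicator (cball 0 (R + 1)) x *\<^sub>R B"
      proof (cases "x \<in> cball 0 (R + 1)")
        case True
        obtain z where "\<theta> (x + tn n *\<^sub>R ?e) - \<theta> (x + 0 *\<^sub>R ?e) = (tn n - 0) * pd j \<theta> (x + z *\<^sub>R ?e)"
          using MVT2[of 0 "tn n" "\<lambda>s. \<theta> (x + s *\<^sub>R ?e)" "\<lambda>s. pd j \<theta> (x + s *\<^sub>R ?e)"] tn line by blast
        then have "q n x = pd j \<theta> (x + z *\<^sub>R ?e)" using tn(1)[of n] by (simp add: q_def)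
        then show ?thesis using B True by simp
      next
        case False
        then have n: "norm x > R + 1" by simp
        have "norm x \<le> norm (x + tn n *\<^sub>R ?e) + norm (tn n *\<^sub>R ?e)" by (metis add_diff_cancel_right' norm_triangle_ineq4)
        then have "norm (x + tn n *\<^sub>R ?e) > R" using n tn[of n] by (simp add: norm_axis_1)
        then have "x \<notin> C" "x + tn n *\<^sub>R ?e \<notin> C" using R n by (auto simp: subset_iff dest: order_trans)
        then show ?thesis using C(3) False by (simp add: q_def)
      qed
    qed
  qed
  then have "(\<lambda>n::nat. 0::real) \<longlonglongrightarrow> (\<integral>x. pd j \<theta> x \<partial>lborel)" unfolding q0 .
  then have "(\<integral>x. pd j \<theta> x \<partial>lborel) = 0" by (simp add: LIMSEQ_const_iff)
  moreover have "(\<integral>x. pd j \<theta> x \<partial>lebesgue_on \<Omega>) = (\<integral>x. pd j \<theta> x \<partial>lborel)"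
    using test_functions_supp[OF test_pd[OF t]] by (intro integral_lebesgue_on_support[OF test_continuous[OF test_pd[OF t]] \<Omega>]) blast
  ultimately show ?thesis by simp
qed

lemma square_integrable_mult:
  fixes f g :: "'a \<Rightarrow> real"
  assumes "f \<in> borel_measurable M" "g \<in> borel_measurable M"
    and "integrable M (\<lambda>x. (f x)\<^sup>2)" "integrable M (\<lambda>x. (g x)\<^sup>2)"
  shows "integrable M (\<lambda>x. f x * g x)"
proof (rule Bochner_Integration.integrable_bound[of M "\<lambda>x. (f x)\<^sup>2 + (g x)\<^sup>2"])
  show "integrable M (\<lambda>x. (f x)\<^sup>2 + (g x)\<^sup>2)" using assms by simp
  show "(\<lambda>x. f x * g x) \<in> borel_measurable M" using assms by measurable
  have "\<bar>a * b\<bar> \<le> a\<^sup>2 + b\<^sup>2" for a b :: real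
  proof -
    have "2 * (\<bar>a\<bar> * \<bar>b\<bar>) \<le> a\<^sup>2 + b\<^sup>2" using sum_squares_bound[of "\<bar>a\<bar>" "\<bar>b\<bar>"] by simp
    moreover have "0 \<le> \<bar>a\<bar> * \<bar>b\<bar>" by simp
    ultimately show ?thesis unfolding abs_mult by linarith
  qed
  then show "AE x in M. norm (f x * g x) \<le> norm ((f x)\<^sup>2 + (g x)\<^sup>2)"
    by (intro AE_I2) (simp add: abs_of_nonneg)
qed

lemma square_integrable_diff:
  fixes f g :: "'a \<Rightarrow> real"
  assumes "f \<in> borel_measurable M" "g \<in> borel_measurable M"
    and "integrable M (\<lambda>x. (f x)\<^sup>2)" "integrable M (\<lambda>x. (g x)\<^sup>2)"
  shows "integrable M (\<lambda>x. (f x - g x)\<^sup>2)"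
proof -
  have "(\<lambda>x. (f x - g x)\<^sup>2) = (\<lambda>x. (f x)\<^sup>2 - 2 * (f x * g x) + (g x)\<^sup>2)"
    by (simp add: fun_eq_iff power2_eq_square algebra_simps)
  then show ?thesis using assms square_integrable_mult[OF assms] by simp
qed

text \<open>A form of the Cauchy--Schwarz inequality in which the parameter need not be optimised.\<close>

lemma integral_product_bound:
  fixes f g :: "'a \<Rightarrow> real"
  assumes m: "f \<in> borel_measurable M" "g \<in> borel_measurable M"
    and i: "integrable M (\<lambda>x. (f x)\<^sup>2)" "integrable M (\<lambda>x. (g x)\<^sup>2)" and s: "s > 0"
    and f: "(\<integral>x. (f x)\<^sup>2 \<partial>M) \<le> s\<^sup>2"
  shows "\<bar>\<integral>x. f x * g x \<partial>M\<bar> \<le> s * (1 + (\<integral>x. (g x)\<^sup>2 \<partial>M))"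
proof -
  have pt: "\<bar>a * b\<bar> \<le> a\<^sup>2 / s + s * b\<^sup>2" for a b :: real
  proof -
    have "0 \<le> (\<bar>a\<bar> - s * \<bar>b\<bar>)\<^sup>2" by simp
    then have "2 * s * (\<bar>a\<bar> * \<bar>b\<bar>) \<le> a\<^sup>2 + s\<^sup>2 * b\<^sup>2"
      by (simp add: power2_diff power_mult_distrib mult_ac)
    moreover have "0 \<le> s * (\<bar>a\<bar> * \<bar>b\<bar>)" using s by simp
    ultimately have "s * (\<bar>a\<bar> * \<bar>b\<bar>) \<le> a\<^sup>2 + s\<^sup>2 * b\<^sup>2" by linarith
    then show ?thesis using s by (simp add: abs_mult field_simps power2_eq_square)
  qed
  have "\<bar>\<integral>x. f x * g x \<partial>M\<bar> \<le> (\<integral>x. \<bar>f x * g x\<bar> \<partial>M)" using integral_norm_bound[of M "\<lambda>x. f x * g x"] by simp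
  also have "\<dots> \<le> (\<integral>x. (f x)\<^sup>2 / s + s * (g x)\<^sup>2 \<partial>M)"
    using square_integrable_mult[OF m i] i pt by (intro integral_mono) auto
  also have "\<dots> = (\<integral>x. (f x)\<^sup>2 \<partial>M) / s + s * (\<integral>x. (g x)\<^sup>2 \<partial>M)" using i by simp
  also have "\<dots> \<le> s\<^sup>2 / s + s * (\<integral>x. (g x)\<^sup>2 \<partial>M)" using f s by (intro add_right_mono divide_right_mono) auto
  also have "\<dots> = s * (1 + (\<integral>x. (g x)\<^sup>2 \<partial>M))" using s by (simp add: field_simps power2_eq_square)
  finally show ?thesis .
qed

lemma norm_vec2_sq: "(norm (v :: real^2))\<^sup>2 = (v$1)\<^sup>2 + (v$2)\<^sup>2"
  using dist_sq[of v 0] by simp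

lemma vec2_measurable_iff:
  fixes g :: "'a \<Rightarrow> real^2"
  shows "g \<in> borel_measurable M \<longleftrightarrow> (\<forall>i. (\<lambda>x. g x $ i) \<in> borel_measurable M)"
proof
  assume "g \<in> borel_measurable M"
  then show "\<forall>i. (\<lambda>x. g x $ i) \<in> borel_measurable M"
    using measurable_compose[OF _ borel_measurable_nth] by blast
next
  assume "\<forall>i. (\<lambda>x. g x $ i) \<in> borel_measurable M"
  then have "(\<lambda>x. g x \<bullet> b) \<in> borel_measurable M" if "b \<in> Basis" for b
    using that by (auto simp: Basis_vec_def inner_axis)
  then show "g \<in> borel_measurable M" using borel_measurable_euclidean_space[of g M] by blast
qed

lemma L2_space_real: "f \<in> L2_space \<Omega> \<longleftrightarrow> f \<in> borel_measurable (lebesgue_on \<Omega>) \<and> integrable (lebesgue_on \<Omega>) (\<lambda>x. (f x)\<^sup>2)"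
  for f :: "real^2 \<Rightarrow> real"
  by (simp add: L2_space_def)

lemma L2_space_vec: "g \<in> L2_space \<Omega> \<longleftrightarrow> (\<forall>i. (\<lambda>x. g x $ i) \<in> L2_space \<Omega>)"
  for g :: "real^2 \<Rightarrow> real^2"
proof
  assume g: "g \<in> L2_space \<Omega>"
  then have m: "(\<lambda>x. g x $ i) \<in> borel_measurable (lebesgue_on \<Omega>)" for i
    unfolding L2_space_def vec2_measurable_iff by blast
  moreover have "integrable (lebesgue_on \<Omega>) (\<lambda>x. (g x $ i)\<^sup>2)" for i
  proof (rule Bochner_Integration.integrable_bound)
    show "integrable (lebesgue_on \<Omega>) (\<lambda>x. (norm (g x))\<^sup>2)" using g by (simp add: L2_space_def)
    show "(\<lambda>x. (g x $ i)\<^sup>2) \<in> borel_measurable (lebesgue_on \<Omega>)" using m by (intro borel_measurable_power)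
    show "AE x in lebesgue_on \<Omega>. norm ((g x $ i)\<^sup>2) \<le> norm ((norm (g x))\<^sup>2)"
      using exhaust_2[of i] by (intro AE_I2) (auto simp: norm_vec2_sq)
  qed
  ultimately show "\<forall>i. (\<lambda>x. g x $ i) \<in> L2_space \<Omega>" by (simp add: L2_space_real)
next
  assume a: "\<forall>i. (\<lambda>x. g x $ i) \<in> L2_space \<Omega>"
  then have "g \<in> borel_measurable (lebesgue_on \<Omega>)" unfolding vec2_measurable_iff by (simp add: L2_space_real)
  then show "g \<in> L2_space \<Omega>" using a by (simp add: L2_space_def norm_vec2_sq)
qed

lemma L2_diff:
  fixes f :: "real^2 \<Rightarrow> real" shows "f \<in> L2_space \<Omega> \<Longrightarrow> g \<in> L2_space \<Omega> \<Longrightarrow> (\<lambda>x. f x - g x) \<in> L2_space \<Omega>"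
  unfolding L2_space_real using square_integrable_diff by (auto intro: borel_measurable_diff)

lemma L2_mult: "f \<in> L2_space \<Omega> \<Longrightarrow> g \<in> L2_space \<Omega> \<Longrightarrow> integrable (lebesgue_on \<Omega>) (\<lambda>x. f x * g x)"
  for f :: "real^2 \<Rightarrow> real"
  unfolding L2_space_real using square_integrable_mult by auto

text \<open>The classical gradient.\<close>

definition test_grad :: "(real^2 \<Rightarrow> real) \<Rightarrow> real^2 \<Rightarrow> real^2"
  where "test_grad \<phi> x = (\<chi> j. pd j \<phi> x)"

text \<open>A bounded open set, the only structure of \<open>\<Omega>\<close> that matters for Sobolev functions here.\<close>

locale bounded_domain =
  fixes \<Omega> :: "(real^2) set"
  assumes open_dom: "open \<Omega>" and bounded_dom: "bounded \<Omega>"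
begin

lemma dom_lmeasurable: "\<Omega> \<in> lmeasurable" using open_dom bounded_dom by (simp add: lmeasurable_open)
lemma dom_sets: "\<Omega> \<in> sets lebesgue" using dom_lmeasurable by blast

lemma bounded_L2:
  fixes f :: "real^2 \<Rightarrow> real"
  assumes "f \<in> borel_measurable (lebesgue_on \<Omega>)" "\<And>x. x \<in> \<Omega> \<Longrightarrow> \<bar>f x\<bar> \<le> B" shows "f \<in> L2_space \<Omega>"
proof -
  have "(f x)\<^sup>2 \<le> B\<^sup>2" if "x \<in> \<Omega>" for x using assms(2)[OF that] by (metis abs_ge_zero power2_abs power_mono)
  then show ?thesis using assms(1)
    unfolding L2_space_real by (intro conjI bounded_measurable_integrable[OF dom_lmeasurable, of _ "B\<^sup>2"]) auto
qed

lemma test_L2: assumes "\<phi> \<in> test_functions \<Omega>" shows "\<phi> \<in> L2_space \<Omega>"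
proof -
  obtain B where "\<forall>x. \<bar>\<phi> x\<bar> \<le> B" using test_bounded[OF assms] by blast
  then show ?thesis
    using continuous_measurable_lebesgue_on[OF test_continuous[OF assms]] by (intro bounded_L2[of _ B]) auto
qed

lemma L2_integrable:
  fixes f :: "real^2 \<Rightarrow> real"
  assumes "f \<in> L2_space \<Omega>" shows "integrable (lebesgue_on \<Omega>) f"
  using L2_mult[OF assms bounded_L2[of "\<lambda>x. 1" 1]] by simp

lemma test_parts:
  assumes "\<phi> \<in> test_functions \<Omega>" "\<psi> \<in> test_functions \<Omega>"
  shows "(\<integral>x. \<phi> x * pd j \<psi> x \<partial>lebesgue_on \<Omega>) = - (\<integral>x. pd j \<phi> x * \<psi> x \<partial>lebesgue_on \<Omega>)"
proof -
  have "(\<lambda>x. \<phi> x * \<psi> x) \<in> test_functions \<Omega>"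
    using assms by (intro test_functions_mult) (auto simp: test_functions_def)
  then have "(\<integral>x. pd j (\<lambda>x. \<phi> x * \<psi> x) x \<partial>lebesgue_on \<Omega>) = 0" using dom_sets by (rule integral_pd_test)
  then have "(\<integral>x. \<phi> x * pd j \<psi> x + pd j \<phi> x * \<psi> x \<partial>lebesgue_on \<Omega>) = 0"
    using pd_mult[OF test_differentiable[OF assms(1)] test_differentiable[OF assms(2)]] by simp
  then show ?thesis
    using L2_mult[OF test_L2[OF assms(1)] test_L2[OF test_pd[OF assms(2)]]] L2_mult[OF test_L2[OF test_pd[OF assms(1)]] test_L2[OF assms(2)]]
    by simp
qed

text \<open>Weak gradients of the same function agree almost everywhere.\<close>

lemma weak_grad_unique:
  assumes u: "u \<in> L2_space \<Omega>" and g: "is_weak_grad \<Omega> u g" "is_weak_grad \<Omega> u g'"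
  shows "L2_norm \<Omega> g = L2_norm \<Omega> g'"
proof -
  have gL: "(\<lambda>x. g x $ j) \<in> L2_space \<Omega>" "(\<lambda>x. g' x $ j) \<in> L2_space \<Omega>" for j
    using g L2_space_vec unfolding is_weak_grad_def by blast+
  have n: "negligible {x \<in> \<Omega>. g x $ j - g' x $ j \<noteq> 0}" for j
  proof (rule fundamental_lemma[OF open_dom bounded_dom])
    show "integrable (lebesgue_on \<Omega>) (\<lambda>x. g x $ j - g' x $ j)"
      using L2_integrable[OF gL(1)] L2_integrable[OF gL(2)] by simp
    fix \<phi> assume t: "\<phi> \<in> test_functions \<Omega>"
    have "(\<integral>x. g x $ j * \<phi> x \<partial>lebesgue_on \<Omega>) = (\<integral>x. g' x $ j * \<phi> x \<partial>lebesgue_on \<Omega>)"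
    proof -
      have "(\<integral>x. u x * pd j \<phi> x \<partial>lebesgue_on \<Omega>) = - (\<integral>x. g x $ j * \<phi> x \<partial>lebesgue_on \<Omega>)"
        "(\<integral>x. u x * pd j \<phi> x \<partial>lebesgue_on \<Omega>) = - (\<integral>x. g' x $ j * \<phi> x \<partial>lebesgue_on \<Omega>)"
        using g t unfolding is_weak_grad_def by blast+
      then show ?thesis by linarith
    qed
    then show "(\<integral>x. (g x $ j - g' x $ j) * \<phi> x \<partial>lebesgue_on \<Omega>) = 0"
      using L2_mult[OF gL(1) test_L2[OF t]] L2_mult[OF gL(2) test_L2[OF t]] by (simp add: left_diff_distrib)
  qed
  have "negligible (\<Union>j. {x \<in> \<Omega>. g x $ j - g' x $ j \<noteq> 0})" using n by (intro negligible_Union) auto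
  then have "(\<integral>x. (norm (g x))\<^sup>2 \<partial>lebesgue_on \<Omega>) = (\<integral>x. (norm (g' x))\<^sup>2 \<partial>lebesgue_on \<Omega>)"
  proof (rule lebesgue_on_spike(2)[OF dom_sets])
    show "integrable (lebesgue_on \<Omega>) (\<lambda>x. (norm (g' x))\<^sup>2)" using g(2) by (simp add: is_weak_grad_def L2_space_def)
    show "(norm (g x))\<^sup>2 = (norm (g' x))\<^sup>2" if "x \<in> \<Omega> - (\<Union>j. {x \<in> \<Omega>. g x $ j - g' x $ j \<noteq> 0})" for x
    proof -
      have "g x = g' x" using that by (auto simp: vec_eq_iff)
      then show ?thesis by simp
    qed
  qed
  then show ?thesis by (simp add: L2_norm_def)
qed

lemma H1_norm_eq:
  assumes "u \<in> L2_space \<Omega>" "is_weak_grad \<Omega> u g"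
  shows "H1_norm \<Omega> u = sqrt ((L2_norm \<Omega> u)\<^sup>2 + (L2_norm \<Omega> g)\<^sup>2)"
  using weak_grad_unique[OF assms(1) someI[of "is_weak_grad \<Omega> u", OF assms(2)] assms(2)]
  by (simp add: H1_norm_def)

text \<open>The pairs \<open>(u, g)\<close> that are limits of test functions and their gradients.\<close>

definition test_limit :: "(real^2 \<Rightarrow> real) \<Rightarrow> (real^2 \<Rightarrow> real^2) \<Rightarrow> bool"
  where "test_limit u g \<longleftrightarrow> u \<in> L2_space \<Omega> \<and> g \<in> L2_space \<Omega> \<and>
    (\<forall>e>0. \<exists>\<phi>\<in>test_functions \<Omega>. (\<integral>x. (u x - \<phi> x)\<^sup>2 \<partial>lebesgue_on \<Omega>) < e \<and>
      (\<forall>j. (\<integral>x. (g x $ j - pd j \<phi> x)\<^sup>2 \<partial>lebesgue_on \<Omega>) < e))"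

lemma test_limit_weak_grad:
  assumes "test_limit u g" shows "is_weak_grad \<Omega> u g"
  unfolding is_weak_grad_def
proof (intro conjI ballI allI)
  show "g \<in> L2_space \<Omega>" using assms by (simp add: test_limit_def)
  have u: "u \<in> L2_space \<Omega>" and g: "(\<lambda>x. g x $ j) \<in> L2_space \<Omega>" for j
    using assms L2_space_vec by (auto simp: test_limit_def)
  fix \<psi> j assume \<psi>: "\<psi> \<in> test_functions \<Omega>"
  let ?M = "lebesgue_on \<Omega>"
  let ?d = "(\<integral>x. u x * pd j \<psi> x \<partial>?M) + (\<integral>x. g x $ j * \<psi> x \<partial>?M)"
  let ?c = "(1 + (\<integral>x. (pd j \<psi> x)\<^sup>2 \<partial>?M)) + (1 + (\<integral>x. (\<psi> x)\<^sup>2 \<partial>?M))"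
  have p\<psi>: "pd j \<psi> \<in> L2_space \<Omega>" "\<psi> \<in> L2_space \<Omega>" using test_L2 \<psi> test_pd by blast+
  have cpos: "?c > 0" by (intro add_pos_nonneg add_nonneg_nonneg integral_nonneg_AE) auto
  have b: "\<bar>?d\<bar> \<le> s * ?c" if s: "s > 0" for s
  proof -
    have "s\<^sup>2 > 0" using s by simp
    then obtain \<phi> where \<phi>: "\<phi> \<in> test_functions \<Omega>" "(\<integral>x. (u x - \<phi> x)\<^sup>2 \<partial>?M) < s\<^sup>2" "(\<integral>x. (g x $ j - pd j \<phi> x)\<^sup>2 \<partial>?M) < s\<^sup>2"
      using assms unfolding test_limit_def by blast
    have L: "\<phi> \<in> L2_space \<Omega>" "pd j \<phi> \<in> L2_space \<Omega>" using test_L2 \<phi>(1) test_pd by blast+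
    have d: "(\<lambda>x. u x - \<phi> x) \<in> L2_space \<Omega>" "(\<lambda>x. g x $ j - pd j \<phi> x) \<in> L2_space \<Omega>"
      using L2_diff u g L by blast+
    have 1: "\<bar>\<integral>x. (u x - \<phi> x) * pd j \<psi> x \<partial>?M\<bar> \<le> s * (1 + (\<integral>x. (pd j \<psi> x)\<^sup>2 \<partial>?M))"
      using d(1) p\<psi>(1) \<phi>(2) s unfolding L2_space_real by (intro integral_product_bound) auto
    have 2: "\<bar>\<integral>x. (g x $ j - pd j \<phi> x) * \<psi> x \<partial>?M\<bar> \<le> s * (1 + (\<integral>x. (\<psi> x)\<^sup>2 \<partial>?M))"
      using d(2) p\<psi>(2) \<phi>(3) s unfolding L2_space_real by (intro integral_product_bound) auto
    have "(\<integral>x. (u x - \<phi> x) * pd j \<psi> x \<partial>?M) = (\<integral>x. u x * pd j \<psi> x \<partial>?M) - (\<integral>x. \<phi> x * pd j \<psi> x \<partial>?M)"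
      using L2_mult[OF u p\<psi>(1)] L2_mult[OF L(1) p\<psi>(1)] by (simp add: left_diff_distrib)
    moreover have "(\<integral>x. (g x $ j - pd j \<phi> x) * \<psi> x \<partial>?M) = (\<integral>x. g x $ j * \<psi> x \<partial>?M) - (\<integral>x. pd j \<phi> x * \<psi> x \<partial>?M)"
      using L2_mult[OF g p\<psi>(2)] L2_mult[OF L(2) p\<psi>(2)] by (simp add: left_diff_distrib)
    ultimately have "?d = (\<integral>x. (u x - \<phi> x) * pd j \<psi> x \<partial>?M) + (\<integral>x. (g x $ j - pd j \<phi> x) * \<psi> x \<partial>?M)"
      using test_parts[OF \<phi>(1) \<psi>, of j] by simp
    then have "\<bar>?d\<bar> \<le> s * (1 + (\<integral>x. (pd j \<psi> x)\<^sup>2 \<partial>?M)) + s * (1 + (\<integral>x. (\<psi> x)\<^sup>2 \<partial>?M))" using 1 2 by linarith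
    then show ?thesis by (simp only: distrib_left)
  qed
  have "\<bar>?d\<bar> \<le> 0"
  proof (rule field_le_epsilon)
    fix e :: real assume "e > 0"
    then show "\<bar>?d\<bar> \<le> 0 + e" using b[of "e / ?c"] cpos by simp
  qed
  then show "(\<integral>x. u x * pd j \<psi> x \<partial>?M) = - (\<integral>x. g x $ j * \<psi> x \<partial>?M)" by simp
qed

lemma test_limit_H10:
  assumes "test_limit u g" shows "u \<in> H10 \<Omega>"
proof -
  have u: "u \<in> L2_space \<Omega>" and gv: "g \<in> L2_space \<Omega>" and g: "(\<lambda>x. g x $ j) \<in> L2_space \<Omega>" for j
    using assms L2_space_vec by (auto simp: test_limit_def)
  have w: "is_weak_grad \<Omega> u g" using test_limit_weak_grad[OF assms] .
  have "\<exists>\<phi>\<in>test_functions \<Omega>. H1_norm \<Omega> (u - \<phi>) < e" if e: "e > 0" for e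
  proof -
    have "e\<^sup>2 / 3 > 0" using e by simp
    then obtain \<phi> where \<phi>: "\<phi> \<in> test_functions \<Omega>" "(\<integral>x. (u x - \<phi> x)\<^sup>2 \<partial>lebesgue_on \<Omega>) < e\<^sup>2 / 3"
      "\<And>j. (\<integral>x. (g x $ j - pd j \<phi> x)\<^sup>2 \<partial>lebesgue_on \<Omega>) < e\<^sup>2 / 3"
      using assms unfolding test_limit_def by blast
    have L: "\<phi> \<in> L2_space \<Omega>" "pd j \<phi> \<in> L2_space \<Omega>" for j using test_L2 \<phi>(1) test_pd by blast+
    have d: "(\<lambda>x. u x - \<phi> x) \<in> L2_space \<Omega>" "(\<lambda>x. g x $ j - pd j \<phi> x) \<in> L2_space \<Omega>" for j
      using L2_diff u g L by blast+
    let ?g = "\<lambda>x. g x - test_grad \<phi> x"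
    have gv': "?g \<in> L2_space \<Omega>" unfolding L2_space_vec using d(2) by (simp add: test_grad_def)
    have "is_weak_grad \<Omega> (u - \<phi>) ?g"
      unfolding is_weak_grad_def
    proof (intro conjI ballI allI)
      fix \<psi> j assume \<psi>: "\<psi> \<in> test_functions \<Omega>"
      have p\<psi>: "pd j \<psi> \<in> L2_space \<Omega>" "\<psi> \<in> L2_space \<Omega>" using test_L2 \<psi> test_pd by blast+
      have "(\<integral>x. (u - \<phi>) x * pd j \<psi> x \<partial>lebesgue_on \<Omega>) = (\<integral>x. u x * pd j \<psi> x \<partial>lebesgue_on \<Omega>) - (\<integral>x. \<phi> x * pd j \<psi> x \<partial>lebesgue_on \<Omega>)"
        using L2_mult[OF u p\<psi>(1)] L2_mult[OF L(1) p\<psi>(1)] by (simp add: left_diff_distrib)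
      also have "\<dots> = - (\<integral>x. g x $ j * \<psi> x \<partial>lebesgue_on \<Omega>) + (\<integral>x. pd j \<phi> x * \<psi> x \<partial>lebesgue_on \<Omega>)"
        using w \<psi> test_parts[OF \<phi>(1) \<psi>, of j] by (simp add: is_weak_grad_def)
      also have "\<dots> = - (\<integral>x. ?g x $ j * \<psi> x \<partial>lebesgue_on \<Omega>)"
        using L2_mult[OF g p\<psi>(2)] L2_mult[OF L(2) p\<psi>(2)] by (simp add: left_diff_distrib test_grad_def)
      finally show "(\<integral>x. (u - \<phi>) x * pd j \<psi> x \<partial>lebesgue_on \<Omega>) = - (\<integral>x. ?g x $ j * \<psi> x \<partial>lebesgue_on \<Omega>)" .
    qed (rule gv')
    moreover have "u - \<phi> \<in> L2_space \<Omega>" using d(1) by (simp add: fun_diff_def)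
    ultimately have "H1_norm \<Omega> (u - \<phi>) = sqrt ((L2_norm \<Omega> (u - \<phi>))\<^sup>2 + (L2_norm \<Omega> ?g)\<^sup>2)" by (intro H1_norm_eq)
    also have "(L2_norm \<Omega> (u - \<phi>))\<^sup>2 = (\<integral>x. (u x - \<phi> x)\<^sup>2 \<partial>lebesgue_on \<Omega>)"
      unfolding L2_norm_def by (subst real_sqrt_pow2) (auto intro: integral_nonneg_AE)
    also have "(L2_norm \<Omega> ?g)\<^sup>2 = (\<integral>x. (g x $ 1 - pd 1 \<phi> x)\<^sup>2 \<partial>lebesgue_on \<Omega>) + (\<integral>x. (g x $ 2 - pd 2 \<phi> x)\<^sup>2 \<partial>lebesgue_on \<Omega>)"
    proof -
      have "(L2_norm \<Omega> ?g)\<^sup>2 = (\<integral>x. (norm (?g x))\<^sup>2 \<partial>lebesgue_on \<Omega>)"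
        unfolding L2_norm_def by (subst real_sqrt_pow2) (auto intro: integral_nonneg_AE)
      then show ?thesis using d(2) by (simp add: norm_vec2_sq test_grad_def L2_space_real)
    qed
    finally have H: "H1_norm \<Omega> (u - \<phi>) = sqrt ((\<integral>x. (u x - \<phi> x)\<^sup>2 \<partial>lebesgue_on \<Omega>) +
      ((\<integral>x. (g x $ 1 - pd 1 \<phi> x)\<^sup>2 \<partial>lebesgue_on \<Omega>) + (\<integral>x. (g x $ 2 - pd 2 \<phi> x)\<^sup>2 \<partial>lebesgue_on \<Omega>)))" .
    have "(\<integral>x. (u x - \<phi> x)\<^sup>2 \<partial>lebesgue_on \<Omega>) +
      ((\<integral>x. (g x $ 1 - pd 1 \<phi> x)\<^sup>2 \<partial>lebesgue_on \<Omega>) + (\<integral>x. (g x $ 2 - pd 2 \<phi> x)\<^sup>2 \<partial>lebesgue_on \<Omega>)) < e\<^sup>2"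
      using \<phi>(2) \<phi>(3)[of 1] \<phi>(3)[of 2] by linarith
    then have "H1_norm \<Omega> (u - \<phi>) < sqrt (e\<^sup>2)" unfolding H by (rule real_sqrt_less_mono)
    then show ?thesis using \<phi>(1) e by auto
  qed
  then show ?thesis using u w unfolding H10_def H1_def by blast
qed

text \<open>Limits of limits are limits.\<close>

lemma test_limit_closed:
  assumes u: "u \<in> L2_space \<Omega>" "g \<in> L2_space \<Omega>"
    and a: "\<And>e. e > 0 \<Longrightarrow> \<exists>u' g'. test_limit u' g' \<and> (\<integral>x. (u x - u' x)\<^sup>2 \<partial>lebesgue_on \<Omega>) < e \<and>
      (\<forall>j. (\<integral>x. (g x $ j - g' x $ j)\<^sup>2 \<partial>lebesgue_on \<Omega>) < e)"
  shows "test_limit u g"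
proof -
  have tri: "(\<integral>x. (a x - c x)\<^sup>2 \<partial>lebesgue_on \<Omega>) < e"
    if L: "a \<in> L2_space \<Omega>" "b \<in> L2_space \<Omega>" "c \<in> L2_space \<Omega>"
      and 1: "(\<integral>x. (a x - b x)\<^sup>2 \<partial>lebesgue_on \<Omega>) < e/4" and 2: "(\<integral>x. (b x - c x)\<^sup>2 \<partial>lebesgue_on \<Omega>) < e/4"
    for a b c :: "real^2 \<Rightarrow> real" and e
  proof -
    have ab: "integrable (lebesgue_on \<Omega>) (\<lambda>x. (a x - b x)\<^sup>2)" "integrable (lebesgue_on \<Omega>) (\<lambda>x. (b x - c x)\<^sup>2)"
      "integrable (lebesgue_on \<Omega>) (\<lambda>x. (a x - c x)\<^sup>2)"
      using L2_diff L unfolding L2_space_real by blast+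
    have "(p - r)\<^sup>2 \<le> 2 * (p - q)\<^sup>2 + 2 * (q - r)\<^sup>2" for p q r :: real
      using zero_le_power2[of "(p - q) - (q - r)"] by (simp add: power2_eq_square algebra_simps)
    then have "(\<integral>x. (a x - c x)\<^sup>2 \<partial>lebesgue_on \<Omega>) \<le> (\<integral>x. 2 * (a x - b x)\<^sup>2 + 2 * (b x - c x)\<^sup>2 \<partial>lebesgue_on \<Omega>)"
      using ab by (intro integral_mono) auto
    also have "\<dots> = 2 * (\<integral>x. (a x - b x)\<^sup>2 \<partial>lebesgue_on \<Omega>) + 2 * (\<integral>x. (b x - c x)\<^sup>2 \<partial>lebesgue_on \<Omega>)" using ab by simp
    finally show ?thesis using 1 2 by linarith
  qed
  have "\<exists>\<phi>\<in>test_functions \<Omega>. (\<integral>x. (u x - \<phi> x)\<^sup>2 \<partial>lebesgue_on \<Omega>) < e \<and>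
      (\<forall>j. (\<integral>x. (g x $ j - pd j \<phi> x)\<^sup>2 \<partial>lebesgue_on \<Omega>) < e)" if e: "e > 0" for e
  proof -
    have e4: "e/4 > 0" using e by simp
    obtain u' g' where 1: "test_limit u' g'" "(\<integral>x. (u x - u' x)\<^sup>2 \<partial>lebesgue_on \<Omega>) < e/4"
      "\<And>j. (\<integral>x. (g x $ j - g' x $ j)\<^sup>2 \<partial>lebesgue_on \<Omega>) < e/4" using a[OF e4] by blast
    obtain \<phi> where 2: "\<phi> \<in> test_functions \<Omega>" "(\<integral>x. (u' x - \<phi> x)\<^sup>2 \<partial>lebesgue_on \<Omega>) < e/4"
      "\<And>j. (\<integral>x. (g' x $ j - pd j \<phi> x)\<^sup>2 \<partial>lebesgue_on \<Omega>) < e/4" using 1(1) e4 unfolding test_limit_def by blast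
    have L: "u' \<in> L2_space \<Omega>" "(\<lambda>x. g' x $ j) \<in> L2_space \<Omega>" "(\<lambda>x. g x $ j) \<in> L2_space \<Omega>" "\<phi> \<in> L2_space \<Omega>" "pd j \<phi> \<in> L2_space \<Omega>" for j
      using 1(1) u(2) L2_space_vec test_L2 2(1) test_pd unfolding test_limit_def by blast+
    show ?thesis
      using tri[OF u(1) L(1) L(4) 1(2) 2(2)] tri[OF L(3) L(2) L(5) 1(3) 2(3)] 2(1) by blast
  qed
  then show ?thesis using u unfolding test_limit_def by blast
qed

end

section \<open>Mollification of Lipschitz functions\<close>

text \<open>The convolution of \<open>u\<close> and \<open>\<rho>\<close>, integrated over a box only; it is applied to functions
  \<open>u\<close> supported in that box.\<close>

definition convolution :: "(real^2 \<Rightarrow> real) \<Rightarrow> real^2 \<Rightarrow> real^2 \<Rightarrow> (real^2 \<Rightarrow> real) \<Rightarrow> real^2 \<Rightarrow> real"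
  where "convolution u a b \<rho> x = integral (cbox a b) (\<lambda>y. u y * \<rho> (x - y))"

lemma convolution_pd:
  assumes u: "continuous_on UNIV u" and r: "\<And>k. Ck k \<rho>"
  shows "convolution u a b \<rho> differentiable (at x)" "pd j (convolution u a b \<rho>) x = convolution u a b (pd j \<rho>) x"
proof -
  define B where "B = (\<lambda>j. Blinfun (\<lambda>h::real^2. h $ j))"
  have B: "blinfun_apply (B j) h = h $ j" for j h
    unfolding B_def by (subst bounded_linear_Blinfun_apply) (auto intro: bounded_linear_vec_nth)
  define F where "F x t = (\<Sum>j\<in>UNIV. (u t * pd j \<rho> (x - t)) *\<^sub>R B j)" for x t
  have Fa: "blinfun_apply (F x t) h = (\<Sum>j\<in>UNIV. (u t * pd j \<rho> (x - t)) * h $ j)" for x t h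
    unfolding F_def by (simp add: blinfun.sum_left blinfun.scaleR_left B)
  have rd: "\<rho> differentiable (at x)" "continuous_on UNIV (pd j \<rho>)" for x j
    using r[of "Suc 0"] by auto
  have rc: "continuous_on UNIV \<rho>" using Ck_continuous[OF r] .
  have "((\<lambda>x. integral (cbox a b) (\<lambda>t. u t * \<rho> (x - t))) has_derivative blinfun_apply (integral (cbox a b) (F x))) (at x within UNIV)"
  proof (rule leibniz_rule)
    fix y t :: "real^2"
    have "((\<lambda>x. x - t) has_derivative (\<lambda>h. h - 0)) (at y)"
      by (intro has_derivative_diff has_derivative_ident has_derivative_const)
    then have "((\<lambda>x. x - t) has_derivative (\<lambda>h. h)) (at y)" by simp
    from has_derivative_mult_right[OF has_derivative_compose[where g=\<rho>, OF this has_derivative_pd[OF rd(1)[of "y - t"]]], of "u t"]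
    have "((\<lambda>x. u t * \<rho> (x - t)) has_derivative (\<lambda>h. u t * (\<Sum>j\<in>UNIV. h $ j * pd j \<rho> (y - t)))) (at y)" .
    moreover have "(\<lambda>h. u t * (\<Sum>j\<in>UNIV. h $ j * pd j \<rho> (y - t))) = blinfun_apply (F y t)"
      by (rule ext) (simp add: Fa sum_distrib_left mult_ac)
    ultimately show "((\<lambda>x. u t * \<rho> (x - t)) has_derivative blinfun_apply (F y t)) (at y within UNIV)" by simp
  next
    show "(\<lambda>t. u t * \<rho> (y - t)) integrable_on cbox a b" for y
      by (intro integrable_continuous continuous_intros continuous_on_subset[OF u] continuous_on_compose2[OF rc]) auto
    have "continuous_on (UNIV \<times> cbox a b) (\<lambda>z. F (fst z) (snd z))"
      unfolding F_def
      by (intro continuous_intros continuous_on_compose2[OF u] continuous_on_compose2[OF rd(2)]) auto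
    then show "continuous_on (UNIV \<times> cbox a b) (\<lambda>(x, t). F x t)" by (simp add: split_beta')
  qed auto
  then have D: "(convolution u a b \<rho> has_derivative blinfun_apply (integral (cbox a b) (F x))) (at x)"
    unfolding convolution_def[abs_def] by simp
  then show "convolution u a b \<rho> differentiable (at x)" unfolding differentiable_def by blast
  have Fi: "F x integrable_on cbox a b"
    unfolding F_def
    by (intro integrable_continuous continuous_intros continuous_on_subset[OF u] continuous_on_compose2[OF rd(2)]) auto
  have "pd j (convolution u a b \<rho>) x = blinfun_apply (integral (cbox a b) (F x)) (axis j 1)" by (rule pd_eqI[OF D])
  also have "\<dots> = integral (cbox a b) ((\<lambda>f. blinfun_apply f (axis j 1)) \<circ> F x)"
    by (rule integral_linear[OF Fi, symmetric]) (rule blinfun.bounded_linear_left)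
  also have "(\<lambda>f. blinfun_apply f (axis j 1)) \<circ> F x = (\<lambda>t. u t * pd j \<rho> (x - t))"
    using exhaust_2[of j] by (auto simp: Fa sum_2 axis_def fun_eq_iff)
  finally show "pd j (convolution u a b \<rho>) x = convolution u a b (pd j \<rho>) x" unfolding convolution_def[of u a b "pd j \<rho>"] .
qed

lemma Ck_convolution:
  assumes u: "continuous_on UNIV u" and r: "\<And>k. Ck k \<rho>"
  shows "Ck k (convolution u a b \<rho>)"
  using r
proof (induction k arbitrary: \<rho>)
  case 0
  then show ?case
    using convolution_pd(1)[OF u 0] by (simp add: continuous_on_eq_continuous_at differentiable_imp_continuous_within)
next
  case (Suc k)
  have "Ck m (pd j \<rho>)" for m j using Suc.prems[of "Suc m"] by simp
  then have "Ck k (convolution u a b (pd j \<rho>))" for j by (rule Suc.IH)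
  moreover have "pd j (convolution u a b \<rho>) = convolution u a b (pd j \<rho>)" for j using convolution_pd(2)[OF u Suc.prems] by (rule ext)
  ultimately show ?case using convolution_pd(1)[OF u Suc.prems] by simp
qed

lemma integral_lborel_reflect:
  fixes f :: "'a::euclidean_space \<Rightarrow> real"
  assumes f: "f \<in> borel_measurable borel"
  shows "(\<integral>x. f (c - x) \<partial>lborel) = (\<integral>x. f x \<partial>lborel)"
proof -
  have e: "lborel = distr lborel borel (\<lambda>x. c + (-1) *\<^sub>R x)" using lborel_affine[of "-1" c] by (simp add: density_1)
  have "(\<integral>x. f x \<partial>lborel) = (\<integral>x. f x \<partial>distr lborel borel (\<lambda>x. c + (-1) *\<^sub>R x))" by (subst e) (rule refl)
  also have "\<dots> = (\<integral>x. f (c + (-1) *\<^sub>R x) \<partial>lborel)" by (rule integral_distr) (use f in auto)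
  finally show ?thesis by simp
qed

lemma mollifier_exists:
  assumes r: "r > 0"
  shows "\<exists>\<rho>. (\<forall>k. Ck k \<rho>) \<and> (\<forall>x. 0 \<le> \<rho> x) \<and> (\<forall>x. norm x \<ge> r \<longrightarrow> \<rho> x = 0) \<and>
    integrable lborel \<rho> \<and> (\<integral>x. \<rho> x \<partial>lborel) = 1"
proof -
  let ?b = "bump 0 r"
  have c: "continuous_on UNIV ?b" using Ck_continuous[OF Ck_bump] .
  have z: "?b x = 0" if "norm x \<ge> r" for x by (rule bump_zero[OF r]) (use that in simp)
  have i: "integrable lborel ?b" by (rule compact_support_integrable[OF c compact_cball[of 0 r]]) (use z in simp)
  have "(\<integral>x. ?b x \<partial>lborel) \<noteq> 0"
  proof
    assume "(\<integral>x. ?b x \<partial>lborel) = 0"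
    then have "AE x in lborel. ?b x = 0" using integral_nonneg_eq_0_iff_AE[OF i] bump_nonneg by simp
    then have "AE x in lebesgue_on UNIV. ?b x = 0" unfolding lebesgue_on_UNIV_eq by (rule AE_completion)
    then have "?b 0 = 0" by (intro AE_zero_on_open[OF open_UNIV c, where S=UNIV]) auto
    then show False using bump_pos[OF r, of 0 0] r by simp
  qed
  moreover have "(\<integral>x. ?b x \<partial>lborel) \<ge> 0" using bump_nonneg by (intro integral_nonneg_AE) simp
  ultimately have m: "(\<integral>x. ?b x \<partial>lborel) > 0" by simp
  define m where "m = (\<integral>x. ?b x \<partial>lborel)"
  show ?thesis
  proof (intro exI[of _ "\<lambda>x. inverse m * ?b x"] conjI allI impI)
    show "Ck k (\<lambda>x. inverse m * ?b x)" for k by (intro Ck_mult Ck_const Ck_bump)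
    show "0 \<le> inverse m * ?b x" for x using m bump_nonneg by (simp add: m_def)
    show "inverse m * ?b x = 0" if "norm x \<ge> r" for x using z[OF that] by simp
    show "integrable lborel (\<lambda>x. inverse m * ?b x)" using i by simp
    show "(\<integral>x. inverse m * ?b x \<partial>lborel) = 1" using m by (simp add: m_def[symmetric])
  qed
qed

text \<open>Strict differentiability: differences of \<open>u\<close> near \<open>x\<close> are linear up to a small Lipschitz
  error.  It is preserved by averaging over small translations.\<close>

definition strict_grad :: "(real^2 \<Rightarrow> real) \<Rightarrow> real^2 \<Rightarrow> real^2 \<Rightarrow> bool"
  where "strict_grad u x v \<longleftrightarrow> (\<forall>e>0. \<exists>r>0. \<forall>y\<in>ball x r. \<forall>z\<in>ball x r. \<bar>u y - u z - v \<bullet> (y - z)\<bar> \<le> e * dist y z)"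

text \<open>If \<open>f\<close> is linear up to a small error along a coordinate direction, its partial derivative is close to
  the slope.\<close>

lemma pd_bound:
  assumes d: "f differentiable (at x)" and s0: "s0 > 0"
    and b: "\<And>s. 0 < s \<Longrightarrow> s < s0 \<Longrightarrow> \<bar>f (x + s *\<^sub>R axis j 1) - f x - s * c\<bar> \<le> K * s"
  shows "\<bar>pd j f x - c\<bar> \<le> K"
proof -
  have "((\<lambda>s. f (x + s *\<^sub>R axis j 1)) has_real_derivative pd j f x) (at 0)"
    using pd_deriv_line[of f x 0 j] d by simp
  then have "((\<lambda>h. (f (x + h *\<^sub>R axis j 1) - f x) / h) \<longlongrightarrow> pd j f x) (at 0)"
    unfolding DERIV_def by simp
  then have "((\<lambda>h. (f (x + h *\<^sub>R axis j 1) - f x) / h) \<longlongrightarrow> pd j f x) (at_right 0)"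
    by (rule filterlim_mono) (auto simp: at_le)
  then have "((\<lambda>h. \<bar>(f (x + h *\<^sub>R axis j 1) - f x) / h - c\<bar>) \<longlongrightarrow> \<bar>pd j f x - c\<bar>) (at_right 0)"
    by (intro tendsto_intros)
  moreover have "\<forall>\<^sub>F h in at_right 0. \<bar>(f (x + h *\<^sub>R axis j 1) - f x) / h - c\<bar> \<le> K"
    unfolding eventually_at_right_field
  proof (intro exI[of _ s0] conjI s0 allI impI)
    fix h assume h: "0 < h" "h < s0"
    have "(f (x + h *\<^sub>R axis j 1) - f x) / h - c = (f (x + h *\<^sub>R axis j 1) - f x - h * c) / h"
      using h by (simp add: field_simps)
    then have "\<bar>(f (x + h *\<^sub>R axis j 1) - f x) / h - c\<bar> = \<bar>f (x + h *\<^sub>R axis j 1) - f x - h * c\<bar> / h"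
      using h by simp
    then show "\<bar>(f (x + h *\<^sub>R axis j 1) - f x) / h - c\<bar> \<le> K" using b[OF h] h by (simp add: field_simps)
  qed
  ultimately show ?thesis by (rule tendsto_upperbound) simp
qed

text \<open>Mollification at scale \<open>r\<close> keeps the Lipschitz constant, moves values by at most \<open>L r\<close>, and carries
  an estimate for strict differentiability on a ball of radius more than \<open>2 r\<close> over to the gradient at
  the centre.\<close>

lemma mollify:
  fixes u :: "real^2 \<Rightarrow> real"
  assumes L: "L \<ge> 0" "\<And>x y. \<bar>u x - u y\<bar> \<le> L * dist x y"
    and C: "compact C" "\<And>x. x \<notin> C \<Longrightarrow> u x = 0" and sub: "(\<Union>x\<in>C. cball x r) \<subseteq> \<Omega>" and r: "r > 0"
  obtains \<phi> where "\<phi> \<in> test_functions \<Omega>" "\<And>x. \<bar>u x - \<phi> x\<bar> \<le> L * r" "\<And>x j. \<bar>pd j \<phi> x\<bar> \<le> L"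
    "\<And>x v e R j. (\<forall>y\<in>ball x R. \<forall>z\<in>ball x R. \<bar>u y - u z - v \<bullet> (y - z)\<bar> \<le> e * dist y z) \<Longrightarrow> 2 * r < R \<Longrightarrow> \<bar>pd j \<phi> x - v $ j\<bar> \<le> e"
proof -
  obtain \<rho> where \<rho>: "\<And>k. Ck k \<rho>" "\<And>x::real^2. 0 \<le> \<rho> x" "\<And>x. norm x \<ge> r \<Longrightarrow> \<rho> x = 0"
    "integrable lborel \<rho>" "(\<integral>x. \<rho> x \<partial>lborel) = 1" using mollifier_exists[OF r] by blast
  define M where "M x = (\<integral>y. u (x - y) * \<rho> y \<partial>lborel)" for x
  have uc: "continuous_on UNIV u"
  proof -
    have "L-lipschitz_on UNIV u" using L by (auto intro!: lipschitz_onI simp: dist_real_def)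
    then show ?thesis by (rule lipschitz_on_continuous_on)
  qed
  have \<rho>c: "continuous_on UNIV \<rho>" using Ck_continuous[OF \<rho>(1)] .
  have im: "integrable lborel (\<lambda>y. u (x - y) * \<rho> y)" for x
    by (rule compact_support_integrable[OF _ compact_cball[of 0 r]])
       (auto intro!: continuous_intros continuous_on_compose2[OF uc] \<rho>c \<rho>(3))
  obtain a where a: "C \<subseteq> cbox (- a) a"
    using bounded_subset_cbox_symmetric[OF compact_imp_bounded[OF C(1)]] by blast
  have Mconv: "M = convolution u (- a) a \<rho>"
  proof
    fix x
    let ?f = "\<lambda>y. u y * \<rho> (x - y)"
    have fc: "continuous_on UNIV ?f" by (intro continuous_intros uc continuous_on_compose2[OF \<rho>c]) auto
    have i: "integrable lborel ?f" by (rule compact_support_integrable[OF fc C(1)]) (simp add: C(2))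
    have "M x = (\<integral>y. ?f y \<partial>lborel)"
      unfolding M_def using integral_lborel_reflect[OF borel_measurable_continuous_onI[OF fc], of x] by simp
    also have "\<dots> = integral UNIV ?f" using i by (rule integral_lborel[symmetric])
    also have "?f = (\<lambda>y. if y \<in> cbox (- a) a then ?f y else 0)" using a C(2) by (auto simp: fun_eq_iff)
    also have "integral UNIV \<dots> = integral (cbox (- a) a) ?f" by (rule integral_restrict_UNIV)
    finally show "M x = convolution u (- a) a \<rho> x" by (simp add: convolution_def)
  qed
  have MCk: "Ck k M" for k unfolding Mconv by (rule Ck_convolution[OF uc \<rho>(1)])
  have bound: "\<bar>(\<integral>y. f y * \<rho> y \<partial>lborel)\<bar> \<le> K"
    if f: "integrable lborel (\<lambda>y. f y * \<rho> y)" and K: "\<And>y. norm y < r \<Longrightarrow> \<bar>f y\<bar> \<le> K" for f K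
  proof -
    have "\<bar>(\<integral>y. f y * \<rho> y \<partial>lborel)\<bar> \<le> (\<integral>y. \<bar>f y * \<rho> y\<bar> \<partial>lborel)" using integral_norm_bound[of lborel "\<lambda>y. f y * \<rho> y"] by simp
    also have "\<dots> \<le> (\<integral>y. K * \<rho> y \<partial>lborel)"
    proof (rule integral_mono)
      show "integrable lborel (\<lambda>y. \<bar>f y * \<rho> y\<bar>)" using f by simp
      show "integrable lborel (\<lambda>y. K * \<rho> y)" using \<rho>(4) by simp
      show "\<bar>f y * \<rho> y\<bar> \<le> K * \<rho> y" for y
      proof (cases "norm y < r")
        case True
        then show ?thesis using K[OF True] \<rho>(2)[of y] by (simp add: abs_mult mult_right_mono)
      next
        case False
        then show ?thesis using \<rho>(3)[of y] by simp
      qed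
    qed
    also have "\<dots> = K" using \<rho>(5) by simp
    finally show ?thesis .
  qed
  have diffb: "\<bar>M x - M x' - c\<bar> \<le> K" if "\<And>y. norm y < r \<Longrightarrow> \<bar>u (x - y) - u (x' - y) - c\<bar> \<le> K" for x x' c K
  proof -
    have "(\<lambda>y. (u (x - y) - u (x' - y) - c) * \<rho> y) = (\<lambda>y. u (x - y) * \<rho> y - u (x' - y) * \<rho> y - c * \<rho> y)"
      by (simp add: fun_eq_iff algebra_simps)
    moreover from this have "integrable lborel (\<lambda>y. (u (x - y) - u (x' - y) - c) * \<rho> y)" using im \<rho>(4) by simp
    ultimately show ?thesis using bound[of "\<lambda>y. u (x - y) - u (x' - y) - c" K] that im \<rho>(4,5) by (simp add: M_def)
  qed
  have lip: "\<bar>M x - M x'\<bar> \<le> L * dist x x'" for x x'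
  proof -
    have "\<bar>M x - M x' - 0\<bar> \<le> L * dist x x'"
    proof (rule diffb)
      fix y
      have "dist (x - y) (x' - y) = dist x x'" by (simp add: dist_norm)
      then show "\<bar>u (x - y) - u (x' - y) - 0\<bar> \<le> L * dist x x'" using L(2)[of "x - y" "x' - y"] by simp
    qed
    then show ?thesis by simp
  qed
  show thesis
  proof (rule that[of M])
    show "M \<in> test_functions \<Omega>"
    proof (rule test_functionsI[OF MCk])
      show "compact {x + y | x y. x \<in> C \<and> y \<in> cball 0 r}" by (rule compact_sums[OF C(1) compact_cball])
      show "{x + y | x y. x \<in> C \<and> y \<in> cball 0 r} \<subseteq> \<Omega>"
      proof clarify
        fix x y :: "real^2" assume "x \<in> C" "y \<in> cball 0 r"
        then have "x + y \<in> cball x r" by (simp add: dist_norm)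
        then show "x + y \<in> \<Omega>" using sub \<open>x \<in> C\<close> by blast
      qed
      show "M x = 0" if x: "x \<notin> {x + y | x y. x \<in> C \<and> y \<in> cball 0 r}" for x
      proof -
        have z: "u (x - y) * \<rho> y = 0" for y
        proof (cases "norm y < r")
          case True
          have "x - y \<notin> C"
          proof
            assume "x - y \<in> C"
            then have "(x - y) + y \<in> {x + y | x y. x \<in> C \<and> y \<in> cball 0 r}" using True by force
            then show False using x by simp
          qed
          then show ?thesis using C(2) by simp
        next
          case False
          then show ?thesis using \<rho>(3) by simp
        qed
        show ?thesis unfolding M_def z by simp
      qed
    qed
    show "\<bar>u x - M x\<bar> \<le> L * r" for x
    proof -
      have eq: "(\<lambda>y. (u x - u (x - y)) * \<rho> y) = (\<lambda>y. u x * \<rho> y - u (x - y) * \<rho> y)"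
        by (simp add: fun_eq_iff algebra_simps)
      have "\<bar>(\<integral>y. (u x - u (x - y)) * \<rho> y \<partial>lborel)\<bar> \<le> L * r"
      proof (rule bound)
        show "integrable lborel (\<lambda>y. (u x - u (x - y)) * \<rho> y)" unfolding eq using im \<rho>(4) by simp
        fix y :: "real^2" assume y: "norm y < r"
        have "dist x (x - y) = norm y" by (simp add: dist_norm)
        then have "\<bar>u x - u (x - y)\<bar> \<le> L * norm y" using L(2)[of x "x - y"] by simp
        also have "\<dots> \<le> L * r" using y L(1) by (intro mult_left_mono) auto
        finally show "\<bar>u x - u (x - y)\<bar> \<le> L * r" .
      qed
      then show ?thesis unfolding eq using im \<rho>(4,5) by (simp add: M_def)
    qed
    have dM: "M differentiable (at x)" for x using MCk[of "Suc 0"] by simp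
    show "\<bar>pd j M x\<bar> \<le> L" for x j
    proof -
      have "\<bar>pd j M x - 0\<bar> \<le> L"
      proof (rule pd_bound[OF dM, of 1])
        fix s :: real assume s: "0 < s"
        have "dist (x + s *\<^sub>R axis j 1) x = s" using s by (simp add: dist_norm norm_axis_1)
        then show "\<bar>M (x + s *\<^sub>R axis j 1) - M x - s * 0\<bar> \<le> L * s" using lip[of "x + s *\<^sub>R axis j 1" x] by simp
      qed simp
      then show ?thesis by simp
    qed
    show "\<bar>pd j M x - v $ j\<bar> \<le> e"
      if b: "\<forall>y\<in>ball x R. \<forall>z\<in>ball x R. \<bar>u y - u z - v \<bullet> (y - z)\<bar> \<le> e * dist y z" and R: "2 * r < R" for x v e R j
    proof (rule pd_bound[OF dM, of "R/2"])
      show "R / 2 > 0" using R r by simp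
      fix s :: real assume s: "0 < s" "s < R / 2"
      show "\<bar>M (x + s *\<^sub>R axis j 1) - M x - s * v $ j\<bar> \<le> e * s"
      proof (rule diffb)
        fix y :: "real^2" assume y: "norm y < r"
        let ?p = "x + s *\<^sub>R axis j 1 - y" and ?q = "x - y"
        have "dist x ?q = norm y" by (simp add: dist_norm)
        then have q: "?q \<in> ball x R" using y R r by simp
        have "dist x ?p \<le> norm y + norm (s *\<^sub>R axis j (1::real) :: real^2)"
          using norm_triangle_ineq4[of y "s *\<^sub>R axis j 1"] by (simp add: dist_norm algebra_simps)
        then have p: "?p \<in> ball x R" using y s R by (simp add: norm_axis_1)
        have "?p - ?q = s *\<^sub>R axis j 1" by simp
        then have "v \<bullet> (?p - ?q) = s * v $ j" "dist ?p ?q = s" using s by (simp_all add: inner_axis dist_norm norm_axis_1)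
        then show "\<bar>u ?p - u ?q - s * v $ j\<bar> \<le> e * s" using b p q by (metis (no_types, lifting))
      qed
    qed
  qed
qed

context bounded_domain begin

text \<open>A compactly supported Lipschitz function that is strictly differentiable almost everywhere is a limit
  of test functions: the gradients of its mollifications are bounded by the Lipschitz constant and
  converge at every point of strict differentiability.\<close>

lemma lipschitz_test_limit:
  fixes u :: "real^2 \<Rightarrow> real"
  assumes L: "L \<ge> 0" "\<And>x y. \<bar>u x - u y\<bar> \<le> L * dist x y"
    and C: "compact C" "C \<subseteq> \<Omega>" "\<And>x. x \<notin> C \<Longrightarrow> u x = 0"
    and Z: "negligible Z" "\<And>x. x \<in> \<Omega> - Z \<Longrightarrow> strict_grad u x (g x)" and g: "g \<in> L2_space \<Omega>"
  shows "test_limit u g"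
proof -
  let ?M = "lebesgue_on \<Omega>"
  obtain d where d: "d > 0" "(\<Union>x\<in>C. cball x d) \<subseteq> \<Omega>"
    using compact_subset_open_imp_cball_epsilon_subset[OF C(1) open_dom C(2)] by blast
  define rn where "rn n = min d (1 / real (Suc n))" for n
  have rn: "rn n > 0" "rn n \<le> d" "rn n \<le> 1" "rn n \<le> 1 / real (Suc n)" for n
  proof -
    show "rn n > 0" "rn n \<le> d" and 1: "rn n \<le> 1 / real (Suc n)" using d by (auto simp: rn_def)
    have "1 / real (Suc n) \<le> 1" by simp
    then show "rn n \<le> 1" using 1 by linarith
  qed
  have rn0: "rn \<longlonglongrightarrow> 0"
  proof (rule tendsto_sandwich[of "\<lambda>n. 0" _ sequentially "\<lambda>n. 1 / real (Suc n)"])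
    show "(\<lambda>n. 1 / real (Suc n)) \<longlonglongrightarrow> 0" by (intro LIMSEQ_Suc lim_1_over_n)
  qed (use rn in \<open>auto intro!: always_eventually less_imp_le\<close>)
  have "\<exists>\<phi>. \<phi> \<in> test_functions \<Omega> \<and> (\<forall>x. \<bar>u x - \<phi> x\<bar> \<le> L * rn n) \<and> (\<forall>x j. \<bar>pd j \<phi> x\<bar> \<le> L) \<and>
    (\<forall>x v e R j. (\<forall>y\<in>ball x R. \<forall>z\<in>ball x R. \<bar>u y - u z - v \<bullet> (y - z)\<bar> \<le> e * dist y z) \<longrightarrow> 2 * rn n < R \<longrightarrow> \<bar>pd j \<phi> x - v $ j\<bar> \<le> e)" for n
  proof -
    have "cball x (rn n) \<subseteq> cball x d" for x :: "real^2" using rn(2) by (rule subset_cball)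
    then have sub: "(\<Union>x\<in>C. cball x (rn n)) \<subseteq> \<Omega>" using d(2) by blast
    show ?thesis by (rule mollify[OF L C(1,3) sub rn(1)]) blast+
  qed
  then obtain \<phi> where \<phi>: "\<And>n. \<phi> n \<in> test_functions \<Omega>" "\<And>n x. \<bar>u x - \<phi> n x\<bar> \<le> L * rn n" "\<And>n x j. \<bar>pd j (\<phi> n) x\<bar> \<le> L"
    "\<And>n x v e R j. (\<forall>y\<in>ball x R. \<forall>z\<in>ball x R. \<bar>u y - u z - v \<bullet> (y - z)\<bar> \<le> e * dist y z) \<Longrightarrow> 2 * rn n < R \<Longrightarrow> \<bar>pd j (\<phi> n) x - v $ j\<bar> \<le> e"
    by metis
  have uc: "continuous_on UNIV u"
  proof -
    have "L-lipschitz_on UNIV u" using L by (auto intro!: lipschitz_onI simp: dist_real_def)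
    then show ?thesis by (rule lipschitz_on_continuous_on)
  qed
  obtain B where B: "\<And>x. \<bar>u x\<bar> \<le> B" using compact_support_bounded[OF uc C(1)] C(3) by metis
  have uL: "u \<in> L2_space \<Omega>" using continuous_measurable_lebesgue_on[OF uc] B by (intro bounded_L2)
  have gL: "(\<lambda>x. g x $ j) \<in> L2_space \<Omega>" for j using g L2_space_vec by blast
  have lim: "(\<lambda>n. pd j (\<phi> n) x) \<longlonglongrightarrow> g x $ j" if x: "x \<in> \<Omega> - Z" for x j
  proof (rule LIMSEQ_I)
    fix e :: real assume e: "e > 0"
    then obtain R where R: "R > 0" "\<forall>y\<in>ball x R. \<forall>z\<in>ball x R. \<bar>u y - u z - g x \<bullet> (y - z)\<bar> \<le> (e/2) * dist y z"
      using Z(2)[OF x] unfolding strict_grad_def by (meson half_gt_zero)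
    have "\<forall>\<^sub>F n in sequentially. rn n < R / 2" using rn0 R(1) by (intro order_tendstoD(2)) auto
    then obtain N where N: "\<And>n. n \<ge> N \<Longrightarrow> rn n < R / 2" by (auto simp: eventually_sequentially)
    have "norm (pd j (\<phi> n) x - g x $ j) < e" if "n \<ge> N" for n
      using \<phi>(4)[OF R(2), of n j] N[OF that] e by simp
    then show "\<exists>no. \<forall>n\<ge>no. norm (pd j (\<phi> n) x - g x $ j) < e" by blast
  qed
  have gb: "\<bar>g x $ j\<bar> \<le> L" if x: "x \<in> \<Omega> - Z" for x j
    by (rule tendsto_upperbound[OF tendsto_rabs[OF lim[OF x]]]) (use \<phi>(3) in \<open>auto intro!: always_eventually\<close>)
  have ic: "integrable ?M (\<lambda>x. c)" for c :: real
    by (rule bounded_measurable_integrable[OF dom_lmeasurable, of _ "\<bar>c\<bar>"]) auto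
  have 1: "(\<lambda>n. \<integral>x. (u x - \<phi> n x)\<^sup>2 \<partial>?M) \<longlonglongrightarrow> (\<integral>x. 0 \<partial>?M)"
  proof (rule integral_dominated_convergence[where w="\<lambda>x. (L * 1)\<^sup>2"])
    show "(\<lambda>x. (u x - \<phi> n x)\<^sup>2) \<in> borel_measurable ?M" for n
      using L2_diff[OF uL test_L2[OF \<phi>(1)]] by (auto simp: L2_space_real)
    show "AE x in ?M. (\<lambda>n. (u x - \<phi> n x)\<^sup>2) \<longlonglongrightarrow> 0"
    proof (rule AE_I2)
      fix x
      have "(\<lambda>n. u x - \<phi> n x) \<longlonglongrightarrow> 0"
      proof (rule Lim_null_comparison)
        show "\<forall>\<^sub>F n in sequentially. norm (u x - \<phi> n x) \<le> L * rn n" using \<phi>(2) by (intro always_eventually) simp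
        show "(\<lambda>n. L * rn n) \<longlonglongrightarrow> 0" using tendsto_mult[OF tendsto_const rn0, of L] by simp
      qed
      then show "(\<lambda>n. (u x - \<phi> n x)\<^sup>2) \<longlonglongrightarrow> 0" using tendsto_power[of _ 0 _ 2] by fastforce
    qed
    show "AE x in ?M. norm ((u x - \<phi> n x)\<^sup>2) \<le> (L * 1)\<^sup>2" for n
    proof (rule AE_I2)
      fix x
      have "L * rn n \<le> L * 1" using rn(3) L(1) by (intro mult_left_mono) auto
      then have "\<bar>u x - \<phi> n x\<bar> \<le> L * 1" using \<phi>(2)[of x n] by linarith
      then have "\<bar>u x - \<phi> n x\<bar>\<^sup>2 \<le> (L * 1)\<^sup>2" by (intro power_mono) auto
      then show "norm ((u x - \<phi> n x)\<^sup>2) \<le> (L * 1)\<^sup>2" by simp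
    qed
  qed (auto intro: ic)
  have ae: "AE x in ?M. x \<notin> Z"
  proof -
    have "Z \<in> null_sets lebesgue" using Z(1) negligible_iff_null_sets by blast
    then have "AE x in lebesgue. x \<notin> Z" by (rule AE_not_in)
    then have "AE x in lebesgue. x \<in> \<Omega> \<longrightarrow> x \<notin> Z" by eventually_elim simp
    then show ?thesis using AE_restrict_space_iff[of \<Omega> lebesgue] dom_sets by simp
  qed
  have aeD: "AE x in ?M. x \<in> \<Omega> - Z" using ae AE_space[of ?M] by eventually_elim simp
  have 2: "(\<lambda>n. \<integral>x. (g x $ j - pd j (\<phi> n) x)\<^sup>2 \<partial>?M) \<longlonglongrightarrow> (\<integral>x. 0 \<partial>?M)" for j
  proof (rule integral_dominated_convergence[where w="\<lambda>x. (L + L)\<^sup>2"])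
    show "(\<lambda>x. (g x $ j - pd j (\<phi> n) x)\<^sup>2) \<in> borel_measurable ?M" for n
      using L2_diff[OF gL test_L2[OF test_pd[OF \<phi>(1)]]] by (auto simp: L2_space_real)
    show "AE x in ?M. (\<lambda>n. (g x $ j - pd j (\<phi> n) x)\<^sup>2) \<longlonglongrightarrow> 0"
      using aeD
    proof eventually_elim
      case (elim x)
      have "(\<lambda>n. (g x $ j - pd j (\<phi> n) x)\<^sup>2) \<longlonglongrightarrow> (g x $ j - g x $ j)\<^sup>2" by (intro tendsto_intros lim elim)
      then show ?case by simp
    qed
    show "AE x in ?M. norm ((g x $ j - pd j (\<phi> n) x)\<^sup>2) \<le> (L + L)\<^sup>2" for n
      using aeD
    proof eventually_elim
      case (elim x)
      have "\<bar>g x $ j - pd j (\<phi> n) x\<bar> \<le> L + L" using gb[OF elim, of j] \<phi>(3)[of j n x] by linarith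
      then have "\<bar>g x $ j - pd j (\<phi> n) x\<bar>\<^sup>2 \<le> (L + L)\<^sup>2" by (intro power_mono) auto
      then show ?case by simp
    qed
  qed (auto intro: ic)
  have "\<exists>\<psi>\<in>test_functions \<Omega>. (\<integral>x. (u x - \<psi> x)\<^sup>2 \<partial>?M) < e \<and> (\<forall>j. (\<integral>x. (g x $ j - pd j \<psi> x)\<^sup>2 \<partial>?M) < e)" if e: "e > 0" for e
  proof -
    have "\<forall>\<^sub>F n in sequentially. (\<integral>x. (u x - \<phi> n x)\<^sup>2 \<partial>?M) < e"
      "\<And>j. \<forall>\<^sub>F n in sequentially. (\<integral>x. (g x $ j - pd j (\<phi> n) x)\<^sup>2 \<partial>?M) < e"
      using order_tendstoD(2)[OF 1] order_tendstoD(2)[OF 2] e by simp_all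
    then have "\<forall>\<^sub>F n in sequentially. (\<integral>x. (u x - \<phi> n x)\<^sup>2 \<partial>?M) < e \<and> (\<forall>j. (\<integral>x. (g x $ j - pd j (\<phi> n) x)\<^sup>2 \<partial>?M) < e)"
      by (simp add: eventually_conj_iff forall_2)
    then obtain n where "(\<integral>x. (u x - \<phi> n x)\<^sup>2 \<partial>?M) < e \<and> (\<forall>j. (\<integral>x. (g x $ j - pd j (\<phi> n) x)\<^sup>2 \<partial>?M) < e)"
      by (auto simp: eventually_sequentially)
    then show ?thesis using \<phi>(1) by blast
  qed
  then show ?thesis using uL g unfolding test_limit_def by blast
qed

end

section \<open>Lipschitz bounds, strict derivatives and soft thresholds\<close>

text \<open>Lipschitz bounds on the members of a finite closed cover of an interval add up.\<close>

lemma lipschitz_cover_interval: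
  fixes f :: "real \<Rightarrow> real"
  assumes "finite F" "\<And>C. C \<in> F \<Longrightarrow> closed C" "{a..b} \<subseteq> \<Union>F" "a \<le> b"
    and "\<And>C s t. C \<in> F \<Longrightarrow> s \<in> C \<Longrightarrow> t \<in> C \<Longrightarrow> s \<in> {a..b} \<Longrightarrow> t \<in> {a..b} \<Longrightarrow> \<bar>f s - f t\<bar> \<le> L * \<bar>s - t\<bar>"
  shows "\<bar>f b - f a\<bar> \<le> L * (b - a)"
  using assms
proof (induction "card F" arbitrary: F a rule: less_induct)
  case less
  obtain C where C: "C \<in> F" "a \<in> C" using less.prems(3,4) by fastforce
  \<comment> \<open>beyond the last point of \<open>C\<close> the remaining sets cover, and there are fewer of them\<close>
  define s where "s = Sup (C \<inter> {a..b})"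
  have ne: "C \<inter> {a..b} \<noteq> {}" using C less.prems(4) by auto
  have bdd: "bdd_above (C \<inter> {a..b})" by (rule bdd_aboveI[of _ b]) auto
  have "closed (C \<inter> {a..b})" using less.prems(2)[OF C(1)] by (intro closed_Int) auto
  then have s: "s \<in> C" "s \<in> {a..b}" using closed_contains_Sup[OF ne bdd] by (auto simp: s_def)
  have fa: "\<bar>f s - f a\<bar> \<le> L * (s - a)"
    using less.prems(5)[OF C(1) s(1) C(2) s(2)] less.prems(4) s(2) by simp
  show ?case
  proof (cases "s = b")
    case True
    then show ?thesis using fa by simp
  next
    case False
    then have sb: "s < b" using s(2) by simp
    have notC: "t \<notin> C" if "s < t" "t \<le> b" for t
    proof
      assume "t \<in> C"
      then have "t \<le> s" unfolding s_def using that s(2) bdd by (intro cSup_upper) auto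
      then show False using that by simp
    qed
    have "{s<..b} \<subseteq> \<Union>(F - {C})"
    proof
      fix t assume t: "t \<in> {s<..b}"
      then have "t \<in> {a..b}" using s(2) by auto
      then obtain D where "D \<in> F" "t \<in> D" using less.prems(3) by blast
      then show "t \<in> \<Union>(F - {C})" using notC[of t] t by auto
    qed
    moreover have "closed (\<Union>(F - {C}))" using less.prems(1,2) by (intro closed_Union) auto
    ultimately have "closure {s<..b} \<subseteq> \<Union>(F - {C})" by (rule closure_minimal)
    then have cov: "{s..b} \<subseteq> \<Union>(F - {C})" using sb by simp
    have "\<bar>f b - f s\<bar> \<le> L * (b - s)"
    proof (rule less.hyps[of "F - {C}" s])
      show "card (F - {C}) < card F" using less.prems(1) C(1) by (intro psubset_card_mono) auto
      show "\<bar>f p - f q\<bar> \<le> L * \<bar>p - q\<bar>" if "D \<in> F - {C}" "p \<in> D" "q \<in> D" "p \<in> {s..b}" "q \<in> {s..b}" for D p q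
        using less.prems(5)[of D p q] that s(2) by auto
    qed (use less.prems(1,2) cov sb in auto)
    then have "\<bar>f b - f a\<bar> \<le> L * (b - s) + L * (s - a)" using fa by linarith
    then show ?thesis by (simp add: algebra_simps)
  qed
qed

text \<open>A function that is Lipschitz on each member of a finite closed cover of the plane is Lipschitz, as one
  sees along line segments.\<close>

lemma lipschitz_closed_cover:
  fixes w :: "real^2 \<Rightarrow> real"
  assumes "finite F" "\<And>C. C \<in> F \<Longrightarrow> closed C" "\<Union>F = UNIV"
    and l: "\<And>C x y. C \<in> F \<Longrightarrow> x \<in> C \<Longrightarrow> y \<in> C \<Longrightarrow> \<bar>w x - w y\<bar> \<le> L * dist x y"
  shows "\<bar>w x - w y\<bar> \<le> L * dist x y"
proof -
  let ?l = "\<lambda>t. y + t *\<^sub>R (x - y)"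
  have cl: "continuous_on UNIV ?l" by (intro continuous_intros)
  have "\<bar>w (?l 1) - w (?l 0)\<bar> \<le> (L * dist x y) * (1 - 0)"
  proof (rule lipschitz_cover_interval[of "(\<lambda>C. ?l -` C) ` F" 0 1 "\<lambda>t. w (?l t)"])
    show "finite ((\<lambda>C. ?l -` C) ` F)" using assms(1) by simp
    show "closed D" if "D \<in> (\<lambda>C. ?l -` C) ` F" for D
      using that assms(2) continuous_closed_vimage[of _ ?l] cl by (auto simp: continuous_on_eq_continuous_at)
    show "{0..1} \<subseteq> \<Union>((\<lambda>C. ?l -` C) ` F)" using assms(3) by auto
    show "\<bar>w (?l s) - w (?l t)\<bar> \<le> L * dist x y * \<bar>s - t\<bar>"
      if "D \<in> (\<lambda>C. ?l -` C) ` F" "s \<in> D" "t \<in> D" for D s t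
    proof -
      have "?l s - ?l t = (s - t) *\<^sub>R (x - y)" by (simp add: algebra_simps)
      then have "dist (?l s) (?l t) = \<bar>s - t\<bar> * dist x y" by (simp add: dist_norm)
      then show ?thesis using l[of _ "?l s" "?l t"] that by (auto simp: mult_ac)
    qed
  qed simp
  then show ?thesis by simp
qed

lemma linear_form_bound: "\<bar>\<Sum>j\<in>UNIV. h $ j * c j\<bar> \<le> (\<Sum>j\<in>UNIV. \<bar>c j\<bar>) * norm (h :: real^2)"
proof -
  have "\<bar>\<Sum>j\<in>UNIV. h $ j * c j\<bar> \<le> (\<Sum>j\<in>UNIV. \<bar>h $ j * c j\<bar>)" by (rule sum_abs)
  also have "\<dots> \<le> (\<Sum>j\<in>UNIV. norm h * \<bar>c j\<bar>)"
    unfolding abs_mult by (intro sum_mono mult_right_mono component_le_norm_cart) auto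
  finally show ?thesis by (simp add: sum_distrib_left mult.commute)
qed

text \<open>The mean value inequality for \<open>f\<close> minus the linear function with gradient \<open>v\<close>.\<close>

lemma C1_lipschitz:
  assumes S: "convex S" and f: "\<And>x. x \<in> S \<Longrightarrow> f differentiable (at x)"
    and B: "\<And>x. x \<in> S \<Longrightarrow> (\<Sum>j\<in>UNIV. \<bar>pd j f x - v $ j\<bar>) \<le> B" and xy: "x \<in> S" "y \<in> S"
  shows "\<bar>f x - f y - v \<bullet> (x - y)\<bar> \<le> B * dist x y"
proof -
  let ?f = "\<lambda>x. f x - v \<bullet> x" and ?f' = "\<lambda>x h. \<Sum>j\<in>UNIV. h $ j * (pd j f x - v $ j)"
  have "norm (?f x - ?f y) \<le> B * norm (x - y)"
  proof (rule differentiable_bound[OF S _ _ xy])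
    fix z assume z: "z \<in> S"
    have D: "((\<lambda>x. f x - v \<bullet> x) has_derivative (\<lambda>h. (\<Sum>j\<in>UNIV. h $ j * pd j f z) - v \<bullet> h)) (at z)"
      by (intro has_derivative_diff has_derivative_pd[OF f[OF z]] has_derivative_inner_right has_derivative_ident)
    have E: "(\<lambda>h. (\<Sum>j\<in>UNIV. h $ j * pd j f z) - v \<bullet> h) = ?f' z"
      by (simp add: fun_eq_iff inner_vec_def right_diff_distrib sum_subtractf mult.commute)
    show "(?f has_derivative ?f' z) (at z within S)" by (rule has_derivative_at_withinI[OF D[unfolded E]])
    show "onorm (?f' z) \<le> B"
    proof (rule onorm_le)
      show "norm (?f' z h) \<le> B * norm h" for h
        using linear_form_bound[of h "\<lambda>j. pd j f z - v $ j"] B[OF z] mult_right_mono[OF B[OF z] norm_ge_zero[of h]] by simp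
    qed
  qed
  then show ?thesis by (simp add: dist_norm inner_diff_right)
qed

lemma polys_lipschitz:
  assumes "convex K" "compact K" "p \<in> polys m"
  shows "\<exists>L\<ge>0. \<forall>x\<in>K. \<forall>y\<in>K. \<bar>p x - p y\<bar> \<le> L * dist x y"
proof -
  have "continuous_on K (\<lambda>x. \<Sum>j\<in>UNIV. \<bar>pd j p x - (0::real^2) $ j\<bar>)"
    using polys_continuous[OF polys_smooth(2)[OF assms(3)]] by (intro continuous_intros)
  then have "bounded ((\<lambda>x. \<Sum>j\<in>UNIV. \<bar>pd j p x - (0::real^2) $ j\<bar>) ` K)"
    using assms(2) by (intro compact_imp_bounded compact_continuous_image)
  then obtain B where "\<And>x. x \<in> K \<Longrightarrow> norm (\<Sum>j\<in>UNIV. \<bar>pd j p x - (0::real^2) $ j\<bar>) \<le> B"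
    unfolding bounded_iff by blast
  then have B: "(\<Sum>j\<in>UNIV. \<bar>pd j p x - (0::real^2) $ j\<bar>) \<le> \<bar>B\<bar>" if "x \<in> K" for x using that by fastforce
  have "\<bar>p x - p y - 0 \<bullet> (x - y)\<bar> \<le> \<bar>B\<bar> * dist x y" if "x \<in> K" "y \<in> K" for x y
    by (rule C1_lipschitz[OF assms(1) _ B that]) (use polys_smooth(1)[OF assms(3)] in auto)
  then show ?thesis by (intro exI[of _ "\<bar>B\<bar>"]) auto
qed

lemma polys_strict_grad: assumes "p \<in> polys m" shows "strict_grad p x (test_grad p x)"
  unfolding strict_grad_def
proof (intro allI impI)
  fix e :: real assume e: "e > 0"
  define h where "h y = (\<Sum>j\<in>UNIV. \<bar>pd j p y - test_grad p x $ j\<bar>)" for y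
  have "continuous_on UNIV h"
    unfolding h_def using polys_continuous[OF polys_smooth(2)[OF assms]] by (intro continuous_intros)
  then have "isCont h x" by (simp add: continuous_on_eq_continuous_at)
  then obtain r where r: "r > 0" "\<And>y. dist y x < r \<Longrightarrow> dist (h y) (h x) < e"
    using e unfolding continuous_at_eps_delta by blast
  have "h x = 0" by (simp add: h_def test_grad_def)
  then have hr: "h y \<le> e" if "y \<in> ball x r" for y
    using r(2)[of y] that by (simp add: dist_real_def dist_commute)
  have "\<bar>p y - p z - test_grad p x \<bullet> (y - z)\<bar> \<le> e * dist y z" if "y \<in> ball x r" "z \<in> ball x r" for y z
    by (rule C1_lipschitz[OF convex_ball polys_smooth(1)[OF assms] hr[unfolded h_def] that])
  then show "\<exists>r>0. \<forall>y\<in>ball x r. \<forall>z\<in>ball x r. \<bar>p y - p z - test_grad p x \<bullet> (y - z)\<bar> \<le> e * dist y z" using r(1) by blast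
qed

lemma strict_grad_cong:
  assumes "strict_grad p x v" "open U" "x \<in> U" "\<And>y. y \<in> U \<Longrightarrow> w y = p y" shows "strict_grad w x v"
  unfolding strict_grad_def
proof (intro allI impI)
  fix e :: real assume "e > 0"
  then obtain r where r: "r > 0" "\<forall>y\<in>ball x r. \<forall>z\<in>ball x r. \<bar>p y - p z - v \<bullet> (y - z)\<bar> \<le> e * dist y z"
    using assms(1) unfolding strict_grad_def by blast
  obtain r' where r': "r' > 0" "ball x r' \<subseteq> U" using assms(2,3) open_contains_ball by blast
  have "\<bar>w y - w z - v \<bullet> (y - z)\<bar> \<le> e * dist y z" if "y \<in> ball x (min r r')" "z \<in> ball x (min r r')" for y z
  proof -
    have "y \<in> ball x r" "z \<in> ball x r" "y \<in> U" "z \<in> U" using that r'(2) by auto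
    then show ?thesis using r(2) assms(4) by simp
  qed
  then show "\<exists>r>0. \<forall>y\<in>ball x r. \<forall>z\<in>ball x r. \<bar>w y - w z - v \<bullet> (y - z)\<bar> \<le> e * dist y z"
    using r(1) r'(1) by (intro exI[of _ "min r r'"]) auto
qed

lemma strict_grad_compose:
  assumes w: "strict_grad w x v" and L: "L \<ge> 0" "\<And>y z. \<bar>w y - w z\<bar> \<le> L * dist y z"
    and S: "\<And>t. (S has_real_derivative s t) (at t)" "continuous_on UNIV s"
  shows "strict_grad (\<lambda>y. S (w y)) x (s (w x) *\<^sub>R v)"
  unfolding strict_grad_def
proof (intro allI impI)
  fix e :: real assume e: "e > 0"
  define c where "c = s (w x)"
  \<comment> \<open>\<open>e1\<close> bounds the error in \<open>S\<close> and \<open>e2\<close> the error in \<open>w\<close>; each contributes at most \<open>e / 2\<close>\<close>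
  define e1 where "e1 = e / (2 * (L + 1))"
  define e2 where "e2 = e / (2 * (\<bar>c\<bar> + 1))"
  have e12: "e1 > 0" "e2 > 0" using e L by (auto simp: e1_def e2_def)
  have "isCont s (w x)" using S(2) by (simp add: continuous_on_eq_continuous_at)
  then obtain d where d: "d > 0" "\<And>t. \<bar>t - w x\<bar> < d \<Longrightarrow> \<bar>s t - c\<bar> < e1"
    using e12(1) unfolding continuous_at_eps_delta c_def dist_real_def by blast
  have Sd: "\<bar>S a - S b - c * (a - b)\<bar> \<le> e1 * \<bar>a - b\<bar>" if "\<bar>a - w x\<bar> < d" "\<bar>b - w x\<bar> < d" for a b
  proof -
    have "norm ((\<lambda>t. S t - c * t) a - (\<lambda>t. S t - c * t) b) \<le> e1 * norm (a - b)"
    proof (rule field_differentiable_bound[of "ball (w x) d" _ "\<lambda>t. s t - c"])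
      show "((\<lambda>t. S t - c * t) has_real_derivative s t - c) (at t within ball (w x) d)" for t
        using DERIV_diff[OF S(1) DERIV_cmult_Id] has_field_derivative_at_within by blast
      show "norm (s t - c) \<le> e1" if "t \<in> ball (w x) d" for t
        using d(2)[of t] that by (simp add: dist_real_def abs_minus_commute)
    qed (use that in \<open>auto simp: dist_real_def abs_minus_commute\<close>)
    then show ?thesis by (simp add: algebra_simps)
  qed
  obtain r where r: "r > 0" "\<forall>y\<in>ball x r. \<forall>z\<in>ball x r. \<bar>w y - w z - v \<bullet> (y - z)\<bar> \<le> e2 * dist y z"
    using w e12(2) unfolding strict_grad_def by blast
  define r' where "r' = min r (d / (L + 1))"
  have r': "r' > 0" using r(1) d(1) L(1) by (simp add: r'_def)
  have near: "\<bar>w y - w x\<bar> < d" if "y \<in> ball x r'" for y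
  proof -
    have "dist y x < d / (L + 1)" using that by (simp add: r'_def dist_commute)
    then have "(L + 1) * dist y x < d" using L(1) by (simp add: field_simps)
    moreover have "L * dist y x \<le> (L + 1) * dist y x" by (intro mult_right_mono) auto
    ultimately show ?thesis using L(2)[of y x] by linarith
  qed
  have "\<bar>S (w y) - S (w z) - (c *\<^sub>R v) \<bullet> (y - z)\<bar> \<le> e * dist y z" if y: "y \<in> ball x r'" and z: "z \<in> ball x r'" for y z
  proof -
    have 1: "\<bar>S (w y) - S (w z) - c * (w y - w z)\<bar> \<le> e1 * (L * dist y z)"
      using Sd[OF near[OF y] near[OF z]] mult_left_mono[OF L(2)[of y z], of e1] e12(1) by linarith
    have "\<bar>w y - w z - v \<bullet> (y - z)\<bar> \<le> e2 * dist y z" using r(2) y z by (simp add: r'_def)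
    then have "\<bar>c\<bar> * \<bar>w y - w z - v \<bullet> (y - z)\<bar> \<le> \<bar>c\<bar> * (e2 * dist y z)" by (intro mult_left_mono) auto
    then have 2: "\<bar>c * (w y - w z) - (c *\<^sub>R v) \<bullet> (y - z)\<bar> \<le> \<bar>c\<bar> * (e2 * dist y z)"
      by (simp add: abs_mult[symmetric] right_diff_distrib)
    have "e1 * L \<le> e / 2"
    proof -
      have "e1 * L \<le> e1 * (L + 1)" using e12 by (intro mult_left_mono) auto
      also have "e1 * (L + 1) = e / 2" using L(1) unfolding e1_def by (simp add: divide_simps)
      finally show ?thesis .
    qed
    moreover have "\<bar>c\<bar> * e2 \<le> e / 2"
    proof -
      have "\<bar>c\<bar> * e2 \<le> (\<bar>c\<bar> + 1) * e2" using e12 by (intro mult_right_mono) auto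
      also have "\<dots> = e / 2" by (simp add: e2_def field_simps add_pos_nonneg)
      finally show ?thesis .
    qed
    ultimately have "e1 * L + \<bar>c\<bar> * e2 \<le> e" by linarith
    then have "(e1 * L + \<bar>c\<bar> * e2) * dist y z \<le> e * dist y z" by (rule mult_right_mono) auto
    then have "e1 * (L * dist y z) + \<bar>c\<bar> * (e2 * dist y z) \<le> e * dist y z" by (simp add: algebra_simps)
    then show ?thesis using 1 2 by linarith
  qed
  then show "\<exists>r>0. \<forall>y\<in>ball x r. \<forall>z\<in>ball x r. \<bar>S (w y) - S (w z) - (s (w x) *\<^sub>R v) \<bullet> (y - z)\<bar> \<le> e * dist y z"
    using r' unfolding c_def by blast
qed

text \<open>A continuously differentiable soft threshold: it vanishes on \<open>[-\<epsilon>, \<epsilon>]\<close> and has slope one outside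
  \<open>[-2\<epsilon>, 2\<epsilon>]\<close>.\<close>

definition soft :: "real \<Rightarrow> real \<Rightarrow> real"
  where "soft \<epsilon> t = ((max 0 (t - \<epsilon>))\<^sup>2 - (max 0 (t - 2 * \<epsilon>))\<^sup>2 - (max 0 (- t - \<epsilon>))\<^sup>2 + (max 0 (- t - 2 * \<epsilon>))\<^sup>2) / (2 * \<epsilon>)"

text \<open>The derivative of the soft threshold.\<close>

definition soft' :: "real \<Rightarrow> real \<Rightarrow> real"
  where "soft' \<epsilon> t = (max 0 (t - \<epsilon>) - max 0 (t - 2 * \<epsilon>) + max 0 (- t - \<epsilon>) - max 0 (- t - 2 * \<epsilon>)) / \<epsilon>"

lemma max_sq_deriv: "((\<lambda>z::real. (max 0 z)\<^sup>2) has_real_derivative 2 * max 0 z) (at z)"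
proof -
  consider "z > 0" | "z < 0" | "z = 0" by linarith
  then show ?thesis
  proof cases
    case 1
    have "((\<lambda>z. z\<^sup>2) has_real_derivative 2 * max 0 z) (at z)" using 1 by (auto intro!: derivative_eq_intros)
    then show ?thesis by (rule has_field_derivative_transform_within_open[of _ _ _ "{0<..}"]) (use 1 in auto)
  next
    case 2
    have "((\<lambda>z. 0) has_real_derivative 2 * max 0 z) (at z)" using 2 by simp
    then show ?thesis by (rule has_field_derivative_transform_within_open[of _ _ _ "{..<0}"]) (use 2 in auto)
  next
    case 3
    have "((\<lambda>h::real. ((max 0 (0 + h))\<^sup>2 - (max 0 0)\<^sup>2) / h) \<longlongrightarrow> 0) (at 0)"
    proof (rule Lim_null_comparison)
      show "\<forall>\<^sub>F h in at 0. norm (((max 0 (0 + h))\<^sup>2 - (max 0 0)\<^sup>2) / h) \<le> \<bar>h::real\<bar>"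
        by (intro always_eventually) (auto simp: max_def power2_eq_square)
      show "((\<lambda>h::real. \<bar>h\<bar>) \<longlongrightarrow> 0) (at 0)" by (rule tendsto_rabs_zero) (rule tendsto_ident_at)
    qed
    then show ?thesis unfolding DERIV_def 3 by simp
  qed
qed

lemma soft_deriv: assumes "\<epsilon> > 0" shows "(soft \<epsilon> has_real_derivative soft' \<epsilon> t) (at t)"
proof -
  have "((\<lambda>t. (max 0 (t - c))\<^sup>2) has_real_derivative 2 * max 0 (t - c) * 1) (at t)" for c
    by (rule DERIV_chain2[where f="\<lambda>z. (max 0 z)\<^sup>2" and g="\<lambda>t. t - c", OF max_sq_deriv])
       (auto intro!: derivative_eq_intros)
  then have p: "((\<lambda>t. (max 0 (t - c))\<^sup>2) has_real_derivative 2 * max 0 (t - c)) (at t)" for c by simp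
  have n: "((\<lambda>t. (max 0 (- t - c))\<^sup>2) has_real_derivative 2 * max 0 (- t - c) * (-1)) (at t)" for c
    by (rule DERIV_chain2[where f="\<lambda>z. (max 0 z)\<^sup>2" and g="\<lambda>t. - t - c", OF max_sq_deriv])
       (auto intro!: derivative_eq_intros)
  have "(soft \<epsilon> has_real_derivative (2 * max 0 (t - \<epsilon>) - 2 * max 0 (t - 2 * \<epsilon>) - 2 * max 0 (- t - \<epsilon>) * (-1)
      + 2 * max 0 (- t - 2 * \<epsilon>) * (-1)) / (2 * \<epsilon>)) (at t)"
    unfolding soft_def[abs_def] by (intro DERIV_cdivide DERIV_add DERIV_diff p n)
  moreover have "(2 * max 0 (t - \<epsilon>) - 2 * max 0 (t - 2 * \<epsilon>) - 2 * max 0 (- t - \<epsilon>) * (-1)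
      + 2 * max 0 (- t - 2 * \<epsilon>) * (-1)) / (2 * \<epsilon>) = soft' \<epsilon> t"
    using assms by (simp add: soft'_def field_simps)
  ultimately show ?thesis by simp
qed

lemma soft'_cont: "\<epsilon> > 0 \<Longrightarrow> continuous_on UNIV (soft' \<epsilon>)"
  unfolding soft'_def[abs_def] by (intro continuous_intros) auto

lemma soft'_range: assumes "\<epsilon> > 0" shows "0 \<le> soft' \<epsilon> t" "soft' \<epsilon> t \<le> 1"
  using assms by (auto simp: soft'_def max_def field_simps)

lemma soft'_one: "\<epsilon> > 0 \<Longrightarrow> 2 * \<epsilon> \<le> \<bar>t\<bar> \<Longrightarrow> soft' \<epsilon> t = 1"
  by (auto simp: soft'_def max_def field_simps abs_if split: if_splits)

lemma soft_zero: "\<epsilon> > 0 \<Longrightarrow> \<bar>t\<bar> \<le> \<epsilon> \<Longrightarrow> soft \<epsilon> t = 0" "\<epsilon> > 0 \<Longrightarrow> soft' \<epsilon> 0 = 0"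
  by (auto simp: soft_def soft'_def max_def)

lemma soft_lipschitz: assumes "\<epsilon> > 0" shows "\<bar>soft \<epsilon> a - soft \<epsilon> b\<bar> \<le> \<bar>a - b\<bar>"
proof -
  have "norm (soft \<epsilon> a - soft \<epsilon> b) \<le> 1 * norm (a - b)"
  proof (rule field_differentiable_bound[of UNIV _ "soft' \<epsilon>"])
    show "(soft \<epsilon> has_real_derivative soft' \<epsilon> t) (at t within UNIV)" for t using soft_deriv[OF assms] .
    show "norm (soft' \<epsilon> t) \<le> 1" for t using soft'_range[OF assms] by (simp add: abs_of_nonneg)
  qed auto
  then show ?thesis by simp
qed

lemma soft_close: assumes "\<epsilon> > 0" shows "\<bar>soft \<epsilon> t - t\<bar> \<le> 4 * \<epsilon>"
proof (cases "\<bar>t\<bar> \<le> 2 * \<epsilon>")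
  case True
  have "\<bar>soft \<epsilon> t - soft \<epsilon> 0\<bar> \<le> \<bar>t - 0\<bar>" by (rule soft_lipschitz[OF assms])
  then show ?thesis using True soft_zero(1)[OF assms, of 0] assms by simp
next
  case False
  then consider "t > 2 * \<epsilon>" | "t < - (2 * \<epsilon>)" by linarith
  then show ?thesis
  proof cases
    case 1
    then have "soft \<epsilon> t = ((t - \<epsilon>)\<^sup>2 - (t - 2 * \<epsilon>)\<^sup>2) / (2 * \<epsilon>)" using assms by (simp add: soft_def max_def)
    also have "\<dots> = t - 3/2 * \<epsilon>" using assms by (simp add: power2_eq_square field_simps)
    finally show ?thesis using assms by simp
  next
    case 2
    then have "soft \<epsilon> t = (- (- t - \<epsilon>)\<^sup>2 + (- t - 2 * \<epsilon>)\<^sup>2) / (2 * \<epsilon>)" using assms by (simp add: soft_def max_def)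
    also have "\<dots> = t + 3/2 * \<epsilon>" using assms by (simp add: power2_eq_square field_simps)
    finally show ?thesis using assms by simp
  qed
qed

section \<open>Conforming finite element functions vanish on the boundary in the Sobolev sense\<close>

context mesh begin

sublocale bounded_domain \<Omega> by standard (rule Omega)+

lemma L2_dominated:
  fixes f :: "nat \<Rightarrow> real^2 \<Rightarrow> real"
  assumes "\<And>n. f n \<in> borel_measurable (lebesgue_on \<Omega>)" "\<And>n x. x \<in> \<Omega> \<Longrightarrow> \<bar>f n x\<bar> \<le> B"
    and "\<And>x. x \<in> \<Omega> \<Longrightarrow> (\<lambda>n. f n x) \<longlonglongrightarrow> 0"
  shows "(\<lambda>n. \<integral>x. (f n x)\<^sup>2 \<partial>lebesgue_on \<Omega>) \<longlonglongrightarrow> 0"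
proof -
  have "(\<lambda>n. \<integral>x. (f n x)\<^sup>2 \<partial>lebesgue_on \<Omega>) \<longlonglongrightarrow> (\<integral>x. 0\<^sup>2 \<partial>lebesgue_on \<Omega>)"
  proof (rule integral_dominated_convergence[where w="\<lambda>x. B\<^sup>2"])
    show "integrable (lebesgue_on \<Omega>) (\<lambda>x. B\<^sup>2)"
      by (rule bounded_measurable_integrable[OF dom_lmeasurable, of _ "B\<^sup>2"]) auto
    show "(\<lambda>x. (f n x)\<^sup>2) \<in> borel_measurable (lebesgue_on \<Omega>)" for n using assms(1) by (intro borel_measurable_power)
    show "AE x in lebesgue_on \<Omega>. (\<lambda>n. (f n x)\<^sup>2) \<longlonglongrightarrow> 0\<^sup>2"
      using assms(3) by (intro AE_I2 tendsto_power) auto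
    have "(f n x)\<^sup>2 \<le> B\<^sup>2" if "x \<in> \<Omega>" for n x using assms(2)[OF that, of n] by (metis abs_ge_zero power2_abs power_mono)
    then show "AE x in lebesgue_on \<Omega>. norm ((f n x)\<^sup>2) \<le> B\<^sup>2" for n by (intro AE_I2) simp
  qed auto
  then show ?thesis by simp
qed

text \<open>A conforming function is the limit of its soft thresholds, which are compactly supported in
  \<open>\<Omega>\<close>; in the limit the gradient is lost only on the zero set.\<close>

lemma conforming_H10:
  assumes w: "w \<in> conforming_P2 \<Omega> T" shows "w \<in> H10 \<Omega>"
proof -
  have wc: "continuous_on UNIV w" and w0: "\<And>x. x \<notin> \<Omega> \<Longrightarrow> w x = 0"
    using w by (auto simp: conforming_P2_def)
  have "\<forall>K\<in>T. \<exists>p. p \<in> polys 2 \<and> (\<forall>x\<in>K. w x = p x)" using w unfolding conforming_P2_def by blast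
  from bchoice[OF this] obtain P where P: "\<And>K. K \<in> T \<Longrightarrow> P K \<in> polys 2" "\<And>K x. K \<in> T \<Longrightarrow> x \<in> K \<Longrightarrow> w x = P K x"
    by blast
  have "\<forall>K\<in>T. \<exists>L. L \<ge> 0 \<and> (\<forall>x\<in>K. \<forall>y\<in>K. \<bar>P K x - P K y\<bar> \<le> L * dist x y)"
    using polys_lipschitz[OF basic_T(1,2) P(1)] by blast
  from bchoice[OF this] obtain l where l: "\<And>K. K \<in> T \<Longrightarrow> l K \<ge> 0"
    "\<And>K x y. K \<in> T \<Longrightarrow> x \<in> K \<Longrightarrow> y \<in> K \<Longrightarrow> \<bar>P K x - P K y\<bar> \<le> l K * dist x y" by blast
  define L where "L = (\<Sum>K\<in>T. l K)"
  have L0: "L \<ge> 0" unfolding L_def using l(1) by (rule sum_nonneg)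
  have lip: "\<bar>w x - w y\<bar> \<le> L * dist x y" for x y
  proof (rule lipschitz_closed_cover[of "insert (- \<Omega>) T"])
    show "finite (insert (- \<Omega>) T)" using finite_T by simp
    show "closed C" if "C \<in> insert (- \<Omega>) T" for C using that basic_T(3) Omega(1) by auto
    show "\<Union>(insert (- \<Omega>) T) = UNIV" using Union_T closure_subset[of \<Omega>] by auto
    show "\<bar>w x - w y\<bar> \<le> L * dist x y" if C: "C \<in> insert (- \<Omega>) T" "x \<in> C" "y \<in> C" for C x y
    proof (cases "C \<in> T")
      case True
      have "l C \<le> L" unfolding L_def using l(1) True finite_T by (intro member_le_sum) auto
      then have "l C * dist x y \<le> L * dist x y" by (rule mult_right_mono) simp
      then show ?thesis using l(2)[OF True C(2,3)] P(2)[OF True C(2)] P(2)[OF True C(3)] by simp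
    next
      case False
      then have "w x = 0" "w y = 0" using C w0 by auto
      then show ?thesis using L0 by simp
    qed
  qed
  define D where "D j = piecewise T (\<lambda>K. pd j (P K))" for j
  have PD: "pd j (P K) \<in> polys 2" if "K \<in> T" for j K using polys_smooth(2)[OF P(1)[OF that]] .
  have Dm: "D j \<in> borel_measurable (lebesgue_on \<Omega>)" for j
    unfolding D_def by (rule piecewise_measurable) (rule PD)
  have "\<exists>B. \<forall>x. \<bar>D j x\<bar> \<le> B" for j unfolding D_def by (rule piecewise_bounded) (rule PD)
  then obtain B where B: "\<And>j x. \<bar>D j x\<bar> \<le> B j" by metis
  have wm: "w \<in> borel_measurable (lebesgue_on \<Omega>)" by (rule continuous_measurable_lebesgue_on[OF wc])
  define cw where "cw \<epsilon> x = soft' \<epsilon> (w x)" for \<epsilon> x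
  \<comment> \<open>the pointwise limit of the slopes \<open>cw \<epsilon>\<close> as \<open>\<epsilon>\<close> tends to zero\<close>
  define c0 where "c0 x = (if w x = 0 then 0 else 1::real)" for x
  have cwm: "cw \<epsilon> \<in> borel_measurable (lebesgue_on \<Omega>)" if "\<epsilon> > 0" for \<epsilon>
  proof -
    have "continuous_on UNIV (\<lambda>x. soft' \<epsilon> (w x))" by (rule continuous_on_compose2[OF soft'_cont[OF that] wc]) simp
    then show ?thesis unfolding cw_def[abs_def] by (rule continuous_measurable_lebesgue_on)
  qed
  have c0m: "c0 \<in> borel_measurable (lebesgue_on \<Omega>)"
    unfolding c0_def[abs_def] using wm by measurable
  have cwb: "\<bar>cw \<epsilon> x\<bar> \<le> 1" if "\<epsilon> > 0" for \<epsilon> x using soft'_range[OF that, of "w x"] by (simp add: cw_def)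
  have c0b: "\<bar>c0 x\<bar> \<le> 1" for x by (simp add: c0_def)
  have L2prod: "(\<lambda>x. (\<chi> j. c x * D j x)) \<in> L2_space \<Omega>"
    if "c \<in> borel_measurable (lebesgue_on \<Omega>)" "\<And>x. \<bar>c x\<bar> \<le> 1" for c
    unfolding L2_space_vec
  proof
    fix j
    have "\<bar>c x * D j x\<bar> \<le> 1 * B j" for x
      unfolding abs_mult using that(2)[of x] B[of j x] by (intro mult_mono) auto
    then show "(\<lambda>x. (\<chi> j. c x * D j x) $ j) \<in> L2_space \<Omega>"
      using that(1) Dm by (intro bounded_L2[of _ "1 * B j"]) auto
  qed
  \<comment> \<open>where \<open>w\<close> is at most \<open>\<epsilon>\<close> in absolute value the threshold vanishes, so its support is compact in \<open>\<Omega>\<close>\<close>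
  have soft_limit: "test_limit (\<lambda>x. soft \<epsilon> (w x)) (\<lambda>x. \<chi> j. cw \<epsilon> x * D j x)" if e: "\<epsilon> > 0" for \<epsilon>
  proof (rule lipschitz_test_limit[OF L0])
    let ?C = "closure \<Omega> \<inter> {x. \<epsilon> \<le> \<bar>w x\<bar>}"
    show "\<bar>soft \<epsilon> (w x) - soft \<epsilon> (w y)\<bar> \<le> L * dist x y" for x y
      using soft_lipschitz[OF e, of "w x" "w y"] lip[of x y] by linarith
    show "compact ?C"
    proof (rule compact_Int_closed)
      show "compact (closure \<Omega>)" using Omega(3) by (simp add: compact_closure)
      show "closed {x. \<epsilon> \<le> \<bar>w x\<bar>}" by (intro closed_Collect_le continuous_intros wc)
    qed
    show "?C \<subseteq> \<Omega>" using w0 e by force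
    show "soft \<epsilon> (w x) = 0" if "x \<notin> ?C" for x
    proof (cases "x \<in> \<Omega>")
      case True
      then have "\<bar>w x\<bar> \<le> \<epsilon>" using that closure_subset by fastforce
      then show ?thesis using soft_zero(1)[OF e] by blast
    next
      case False
      then show ?thesis using w0 soft_zero(1)[OF e, of 0] e by simp
    qed
    show "negligible (\<Omega> - (\<Union>K\<in>T. interior K))" by (rule negligible_skeleton)
    show "strict_grad (\<lambda>x. soft \<epsilon> (w x)) x (\<chi> j. cw \<epsilon> x * D j x)" if "x \<in> \<Omega> - (\<Omega> - (\<Union>K\<in>T. interior K))" for x
    proof -
      obtain K where K: "K \<in> T" "x \<in> interior K" using \<open>x \<in> \<Omega> - (\<Omega> - (\<Union>K\<in>T. interior K))\<close> by blast
      have "strict_grad w x (test_grad (P K) x)"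
        by (rule strict_grad_cong[OF polys_strict_grad[OF P(1)[OF K(1)]] open_interior K(2)])
           (use P(2)[OF K(1)] interior_subset in blast)
      then have "strict_grad (\<lambda>x. soft \<epsilon> (w x)) x (soft' \<epsilon> (w x) *\<^sub>R test_grad (P K) x)"
        by (rule strict_grad_compose[OF _ L0 lip soft_deriv[OF e] soft'_cont[OF e]])
      moreover have "soft' \<epsilon> (w x) *\<^sub>R test_grad (P K) x = (\<chi> j. cw \<epsilon> x * D j x)"
        by (simp add: vec_eq_iff test_grad_def cw_def D_def piecewise_in[OF K])
      ultimately show ?thesis by simp
    qed
    show "(\<lambda>x. (\<chi> j. cw \<epsilon> x * D j x)) \<in> L2_space \<Omega>" by (rule L2prod[OF cwm[OF e] cwb[OF e]])
  qed
  define en where "en n = 1 / real (Suc n)" for n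
  have en: "en n > 0" "en n \<le> 1" for n by (auto simp: en_def)
  have en0: "en \<longlonglongrightarrow> 0" unfolding en_def[abs_def] by (intro LIMSEQ_Suc lim_1_over_n)
  have sm: "(\<lambda>x. soft \<epsilon> (w x)) \<in> borel_measurable (lebesgue_on \<Omega>)" if "\<epsilon> > 0" for \<epsilon>
    using soft_limit[OF that] by (simp add: test_limit_def L2_space_real)
  have lim1: "(\<lambda>n. \<integral>x. (w x - soft (en n) (w x))\<^sup>2 \<partial>lebesgue_on \<Omega>) \<longlonglongrightarrow> 0"
  proof (rule L2_dominated)
    show "(\<lambda>x. w x - soft (en n) (w x)) \<in> borel_measurable (lebesgue_on \<Omega>)" for n
      using wm sm[OF en(1)] by (intro borel_measurable_diff)
    have b: "\<bar>w x - soft (en n) (w x)\<bar> \<le> 4 * en n" for n x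
      using soft_close[OF en(1), of n "w x"] by (simp add: abs_minus_commute)
    show "\<bar>w x - soft (en n) (w x)\<bar> \<le> 4" for n x using en(2)[of n] b[of x n] by linarith
    show "(\<lambda>n. w x - soft (en n) (w x)) \<longlonglongrightarrow> 0" for x
    proof (rule Lim_null_comparison)
      show "\<forall>\<^sub>F n in sequentially. norm (w x - soft (en n) (w x)) \<le> 4 * en n" using b by (intro always_eventually) simp
      show "(\<lambda>n. 4 * en n) \<longlonglongrightarrow> 0" using tendsto_mult[OF tendsto_const en0, of 4] by simp
    qed
  qed
  have lim2: "(\<lambda>n. \<integral>x. ((\<chi> j. c0 x * D j x) $ j - (\<chi> j. cw (en n) x * D j x) $ j)\<^sup>2 \<partial>lebesgue_on \<Omega>) \<longlonglongrightarrow> 0" for j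
  proof -
    have "(\<lambda>n. \<integral>x. (c0 x * D j x - cw (en n) x * D j x)\<^sup>2 \<partial>lebesgue_on \<Omega>) \<longlonglongrightarrow> 0"
    proof (rule L2_dominated)
      show "(\<lambda>x. c0 x * D j x - cw (en n) x * D j x) \<in> borel_measurable (lebesgue_on \<Omega>)" for n
        using c0m cwm[OF en(1)] Dm by (intro borel_measurable_diff borel_measurable_times)
      show "\<bar>c0 x * D j x - cw (en n) x * D j x\<bar> \<le> 2 * B j" for n x
      proof -
        have "\<bar>c0 x - cw (en n) x\<bar> \<le> 2" using c0b[of x] cwb[OF en(1), of n x] by linarith
        then have "\<bar>c0 x - cw (en n) x\<bar> * \<bar>D j x\<bar> \<le> 2 * B j" using B[of j x] by (intro mult_mono) auto
        then show ?thesis by (simp add: abs_mult[symmetric] left_diff_distrib)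
      qed
      show "(\<lambda>n. c0 x * D j x - cw (en n) x * D j x) \<longlonglongrightarrow> 0" for x
      proof (cases "w x = 0")
        case True
        then show ?thesis using soft_zero(2)[OF en(1)] by (simp add: c0_def cw_def)
      next
        case False
        have "\<forall>\<^sub>F n in sequentially. en n < \<bar>w x\<bar> / 2" using en0 False by (intro order_tendstoD(2)) auto
        then have "\<forall>\<^sub>F n in sequentially. 0 = c0 x * D j x - cw (en n) x * D j x"
        proof eventually_elim
          case (elim n)
          then have "soft' (en n) (w x) = 1" by (intro soft'_one[OF en(1)]) simp
          then show ?case using False by (simp add: c0_def cw_def)
        qed
        then show ?thesis by (rule Lim_transform_eventually[OF tendsto_const])
      qed
    qed
    then show ?thesis by simp
  qed
  have "test_limit w (\<lambda>x. \<chi> j. c0 x * D j x)"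
  proof (rule test_limit_closed)
    have "compact (closure \<Omega>)" using Omega(3) by (simp add: compact_closure)
    moreover have "w x = 0" if "x \<notin> closure \<Omega>" for x using w0 that closure_subset by blast
    ultimately obtain Bw where "\<And>x. \<bar>w x\<bar> \<le> Bw" using compact_support_bounded[OF wc] by metis
    then show "w \<in> L2_space \<Omega>" by (intro bounded_L2[OF wm])
    show "(\<lambda>x. \<chi> j. c0 x * D j x) \<in> L2_space \<Omega>" by (rule L2prod[OF c0m c0b])
    fix e :: real assume e: "e > 0"
    have "\<forall>\<^sub>F n in sequentially. (\<integral>x. (w x - soft (en n) (w x))\<^sup>2 \<partial>lebesgue_on \<Omega>) < e"
      "\<And>j. \<forall>\<^sub>F n in sequentially. (\<integral>x. ((\<chi> j. c0 x * D j x) $ j - (\<chi> j. cw (en n) x * D j x) $ j)\<^sup>2 \<partial>lebesgue_on \<Omega>) < e"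
      using order_tendstoD(2)[OF lim1 e] order_tendstoD(2)[OF lim2 e] by blast+
    then have "\<forall>\<^sub>F n in sequentially. (\<integral>x. (w x - soft (en n) (w x))\<^sup>2 \<partial>lebesgue_on \<Omega>) < e \<and>
      (\<forall>j. (\<integral>x. ((\<chi> j. c0 x * D j x) $ j - (\<chi> j. cw (en n) x * D j x) $ j)\<^sup>2 \<partial>lebesgue_on \<Omega>) < e)"
      unfolding forall_2 by (intro eventually_conj)
    then obtain n where "(\<integral>x. (w x - soft (en n) (w x))\<^sup>2 \<partial>lebesgue_on \<Omega>) < e \<and>
      (\<forall>j. (\<integral>x. ((\<chi> j. c0 x * D j x) $ j - (\<chi> j. cw (en n) x * D j x) $ j)\<^sup>2 \<partial>lebesgue_on \<Omega>) < e)"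
      unfolding eventually_sequentially by blast
    then show "\<exists>u' g'. test_limit u' g' \<and> (\<integral>x. (w x - u' x)\<^sup>2 \<partial>lebesgue_on \<Omega>) < e \<and>
      (\<forall>j. (\<integral>x. ((\<chi> j. c0 x * D j x) $ j - g' x $ j)\<^sup>2 \<partial>lebesgue_on \<Omega>) < e)"
      using soft_limit[OF en(1)[of n]] by blast
  qed
  then show ?thesis by (rule test_limit_H10)
qed

end

section \<open>Quadratic Lagrange interpolation and the averaging operator\<close>

text \<open>A quadratic form in the barycentric coordinates.\<close>

definition qform :: "real^2 \<Rightarrow> real^2 \<Rightarrow> real^2 \<Rightarrow> (nat \<Rightarrow> real) \<Rightarrow> real^2 \<Rightarrow> real"
  where "qform a b c q x = q 0 * (bary a b c x * bary a b c x) + q 1 * (bary b c a x * bary b c a x) + q 2 * (bary c a b x * bary c a b x)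
    + q 3 * (bary a b c x * bary b c a x) + q 4 * (bary b c a x * bary c a b x) + q 5 * (bary c a b x * bary a b c x)"

lemma qform_polys: "qform a b c q \<in> polys 2"
  unfolding qform_def[abs_def] by (intro polys_add polys_scale polys1_mult bary_polys)

lemma polys1_product_qform:
  assumes K: "tri a b c K" and f: "f \<in> polys 1" "g \<in> polys 1"
  shows "\<exists>q. (\<lambda>x. f x * g x) = qform a b c q"
proof -
  define q where "q = (\<lambda>n::nat. if n = 0 then f a * g a else if n = 1 then f b * g b else if n = 2 then f c * g c
    else if n = 3 then f a * g b + f b * g a else if n = 4 then f b * g c + f c * g b else f c * g a + f a * g c)"
  have q: "q 0 = f a * g a" "q 1 = f b * g b" "q 2 = f c * g c" "q 3 = f a * g b + f b * g a" "q 4 = f b * g c + f c * g b" "q 5 = f c * g a + f a * g c"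
    by (simp_all add: q_def)
  have "f x * g x = qform a b c q x" for x
    unfolding qform_def q polys1_interpolation[OF K f(1), of x] polys1_interpolation[OF K f(2), of x]
    by (simp only: distrib_left distrib_right mult_ac add_ac)
  then show ?thesis by blast
qed

text \<open>Every quadratic polynomial is homogeneous quadratic in the barycentric coordinates, since these add
  up to one.\<close>

lemma polys2_qform:
  assumes K: "tri a b c K" and p: "p \<in> polys 2"
  shows "\<exists>q. p = qform a b c q"
  using p
proof (induction rule: polys_induct)
  case (monom i j)
  have m: "(\<lambda>x::real^2. x$1) \<in> polys 1" "(\<lambda>x::real^2. x$2) \<in> polys 1" "(\<lambda>x::real^2. 1) \<in> polys 1"
    using polys_monom[of 1 0 1] polys_monom[of 0 1 1] polys_const by simp_all
  have "(i, j) \<in> {(0,0), (1,0), (0,1), (2,0), (1,1), (0,2)}" using monom by auto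
  then show ?case
    using polys1_product_qform[OF K m(3) m(3)] polys1_product_qform[OF K m(1) m(3)] polys1_product_qform[OF K m(2) m(3)]
      polys1_product_qform[OF K m(1) m(1)] polys1_product_qform[OF K m(1) m(2)] polys1_product_qform[OF K m(2) m(2)]
    by (auto simp: power2_eq_square)
next
  case (add p r)
  then obtain q q' where "p = qform a b c q" "r = qform a b c q'" by blast
  then have "(\<lambda>x. p x + r x) = qform a b c (\<lambda>n. q n + q' n)" by (simp add: fun_eq_iff qform_def algebra_simps)
  then show ?case by blast
next
  case (scale s p)
  then obtain q where "p = qform a b c q" by blast
  then have "(\<lambda>x. s * p x) = qform a b c (\<lambda>n. s * q n)" by (simp add: fun_eq_iff qform_def algebra_simps)
  then show ?case by blast
qed

lemma bary_midpoint: "bary a b c (midpoint x y) = (bary a b c x + bary a b c y) / 2"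
  using bary_add_scale[of "1/2" "1/2" a b c x y] by (simp add: midpoint_def scaleR_add_right)

lemma tri_bary_nodes:
  assumes "tri a b c K"
  shows "bary a b c a = 1" "bary a b c b = 0" "bary a b c c = 0"
    "bary b c a a = 0" "bary b c a b = 1" "bary b c a c = 0"
    "bary c a b a = 0" "bary c a b b = 0" "bary c a b c = 1"
  using tri_bary_vertices[OF assms] tri_bary_vertices[OF tri_rotate[OF assms]]
    tri_bary_vertices[OF tri_rotate[OF tri_rotate[OF assms]]] by auto

lemma qform_nodes:
  assumes "tri a b c K"
  shows "qform a b c q a = q 0" "qform a b c q b = q 1" "qform a b c q c = q 2"
    "qform a b c q (midpoint a b) = (q 0 + q 1 + q 3) / 4" "qform a b c q (midpoint b c) = (q 1 + q 2 + q 4) / 4"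
    "qform a b c q (midpoint c a) = (q 2 + q 0 + q 5) / 4"
  by (simp_all add: qform_def bary_midpoint tri_bary_nodes[OF assms] field_simps)

text \<open>A quadratic polynomial is determined on an edge by its values at the end points and at the
  midpoint, and on the triangle by its six nodal values.\<close>

lemma polys2_edge_zero:
  assumes K: "tri a b c K" and p: "p \<in> polys 2" "p a = 0" "p b = 0" "p (midpoint a b) = 0" and x: "x \<in> closed_segment a b"
  shows "p x = 0"
proof -
  obtain q where q: "p = qform a b c q" using polys2_qform[OF K p(1)] by blast
  then have "q 0 = 0" "q 1 = 0" "q 3 = 0" using p qform_nodes[OF K, of q] by auto
  then show ?thesis using bary_edge[OF K x] by (simp add: q qform_def)
qed

lemma polys2_zero:
  assumes K: "tri a b c K" and p: "p \<in> polys 2" "p a = 0" "p b = 0" "p c = 0"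
    "p (midpoint a b) = 0" "p (midpoint b c) = 0" "p (midpoint c a) = 0"
  shows "p x = 0"
proof -
  obtain q where q: "p = qform a b c q" using polys2_qform[OF K p(1)] by blast
  then have "q 0 = 0" "q 1 = 0" "q 2 = 0" "q 3 = 0" "q 4 = 0" "q 5 = 0" using p qform_nodes[OF K, of q] by auto
  then show ?thesis by (simp add: q qform_def)
qed

text \<open>The coefficient of \<open>\<lambda>\<^sub>a \<lambda>\<^sub>b\<close> follows from the value at the midpoint, where \<open>\<lambda>\<^sub>a = \<lambda>\<^sub>b = 1/2\<close>.\<close>

lemma polys2_interpolation_exists:
  assumes K: "tri a b c K"
  shows "\<exists>p\<in>polys 2. p a = V a \<and> p b = V b \<and> p c = V c \<and>
    p (midpoint a b) = V (midpoint a b) \<and> p (midpoint b c) = V (midpoint b c) \<and> p (midpoint c a) = (V (midpoint c a) :: real)"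
proof -
  define q where "q = (\<lambda>n::nat. if n = 0 then V a else if n = 1 then V b else if n = 2 then V c
    else if n = 3 then 4 * V (midpoint a b) - V a - V b else if n = 4 then 4 * V (midpoint b c) - V b - V c
    else 4 * V (midpoint c a) - V c - V a)"
  have q: "q 0 = V a" "q 1 = V b" "q (Suc 0) = V b" "q 2 = V c" "q 3 = 4 * V (midpoint a b) - V a - V b"
    "q 4 = 4 * V (midpoint b c) - V b - V c" "q 5 = 4 * V (midpoint c a) - V c - V a"
    by (simp_all add: q_def)
  show ?thesis
    by (rule bexI[OF _ qform_polys[of a b c q]]) (simp add: qform_nodes[OF K] q)
qed

lemma tri_vertex_face:
  assumes "tri a b c K" "{v} face_of K" shows "v \<in> {a, b, c}"
proof -
  have "{v} \<in> {{}, {a}, {b}, {c}, closed_segment a b, closed_segment b c, closed_segment c a, K}"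
    using tri_faces[OF assms] .
  moreover have "closed_segment a b \<noteq> {v}" "closed_segment b c \<noteq> {v}" "closed_segment c a \<noteq> {v}"
    using tri_distinct[OF assms(1)] by (auto simp: closed_segment_eq_sing)
  moreover have "K \<noteq> {v}" using tri_aff_dim[OF assms(1)] by auto
  ultimately have "{v} \<in> {{a}, {b}, {c}}" by (metis insertE insertI1 insert_not_empty insertCI)
  then show ?thesis by simp
qed

context mesh begin

text \<open>The nodal interpolation condition on one triangle, independent of a labelling of its vertices.\<close>

definition nodal :: "(real^2 \<Rightarrow> real) \<Rightarrow> (real^2) set \<Rightarrow> (real^2 \<Rightarrow> real) \<Rightarrow> bool"
  where "nodal V K p \<longleftrightarrow> (\<forall>v. {v} face_of K \<longrightarrow> p v = V v) \<and>
    (\<forall>a b. closed_segment a b edge_of K \<longrightarrow> p (midpoint a b) = V (midpoint a b))"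

lemma nodal_exists: assumes "K \<in> T" shows "\<exists>p. p \<in> polys 2 \<and> nodal V K p"
proof -
  obtain a b c where K: "tri a b c K" using tri_T[OF assms] .
  obtain p where p: "p \<in> polys 2" "p a = V a" "p b = V b" "p c = V c"
    "p (midpoint a b) = V (midpoint a b)" "p (midpoint b c) = V (midpoint b c)" "p (midpoint c a) = V (midpoint c a)"
    using polys2_interpolation_exists[OF K, of V] by blast
  have "p v = V v" if "{v} face_of K" for v using tri_vertex_face[OF K that] p by auto
  moreover have "p (midpoint x y) = V (midpoint x y)" if "closed_segment x y edge_of K" for x y
  proof -
    have "closed_segment x y \<in> {closed_segment a b, closed_segment b c, closed_segment c a}" using tri_edges[OF K] that by blast
    then have "{x, y} = {a, b} \<or> {x, y} = {b, c} \<or> {x, y} = {c, a}" by simp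
    then have "midpoint x y \<in> {midpoint a b, midpoint b c, midpoint c a}"
      by (auto simp: doubleton_eq_iff midpoint_sym)
    then show ?thesis using p by auto
  qed
  ultimately show ?thesis using p(1) unfolding nodal_def by blast
qed

lemma nodal_tri:
  assumes "nodal V K p" "tri a b c K"
  shows "p a = V a" "p b = V b" "p c = V c" "p (midpoint a b) = V (midpoint a b)"
    "p (midpoint b c) = V (midpoint b c)" "p (midpoint c a) = V (midpoint c a)"
proof -
  note t = assms(2) tri_rotate[OF assms(2)] tri_rotate[OF tri_rotate[OF assms(2)]]
  show "p a = V a" "p b = V b" "p c = V c" "p (midpoint a b) = V (midpoint a b)"
    "p (midpoint b c) = V (midpoint b c)" "p (midpoint c a) = V (midpoint c a)"
    using assms(1) tri_edge_face[OF t(1)] tri_edge_face[OF t(2)] tri_edge_face[OF t(3)] unfolding nodal_def by blast+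
qed

text \<open>Two triangles meet in a common face, on which both interpolants are determined by the nodes of that
  face.\<close>

lemma nodal_agree:
  assumes K: "K \<in> T" "p \<in> polys 2" "nodal V K p" and K': "K' \<in> T" "p' \<in> polys 2" "nodal V K' p'"
    and x: "x \<in> K" "x \<in> K'"
  shows "p x = p' x"
proof -
  obtain a0 b0 c0 where t0: "tri a0 b0 c0 K" using tri_T[OF K(1)] .
  note t = t0 tri_rotate[OF t0] tri_rotate[OF tri_rotate[OF t0]]
  have d: "(\<lambda>x. p x - p' x) \<in> polys 2" using polys_diff[OF K(2) K'(2)] .
  have vert: "p x = p' x" if "K \<inter> K' = {v}" for v
  proof -
    have "{v} face_of K" "{v} face_of K'" using face_T[OF K(1) K'(1)] face_T[OF K'(1) K(1)] that by (auto simp: Int_commute)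
    moreover have "x = v" using that x by blast
    ultimately show ?thesis using K(3) K'(3) by (simp add: nodal_def)
  qed
  have edge: "p x = p' x" if e: "K \<inter> K' = closed_segment a b" and tk: "tri a b c K" for a b c
  proof -
    have "closed_segment a b edge_of K" using tri_edge_face[OF tk] by blast
    then have "closed_segment a b edge_of K'"
      using face_T[OF K'(1) K(1)] e by (simp add: edge_of_def Int_commute)
    then obtain c' where tk': "tri a b c' K'" using edge_tri[OF simplex_T[OF K'(1)]] by blast
    have "x \<in> closed_segment a b" using e x by blast
    then have "p x - p' x = 0"
      using polys2_edge_zero[OF tk d] nodal_tri[OF K(3) tk] nodal_tri[OF K'(3) tk'] by simp
    then show ?thesis by simp
  qed
  have same: "p x = p' x" if "K \<inter> K' = K"
  proof -
    have "K = K'" using interior_meets[OF K(1) K'(1)] basic_T(5)[OF K(1)] that interior_subset by blast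
    then have nK: "nodal V K p'" using K'(3) by simp
    have "p x - p' x = 0" using polys2_zero[OF t0 d] nodal_tri[OF K(3) t0] nodal_tri[OF nK t0] by simp
    then show ?thesis by simp
  qed
  have "K \<inter> K' \<in> {{}, {a0}, {b0}, {c0}, closed_segment a0 b0, closed_segment b0 c0, closed_segment c0 a0, K}"
    using tri_faces[OF t0 face_T[OF K(1) K'(1)]] .
  moreover have "K \<inter> K' \<noteq> {}" using x by blast
  ultimately consider "K \<inter> K' = {a0}" | "K \<inter> K' = {b0}" | "K \<inter> K' = {c0}" | "K \<inter> K' = closed_segment a0 b0"
    | "K \<inter> K' = closed_segment b0 c0" | "K \<inter> K' = closed_segment c0 a0" | "K \<inter> K' = K" by blast
  then show ?thesis
  proof cases
    case 4 then show ?thesis using edge t(1) by blast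
  next
    case 5 then show ?thesis using edge t(2) by blast
  next
    case 6 then show ?thesis using edge t(3) by blast
  qed (use vert same in blast)+
qed

lemma Lagrange_nodesE:
  assumes "x \<in> Lagrange_nodes T"
  shows "\<exists>K\<in>T. x \<in> K \<and> (\<forall>V p. nodal V K p \<longrightarrow> p x = V x)"
proof -
  from assms consider K where "K \<in> T" "x extreme_point_of K" | a b where "closed_segment a b \<in> edges T" "x = midpoint a b"
    by (auto simp: Lagrange_nodes_def)
  then show ?thesis
  proof cases
    case 1
    then have "{x} face_of K" using face_of_singleton by blast
    then show ?thesis using 1 face_of_imp_subset unfolding nodal_def by blast
  next
    case 2
    then obtain K where K: "K \<in> T" "closed_segment a b edge_of K" by (auto simp: edges_def)
    then have "midpoint a b \<in> K" using edge_of_imp_subset midpoints_in_convex_hull by (metis midpoint_in_closed_segment subsetD)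
    then show ?thesis using K 2 unfolding nodal_def by blast
  qed
qed

lemma nodes_of_triangle:
  assumes "K \<in> T" "tri a b c K" shows "a \<in> Lagrange_nodes T" "midpoint a b \<in> Lagrange_nodes T"
  using assms(1) tri_edge_face[OF assms(2)] by (auto simp: Lagrange_nodes_def edges_def face_of_singleton)

text \<open>Nodal values that vanish on the boundary determine a conforming function.  It vanishes on the boundary,
  which consists of edges whose three nodes lie on the boundary.\<close>

lemma conforming_interpolation:
  assumes V: "\<And>x. x \<in> frontier \<Omega> \<Longrightarrow> V x = 0"
  shows "\<exists>!w. w \<in> conforming_P2 \<Omega> T \<and> (\<forall>x\<in>Lagrange_nodes T. w x = V x)"
proof (rule ex_ex1I)
  have "\<forall>K\<in>T. \<exists>p. p \<in> polys 2 \<and> nodal V K p" using nodal_exists by blast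
  from bchoice[OF this] obtain P where P: "\<And>K. K \<in> T \<Longrightarrow> P K \<in> polys 2" "\<And>K. K \<in> T \<Longrightarrow> nodal V K (P K)" by blast
  \<comment> \<open>the choice of the triangle is irrelevant, since the interpolants agree on intersections\<close>
  define w where "w x = (if x \<in> \<Union>T then P (SOME K. K \<in> T \<and> x \<in> K) x else 0)" for x
  have wK: "w x = P K x" if K: "K \<in> T" "x \<in> K" for K x
  proof -
    have "(SOME K. K \<in> T \<and> x \<in> K) \<in> T \<and> x \<in> (SOME K. K \<in> T \<and> x \<in> K)" by (rule someI[of _ K]) (use K in blast)
    then have "P (SOME K. K \<in> T \<and> x \<in> K) x = P K x" using nodal_agree[of _ "P _" V K "P K" x] P K by blast
    then show ?thesis using K by (auto simp: w_def)
  qed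
  have wfr: "w x = 0" if x: "x \<in> frontier \<Omega>" for x
  proof -
    have "x \<in> \<Union>(boundary_edges \<Omega> T)" using x frontier_Omega by blast
    then obtain F K where F: "x \<in> F" "K \<in> T" "F edge_of K" "F \<subseteq> frontier \<Omega>"
      unfolding boundary_edges_def edges_def by blast
    obtain p q r where "tri p q r K" using tri_T[OF F(2)] .
    then obtain a b where ab: "F = closed_segment a b" using F(3) tri_edges by blast
    obtain c where t: "tri a b c K" using edge_tri[OF simplex_T[OF F(2)]] F(3) ab by blast
    have "a \<in> frontier \<Omega>" "b \<in> frontier \<Omega>" "midpoint a b \<in> frontier \<Omega>"
      using F(4) ab midpoint_in_closed_segment[of a b] by auto
    then have "P K a = 0" "P K b = 0" "P K (midpoint a b) = 0"
      using V nodal_tri[OF P(2)[OF F(2)] t] by auto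
    then have "P K x = 0" using polys2_edge_zero[OF t P(1)[OF F(2)]] F(1) ab by blast
    then show ?thesis using wK[OF F(2)] edge_of_imp_subset[OF F(3)] F(1) by (metis subsetD)
  qed
  have w0: "w x = 0" if "x \<notin> \<Omega>" for x
  proof (cases "x \<in> closure \<Omega>")
    case True
    then show ?thesis using wfr that Omega(1) by (auto simp: frontier_def interior_open)
  next
    case False
    then show ?thesis using Union_T by (simp add: w_def)
  qed
  have "continuous_on (\<Union>K\<in>T. K) w"
  proof (rule continuous_on_closed_Union[OF finite_T])
    show "closed K" if "K \<in> T" for K using basic_T(3)[OF that] .
    show "continuous_on K w" if "K \<in> T" for K
      using polys_continuous[OF P(1)[OF that]] wK[OF that] by (simp cong: continuous_on_cong)
  qed
  moreover have "continuous_on (- \<Omega>) w"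
    by (rule continuous_on_eq[OF continuous_on_const[of "- \<Omega>" 0]]) (simp add: w0)
  moreover have "closed (\<Union>K\<in>T. K)" "closed (- \<Omega>)" using finite_T basic_T(3) Omega(1) by (auto intro!: closed_Union)
  ultimately have "continuous_on ((\<Union>K\<in>T. K) \<union> - \<Omega>) w" by (intro continuous_on_closed_Un)
  moreover have "(\<Union>K\<in>T. K) \<union> - \<Omega> = UNIV" using Union_T closure_subset[of \<Omega>] by auto
  ultimately have "continuous_on UNIV w" by simp
  then have "w \<in> conforming_P2 \<Omega> T" unfolding conforming_P2_def using P(1) wK w0 by blast
  moreover have "w x = V x" if "x \<in> Lagrange_nodes T" for x
    using Lagrange_nodesE[OF that] P(2) wK by metis
  ultimately show "\<exists>w. w \<in> conforming_P2 \<Omega> T \<and> (\<forall>x\<in>Lagrange_nodes T. w x = V x)" by blast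
next
  fix w w' assume w: "w \<in> conforming_P2 \<Omega> T \<and> (\<forall>x\<in>Lagrange_nodes T. w x = V x)"
    and w': "w' \<in> conforming_P2 \<Omega> T \<and> (\<forall>x\<in>Lagrange_nodes T. w' x = V x)"
  show "w = w'"
  proof
    fix x
    show "w x = w' x"
    proof (cases "x \<in> \<Omega>")
      case False
      then show ?thesis using w w' by (simp add: conforming_P2_def)
    next
      case True
      then obtain K where K: "K \<in> T" "x \<in> K" using Union_T closure_subset by blast
      obtain a b c where t: "tri a b c K" using tri_T[OF K(1)] .
      have "\<exists>p\<in>polys 2. \<forall>x\<in>K. w x = p x" "\<exists>p\<in>polys 2. \<forall>x\<in>K. w' x = p x"
        using w w' K(1) by (simp_all add: conforming_P2_def)
      then obtain p p' where p: "p \<in> polys 2" "\<forall>x\<in>K. w x = p x" "p' \<in> polys 2" "\<forall>x\<in>K. w' x = p' x"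
        by blast
      have nz: "p y - p' y = 0" if "y \<in> Lagrange_nodes T" "y \<in> K" for y
        using w w' that p(2,4) by (metis diff_self)
      have mid: "midpoint u v \<in> K" if "u \<in> K" "v \<in> K" for u v
        using closed_segment_subset[OF that basic_T(1)[OF K(1)]] midpoint_in_closed_segment[of u v] by blast
      note r1 = tri_rotate[OF t] and r2 = tri_rotate[OF tri_rotate[OF t]]
      note k = tri_basic(5-7)[OF t]
      have "p x - p' x = 0"
        using polys2_zero[OF t polys_diff[OF p(1,3)], of x]
          nz[OF nodes_of_triangle(1)[OF K(1) t] k(1)] nz[OF nodes_of_triangle(1)[OF K(1) r1] k(2)] nz[OF nodes_of_triangle(1)[OF K(1) r2] k(3)]
          nz[OF nodes_of_triangle(2)[OF K(1) t] mid[OF k(1,2)]] nz[OF nodes_of_triangle(2)[OF K(1) r1] mid[OF k(2,3)]]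
          nz[OF nodes_of_triangle(2)[OF K(1) r2] mid[OF k(3,1)]] by simp
      then show ?thesis using p K(2) by simp
    qed
  qed
qed

lemma conforming_vector_interpolation:
  fixes V :: "real^2 \<Rightarrow> real^2"
  assumes V: "\<And>x. x \<in> frontier \<Omega> \<Longrightarrow> V x = 0"
  shows "\<exists>!w. w \<in> vector_fields (conforming_P2 \<Omega> T) \<and> (\<forall>x\<in>Lagrange_nodes T. w x = V x)"
proof -
  have ex: "\<exists>!w. w \<in> conforming_P2 \<Omega> T \<and> (\<forall>x\<in>Lagrange_nodes T. w x = V x $ i)" for i
    using V by (intro conforming_interpolation) simp
  then have "\<forall>i. \<exists>w. w \<in> conforming_P2 \<Omega> T \<and> (\<forall>x\<in>Lagrange_nodes T. w x = V x $ i)" by blast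
  then obtain W where W: "\<And>i. W i \<in> conforming_P2 \<Omega> T" "\<And>i x. x \<in> Lagrange_nodes T \<Longrightarrow> W i x = V x $ i" by metis
  show ?thesis
  proof (rule ex1I[of _ "\<lambda>x. \<chi> i. W i x"])
    show "(\<lambda>x. \<chi> i. W i x) \<in> vector_fields (conforming_P2 \<Omega> T) \<and> (\<forall>x\<in>Lagrange_nodes T. (\<chi> i. W i x) = V x)"
      using W by (simp add: vector_fields_def vec_eq_iff)
    fix w assume w: "w \<in> vector_fields (conforming_P2 \<Omega> T) \<and> (\<forall>x\<in>Lagrange_nodes T. w x = V x)"
    have "(\<lambda>x. w x $ i) = W i" for i
    proof -
      have "(\<lambda>x. w x $ i) \<in> conforming_P2 \<Omega> T \<and> (\<forall>x\<in>Lagrange_nodes T. (\<lambda>x. w x $ i) x = V x $ i)"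
        using w by (simp add: vector_fields_def)
      moreover have "W i \<in> conforming_P2 \<Omega> T \<and> (\<forall>x\<in>Lagrange_nodes T. W i x = V x $ i)" using W by blast
      ultimately show ?thesis using ex[of i] by blast
    qed
    then show "w = (\<lambda>x. \<chi> i. W i x)" by (metis (no_types, lifting) ext vec_lambda_eta)
  qed
qed

text \<open>The nodal values that define the averaging operator.\<close>

definition node_average :: "(real^2 \<Rightarrow> real^2) \<Rightarrow> real^2 \<Rightarrow> real^2"
  where "node_average v x = (if x \<in> frontier \<Omega> then 0
    else (\<Sum>K | K \<in> T \<and> x \<in> K. elem_trace K v x) /\<^sub>R real (card {K \<in> T. x \<in> K}))"

lemma averaging_unique:
  "w = averaging \<Omega> T v \<longleftrightarrow> w \<in> vector_fields (conforming_P2 \<Omega> T) \<and> (\<forall>x\<in>Lagrange_nodes T. w x = node_average v x)"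
proof -
  have ex: "\<exists>!w. w \<in> vector_fields (conforming_P2 \<Omega> T) \<and> (\<forall>x\<in>Lagrange_nodes T. w x = node_average v x)"
    by (rule conforming_vector_interpolation) (simp add: node_average_def)
  have "averaging \<Omega> T v = (THE w. w \<in> vector_fields (conforming_P2 \<Omega> T) \<and> (\<forall>x\<in>Lagrange_nodes T. w x = node_average v x))"
    unfolding averaging_def node_average_def ..
  then show ?thesis using theI'[OF ex] ex by metis
qed

lemma VP_trace:
  assumes "v \<in> VP" "K \<in> T"
  shows "\<exists>p. (\<forall>x\<in>K. elem_trace K v x = p x) \<and> (\<forall>y\<in>interior K. v y = p y) \<and> (\<forall>x. isCont p x)"
proof -
  obtain a b c where K: "tri a b c K" using tri_T[OF assms(2)] .
  have "\<exists>p. p \<in> polys 2 \<and> (\<forall>x\<in>interior K. v x $ i = p x)" for i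
  proof -
    have "(\<lambda>x. v x $ i) \<in> P_disc 2 \<Omega> T" using assms(1) by (simp add: vector_fields_def)
    then show ?thesis by (rule P_disc_local[OF _ assms(2)]) blast
  qed
  then obtain p where p: "\<And>i. p i \<in> polys 2" "\<And>i x. x \<in> interior K \<Longrightarrow> v x $ i = p i x" by metis
  let ?p = "\<lambda>x. \<chi> i. p i x"
  have "isCont (p i) x" for i x using polys_continuous[OF p(1), of UNIV] by (simp add: continuous_on_eq_continuous_at)
  then have c: "isCont ?p x" for x unfolding isCont_def by (intro tendsto_vec_lambda)
  have e: "v y = ?p y" if "y \<in> interior K" for y using p(2)[OF that] by (simp add: vec_eq_iff)
  show ?thesis
    by (intro exI[of _ ?p] conjI ballI allI elem_trace_eq[OF K _ e c] e c) auto
qed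

lemma trace_add:
  assumes "v \<in> VP" "w \<in> VP" "K \<in> T" "x \<in> K"
  shows "elem_trace K (v + w) x = elem_trace K v x + elem_trace K w x"
proof -
  obtain a b c where K: "tri a b c K" using tri_T[OF assms(3)] .
  obtain p where p: "\<forall>x\<in>K. elem_trace K v x = p x" "\<forall>y\<in>interior K. v y = p y" "\<forall>x. isCont p x"
    using VP_trace[OF assms(1,3)] by blast
  obtain q where q: "\<forall>x\<in>K. elem_trace K w x = q x" "\<forall>y\<in>interior K. w y = q y" "\<forall>x. isCont q x"
    using VP_trace[OF assms(2,3)] by blast
  have "elem_trace K (v + w) x = p x + q x"
    using p q by (intro elem_trace_eq[OF K assms(4), of _ "\<lambda>x. p x + q x"]) (auto intro: continuous_add)
  then show ?thesis using p(1) q(1) assms(4) by simp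
qed

lemma trace_scale:
  assumes "v \<in> VP" "K \<in> T" "x \<in> K" shows "elem_trace K (c *\<^sub>R v) x = c *\<^sub>R elem_trace K v x"
proof -
  obtain a b d where K: "tri a b d K" using tri_T[OF assms(2)] .
  obtain p where p: "\<forall>x\<in>K. elem_trace K v x = p x" "\<forall>y\<in>interior K. v y = p y" "\<forall>x. isCont p x"
    using VP_trace[OF assms(1,2)] by blast
  have "elem_trace K (c *\<^sub>R v) x = c *\<^sub>R p x"
    using p by (intro elem_trace_eq[OF K assms(3), of _ "\<lambda>x. c *\<^sub>R p x"]) (auto simp: scaleR_fun_def intro: continuous_intros)
  then show ?thesis using p(1) assms(3) by simp
qed

lemma subspace_conforming: "subspace (conforming_P2 \<Omega> T)"
  unfolding subspace_def
proof (intro conjI ballI allI)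
  show "0 \<in> conforming_P2 \<Omega> T"
    unfolding conforming_P2_def using polys_const[of 0 2] by (auto simp: zero_fun_def intro: bexI[of _ "\<lambda>x. 0"])
next
  fix w z assume w: "w \<in> conforming_P2 \<Omega> T" and z: "z \<in> conforming_P2 \<Omega> T"
  have "\<exists>p\<in>polys 2. \<forall>x\<in>K. (w + z) x = p x" if K: "K \<in> T" for K
  proof -
    obtain p q where "p \<in> polys 2" "\<forall>x\<in>K. w x = p x" "q \<in> polys 2" "\<forall>x\<in>K. z x = q x"
      using w z K unfolding conforming_P2_def by blast
    then show ?thesis by (intro bexI[of _ "\<lambda>x. p x + q x"] polys_add) auto
  qed
  then show "w + z \<in> conforming_P2 \<Omega> T"
    using w z unfolding conforming_P2_def by (auto simp: plus_fun_def intro!: continuous_intros)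
next
  fix w c assume w: "w \<in> conforming_P2 \<Omega> T"
  have "\<exists>p\<in>polys 2. \<forall>x\<in>K. (c *\<^sub>R w) x = p x" if K: "K \<in> T" for K
  proof -
    obtain p where "p \<in> polys 2" "\<forall>x\<in>K. w x = p x" using w K unfolding conforming_P2_def by blast
    then show ?thesis by (intro bexI[of _ "\<lambda>x. c * p x"] polys_scale) (auto simp: scaleR_fun_def)
  qed
  then show "c *\<^sub>R w \<in> conforming_P2 \<Omega> T"
    using w unfolding conforming_P2_def by (auto simp: scaleR_fun_def intro!: continuous_intros)
qed

lemma averaging_props:
  "averaging \<Omega> T v \<in> vector_fields (conforming_P2 \<Omega> T)" "x \<in> Lagrange_nodes T \<Longrightarrow> averaging \<Omega> T v x = node_average v x"
  using averaging_unique[of "averaging \<Omega> T v" v] by auto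

lemma averaging_add:
  assumes "v \<in> VP" "w \<in> VP" shows "averaging \<Omega> T (v + w) = averaging \<Omega> T v + averaging \<Omega> T w"
proof -
  have "node_average (v + w) x = node_average v x + node_average w x" for x
    unfolding node_average_def using trace_add[OF assms] by (simp add: sum.distrib scaleR_add_right)
  then have "averaging \<Omega> T v + averaging \<Omega> T w = averaging \<Omega> T (v + w)"
    unfolding averaging_unique using averaging_props subspace_add[OF vector_fields_subspace[OF subspace_conforming]]
    by (simp add: averaging_props)
  then show ?thesis by simp
qed

lemma averaging_scale:
  assumes "v \<in> VP" shows "averaging \<Omega> T (c *\<^sub>R v) = c *\<^sub>R averaging \<Omega> T v"
proof -
  have "node_average (c *\<^sub>R v) x = c *\<^sub>R node_average v x" for x
    unfolding node_average_def using trace_scale[OF assms] by (simp add: scaleR_sum_right[symmetric])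
  then have "c *\<^sub>R averaging \<Omega> T v = averaging \<Omega> T (c *\<^sub>R v)"
    unfolding averaging_unique using averaging_props subspace_scale[OF vector_fields_subspace[OF subspace_conforming]]
    by (simp add: averaging_props scaleR_fun_def)
  then show ?thesis by simp
qed

lemma averaging_H10: "averaging \<Omega> T v \<in> vector_fields (H10 \<Omega>)"
  using averaging_props(1)[of v] conforming_H10 by (auto simp: vector_fields_def)

lemma load_linear:
  assumes f: "f \<in> H_minus1 \<Omega>" shows "linear_on (mixed_FS \<Omega> T) (load \<Omega> T f)"
proof (cases "\<exists>g. represents \<Omega> g f")
  case True
  define g where "g = (SOME g. represents \<Omega> g f)"
  have "represents \<Omega> g f" unfolding g_def using someI_ex[OF True] .
  then have gL: "(\<lambda>x. g x $ i) \<in> L2_space \<Omega>" for i using L2_space_vec by (auto simp: represents_def)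
  have ld: "load \<Omega> T f (v, q) = (\<integral>x. g x \<bullet> v x \<partial>lebesgue_on \<Omega>)" for v q
    using True by (simp add: load_def g_def)
  have i: "integrable (lebesgue_on \<Omega>) (\<lambda>x. g x \<bullet> v x)" if "v \<in> VX" for v
  proof -
    have "(\<lambda>x. v x $ i) \<in> L2_space \<Omega>" for i
      using that X0_FS_P_disc by (auto simp: vector_fields_def P_disc_def)
    then have "integrable (lebesgue_on \<Omega>) (\<lambda>x. g x $ i * v x $ i)" for i using L2_mult[OF gL] by blast
    then show ?thesis by (simp add: inner_vec_def)
  qed
  show ?thesis
    unfolding linear_on_def
  proof (intro conjI ballI allI)
    fix y z assume "y \<in> mixed_FS \<Omega> T" "z \<in> mixed_FS \<Omega> T"
    then obtain v q w r where yz: "y = (v, q)" "z = (w, r)" "v \<in> VX" "w \<in> VX" by (auto simp: mixed_FS_def)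
    show "load \<Omega> T f (y + z) = load \<Omega> T f y + load \<Omega> T f z"
      using i[OF yz(3)] i[OF yz(4)] by (simp add: yz ld inner_add_right)
  next
    fix c y assume "y \<in> mixed_FS \<Omega> T"
    then obtain v q where y: "y = (v, q)" "v \<in> VX" by (auto simp: mixed_FS_def)
    show "load \<Omega> T f (c *\<^sub>R y) = c *\<^sub>R load \<Omega> T f y"
      by (simp add: y ld scaleR_fun_def)
  qed
next
  case False
  have ld: "load \<Omega> T f (v, q) = f (averaging \<Omega> T v)" for v q using False by (simp add: load_def)
  have f_lin: "linear_on (vector_fields (H10 \<Omega>)) f" using f by (simp add: H_minus1_def continuous_dual_def)
  show ?thesis
    unfolding linear_on_def
  proof (intro conjI ballI allI)
    fix y z assume "y \<in> mixed_FS \<Omega> T" "z \<in> mixed_FS \<Omega> T"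
    then obtain v q w r where yz: "y = (v, q)" "z = (w, r)" "v \<in> VX" "w \<in> VX" by (auto simp: mixed_FS_def)
    then have "v \<in> VP" "w \<in> VP" using VX_VP by blast+
    then show "load \<Omega> T f (y + z) = load \<Omega> T f y + load \<Omega> T f z"
      using linear_on_add[OF f_lin averaging_H10 averaging_H10] by (simp add: yz ld averaging_add)
  next
    fix c y assume "y \<in> mixed_FS \<Omega> T"
    then obtain v q where y: "y = (v, q)" "v \<in> VX" by (auto simp: mixed_FS_def)
    then have "v \<in> VP" using VX_VP by blast
    then show "load \<Omega> T f (c *\<^sub>R y) = c *\<^sub>R load \<Omega> T f y"
      using linear_on_scale[OF f_lin averaging_H10] by (simp add: y ld averaging_scale)
  qed
qed

end

theorem theorem6:
  fixes \<nu> :: real and \<Omega> :: "(real^2) set" and \<T> :: "'h \<Rightarrow> (real^2) set set"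
  assumes "\<nu> > 0"
    and "polygonal_domain \<Omega>"
    and "shape_regular_triangulations \<Omega> \<T>"
  shows "\<forall>h.
    continuous_bilinear_form (mixed_FS \<Omega> (\<T> h)) (mixed_norm \<nu> \<Omega> (\<T> h)) (a_S \<nu> (\<T> h)) \<and>
    T_coercive (mixed_FS \<Omega> (\<T> h)) (mixed_norm \<nu> \<Omega> (\<T> h)) (a_S \<nu> (\<T> h)) \<and>
    well_posed (mixed_FS \<Omega> (\<T> h)) (mixed_norm \<nu> \<Omega> (\<T> h)) (a_S \<nu> (\<T> h)) \<and>
    (\<forall>f\<in>H_minus1 \<Omega>.
      load \<Omega> (\<T> h) f \<in> continuous_dual (mixed_FS \<Omega> (\<T> h)) (mixed_norm \<nu> \<Omega> (\<T> h)) \<and>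
      (\<exists>!x. solves (mixed_FS \<Omega> (\<T> h)) (a_S \<nu> (\<T> h)) (load \<Omega> (\<T> h) f) x))"
proof
  fix h
  interpret mesh \<Omega> "\<T> h"
    using assms(2,3) by unfold_locales (auto simp: shape_regular_triangulations_def)
  interpret normed_inner_on "mixed_FS \<Omega> (\<T> h)" "mixed_inner \<nu>" "mixed_norm \<nu> \<Omega> (\<T> h)" "a_S \<nu> (\<T> h)"
    using assms(1) by (rule normed_inner_mixed)
  show "continuous_bilinear_form (mixed_FS \<Omega> (\<T> h)) (mixed_norm \<nu> \<Omega> (\<T> h)) (a_S \<nu> (\<T> h)) \<and>
    T_coercive (mixed_FS \<Omega> (\<T> h)) (mixed_norm \<nu> \<Omega> (\<T> h)) (a_S \<nu> (\<T> h)) \<and>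
    well_posed (mixed_FS \<Omega> (\<T> h)) (mixed_norm \<nu> \<Omega> (\<T> h)) (a_S \<nu> (\<T> h)) \<and>
    (\<forall>f\<in>H_minus1 \<Omega>.
      load \<Omega> (\<T> h) f \<in> continuous_dual (mixed_FS \<Omega> (\<T> h)) (mixed_norm \<nu> \<Omega> (\<T> h)) \<and>
      (\<exists>!x. solves (mixed_FS \<Omega> (\<T> h)) (a_S \<nu> (\<T> h)) (load \<Omega> (\<T> h) f) x))"
    using form_continuous coercive well_posed in_dual[OF load_linear] unique_solution[OF load_linear] by blast
qed

end
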